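(* For each $n\ge 14$ there exist origin-symmetric convex bodies $K,L$ in $\mathbb{R}^n$ such that for all $a\in S^{n-1}$ $$\mathrm{vol}_{n-2}(\partial K\cap a^\perp)\le \mathrm{vol}_{n-2}(\partial L\cap a^\perp),$$ but $$\mathrm{vol}_{n-1}(\partial K)>\mathrm{vol}_{n-1}(\partial L).$$
   Context: $S^{n-1}$ is the Euclidean unit sphere of $\mathbb{R}^n$, $a^\perp$ is the hyperplane through the origin orthogonal to $a$, $\partial K$ is the boundary of $K$, and $\mathrm{vol}_d$ is $d$-dimensional volume (Hausdorff measure). A convex body is a compact convex set with non-empty interior; origin-symmetric means $K=-K$. *)

theory Defs
  imports "HOL-Analysis.Analysis"
begin

(* Hausdorff (outer) measure, normalised so that on R^d it is Lebesgue measure in dimension d.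
   Covering sets are required to be bounded because diameter is unspecified on unbounded
   sets; empty covering sets contribute 0 also for d = 0, where 0 ^ 0 = 1. *)

definition hausdorff_weight :: "nat \<Rightarrow> 'a::metric_space set \<Rightarrow> ennreal" where
  "hausdorff_weight d U =
     (if U = {} then 0 else ennreal (unit_ball_vol (real d) * (diameter U / 2) ^ d))"

definition hausdorff_content :: "nat \<Rightarrow> real \<Rightarrow> 'a::metric_space set \<Rightarrow> ennreal" where
  "hausdorff_content d \<delta> A =
     (INF U \<in> {U :: nat \<Rightarrow> 'a set. A \<subseteq> (\<Union>i. U i) \<and> (\<forall>i. bounded (U i) \<and> diameter (U i) \<le> \<delta>)}.
        \<Sum>i. hausdorff_weight d (U i))"

definition hausdorff_measure :: "nat \<Rightarrow> 'a::metric_space set \<Rightarrow> ennreal" where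
  "hausdorff_measure d A = (SUP \<delta> \<in> {0<..}. hausdorff_content d \<delta> A)"

definition convex_body :: "'a::euclidean_space set \<Rightarrow> bool" where
  "convex_body K \<longleftrightarrow> compact K \<and> convex K \<and> interior K \<noteq> {}"

definition origin_symmetric :: "'a::real_vector set \<Rightarrow> bool" where
  "origin_symmetric K \<longleftrightarrow> K = uminus ` K"

definition orthogonal_hyperplane :: "'a::real_inner \<Rightarrow> 'a set" where
  "orthogonal_hyperplane a = {x. a \<bullet> x = 0}"

end

theory Submission
  imports Defs
begin

text \<open>Let \<open>N = n - 2 = a + b\<close> with \<open>b = a\<close> or \<open>b = a + 1\<close>. The body \<open>K\<close> is the product of a ball of radius
  \<open>sqrt a\<close> in dimension \<open>a + 1\<close> and a ball of radius \<open>sqrt b\<close> in dimension \<open>b + 1\<close>, and \<open>L\<close> is a ball. Write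
  a unit normal as \<open>s u + c v\<close> with unit vectors \<open>u\<close>, \<open>v\<close> in the two factors. Differentiating the volume of the
  parallel bodies of the section, fibred over the line spanned by \<open>c u - s v\<close>, bounds the measure of its boundary by
  an integral of \<open>(1 - c^2 t^2 / a)^(a/2) (1 - s^2 t^2 / b)^(b/2)\<close> with a negative correction of order \<open>s^2 c^2 t^2\<close>
  due to the curvature of the two balls. By the inequality of arithmetic and geometric means the integrand is at
  most \<open>(1 - t^2 / N)^(N/2)\<close>; the loss in that inequality and the correction term cannot both be small, which
  gives a gain of relative order \<open>1 / N^2\<close> uniformly in \<open>s\<close>, \<open>c\<close>. The radius of \<open>L\<close> is chosen so that its sections
  match this bound, and for \<open>n \<ge> 14\<close> the surface area of \<open>K\<close> still exceeds that of \<open>L\<close>.\<close>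

section \<open>Hausdorff measure\<close>

text \<open>The factor between Hausdorff measure and volume on flat pieces is carried along as an
  undetermined positive constant. Both inequalities compare measures in one dimension, so it
  cancels, provided a single constant serves every hyperplane; \<open>flat_constant_exists\<close>
  orders its quantifiers accordingly. Curved boundaries are reached through polytopes: unit prisms
  over the facets pack an outer layer of the body or cover an inner one, so differences of volumes
  bound the boundary measure from both sides. Volumes inside a subspace are expressed by volumes of
  products with a unit ball of the complement, which leaves Lebesgue measure of the whole space as
  the only volume. The radii \<open>sqrt a\<close>, \<open>sqrt b\<close> are those for which the
  mean of \<open>c^2 t^2 / a\<close> and \<open>s^2 t^2 / b\<close> with weights
  \<open>a / N\<close>, \<open>b / N\<close> equals \<open>t^2 / N\<close> in every direction, so
  the arithmetic-geometric bound is independent of the direction. The gain beyond that bound is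
  essential here: at \<open>a = 6\<close> the inequality in \<open>numeric_even\<close> fails
  without it.\<close>

definition hausdorff_covers :: "real \<Rightarrow> 'a::metric_space set \<Rightarrow> (nat \<Rightarrow> 'a set) set" where
  "hausdorff_covers \<delta> A =
     {U. A \<subseteq> (\<Union>i. U i) \<and> (\<forall>i. bounded (U i) \<and> diameter (U i) \<le> \<delta>)}"

lemma hausdorff_coversD:
  "U \<in> hausdorff_covers \<delta> A \<Longrightarrow> x \<in> A \<Longrightarrow> \<exists>i. x \<in> U i"
  by (auto simp: hausdorff_covers_def)

lemma hausdorff_content_eq:
  "hausdorff_content d \<delta> A = (INF U\<in>hausdorff_covers \<delta> A. \<Sum>i. hausdorff_weight d (U i))"
  by (simp add: hausdorff_content_def hausdorff_covers_def)

lemma hausdorff_content_le: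
  "U \<in> hausdorff_covers \<delta> A \<Longrightarrow> hausdorff_content d \<delta> A \<le> (\<Sum>i. hausdorff_weight d (U i))"
  unfolding hausdorff_content_eq by (rule INF_lower)

lemma hausdorff_content_geI:
  "(\<And>U. U \<in> hausdorff_covers \<delta> A \<Longrightarrow> x \<le> (\<Sum>i. hausdorff_weight d (U i)))
     \<Longrightarrow> x \<le> hausdorff_content d \<delta> A"
  unfolding hausdorff_content_eq by (rule INF_greatest)

lemma hausdorff_measure_leI:
  "(\<And>\<delta>. \<delta> > 0 \<Longrightarrow> hausdorff_content d \<delta> A \<le> x) \<Longrightarrow> hausdorff_measure d A \<le> x"
  unfolding hausdorff_measure_def by (intro SUP_least) auto

lemma hausdorff_content_le_measure:
  "\<delta> > 0 \<Longrightarrow> hausdorff_content d \<delta> A \<le> hausdorff_measure d A"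
  unfolding hausdorff_measure_def by (intro SUP_upper) auto

lemma hausdorff_measure_mono:
  assumes "A \<subseteq> B"
  shows "hausdorff_measure d A \<le> hausdorff_measure d B"
proof -
  have "hausdorff_content d \<delta> A \<le> hausdorff_content d \<delta> B" for \<delta>
    unfolding hausdorff_content_eq using assms
    by (intro INF_superset_mono) (auto simp: hausdorff_covers_def)
  then show ?thesis unfolding hausdorff_measure_def by (intro SUP_mono) auto
qed

lemma hausdorff_weight_empty [simp]: "hausdorff_weight d {} = 0"
  by (simp add: hausdorff_weight_def)

lemma hausdorff_measure_empty [simp]: "hausdorff_measure d {} = 0"
proof -
  have "hausdorff_content d \<delta> {} \<le> 0" if "\<delta> > 0" for \<delta>
    using hausdorff_content_le[of "\<lambda>_. {}" \<delta> "{}" d] that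
    by (simp add: hausdorff_covers_def)
  then have "hausdorff_measure d {} \<le> 0" by (rule hausdorff_measure_leI)
  then show ?thesis by simp
qed

lemma hausdorff_measure_UN_le:
  "hausdorff_measure d (\<Union>i::nat. A i) \<le> (\<Sum>i. hausdorff_measure d (A i))"
proof (rule hausdorff_measure_leI)
  fix \<delta> :: real assume \<delta>: "\<delta> > 0"
  show "hausdorff_content d \<delta> (\<Union>i. A i) \<le> (\<Sum>i. hausdorff_measure d (A i))"
  proof (rule ennreal_le_epsilon)
    fix e :: real assume fin: "(\<Sum>i. hausdorff_measure d (A i)) < top" and e: "e > 0"
    have fin': "hausdorff_content d \<delta> (A i) < top" for i
    proof -
      have "hausdorff_content d \<delta> (A i) \<le> hausdorff_measure d (A i)"
        using \<delta> by (rule hausdorff_content_le_measure)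
      also have "\<dots> \<le> (\<Sum>i. hausdorff_measure d (A i))"
        using sum_le_suminf[of "\<lambda>i. hausdorff_measure d (A i)" "{i}"] by simp
      finally show ?thesis using fin by (rule le_less_trans)
    qed
    have "\<exists>U. U \<in> hausdorff_covers \<delta> (A i) \<and>
        (\<Sum>j. hausdorff_weight d (U j)) \<le> hausdorff_content d \<delta> (A i) + ennreal (e * (1/2) ^ Suc i)" for i
    proof -
      have "hausdorff_content d \<delta> (A i) < hausdorff_content d \<delta> (A i) + ennreal (e * (1/2) ^ Suc i)"
        using fin'[of i] e by (auto simp: less_top ennreal_less_zero_iff)
      then show ?thesis
        unfolding hausdorff_content_eq INF_less_iff by (meson less_imp_le)
    qed
    then obtain U where U: "\<And>i. U i \<in> hausdorff_covers \<delta> (A i)"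
      and le: "\<And>i. (\<Sum>j. hausdorff_weight d (U i j)) \<le> hausdorff_content d \<delta> (A i) + ennreal (e * (1/2) ^ Suc i)"
      by metis
    define V where "V k = (case prod_decode k of (i, j) \<Rightarrow> U i j)" for k
    have V: "V \<in> hausdorff_covers \<delta> (\<Union>i. A i)"
    proof -
      have "x \<in> (\<Union>k. V k)" if "x \<in> A i" for x i
      proof -
        from hausdorff_coversD[OF U that] obtain j where "x \<in> U i j" by blast
        then have "x \<in> V (prod_encode (i, j))" by (simp add: V_def)
        then show ?thesis by blast
      qed
      then show ?thesis using U by (auto simp: hausdorff_covers_def V_def split: prod.split)
    qed
    have "hausdorff_content d \<delta> (\<Union>i. A i) \<le> (\<Sum>k. hausdorff_weight d (V k))"
      using V by (rule hausdorff_content_le)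
    also have "\<dots> = (\<Sum>i. \<Sum>j. hausdorff_weight d (U i j))"
      using suminf_ennreal_2dimen[of "\<lambda>i. \<Sum>j. hausdorff_weight d (U i j)"
          "\<lambda>(i,j). hausdorff_weight d (U i j)"]
      by (simp add: V_def split_beta)
    also have "\<dots> \<le> (\<Sum>i. hausdorff_content d \<delta> (A i) + ennreal (e * (1/2) ^ Suc i))"
      by (intro suminf_le le) auto
    also have "\<dots> = (\<Sum>i. hausdorff_content d \<delta> (A i)) + (\<Sum>i. ennreal (e * (1/2) ^ Suc i))"
      by (intro suminf_add[symmetric]) auto
    also have "(\<Sum>i. ennreal (e * (1/2) ^ Suc i)) = ennreal e"
      using sums_mult[OF power_half_series, of e] e
      by (intro suminf_ennreal_eq) auto
    also have "(\<Sum>i. hausdorff_content d \<delta> (A i)) \<le> (\<Sum>i. hausdorff_measure d (A i))"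
      by (intro suminf_le hausdorff_content_le_measure \<delta>) auto
    finally show "hausdorff_content d \<delta> (\<Union>i. A i) \<le> (\<Sum>i. hausdorff_measure d (A i)) + ennreal e"
      by (simp add: add_right_mono)
  qed
qed

lemma hausdorff_measure_Un_le:
  "hausdorff_measure d (A \<union> B) \<le> hausdorff_measure d A + hausdorff_measure d B"
proof -
  define C where "C i = (if i = 0 then A else if i = Suc 0 then B else {})" for i :: nat
  have "A \<union> B = (\<Union>i. C i)" by (auto simp: C_def split: if_splits)
  moreover have "(\<Sum>i. hausdorff_measure d (C i)) = (\<Sum>i<2. hausdorff_measure d (C i))"
    by (rule suminf_finite) (auto simp: C_def)
  ultimately show ?thesis
    using hausdorff_measure_UN_le[of d C] by (simp add: C_def numeral_2_eq_2)
qed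

lemma hausdorff_measure_finite_UN_le:
  "finite I \<Longrightarrow> hausdorff_measure d (\<Union>i\<in>I. A i) \<le> (\<Sum>i\<in>I. hausdorff_measure d (A i))"
proof (induction I rule: finite_induct)
  case (insert i I)
  have "hausdorff_measure d (\<Union>j\<in>insert i I. A j)
      \<le> hausdorff_measure d (A i) + hausdorff_measure d (\<Union>j\<in>I. A j)"
    using hausdorff_measure_Un_le[of d "A i" "\<Union>j\<in>I. A j"] by simp
  then show ?case using insert by (auto intro: order_trans add_left_mono)
qed simp

text \<open>The sum is an integral against the counting measure of \<open>\<C>\<close> so that it
  matches \<open>emeasure_UN_countable\<close> on the volume side in
  \<open>hausdorff_open_le\<close>.\<close>

lemma hausdorff_measure_countable_UN_le:
  assumes "countable \<C>"
  shows "hausdorff_measure d (\<Union>\<C>) \<le> (\<integral>\<^sup>+C. hausdorff_measure d C \<partial>count_space \<C>)"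
proof (cases "\<C> = {}")
  case False
  let ?f = "to_nat_on \<C>"
  define U where "U n = (if n \<in> ?f ` \<C> then from_nat_into \<C> n else {})" for n
  have U: "U (?f C) = C" if "C \<in> \<C>" for C using that assms by (auto simp: U_def)
  have "\<Union>\<C> \<subseteq> (\<Union>n. U n)" using U by blast
  then have "hausdorff_measure d (\<Union>\<C>) \<le> hausdorff_measure d (\<Union>n. U n)"
    by (rule hausdorff_measure_mono)
  also have "\<dots> \<le> (\<Sum>n. hausdorff_measure d (U n))" by (rule hausdorff_measure_UN_le)
  also have "\<dots> = (\<integral>\<^sup>+n. hausdorff_measure d (U n) \<partial>count_space UNIV)"
    by (rule nn_integral_count_space_nat[symmetric])
  also have "\<dots> = (\<integral>\<^sup>+n. hausdorff_measure d (U n) \<partial>count_space (?f ` \<C>))"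
    by (subst nn_integral_count_space_indicator)
       (auto intro!: nn_integral_cong simp: U_def split: split_indicator)
  also have "\<dots> = (\<integral>\<^sup>+C. hausdorff_measure d (U (?f C)) \<partial>count_space \<C>)"
    by (rule nn_integral_bij_count_space[symmetric])
       (use assms inj_on_to_nat_on in \<open>auto simp: bij_betw_def\<close>)
  also have "\<dots> = (\<integral>\<^sup>+C. hausdorff_measure d C \<partial>count_space \<C>)"
    by (intro nn_integral_cong) (auto simp: U)
  finally show ?thesis .
qed simp

text \<open>A cover at scale \<open>\<delta> / L\<close> is carried to a cover at scale
  \<open>\<delta>\<close>, each weight growing by at most \<open>L^d\<close>. Isometries, dilations
  and nearest-point projections are the three uses.\<close>

lemma hausdorff_measure_lipschitz_image:
  fixes f :: "'a::metric_space \<Rightarrow> 'b::metric_space"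
  assumes lip: "\<And>x y. x \<in> A \<Longrightarrow> y \<in> A \<Longrightarrow> dist (f x) (f y) \<le> L * dist x y" and L: "L > 0"
  shows "hausdorff_measure d (f ` A) \<le> ennreal (L ^ d) * hausdorff_measure d A"
proof (rule hausdorff_measure_leI)
  fix \<delta> :: real assume \<delta>: "\<delta> > 0"
  define c where "c = ennreal (L ^ d)"
  have c: "c \<noteq> 0" "c \<noteq> top" using L by (auto simp: c_def)
  have "hausdorff_content d \<delta> (f ` A) / c \<le> hausdorff_content d (\<delta>/L) A"
  proof (rule hausdorff_content_geI)
    fix U :: "nat \<Rightarrow> 'a set" assume U: "U \<in> hausdorff_covers (\<delta>/L) A"
    \<comment> \<open>The pieces are cut down to \<open>A\<close>, the only set on which
      \<open>f\<close> is known to be Lipschitz.\<close>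
    define V where "V i = f ` (U i \<inter> A)" for i
    have dV: "dist y z \<le> L * diameter (U i)" if yz: "y \<in> V i" "z \<in> V i" for y z i
    proof -
      obtain y' z' where "y = f y'" "z = f z'" "y' \<in> U i \<inter> A" "z' \<in> U i \<inter> A"
        using yz by (auto simp: V_def)
      then have "dist y z \<le> L * dist y' z'" using lip by auto
      also have "\<dots> \<le> L * diameter (U i)"
        using L U \<open>y' \<in> U i \<inter> A\<close> \<open>z' \<in> U i \<inter> A\<close>
        by (intro mult_left_mono diameter_bounded_bound) (auto simp: hausdorff_covers_def)
      finally show ?thesis .
    qed
    have dge: "diameter (U i) \<ge> 0" for i using U by (auto simp: hausdorff_covers_def intro: diameter_ge_0)
    have diam: "diameter (V i) \<le> L * diameter (U i)" for i
    proof (cases "V i = {}")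
      case False
      then show ?thesis
        using dV[of _ i] unfolding diameter_def[of "V i"] by (auto intro!: cSUP_least)
    qed (use dge L in auto)
    have bV: "bounded (V i)" for i
    proof (cases "V i = {}")
      case False
      then obtain y where "y \<in> V i" by auto
      then have "V i \<subseteq> cball y (L * diameter (U i))" using dV by auto
      then show ?thesis by (rule bounded_subset[OF bounded_cball])
    qed simp
    have "diameter (V i) \<le> \<delta>" for i
    proof -
      have "L * diameter (U i) \<le> L * (\<delta> / L)"
        using U L by (intro mult_left_mono) (auto simp: hausdorff_covers_def)
      with diam[of i] L show ?thesis by simp
    qed
    moreover have "f x \<in> (\<Union>i. V i)" if "x \<in> A" for x
    proof -
      from hausdorff_coversD[OF U, of x] that obtain i where "x \<in> U i" by blast
      then have "f x \<in> V i" using that by (auto simp: V_def)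
      then show ?thesis by blast
    qed
    ultimately have "V \<in> hausdorff_covers \<delta> (f ` A)"
      using bV by (auto simp: hausdorff_covers_def)
    then have "hausdorff_content d \<delta> (f ` A) \<le> (\<Sum>i. hausdorff_weight d (V i))"
      by (rule hausdorff_content_le)
    also have "\<dots> \<le> (\<Sum>i. c * hausdorff_weight d (U i))"
    proof (intro suminf_le)
      fix i
      show "hausdorff_weight d (V i) \<le> c * hausdorff_weight d (U i)"
      proof (cases "V i = {}")
        case False
        then have "U i \<noteq> {}" by (auto simp: V_def)
        have "hausdorff_weight d (V i) = ennreal (unit_ball_vol (real d) * (diameter (V i) / 2) ^ d)"
          using False by (simp add: hausdorff_weight_def)
        also have "\<dots> \<le> ennreal (unit_ball_vol (real d) * (L * (diameter (U i) / 2)) ^ d)"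
          using diam[of i] diameter_ge_0[OF bV, of i]
          by (intro ennreal_leI mult_left_mono power_mono) auto
        also have "\<dots> = c * hausdorff_weight d (U i)"
          using \<open>U i \<noteq> {}\<close> L dge[of i]
          by (simp add: hausdorff_weight_def c_def power_mult_distrib ennreal_mult' [symmetric] mult_ac
                   del: times_divide_eq_right)
        finally show ?thesis .
      qed simp
    qed auto
    also have "\<dots> = c * (\<Sum>i. hausdorff_weight d (U i))" by (simp add: ennreal_suminf_cmult)
    finally show "hausdorff_content d \<delta> (f ` A) / c \<le> (\<Sum>i. hausdorff_weight d (U i))"
      using c by (subst divide_le_posI_ennreal) (auto simp: mult.commute zero_less_iff_neq_zero)
  qed
  also have "\<dots> \<le> hausdorff_measure d A"
    using \<delta> L by (intro hausdorff_content_le_measure) auto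
  finally have "hausdorff_content d \<delta> (f ` A) / c * c \<le> hausdorff_measure d A * c"
    by (rule mult_right_mono) simp
  moreover have "hausdorff_content d \<delta> (f ` A) / c * c = hausdorff_content d \<delta> (f ` A)"
    using mult_divide_eq_ennreal[of c "hausdorff_content d \<delta> (f ` A)"] c
    by (metis ennreal_times_divide ennreal_divide_times)
  ultimately show "hausdorff_content d \<delta> (f ` A) \<le> ennreal (L ^ d) * hausdorff_measure d A"
    by (simp add: c_def mult.commute)
qed

lemma hausdorff_measure_isometry:
  assumes "\<And>x y. x \<in> A \<Longrightarrow> y \<in> A \<Longrightarrow> dist (f x) (f y) = dist x y"
  shows "hausdorff_measure d (f ` A) = hausdorff_measure d A"
proof (rule antisym)
  show "hausdorff_measure d (f ` A) \<le> hausdorff_measure d A"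
    using hausdorff_measure_lipschitz_image[of A f 1 d] assms by simp
  have inj: "inj_on f A" using assms by (metis dist_eq_0_iff inj_onI)
  have "hausdorff_measure d (inv_into A f ` f ` A) \<le> ennreal (1 ^ d) * hausdorff_measure d (f ` A)"
    by (rule hausdorff_measure_lipschitz_image) (use inj assms in auto)
  then show "hausdorff_measure d A \<le> hausdorff_measure d (f ` A)" using inj by simp
qed

lemma hausdorff_measure_scaleR:
  fixes A :: "'a::real_normed_vector set"
  assumes r: "r > 0"
  shows "hausdorff_measure d ((\<lambda>x. r *\<^sub>R x) ` A) = ennreal (r ^ d) * hausdorff_measure d A"
proof (rule antisym)
  have le: "hausdorff_measure d ((\<lambda>x. s *\<^sub>R x) ` B) \<le> ennreal (s ^ d) * hausdorff_measure d B"
    if "s > 0" for s and B :: "'a set"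
    using that by (intro hausdorff_measure_lipschitz_image)
      (auto simp: dist_norm simp flip: scaleR_diff_right)
  show "hausdorff_measure d ((\<lambda>x. r *\<^sub>R x) ` A) \<le> ennreal (r ^ d) * hausdorff_measure d A"
    using le[OF r] .
  have "hausdorff_measure d ((\<lambda>x. (1/r) *\<^sub>R x) ` (\<lambda>x. r *\<^sub>R x) ` A)
      \<le> ennreal ((1/r) ^ d) * hausdorff_measure d ((\<lambda>x. r *\<^sub>R x) ` A)"
    using r by (intro le) auto
  moreover have "(\<lambda>x. (1/r) *\<^sub>R x) ` (\<lambda>x. r *\<^sub>R x) ` A = A" using r by (simp add: image_image)
  ultimately have "ennreal (r ^ d) * hausdorff_measure d A
      \<le> ennreal (r ^ d) * (ennreal ((1/r) ^ d) * hausdorff_measure d ((\<lambda>x. r *\<^sub>R x) ` A))"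
    by (metis mult_left_mono zero_le)
  also have "\<dots> = hausdorff_measure d ((\<lambda>x. r *\<^sub>R x) ` A)"
    using r by (simp add: mult.assoc[symmetric] ennreal_mult'[symmetric] power_mult_distrib[symmetric])
  finally show "ennreal (r ^ d) * hausdorff_measure d A \<le> hausdorff_measure d ((\<lambda>x. r *\<^sub>R x) ` A)" .
qed

text \<open>A covering set of diameter below \<open>\<eta>\<close> meets at most one of
  \<open>A\<close> and \<open>B\<close>, so a fine cover of the union splits into covers of the two.
  It is applied to parts of facets that keep a positive distance from each other.\<close>

lemma hausdorff_measure_separated:
  fixes A B :: "'a::metric_space set"
  assumes \<eta>: "\<eta> > 0" and sep: "\<And>x y. x \<in> A \<Longrightarrow> y \<in> B \<Longrightarrow> dist x y \<ge> \<eta>"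
  shows "hausdorff_measure d A + hausdorff_measure d B \<le> hausdorff_measure d (A \<union> B)"
proof -
  have split: "hausdorff_content d \<delta> A + hausdorff_content d \<delta> B \<le> hausdorff_measure d (A \<union> B)"
    if \<delta>: "\<delta> > 0" "\<delta> < \<eta>" for \<delta>
  proof -
    have "hausdorff_content d \<delta> A + hausdorff_content d \<delta> B \<le> hausdorff_content d \<delta> (A \<union> B)"
    proof (rule hausdorff_content_geI)
      fix U :: "nat \<Rightarrow> 'a set" assume U: "U \<in> hausdorff_covers \<delta> (A \<union> B)"
      define UA where "UA i = (if U i \<inter> A = {} then {} else U i)" for i
      define UB where "UB i = (if U i \<inter> A = {} then U i else {})" for i
      have disj: "U i \<inter> B = {}" if "U i \<inter> A \<noteq> {}" for i
      proof (rule ccontr)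
        assume "U i \<inter> B \<noteq> {}"
        with that obtain x y where xy: "x \<in> U i" "x \<in> A" "y \<in> U i" "y \<in> B" by auto
        then have "\<eta> \<le> dist x y" using sep by auto
        also have "\<dots> \<le> diameter (U i)"
          using U xy by (intro diameter_bounded_bound) (auto simp: hausdorff_covers_def)
        also have "\<dots> \<le> \<delta>" using U by (auto simp: hausdorff_covers_def)
        finally show False using \<delta> by simp
      qed
      have bd: "bounded (UA i) \<and> diameter (UA i) \<le> \<delta>" "bounded (UB i) \<and> diameter (UB i) \<le> \<delta>" for i
        using U \<delta> by (auto simp: hausdorff_covers_def UA_def UB_def)
      have "x \<in> (\<Union>i. UA i)" if "x \<in> A" for x
      proof -
        from hausdorff_coversD[OF U, of x] that obtain i where "x \<in> U i" by blast
        then have "x \<in> UA i" using that by (auto simp: UA_def)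
        then show ?thesis by blast
      qed
      moreover have "x \<in> (\<Union>i. UB i)" if "x \<in> B" for x
      proof -
        from hausdorff_coversD[OF U, of x] that obtain i where i: "x \<in> U i" by blast
        then have "x \<in> UB i" using that disj[of i] by (auto simp: UB_def)
        then show ?thesis by blast
      qed
      ultimately have "UA \<in> hausdorff_covers \<delta> A" "UB \<in> hausdorff_covers \<delta> B"
        using bd by (auto simp: hausdorff_covers_def)
      then have "hausdorff_content d \<delta> A + hausdorff_content d \<delta> B
          \<le> (\<Sum>i. hausdorff_weight d (UA i)) + (\<Sum>i. hausdorff_weight d (UB i))"
        by (intro add_mono hausdorff_content_le)
      also have "\<dots> = (\<Sum>i. hausdorff_weight d (UA i) + hausdorff_weight d (UB i))"
        by (intro suminf_add) auto
      also have "\<dots> = (\<Sum>i. hausdorff_weight d (U i))"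
        by (intro suminf_cong) (auto simp: UA_def UB_def)
      finally show "hausdorff_content d \<delta> A + hausdorff_content d \<delta> B
          \<le> (\<Sum>i. hausdorff_weight d (U i))" .
    qed
    also have "\<dots> \<le> hausdorff_measure d (A \<union> B)" using \<delta> by (intro hausdorff_content_le_measure)
    finally show ?thesis .
  qed
  \<comment> \<open>Contents increase as the scale shrinks; hence the two suprema may be taken over
    independent scales, one after the other.\<close>
  have anti: "hausdorff_content d \<delta> C \<le> hausdorff_content d \<delta>' C" if "\<delta>' \<le> \<delta>" for \<delta> \<delta>' and C :: "'a set"
    unfolding hausdorff_content_eq using that
    by (intro INF_superset_mono) (auto simp: hausdorff_covers_def intro: order_trans)
  have "hausdorff_measure d A + hausdorff_content d \<delta>' B \<le> hausdorff_measure d (A \<union> B)"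
    if \<delta>': "\<delta>' > 0" for \<delta>'
  proof -
    have "hausdorff_content d \<delta> A + hausdorff_content d \<delta>' B \<le> hausdorff_measure d (A \<union> B)"
      if \<delta>: "\<delta> > 0" for \<delta>
    proof -
      let ?m = "min (\<eta>/2) (min \<delta> \<delta>')"
      have "hausdorff_content d \<delta> A + hausdorff_content d \<delta>' B
          \<le> hausdorff_content d ?m A + hausdorff_content d ?m B"
        by (intro add_mono anti) auto
      also have "\<dots> \<le> hausdorff_measure d (A \<union> B)"
        using \<eta> \<delta> \<delta>' by (intro split) auto
      finally show ?thesis .
    qed
    then have "(SUP \<delta>\<in>{0<..}. hausdorff_content d \<delta> A + hausdorff_content d \<delta>' B)
        \<le> hausdorff_measure d (A \<union> B)"
      by (intro SUP_least) auto
    then show ?thesis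
      unfolding hausdorff_measure_def[of d A] by (subst (asm) ennreal_SUP_add_left) auto
  qed
  then have "(SUP \<delta>\<in>{0<..}. hausdorff_measure d A + hausdorff_content d \<delta> B)
      \<le> hausdorff_measure d (A \<union> B)"
    by (intro SUP_least) auto
  then show ?thesis
    unfolding hausdorff_measure_def[of d B] by (subst ennreal_SUP_add_right) auto
qed

lemma hausdorff_measure_separated_UN:
  assumes "finite I" and "\<eta> > 0"
    and "\<And>i j x y. i \<in> I \<Longrightarrow> j \<in> I \<Longrightarrow> i \<noteq> j \<Longrightarrow> x \<in> A i \<Longrightarrow> y \<in> A j \<Longrightarrow> dist x y \<ge> \<eta>"
  shows "(\<Sum>i\<in>I. hausdorff_measure d (A i)) \<le> hausdorff_measure d (\<Union>i\<in>I. A i)"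
  using assms
proof (induction I rule: finite_induct)
  case (insert i I)
  have "(\<Sum>j\<in>insert i I. hausdorff_measure d (A j))
      \<le> hausdorff_measure d (A i) + hausdorff_measure d (\<Union>j\<in>I. A j)"
  proof -
    have "(\<Sum>j\<in>I. hausdorff_measure d (A j)) \<le> hausdorff_measure d (\<Union>j\<in>I. A j)"
    proof (rule insert.IH[OF \<open>\<eta> > 0\<close>])
      fix i' j x y assume "i' \<in> I" "j \<in> I" "i' \<noteq> j" "x \<in> A i'" "y \<in> A j"
      then show "\<eta> \<le> dist x y" by (intro insert.prems(2)[of i' j]) auto
    qed
    then show ?thesis using insert.hyps by (simp add: add_left_mono)
  qed
  also have "\<dots> \<le> hausdorff_measure d (A i \<union> (\<Union>j\<in>I. A j))"
  proof (rule hausdorff_measure_separated[OF \<open>\<eta> > 0\<close>])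
    fix x y assume "x \<in> A i" "y \<in> (\<Union>j\<in>I. A j)"
    then obtain j where "j \<in> I" "y \<in> A j" by blast
    then show "dist x y \<ge> \<eta>"
      using insert.hyps \<open>x \<in> A i\<close> by (intro insert.prems(2)[of i j]) auto
  qed
  finally show ?case by simp
qed simp

section \<open>Hausdorff measure and volume on coordinate subspaces\<close>

definition coord_proj :: "'a::euclidean_space set \<Rightarrow> 'a \<Rightarrow> 'a" where
  "coord_proj D x = (\<Sum>i\<in>D. (x \<bullet> i) *\<^sub>R i)"

definition coord_space :: "'a::euclidean_space set \<Rightarrow> 'a set" where
  "coord_space D = {x. \<forall>i\<in>Basis - D. x \<bullet> i = 0}"

lemma coord_proj_inner:
  "D \<subseteq> Basis \<Longrightarrow> i \<in> Basis \<Longrightarrow> coord_proj D x \<bullet> i = (if i \<in> D then x \<bullet> i else 0)"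
proof -
  assume D: "D \<subseteq> Basis" and i: "i \<in> Basis"
  have "coord_proj D x \<bullet> i = (\<Sum>j\<in>D. if j = i then x \<bullet> i else 0)"
    unfolding coord_proj_def inner_sum_left using D i
    by (intro sum.cong) (auto simp: inner_Basis subset_iff)
  then show ?thesis using finite_subset[OF D finite_Basis] by simp
qed

lemma coord_proj_in: "D \<subseteq> Basis \<Longrightarrow> coord_proj D x \<in> coord_space D"
  by (auto simp: coord_space_def coord_proj_inner)

lemma coord_proj_id: "D \<subseteq> Basis \<Longrightarrow> x \<in> coord_space D \<Longrightarrow> coord_proj D x = x"
  by (rule euclidean_eqI) (auto simp: coord_space_def coord_proj_inner)

lemma closed_coord_space: "closed (coord_space D)"
proof -
  have "coord_space D = (\<Inter>i\<in>Basis - D. {x. i \<bullet> x = 0})"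
    by (auto simp: coord_space_def inner_commute)
  then show ?thesis by (simp add: closed_INT closed_hyperplane)
qed

lemma borel_measurable_coord_proj [measurable]: "coord_proj D \<in> borel_measurable borel"
  unfolding coord_proj_def by measurable

text \<open>\<open>Q\<close> is a compact set of directions complementary to \<open>D\<close>. The
  full-dimensional volume of \<open>A + Q\<close> acts as the \<open>d\<close>-dimensional volume of
  \<open>A\<close>. Two windows occur: \<open>{0}\<close> when \<open>D\<close> is the whole basis,
  and a unit segment times a unit ball for facets.\<close>

locale window =
  fixes D Q :: "'a::euclidean_space set" and d :: nat
  assumes D: "D \<subseteq> Basis" and d_def: "d = card D" and Q: "compact Q" "Q \<subseteq> coord_space (Basis - D)"
begin

definition thick :: "'a set \<Rightarrow> 'a set" where
  "thick A = {p. coord_proj D p \<in> A \<and> p - coord_proj D p \<in> Q}"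

definition cell :: "'a set" where
  "cell = {y \<in> coord_space D. \<forall>i\<in>D. 0 \<le> y \<bullet> i \<and> y \<bullet> i < 1}"

lemma finD: "finite D" using D finite_Basis by (rule finite_subset)

lemma thick_borel [measurable]:
  assumes "A \<in> sets borel" shows "thick A \<in> sets borel"
proof -
  have [measurable]: "Q \<in> sets borel" using Q(1) by (simp add: borel_compact)
  note assms[measurable]
  show ?thesis unfolding thick_def by measurable
qed

lemma thick_eq_sums:
  assumes "A \<subseteq> coord_space D"
  shows "thick A = {x + y | x y. x \<in> A \<and> y \<in> Q}"
proof -
  have "coord_proj D (x + y) = x" if "x \<in> A" "y \<in> Q" for x y
    using that assms Q D
    by (intro euclidean_eqI[of "coord_proj D (x + y)" x])
       (auto simp: coord_proj_inner inner_add_left coord_space_def subset_iff)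
  then show ?thesis
    unfolding thick_def by (force intro: exI[of _ "coord_proj D _"])
qed

lemma coord_space_borel [measurable]: "coord_space D \<in> sets borel"
  using closed_coord_space by (rule borel_closed)

lemma cell_borel [measurable]: "cell \<in> sets borel"
proof -
  have "cell = coord_space D \<inter> (\<Inter>i\<in>D. {y. 0 \<le> y \<bullet> i} \<inter> {y. y \<bullet> i < 1}) "
    by (auto simp: cell_def)
  also have "\<dots> \<in> sets borel"
  proof (cases "D = {}")
    case False
    have "{y. 0 \<le> y \<bullet> i} \<inter> {y. y \<bullet> i < 1} \<in> sets borel" for i :: 'a by measurable
    then show ?thesis using False finD by (intro sets.Int sets.finite_INT) auto
  qed (use borel_closed[OF closed_coord_space] in auto)
  finally show ?thesis .
qed

text \<open>The thickened image is the image of \<open>thick A\<close> under the map that scales the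
  coordinates in \<open>D\<close> by \<open>r\<close>, fixes the others and translates by
  \<open>z\<close>; its determinant is \<open>r^d\<close>.\<close>

lemma vol_affine:
  assumes A: "A \<in> sets borel" "A \<subseteq> coord_space D" and z: "z \<in> coord_space D" and r: "r > 0"
  shows "emeasure lborel (thick ((\<lambda>x. z + r *\<^sub>R x) ` A)) = ennreal (r ^ d) * emeasure lborel (thick A)"
    (is "emeasure lborel (thick ?rA) = _")
proof -
  have rA: "?rA = (\<lambda>x. (1/r) *\<^sub>R (x - z)) -` A"
  proof (intro set_eqI iffI)
    fix x assume "x \<in> (\<lambda>x. (1/r) *\<^sub>R (x - z)) -` A"
    then show "x \<in> ?rA" using r by (intro image_eqI[of _ _ "(1/r) *\<^sub>R (x - z)"]) auto
  qed (use r in auto)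
  have m: "(\<lambda>x. (1/r) *\<^sub>R (x - z)) \<in> borel_measurable borel" by measurable
  have "?rA \<in> sets borel"
    using measurable_sets[OF m A(1)] unfolding rA by simp
  note [measurable] = thick_borel[OF this]
  define c where "c j = (if j \<in> D then r else 1)" for j :: 'a
  define T where "T x = z + (\<Sum>j\<in>Basis. (c j * (x \<bullet> j)) *\<^sub>R j)" for x
  have [measurable]: "T \<in> borel_measurable borel" unfolding T_def by measurable
  have T: "T x \<bullet> i = z \<bullet> i + c i * (x \<bullet> i)" if "i \<in> Basis" for x i
    using that by (simp add: T_def inner_add_left inner_sum_left inner_Basis if_distrib cong: if_cong)
  have proj: "coord_proj D (T x) = z + r *\<^sub>R coord_proj D x" for x
    using D z by (intro euclidean_eqI[of "coord_proj D (T x)"])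
      (auto simp: coord_proj_inner T inner_add_left c_def coord_space_def)
  have proj': "T x - coord_proj D (T x) = x - coord_proj D x" for x
    using D z by (intro euclidean_eqI[of "T x - coord_proj D (T x)"])
      (auto simp: coord_proj_inner T inner_add_left inner_diff_left c_def coord_space_def)
  have pre: "T -` thick ?rA = thick A"
    unfolding thick_def vimage_def mem_Collect_eq proj' unfolding proj using r by (auto simp: image_iff)
  have "emeasure lborel (thick ?rA)
      = emeasure (density (distr lborel borel T) (\<lambda>_. (\<Prod>j\<in>Basis. \<bar>c j\<bar>))) (thick ?rA)"
    unfolding T_def using r by (subst lborel_affine_euclidean[of c z]) (auto simp: c_def)
  also have "\<dots> = ennreal (\<Prod>j\<in>Basis. \<bar>c j\<bar>) * emeasure (distr lborel borel T) (thick ?rA)"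
    by (simp add: emeasure_density_const)
  also have "emeasure (distr lborel borel T) (thick ?rA) = emeasure lborel (thick A)"
    by (simp add: emeasure_distr pre)
  also have "(\<Prod>j\<in>Basis. \<bar>c j\<bar>) = (\<Prod>j\<in>D. r)"
    using D r by (intro prod.mono_neutral_cong_right) (auto simp: c_def)
  finally show ?thesis by (simp add: d_def)
qed

lemma hausdorff_affine:
  fixes A :: "'a set"
  assumes "r > 0"
  shows "hausdorff_measure k ((\<lambda>x. z + r *\<^sub>R x) ` A) = ennreal (r ^ k) * hausdorff_measure k A"
proof -
  have "hausdorff_measure k ((+) z ` (\<lambda>x. r *\<^sub>R x) ` A) = hausdorff_measure k ((\<lambda>x. r *\<^sub>R x) ` A)"
    by (rule hausdorff_measure_isometry) simp
  then show ?thesis using hausdorff_measure_scaleR[OF assms, of k A] by (simp add: image_image)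
qed

text \<open>Thickening fits into a box with side \<open>2 * \<delta>\<close> in the directions of
  \<open>D\<close> and \<open>2 * B\<close> in the others, where \<open>B\<close> bounds
  \<open>Q\<close>. The volume is thus controlled by the \<open>d\<close>-th power of the diameter,
  as Hausdorff weights are.\<close>

lemma thick_subset_box:
  obtains M where "M > 0"
    "\<And>p \<delta> S. p \<in> coord_space D \<Longrightarrow> S \<subseteq> coord_space D \<Longrightarrow> (\<And>x. x \<in> S \<Longrightarrow> dist p x \<le> \<delta>) \<Longrightarrow> \<delta> \<ge> 0 \<Longrightarrow>
       emeasure lborel (thick S) \<le> ennreal ((2 * \<delta>) ^ d * M)"
proof -
  from Q(1) obtain B where B: "B > 0" "\<And>y. y \<in> Q \<Longrightarrow> norm y \<le> B"
    using compact_imp_bounded bounded_pos by metis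
  show ?thesis
  proof (rule that[of "(2 * B) ^ card (Basis - D)"])
    fix p \<delta> S assume p: "p \<in> coord_space D" and S: "S \<subseteq> coord_space D"
      and dist: "\<And>x. x \<in> S \<Longrightarrow> dist p x \<le> \<delta>" and \<delta>: "\<delta> \<ge> 0"
    define w where "w = (\<Sum>i\<in>Basis. (if i \<in> D then \<delta> else B) *\<^sub>R i)"
    have w: "w \<bullet> i = (if i \<in> D then \<delta> else B)" if "i \<in> Basis" for i
      using that by (simp add: w_def)
    have "thick S \<subseteq> cbox (p - w) (p + w)"
    proof
      fix x assume x: "x \<in> thick S"
      have "\<bar>(x - p) \<bullet> i\<bar> \<le> w \<bullet> i" if i: "i \<in> Basis" for i
      proof (cases "i \<in> D")
        case True
        have "\<bar>(coord_proj D x - p) \<bullet> i\<bar> \<le> norm (coord_proj D x - p)"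
          using i by (rule Basis_le_norm)
        also have "\<dots> \<le> \<delta>" using dist[of "coord_proj D x"] x by (auto simp: thick_def dist_norm norm_minus_commute)
        finally show ?thesis using True i D by (simp add: w inner_diff_left coord_proj_inner)
      next
        case False
        have "\<bar>(x - coord_proj D x) \<bullet> i\<bar> \<le> norm (x - coord_proj D x)"
          using i by (rule Basis_le_norm)
        also have "\<dots> \<le> B" using x B by (auto simp: thick_def)
        finally show ?thesis using False i D p by (simp add: w inner_diff_left coord_proj_inner coord_space_def)
      qed
      then show "x \<in> cbox (p - w) (p + w)"
        by (auto simp: mem_box inner_diff_left inner_add_left abs_le_iff algebra_simps)
    qed
    then have "emeasure lborel (thick S) \<le> emeasure lborel (cbox (p - w) (p + w))"
      by (intro emeasure_mono) auto
    also have "\<dots> = ennreal (\<Prod>i\<in>Basis. 2 * (w \<bullet> i))"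
      using \<delta> B by (subst emeasure_lborel_cbox_eq) (auto simp: w inner_diff_left inner_add_left)
    also have "(\<Prod>i\<in>Basis. 2 * (w \<bullet> i)) = (\<Prod>i\<in>D. 2 * (w \<bullet> i)) * (\<Prod>i\<in>Basis - D. 2 * (w \<bullet> i))"
      using D finite_Basis by (subst prod.subset_diff[of D Basis]) (auto simp: mult.commute)
    also have "(\<Prod>i\<in>D. 2 * (w \<bullet> i)) = (\<Prod>i\<in>D. 2 * \<delta>)"
      using D by (intro prod.cong) (auto simp: w)
    also have "(\<Prod>i\<in>Basis - D. 2 * (w \<bullet> i)) = (\<Prod>i\<in>Basis - D. 2 * B)"
      by (intro prod.cong) (auto simp: w)
    finally show "emeasure lborel (thick S) \<le> ennreal ((2 * \<delta>) ^ d * (2 * B) ^ card (Basis - D))"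
      by (simp add: d_def)
  qed (use B in auto)
qed

lemma cell_norm: "x \<in> cell \<Longrightarrow> y \<in> cell \<Longrightarrow> dist x y \<le> real d"
proof -
  assume xy: "x \<in> cell" "y \<in> cell"
  have "norm (x - y) \<le> (\<Sum>i\<in>Basis. \<bar>(x - y) \<bullet> i\<bar>)" by (rule norm_le_l1)
  also have "\<dots> \<le> (\<Sum>i\<in>Basis. if i \<in> D then 1 else 0)"
  proof (intro sum_mono)
    fix i :: 'a assume "i \<in> Basis"
    then show "\<bar>(x - y) \<bullet> i\<bar> \<le> (if i \<in> D then 1 else 0)"
      using xy by (cases "i \<in> D") (fastforce simp: cell_def coord_space_def inner_diff_left)+
  qed
  also have "\<dots> = real d" using D by (simp add: d_def sum.If_cases Int_absorb1)
  finally show ?thesis by (simp add: dist_norm)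
qed

lemma vol_cell_finite: "emeasure lborel (thick cell) < top"
proof -
  obtain M where "M > 0" and M: "\<And>p \<delta> S. p \<in> coord_space D \<Longrightarrow> S \<subseteq> coord_space D \<Longrightarrow>
      (\<And>x. x \<in> S \<Longrightarrow> dist p x \<le> \<delta>) \<Longrightarrow> \<delta> \<ge> 0 \<Longrightarrow>
       emeasure lborel (thick S) \<le> ennreal ((2 * \<delta>) ^ d * M)"
    using thick_subset_box by blast
  have "0 \<in> cell" by (simp add: cell_def coord_space_def)
  then have "emeasure lborel (thick cell) \<le> ennreal ((2 * real d) ^ d * M)"
    using cell_norm[OF \<open>0 \<in> cell\<close>]
    by (intro M[of 0]) (auto simp: cell_def coord_space_def)
  then show ?thesis by (rule le_less_trans) simp
qed

text \<open>Mass distribution: the thickened volume of any covering set is at most \<open>k\<close>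
  times its weight, so no cover can have total weight below the volume of \<open>thick cell\<close>
  divided by \<open>k\<close>.\<close>

lemma hausdorff_cell_pos:
  assumes "emeasure lborel (thick cell) > 0"
  shows "hausdorff_measure d cell > 0"
proof -
  obtain M where M0: "M > 0" and M: "\<And>p \<delta> S. p \<in> coord_space D \<Longrightarrow> S \<subseteq> coord_space D \<Longrightarrow>
      (\<And>x. x \<in> S \<Longrightarrow> dist p x \<le> \<delta>) \<Longrightarrow> \<delta> \<ge> 0 \<Longrightarrow>
       emeasure lborel (thick S) \<le> ennreal ((2 * \<delta>) ^ d * M)"
    using thick_subset_box by blast
  \<comment> \<open>The ratio of the volume bound \<open>(2 * diameter)^d * M\<close> to the weight
    \<open>unit_ball_vol d * (diameter / 2)^d\<close>.\<close>
  define k where "k = 4 ^ d * M / unit_ball_vol (real d)"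
  have k: "k > 0" using M0 by (simp add: k_def)
  have "emeasure lborel (thick cell) \<le> ennreal k * hausdorff_content d 1 cell"
  proof -
    have "emeasure lborel (thick cell) / ennreal k \<le> hausdorff_content d 1 cell"
    proof (rule hausdorff_content_geI)
      fix U assume U: "U \<in> hausdorff_covers 1 cell"
      \<comment> \<open>Closures make the arbitrary covering sets Borel and leave their diameters
        unchanged.\<close>
      define V where "V i = coord_space D \<inter> closure (U i)" for i
      have V[measurable]: "V i \<in> sets borel" for i unfolding V_def by measurable
      have "thick cell \<subseteq> (\<Union>i. thick (V i))"
      proof
        fix x assume x: "x \<in> thick cell"
        then obtain i where "coord_proj D x \<in> U i" using hausdorff_coversD[OF U] by (auto simp: thick_def)
        then have "x \<in> thick (V i)"
          using x coord_proj_in[OF D] closure_subset by (auto simp: thick_def V_def)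
        then show "x \<in> (\<Union>i. thick (V i))" by blast
      qed
      then have "emeasure lborel (thick cell) \<le> emeasure lborel (\<Union>i. thick (V i))"
        by (intro emeasure_mono) auto
      also have "\<dots> \<le> (\<Sum>i. emeasure lborel (thick (V i)))"
        by (intro emeasure_subadditive_countably) auto
      also have "\<dots> \<le> (\<Sum>i. ennreal k * hausdorff_weight d (U i))"
      proof (intro suminf_le)
        fix i
        show "emeasure lborel (thick (V i)) \<le> ennreal k * hausdorff_weight d (U i)"
        proof (cases "V i = {}")
          case True
          then show ?thesis by (simp add: thick_def)
        next
          case False
          then obtain p where p: "p \<in> V i" by auto
          have bU: "bounded (U i)" using U by (auto simp: hausdorff_covers_def)
          have "dist p x \<le> diameter (U i)" if "x \<in> V i" for x
            using diameter_bounded_bound[OF bounded_closure[OF bU], of p x] p that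
            by (simp add: V_def diameter_closure bU)
          then have "emeasure lborel (thick (V i)) \<le> ennreal ((2 * diameter (U i)) ^ d * M)"
            using p by (intro M[of p]) (auto simp: V_def diameter_ge_0 bU)
          also have "\<dots> = ennreal (k * (unit_ball_vol (real d) * (diameter (U i) / 2) ^ d))"
          proof -
            have "2 * diameter (U i) = 4 * (diameter (U i) / 2)" by simp
            then have "(2 * diameter (U i)) ^ d = 4 ^ d * (diameter (U i) / 2) ^ d"
              by (metis power_mult_distrib)
            moreover have "unit_ball_vol (real d) \<noteq> 0" using unit_ball_vol_pos[of "real d"] by linarith
            ultimately show ?thesis by (simp add: k_def mult_ac)
          qed
          also have "\<dots> = ennreal k * hausdorff_weight d (U i)"
            using False k by (auto simp: hausdorff_weight_def ennreal_mult' V_def)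
          finally show ?thesis .
        qed
      qed auto
      also have "\<dots> = ennreal k * (\<Sum>i. hausdorff_weight d (U i))" by (simp add: ennreal_suminf_cmult)
      finally show "emeasure lborel (thick cell) / ennreal k \<le> (\<Sum>i. hausdorff_weight d (U i))"
        using k by (subst divide_le_posI_ennreal) (auto simp: mult.commute)
    qed
    then have "emeasure lborel (thick cell) / ennreal k * ennreal k \<le> hausdorff_content d 1 cell * ennreal k"
      by (rule mult_right_mono) simp
    moreover have "emeasure lborel (thick cell) / ennreal k * ennreal k = emeasure lborel (thick cell)"
      using mult_divide_eq_ennreal[of "ennreal k" "emeasure lborel (thick cell)"] k
      by (metis ennreal_times_divide ennreal_divide_times ennreal_eq_0_iff ennreal_neq_top not_less)
    ultimately show ?thesis by (simp add: mult.commute)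
  qed
  also have "\<dots> \<le> ennreal k * hausdorff_measure d cell"
    by (intro mult_left_mono hausdorff_content_le_measure) auto
  finally show ?thesis using assms by (metis mult_zero_right not_gr_zero less_le_trans less_irrefl)
qed


text \<open>The half-open dyadic cube of side \<open>2^-N\<close> on which the
  \<open>D\<close>-coordinates have the same floors as those of \<open>x\<close>. Labelling cubes by
  points instead of lattice indices reduces equality of cubes to \<open>dyadic_eq\<close>.\<close>

definition dyadic :: "nat \<Rightarrow> 'a \<Rightarrow> 'a set" where
  "dyadic N x = {y \<in> coord_space D. \<forall>i\<in>D. \<lfloor>2 ^ N * (y \<bullet> i)\<rfloor> = \<lfloor>2 ^ N * (x \<bullet> i)\<rfloor>}"

lemma dyadic_self: "x \<in> coord_space D \<Longrightarrow> x \<in> dyadic N x"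
  by (simp add: dyadic_def)

lemma dyadic_eq: "y \<in> dyadic N x \<Longrightarrow> dyadic N y = dyadic N x"
  by (auto simp: dyadic_def)

lemma dyadic_mono:
  assumes "M \<le> N" shows "dyadic N x \<subseteq> dyadic M x"
proof -
  have "\<lfloor>2 ^ M * t\<rfloor> = \<lfloor>2 ^ N * t\<rfloor> div 2 ^ (N - M)" for t :: real
  proof -
    obtain k where "N = M + k" using assms le_Suc_ex by blast
    then have "\<lfloor>2 ^ M * t\<rfloor> = \<lfloor>(2 ^ N * t) / real_of_int (2 ^ (N - M))\<rfloor>"
      by (simp add: power_add)
    also have "\<dots> = \<lfloor>2 ^ N * t\<rfloor> div 2 ^ (N - M)" by (rule floor_divide_real_eq_div) simp
    finally show ?thesis .
  qed
  then show ?thesis by (auto simp: dyadic_def)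
qed

lemma dyadic_image:
  obtains z where "z \<in> coord_space D" "dyadic N x = (\<lambda>y. z + (1 / 2 ^ N) *\<^sub>R y) ` cell"
proof -
  define z where "z = (\<Sum>i\<in>Basis. (if i \<in> D then of_int \<lfloor>2 ^ N * (x \<bullet> i)\<rfloor> / 2 ^ N else 0) *\<^sub>R i)"
  have zi: "z \<bullet> i = (if i \<in> D then of_int \<lfloor>2 ^ N * (x \<bullet> i)\<rfloor> / 2 ^ N else 0)" if "i \<in> Basis" for i
    using that by (simp add: z_def)
  have z: "z \<in> coord_space D" by (simp add: coord_space_def zi)
  have "y \<in> dyadic N x \<longleftrightarrow> 2 ^ N *\<^sub>R (y - z) \<in> cell" for y
  proof -
    have "\<lfloor>2 ^ N * (y \<bullet> i)\<rfloor> = \<lfloor>2 ^ N * (x \<bullet> i)\<rfloor> \<longleftrightarrow>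
        0 \<le> (2 ^ N *\<^sub>R (y - z)) \<bullet> i \<and> (2 ^ N *\<^sub>R (y - z)) \<bullet> i < 1" if i: "i \<in> D" for i
    proof -
      have "(2 ^ N *\<^sub>R (y - z)) \<bullet> i = 2 ^ N * (y \<bullet> i) - of_int \<lfloor>2 ^ N * (x \<bullet> i)\<rfloor>"
        using i D by (auto simp: inner_diff_left right_diff_distrib zi subset_iff)
      then show ?thesis by (auto simp: floor_eq_iff)
    qed
    moreover have "y \<in> coord_space D \<longleftrightarrow> 2 ^ N *\<^sub>R (y - z) \<in> coord_space D"
      using z by (auto simp: coord_space_def inner_diff_left)
    ultimately show ?thesis by (auto simp: dyadic_def cell_def)
  qed
  moreover have "2 ^ N *\<^sub>R (y - z) \<in> cell \<longleftrightarrow> y \<in> (\<lambda>y. z + (1 / 2 ^ N) *\<^sub>R y) ` cell" for y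
  proof
    assume "2 ^ N *\<^sub>R (y - z) \<in> cell"
    then show "y \<in> (\<lambda>y. z + (1 / 2 ^ N) *\<^sub>R y) ` cell"
      by (intro image_eqI[of _ _ "2 ^ N *\<^sub>R (y - z)"]) auto
  qed auto
  ultimately show ?thesis using z by (intro that[of z]) auto
qed

lemma dyadic_borel [measurable]: "dyadic N x \<in> sets borel"
proof -
  have "dyadic N x = coord_space D \<inter> (\<Inter>i\<in>D. {y. \<lfloor>2 ^ N * (y \<bullet> i)\<rfloor> = \<lfloor>2 ^ N * (x \<bullet> i)\<rfloor>})"
    by (auto simp: dyadic_def)
  also have "\<dots> \<in> sets borel"
  proof (cases "D = {}")
    case False
    have "{y. \<lfloor>2 ^ N * (y \<bullet> i)\<rfloor> = \<lfloor>2 ^ N * (x \<bullet> i)\<rfloor>} \<in> sets borel" for i :: 'a by measurable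
    then show ?thesis using False finD by (intro sets.Int sets.finite_INT) auto
  qed (use borel_closed[OF closed_coord_space] in auto)
  finally show ?thesis .
qed

lemma cell_subset: "cell \<subseteq> coord_space D"
  by (auto simp: cell_def)

lemma dyadic_measures:
  "emeasure lborel (thick (dyadic N x)) = ennreal ((1 / 2 ^ N) ^ d) * emeasure lborel (thick cell)"
  "hausdorff_measure d (dyadic N x) = ennreal ((1 / 2 ^ N) ^ d) * hausdorff_measure d cell"
proof -
  obtain z where z: "z \<in> coord_space D" "dyadic N x = (\<lambda>y. z + (1 / 2 ^ N) *\<^sub>R y) ` cell"
    by (rule dyadic_image)
  show "emeasure lborel (thick (dyadic N x)) = ennreal ((1 / 2 ^ N) ^ d) * emeasure lborel (thick cell)"
    unfolding z(2) by (rule vol_affine[OF cell_borel cell_subset z(1)]) simp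
  show "hausdorff_measure d (dyadic N x) = ennreal ((1 / 2 ^ N) ^ d) * hausdorff_measure d cell"
    unfolding z(2) by (rule hausdorff_affine) simp
qed

lemma dyadic_dist:
  assumes "y \<in> dyadic N x" "z \<in> dyadic N x" shows "dist y z \<le> real d / 2 ^ N"
proof -
  obtain w where w: "dyadic N x = (\<lambda>y. w + (1 / 2 ^ N) *\<^sub>R y) ` cell"
    using dyadic_image by metis
  then obtain y' z' where *: "y' \<in> cell" "z' \<in> cell" "y = w + (1 / 2 ^ N) *\<^sub>R y'" "z = w + (1 / 2 ^ N) *\<^sub>R z'"
    using assms by auto
  have "dist y z = dist y' z' / 2 ^ N"
    by (simp add: * dist_norm norm_minus_commute divide_inverse mult.commute flip: scaleR_diff_right)
  then show ?thesis using cell_norm[OF *(1,2)] by (simp add: divide_right_mono)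
qed

lemma countable_dyadic: "countable (range (dyadic N))"
proof -
  define g where "g f = {y \<in> coord_space D. \<forall>i\<in>D. \<lfloor>2 ^ N * (y \<bullet> i)\<rfloor> = f i}" for f :: "'a \<Rightarrow> int"
  have "dyadic N x = g (\<lambda>i\<in>D. \<lfloor>2 ^ N * (x \<bullet> i)\<rfloor>)" for x
    by (auto simp: dyadic_def g_def)
  then have "range (dyadic N) \<subseteq> g ` PiE D (\<lambda>_. UNIV)" by auto
  moreover have "countable (PiE D (\<lambda>_. UNIV :: int set))"
    using finD by (intro countable_PiE) auto
  ultimately show ?thesis by (meson countable_image countable_subset)
qed

text \<open>The cell is cut into \<open>2^(N d)\<close> dyadic cubes of diameter at most
  \<open>d / 2^N\<close>, with \<open>N\<close> so large that this is below \<open>\<delta>\<close>.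
  The total weight bound \<open>unit_ball_vol d * d^d\<close> is free of \<open>N\<close>, hence of
  the scale.\<close>

lemma hausdorff_cell_finite: "hausdorff_measure d cell < top"
proof -
  have "hausdorff_content d \<delta> cell \<le> ennreal (unit_ball_vol (real d) * real d ^ d)" if \<delta>: "\<delta> > 0" for \<delta>
  proof -
    obtain N :: nat where N: "real d / \<delta> < 2 ^ N"
      using real_arch_pow[of 2 "real d / \<delta>"] by auto
    define I where "I = PiE D (\<lambda>_. {0..<(2 :: int) ^ N})"
    define E where "E f = {y \<in> coord_space D. \<forall>i\<in>D. \<lfloor>2 ^ N * (y \<bullet> i)\<rfloor> = f i}" for f :: "'a \<Rightarrow> int"
    have finI: "finite I" unfolding I_def using finD by (intro finite_PiE) auto
    have cardI: "card I = (2 ^ N) ^ d"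
      unfolding I_def using finD by (simp add: card_PiE d_def nat_power_eq)
    obtain g where g: "bij_betw g {..<card I} I"
      using finI bij_betw_from_nat_into_finite by blast
    define U where "U n = (if n < card I then E (g n) else {})" for n
    have E: "dist y z \<le> real d / 2 ^ N" if "y \<in> E f" "z \<in> E f" for y z f
      using that by (intro dyadic_dist[of y N y]) (auto simp: E_def dyadic_def)
    have Ub: "bounded (U n)" "diameter (U n) \<le> real d / 2 ^ N" for n
    proof -
      have "U n \<subseteq> cball y (real d / 2 ^ N)" if "y \<in> U n" for y
        using that E by (auto simp: U_def split: if_splits)
      then show "bounded (U n)"
        by (cases "U n = {}") (auto, meson bounded_cball bounded_subset)
      show "diameter (U n) \<le> real d / 2 ^ N"
      proof (cases "U n = {}")
        case False
        then show ?thesis unfolding diameter_def using E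
          by (auto intro!: cSUP_least simp: U_def split: if_splits)
      qed simp
    qed
    have "cell \<subseteq> (\<Union>n. U n)"
    proof
      fix y assume y: "y \<in> cell"
      define f where "f = (\<lambda>i\<in>D. \<lfloor>2 ^ N * (y \<bullet> i)\<rfloor>)"
      have "\<lfloor>2 ^ N * (y \<bullet> i)\<rfloor> < 2 ^ N" if "i \<in> D" for i
      proof -
        have "2 ^ N * (y \<bullet> i) < 2 ^ N * 1" using y that by (intro mult_strict_left_mono) (auto simp: cell_def)
        then show ?thesis by (simp add: floor_less_iff)
      qed
      then have "f \<in> I" using y by (auto simp: I_def f_def cell_def)
      then have "f \<in> g ` {..<card I}" using g by (simp add: bij_betw_def)
      then obtain n where "n < card I" "g n = f" by auto
      moreover have "y \<in> E f" using y by (auto simp: E_def f_def cell_def)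
      ultimately show "y \<in> (\<Union>n. U n)" by (auto simp: U_def)
    qed
    moreover have "real d / 2 ^ N \<le> \<delta>" using N \<delta> by (simp add: field_simps)
    ultimately have "U \<in> hausdorff_covers \<delta> cell" using Ub by (auto simp: hausdorff_covers_def intro: order_trans)
    then have "hausdorff_content d \<delta> cell \<le> (\<Sum>n. hausdorff_weight d (U n))"
      by (rule hausdorff_content_le)
    also have "\<dots> = (\<Sum>n<card I. hausdorff_weight d (U n))"
      by (rule suminf_finite) (auto simp: U_def)
    also have "\<dots> \<le> (\<Sum>n<card I. ennreal (unit_ball_vol (real d) * (real d / 2 ^ N) ^ d))"
    proof (intro sum_mono)
      fix n
      have "diameter (U n) \<ge> 0" using Ub(1) by (rule diameter_ge_0)
      moreover have "diameter (U n) / 2 \<le> real d / 2 ^ N"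
        using Ub(2)[of n] calculation by linarith
      ultimately have "(diameter (U n) / 2) ^ d \<le> (real d / 2 ^ N) ^ d"
        by (intro power_mono) auto
      then show "hausdorff_weight d (U n) \<le> ennreal (unit_ball_vol (real d) * (real d / 2 ^ N) ^ d)"
        by (auto simp: hausdorff_weight_def intro!: ennreal_leI mult_left_mono)
    qed
    also have "\<dots> = ennreal (unit_ball_vol (real d) * real d ^ d)"
      by (simp add: cardI power_divide ennreal_of_nat_eq_real_of_nat ennreal_mult'[symmetric])
    finally show ?thesis .
  qed
  then have "hausdorff_measure d cell \<le> ennreal (unit_ball_vol (real d) * real d ^ d)"
    by (rule hausdorff_measure_leI)
  then show ?thesis by (rule le_less_trans) simp
qed

lemma thick_UN: "thick (\<Union>\<C>) = (\<Union>C\<in>\<C>. thick C)"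
  by (auto simp: thick_def)

text \<open>The open set is the disjoint union of its maximal dyadic cubes, and on dyadic cubes the
  two measures are proportional with the ratio of the unit cell. Subadditivity of one and additivity
  of the other sum this up to an inequality in one direction.\<close>

lemma hausdorff_open_le:
  assumes U: "open U"
  shows "emeasure lborel (thick cell) * hausdorff_measure d (U \<inter> coord_space D)
       \<le> hausdorff_measure d cell * emeasure lborel (thick (U \<inter> coord_space D))"
proof -
  let ?S = "U \<inter> coord_space D"
  \<comment> \<open>The coarsest level at which the cube around \<open>x\<close> fits into
    \<open>U\<close>. Members of \<open>\<C>\<close> are therefore maximal, and two that meet
    coincide.\<close>
  define n where "n x = (LEAST N. dyadic N x \<subseteq> U)" for x
  define \<C> where "\<C> = (\<lambda>x. dyadic (n x) x) ` ?S"
  have ex: "\<exists>N. dyadic N x \<subseteq> U" if x: "x \<in> ?S" for x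
  proof -
    obtain e where e: "e > 0" "ball x e \<subseteq> U" using U x by (meson IntD1 openE)
    obtain N :: nat where "real d / e < 2 ^ N" using real_arch_pow[of 2 "real d / e"] by auto
    then have "real d / 2 ^ N < e" using e by (simp add: field_simps)
    then have "dyadic N x \<subseteq> ball x e"
      using dyadic_dist[OF dyadic_self, of x] x by (force simp: subset_iff)
    then show ?thesis using e by blast
  qed
  have sub: "dyadic (n x) x \<subseteq> U" if "x \<in> ?S" for x
    unfolding n_def using ex[OF that] by (rule LeastI_ex)
  have least: "n x \<le> N" if "dyadic N x \<subseteq> U" for x N
    unfolding n_def using that by (rule Least_le)
  have un: "\<Union>\<C> = ?S"
    using sub dyadic_self by (auto simp: \<C>_def) (auto simp: dyadic_def)
  have same: "dyadic (n x) x = dyadic (n y) y"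
    if "x \<in> ?S" "y \<in> ?S" "n x \<le> n y" "dyadic (n x) x \<inter> dyadic (n y) y \<noteq> {}" for x y
  proof -
    from that(4) obtain p where p: "p \<in> dyadic (n x) x" "p \<in> dyadic (n y) y" by auto
    have "dyadic (n y) y \<subseteq> dyadic (n x) p"
      using dyadic_eq[OF p(2)] dyadic_mono[OF that(3), of p] by auto
    also have eq: "dyadic (n x) p = dyadic (n x) x" by (rule dyadic_eq[OF p(1)])
    finally have "y \<in> dyadic (n x) x" using dyadic_self[of y] that(2) by auto
    then have eq': "dyadic (n x) y = dyadic (n x) x" by (rule dyadic_eq)
    then have "n y \<le> n x" using sub[OF that(1)] by (intro least) simp
    then show ?thesis using that(3) eq' by (metis order_antisym)
  qed
  have disj: "disjoint \<C>"
  proof (rule disjointI)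
    fix a b assume ab: "a \<in> \<C>" "b \<in> \<C>" "a \<noteq> b"
    then obtain x y where *: "x \<in> ?S" "y \<in> ?S" "a = dyadic (n x) x" "b = dyadic (n y) y"
      by (auto simp: \<C>_def)
    show "a \<inter> b = {}"
      using same[OF *(1,2)] same[OF *(2,1)] ab(3) *(3,4) by (metis Int_commute nat_le_linear)
  qed
  have cnt: "countable \<C>"
  proof (rule countable_subset)
    show "\<C> \<subseteq> (\<Union>N. range (dyadic N))" by (auto simp: \<C>_def)
    show "countable (\<Union>N. range (dyadic N))" by (intro countable_UN countable_dyadic) auto
  qed
  have bor: "C \<in> sets borel" if "C \<in> \<C>" for C using that by (auto simp: \<C>_def)
  have proportional: "emeasure lborel (thick cell) * hausdorff_measure d C = hausdorff_measure d cell * emeasure lborel (thick C)"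
    if "C \<in> \<C>" for C
    using that by (auto simp: \<C>_def dyadic_measures mult_ac)
  have "emeasure lborel (thick cell) * hausdorff_measure d ?S
      \<le> emeasure lborel (thick cell) * (\<integral>\<^sup>+C. hausdorff_measure d C \<partial>count_space \<C>)"
    unfolding un[symmetric] by (intro mult_left_mono hausdorff_measure_countable_UN_le cnt) auto
  also have "\<dots> = (\<integral>\<^sup>+C. emeasure lborel (thick cell) * hausdorff_measure d C \<partial>count_space \<C>)"
    by (simp add: nn_integral_cmult)
  also have "\<dots> = (\<integral>\<^sup>+C. hausdorff_measure d cell * emeasure lborel (thick C) \<partial>count_space \<C>)"
    by (intro nn_integral_cong proportional) auto
  also have "\<dots> = hausdorff_measure d cell * (\<integral>\<^sup>+C. emeasure lborel (thick C) \<partial>count_space \<C>)"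
    by (simp add: nn_integral_cmult)
  also have "(\<integral>\<^sup>+C. emeasure lborel (thick C) \<partial>count_space \<C>) = emeasure lborel (\<Union>C\<in>\<C>. thick C)"
  proof (rule emeasure_UN_countable[symmetric])
    show "disjoint_family_on thick \<C>"
      using disj by (auto simp: disjoint_family_on_def disjoint_def thick_def)
  qed (use bor cnt thick_borel in auto)
  finally show ?thesis by (simp only: thick_UN[symmetric] un)
qed

lemma vol_finite:
  assumes "bounded A" "A \<subseteq> coord_space D"
  shows "emeasure lborel (thick A) < top"
proof -
  obtain M where M: "\<And>p \<delta> S. p \<in> coord_space D \<Longrightarrow> S \<subseteq> coord_space D \<Longrightarrow>
      (\<And>x. x \<in> S \<Longrightarrow> dist p x \<le> \<delta>) \<Longrightarrow> \<delta> \<ge> 0 \<Longrightarrow>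
       emeasure lborel (thick S) \<le> ennreal ((2 * \<delta>) ^ d * M)"
    using thick_subset_box by metis
  obtain B where B: "B > 0" "\<And>x. x \<in> A \<Longrightarrow> norm x \<le> B"
    using assms(1) bounded_pos by metis
  have "emeasure lborel (thick A) \<le> ennreal ((2 * B) ^ d * M)"
    using B assms by (intro M[of 0]) (auto simp: coord_space_def)
  then show ?thesis by (rule le_less_trans) simp
qed

text \<open>\<open>F\<close> is the intersection of its open neighbourhoods of width
  \<open>1 / (k + 1)\<close>; the inequality for open sets passes to the limit because the volume is
  continuous from above.\<close>

lemma hausdorff_compact_le:
  assumes F: "compact F" "F \<subseteq> coord_space D"
  shows "emeasure lborel (thick cell) * hausdorff_measure d F
       \<le> hausdorff_measure d cell * emeasure lborel (thick F)"
proof (cases "F = {}")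
  case False
  define U where "U k = {x. infdist x F < 1 / real (Suc k)}" for k
  have U: "open (U k)" for k
    unfolding U_def by (intro open_Collect_less continuous_intros)
  have FU: "F \<subseteq> U k" for k by (auto simp: U_def)
  have dec: "U k \<subseteq> U j" if "j \<le> k" for j k
  proof -
    have "1 / real (Suc k) \<le> 1 / real (Suc j)" using that by (simp add: frac_le)
    then show ?thesis by (auto simp: U_def)
  qed
  have INT: "(\<Inter>k. U k) = F"
  proof
    show "(\<Inter>k. U k) \<subseteq> F"
    proof
      fix x assume x: "x \<in> (\<Inter>k. U k)"
      have "infdist x F \<le> 0"
      proof (rule ccontr)
        assume "\<not> infdist x F \<le> 0"
        then have "\<exists>k. inverse (real (Suc k)) < infdist x F"
          using reals_Archimedean[of "infdist x F"] by auto
        then obtain k where "inverse (real (Suc k)) < infdist x F" ..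
        moreover have "x \<in> U k" using x by blast
        ultimately show False by (simp add: U_def inverse_eq_divide)
      qed
      then show "x \<in> F"
        using False F(1) in_closed_iff_infdist_zero[of F x] infdist_nonneg[of x F]
        by (auto simp: compact_imp_closed)
    qed
  qed (use FU in auto)
  have bdd: "bounded (U k)" for k
  proof -
    obtain B where B: "\<And>x. x \<in> F \<Longrightarrow> norm x \<le> B"
      using F(1) compact_imp_bounded bounded_iff by metis
    have "norm x \<le> B + 1" if "x \<in> U k" for x
    proof -
      obtain y where y: "y \<in> F" "infdist x F = dist x y"
        using infdist_attains_inf[OF compact_imp_closed[OF F(1)] False] by metis
      then have "dist x y \<le> 1" using that by (auto simp: U_def intro: order_trans less_imp_le)
      then show ?thesis using B[OF y(1)] norm_triangle_sub[of x y] by (auto simp: dist_norm)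
    qed
    then show ?thesis by (auto simp: bounded_iff)
  qed
  have "(\<lambda>k. emeasure lborel (thick (U k \<inter> coord_space D))) \<longlonglongrightarrow> emeasure lborel (\<Inter>k. thick (U k \<inter> coord_space D))"
  proof (rule Lim_emeasure_decseq)
    show "range (\<lambda>k. thick (U k \<inter> coord_space D)) \<subseteq> sets lborel"
      using borel_open[OF U] by (auto intro!: thick_borel)
    show "decseq (\<lambda>k. thick (U k \<inter> coord_space D))"
      using dec by (force simp: decseq_def thick_def)
    show "emeasure lborel (thick (U k \<inter> coord_space D)) \<noteq> \<infinity>" for k
      using vol_finite[of "U k \<inter> coord_space D"] bdd[of k]
      by (auto simp: less_top bounded_Int)
  qed
  also have "(\<Inter>k. thick (U k \<inter> coord_space D)) = thick F"
    using INT F(2) by (auto simp: thick_def)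
  finally have lim: "(\<lambda>k. hausdorff_measure d cell * emeasure lborel (thick (U k \<inter> coord_space D)))
      \<longlonglongrightarrow> hausdorff_measure d cell * emeasure lborel (thick F)"
    using hausdorff_cell_finite by (intro ennreal_tendsto_cmult) (auto simp: less_top)
  show ?thesis
  proof (rule LIMSEQ_le_const[OF lim], intro exI[of _ 0] allI impI)
    fix k
    have "emeasure lborel (thick cell) * hausdorff_measure d F
        \<le> emeasure lborel (thick cell) * hausdorff_measure d (U k \<inter> coord_space D)"
      using FU F(2) by (intro mult_left_mono hausdorff_measure_mono) auto
    also have "\<dots> \<le> hausdorff_measure d cell * emeasure lborel (thick (U k \<inter> coord_space D))"
      by (rule hausdorff_open_le[OF U])
    finally show "emeasure lborel (thick cell) * hausdorff_measure d F
       \<le> hausdorff_measure d cell * emeasure lborel (thick (U k \<inter> coord_space D))" .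
  qed
qed simp

text \<open>The reverse inequality comes from the complement in a cube: Hausdorff measure of the
  cube is at most that of \<open>F\<close> plus that of the rest, and the rest is relatively open,
  so \<open>hausdorff_open_le\<close> bounds it by the volume that \<open>F\<close> leaves
  over.\<close>

lemma hausdorff_compact_eq:
  assumes F: "compact F" "F \<subseteq> coord_space D" and q0: "emeasure lborel (thick cell) > 0"
  shows "emeasure lborel (thick cell) * hausdorff_measure d F
       = hausdorff_measure d cell * emeasure lborel (thick F)"
proof (rule antisym[OF hausdorff_compact_le[OF F]])
  define q where "q = enn2real (emeasure lborel (thick cell))"
  define h where "h = enn2real (hausdorff_measure d cell)"
  define v where "v = enn2real (emeasure lborel (thick F))"
  have q: "emeasure lborel (thick cell) = ennreal q" "q > 0"
    using vol_cell_finite q0 by (auto simp: q_def enn2real_positive_iff)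
  have h: "hausdorff_measure d cell = ennreal h" "h \<ge> 0"
    using hausdorff_cell_finite by (auto simp: h_def)
  have bF: "bounded F" using F(1) by (rule compact_imp_bounded)
  have v: "emeasure lborel (thick F) = ennreal v" "v \<ge> 0"
    using vol_finite[OF bF F(2)] by (auto simp: v_def)
  obtain B where B: "B > 0" "\<And>x. x \<in> F \<Longrightarrow> norm x < B"
    using bF bounded_pos_less by metis
  define one where "one = (\<Sum>i\<in>Basis. (if i \<in> D then 1 else 0) *\<^sub>R i :: 'a)"
  have one: "one \<bullet> i = (if i \<in> D then 1 else 0)" if "i \<in> Basis" for i
    using that by (simp add: one_def)
  have oneD: "r *\<^sub>R one \<in> coord_space D" for r by (simp add: coord_space_def one)
  \<comment> \<open>An affine copy of the cell, namely the half-open cube with coordinates in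
    \<open>[-r, r)\<close>; both measures of it are known by scaling.\<close>
  define C where "C r = (\<lambda>x. (- r) *\<^sub>R one + (2 * r) *\<^sub>R x) ` cell" for r
  have C: "C r = {y \<in> coord_space D. \<forall>i\<in>D. - r \<le> y \<bullet> i \<and> y \<bullet> i < r}" if r: "r > 0" for r
  proof (intro set_eqI iffI)
    fix y assume "y \<in> {y \<in> coord_space D. \<forall>i\<in>D. - r \<le> y \<bullet> i \<and> y \<bullet> i < r}"
    then have "(1 / (2 * r)) *\<^sub>R (y + r *\<^sub>R one) \<in> cell"
      using D r oneD[of r] by (auto simp: cell_def coord_space_def inner_add_left one subset_iff field_simps)
    then show "y \<in> C r"
      unfolding C_def using r by (intro image_eqI[of _ _ "(1 / (2 * r)) *\<^sub>R (y + r *\<^sub>R one)"]) auto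
  next
    fix y assume "y \<in> C r"
    then obtain x where x: "x \<in> cell" "y = (- r) *\<^sub>R one + (2 * r) *\<^sub>R x" by (auto simp: C_def)
    have "- r \<le> y \<bullet> i \<and> y \<bullet> i < r" if "i \<in> D" for i
    proof -
      have "y \<bullet> i = 2 * r * (x \<bullet> i) - r" using x(2) that D by (auto simp: inner_add_left inner_diff_left one subset_iff)
      moreover have "0 \<le> 2 * r * (x \<bullet> i)" "2 * r * (x \<bullet> i) < 2 * r * 1"
        using x(1) that r by (auto simp: cell_def)
      ultimately show ?thesis by linarith
    qed
    moreover have "y \<in> coord_space D"
      using x by (auto simp: cell_def coord_space_def inner_add_left inner_diff_left one)
    ultimately show "y \<in> {y \<in> coord_space D. \<forall>i\<in>D. - r \<le> y \<bullet> i \<and> y \<bullet> i < r}" by auto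
  qed
  have HC: "hausdorff_measure d (C r) = ennreal ((2 * r) ^ d * h)" if "r > 0" for r
    unfolding C_def using that h hausdorff_affine[of "2 * r" d "(- r) *\<^sub>R one" cell]
    by (simp add: ennreal_mult')
  have VC: "emeasure lborel (thick (C r)) = ennreal ((2 * r) ^ d * q)" if "r > 0" for r
    unfolding C_def using that q vol_affine[OF cell_borel cell_subset oneD[of "- r"], of "2 * r"]
    by (simp add: ennreal_mult')
  have FC: "F \<subseteq> C B"
  proof
    fix x assume x: "x \<in> F"
    have "\<bar>x \<bullet> i\<bar> < B" if "i \<in> D" for i
      using Basis_le_norm[of i x] B(2)[OF x] that D by fastforce
    then show "x \<in> C B" using x F(2) B(1) by (force simp: C abs_less_iff)
  qed
  have HF: "hausdorff_measure d F < top"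
    using hausdorff_measure_mono[OF FC, of d] HC[OF B(1)] by (auto intro: le_less_trans)
  define g where "g = enn2real (hausdorff_measure d F)"
  have g: "hausdorff_measure d F = ennreal g" "g \<ge> 0" using HF by (auto simp: g_def)
  \<comment> \<open>The rest must be open, so it is taken in the open cube of half-side
    \<open>r > B\<close>, which contains the half-open cube \<open>C B\<close>. The surplus
    \<open>(2 r)^d - (2 B)^d\<close> disappears as \<open>r\<close> tends to
    \<open>B\<close>.\<close>
  have key: "h * v \<le> q * g + h * q * ((2 * r) ^ d - (2 * B) ^ d)" if r: "r > B" for r
  proof -
    define G where "G = {x. \<forall>i\<in>D. - r < x \<bullet> i \<and> x \<bullet> i < r}"
    have "G = (\<Inter>i\<in>D. {x. - r < x \<bullet> i} \<inter> {x. x \<bullet> i < r})" by (auto simp: G_def)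
    then have "open G" using finD
      by (auto intro!: open_INT open_Int simp: open_halfspace_component_gt open_halfspace_component_lt)
    then have oG: "open (G - F)" using F(1) by (intro open_Diff compact_imp_closed)
    let ?E = "(G - F) \<inter> coord_space D"
    have [measurable]: "F \<in> sets borel" using F(1) by (rule borel_compact)
    have Eb [measurable]: "?E \<in> sets borel" using borel_open[OF oG] by measurable
    have EC: "?E \<subseteq> C r" using r B by (auto simp: C G_def less_imp_le)
    have FCr: "F \<subseteq> C r" using FC r B by (auto simp: C less_imp_le) force+
    have bor: "C r \<in> sets borel"
    proof -
      have "C r = coord_space D \<inter> (\<Inter>i\<in>D. {y. - r \<le> y \<bullet> i} \<inter> {y. y \<bullet> i < r})"
        using r B by (auto simp: C)
      also have "\<dots> \<in> sets borel"
      proof (cases "D = {}")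
        case False
        have "{y. - r \<le> y \<bullet> i} \<inter> {y. y \<bullet> i < r} \<in> sets borel" for i :: 'a by measurable
        then show ?thesis using False finD by (intro sets.Int sets.finite_INT) auto
      qed (use borel_closed[OF closed_coord_space] in auto)
      finally show ?thesis .
    qed
    note [measurable] = bor
    have "emeasure lborel (thick ?E) + emeasure lborel (thick F) = emeasure lborel (thick ?E \<union> thick F)"
    proof (rule plus_emeasure)
      show "thick ?E \<in> sets lborel" "thick F \<in> sets lborel" by measurable
    qed (auto simp: thick_def)
    also have "\<dots> \<le> emeasure lborel (thick (C r))"
    proof (rule emeasure_mono)
      show "thick (C r) \<in> sets lborel" by measurable
    qed (use EC FCr in \<open>auto simp: thick_def\<close>)
    finally have VE: "emeasure lborel (thick ?E) + ennreal v \<le> ennreal ((2 * r) ^ d * q)"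
      using VC[of r] r B by (simp add: v)
    then have "emeasure lborel (thick ?E) < top"
      by (metis ennreal_less_top le_less_trans le_iff_add)
    then obtain e where e: "emeasure lborel (thick ?E) = ennreal e" "e \<ge> 0"
      by (metis ennreal_enn2real enn2real_nonneg)
    have e2: "e + v \<le> (2 * r) ^ d * q"
      using VE e v q r B by (simp flip: ennreal_plus)
    have "C B \<subseteq> F \<union> ?E" using r B by (auto simp: C G_def)
    then have "hausdorff_measure d (C B) \<le> hausdorff_measure d F + hausdorff_measure d ?E"
      using hausdorff_measure_mono hausdorff_measure_Un_le order_trans by metis
    then have "ennreal q * hausdorff_measure d (C B) \<le> ennreal q * hausdorff_measure d F + ennreal q * hausdorff_measure d ?E"
      by (metis distrib_left mult_left_mono zero_le)
    also have "ennreal q * hausdorff_measure d ?E \<le> ennreal h * ennreal e"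
      using hausdorff_open_le[OF oG] by (simp add: q h e)
    finally have "ennreal (q * ((2 * B) ^ d * h)) \<le> ennreal (q * g + h * e)"
      using q h e g B by (simp add: HC add_left_mono ennreal_mult')
    then have "q * ((2 * B) ^ d * h) \<le> q * g + h * e"
      using q h e g by (subst (asm) ennreal_le_iff) auto
    also have "h * e \<le> h * ((2 * r) ^ d * q - v)" using h e2 by (intro mult_left_mono) auto
    finally show ?thesis by (simp add: algebra_simps)
  qed
  have "((\<lambda>r. q * g + h * q * ((2 * r) ^ d - (2 * B) ^ d)) \<longlongrightarrow> q * g + h * q * ((2 * B) ^ d - (2 * B) ^ d)) (at_right B)"
    by (intro tendsto_intros)
  moreover have "eventually (\<lambda>r. h * v \<le> q * g + h * q * ((2 * r) ^ d - (2 * B) ^ d)) (at_right B)"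
    using key by (auto simp: eventually_at_filter)
  ultimately have "h * v \<le> q * g + h * q * ((2 * B) ^ d - (2 * B) ^ d)"
    by (intro tendsto_lowerbound) auto
  then have "h * v \<le> q * g" by simp
  then show "hausdorff_measure d cell * emeasure lborel (thick F) \<le> emeasure lborel (thick cell) * hausdorff_measure d F"
    using q h v g by (simp flip: ennreal_mult)
qed

end

section \<open>Flat sets in arbitrary subspaces\<close>

lemma emeasure_lborel_open_pos:
  fixes G :: "'a::euclidean_space set"
  assumes "open G" "x \<in> G"
  shows "emeasure lborel G > 0"
proof -
  obtain e where e: "e > 0" "ball x e \<subseteq> G" using assms openE by blast
  have "0 < emeasure lborel (ball x e)"
    using e unit_ball_vol_pos[of "real DIM('a)"] by (subst emeasure_ball) (auto intro!: mult_pos_pos)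
  also have "\<dots> \<le> emeasure lborel G" using e assms by (intro emeasure_mono) auto
  finally show ?thesis .
qed

lemma orthogonal_transformation_inner: "orthogonal_transformation f \<Longrightarrow> f v \<bullet> f w = v \<bullet> w"
  by (simp add: orthogonal_transformation_def)

text \<open>Hausdorff measure is invariant under isometries by its very construction, and in full
  dimension it is a positive multiple of Lebesgue measure on compact sets. Invariance therefore
  transfers to volume.\<close>

lemma emeasure_orthogonal_image:
  fixes K :: "'a::euclidean_space set" and f :: "'a \<Rightarrow> 'a"
  assumes f: "orthogonal_transformation f" and K: "compact K"
  shows "emeasure lborel (f ` K) = emeasure lborel K"
proof -
  interpret window "Basis :: 'a set" "{0}" "DIM('a)"
    by unfold_locales (auto simp: coord_space_def)
  have proj: "coord_proj Basis p = p" for p :: 'a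
    by (simp add: coord_proj_id coord_space_def)
  have thick: "thick A = A" for A by (simp add: thick_def proj)
  have all: "A \<subseteq> coord_space Basis" for A :: "'a set" by (auto simp: coord_space_def)
  have "box 0 One \<subseteq> cell" by (auto simp: cell_def mem_box coord_space_def less_imp_le)
  moreover have "emeasure lborel (box 0 (One :: 'a)) > 0" by (simp add: emeasure_lborel_box_eq)
  ultimately have pos: "emeasure lborel (thick cell) > 0"
    unfolding thick by (metis cell_borel emeasure_mono less_le_trans sets_lborel)
  define q where "q = enn2real (emeasure lborel (thick cell))"
  define h where "h = enn2real (hausdorff_measure DIM('a) cell)"
  have q: "emeasure lborel (thick cell) = ennreal q" "q > 0"
    using vol_cell_finite pos by (auto simp: q_def enn2real_positive_iff)
  have h: "hausdorff_measure DIM('a) cell = ennreal h" "h > 0"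
    using hausdorff_cell_finite hausdorff_cell_pos[OF pos] by (auto simp: h_def enn2real_positive_iff)
  have eq: "ennreal q * hausdorff_measure DIM('a) F = ennreal h * emeasure lborel F" if "compact F" for F :: "'a set"
    using hausdorff_compact_eq[OF that all[of F] pos] by (simp add: q(1) h(1) thick[of F])
  have "compact (f ` K)"
    using K f by (intro compact_continuous_image linear_continuous_on)
      (auto simp: orthogonal_transformation_def linear_conv_bounded_linear)
  moreover have "hausdorff_measure DIM('a) (f ` K) = hausdorff_measure DIM('a) K"
    using f by (intro hausdorff_measure_isometry)
      (auto simp: dist_norm orthogonal_transformation simp flip: linear_diff)
  ultimately have "ennreal h * emeasure lborel (f ` K) = ennreal h * emeasure lborel K"
    using eq[of "f ` K"] eq[OF K] by simp
  then show ?thesis using h by (simp add: ennreal_mult_cancel_left)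
qed

lemma emeasure_translate:
  fixes K :: "'a::euclidean_space set"
  assumes "compact K"
  shows "emeasure lborel ((+) z ` K) = emeasure lborel K"
proof -
  have "compact ((+) z ` K)" using assms by (rule compact_translation)
  then have "emeasure lborel ((+) z ` K) = emeasure lebesgue ((+) z ` K)"
    by (simp add: borel_compact emeasure_completion)
  also have "\<dots> = emeasure lebesgue K"
    using emeasure_lebesgue_affine[of 1 z K] by (simp add: add.commute)
  also have "\<dots> = emeasure lborel K" using assms by (simp add: borel_compact emeasure_completion)
  finally show ?thesis .
qed

lemma orthogonal_transformation_of_basis:
  fixes g :: "'a::euclidean_space \<Rightarrow> 'a"
  assumes g: "\<And>i j. i \<in> Basis \<Longrightarrow> j \<in> Basis \<Longrightarrow> g i \<bullet> g j = (if i = j then 1 else 0)"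
  obtains f where "orthogonal_transformation f" "\<And>i. i \<in> Basis \<Longrightarrow> f i = g i"
proof
  define f where "f x = (\<Sum>b\<in>Basis. (x \<bullet> b) *\<^sub>R g b)" for x :: 'a
  have lin: "linear f"
    unfolding f_def by (intro linearI) (simp_all add: inner_add_left scaleR_add_left sum.distrib scaleR_sum_right)
  have "f v \<bullet> f w = v \<bullet> w" for v w
  proof -
    have gw: "g b \<bullet> f w = w \<bullet> b" if b: "b \<in> Basis" for b
    proof -
      have "g b \<bullet> f w = (\<Sum>c\<in>Basis. if c = b then w \<bullet> b else 0)"
        unfolding f_def inner_sum_right using b by (intro sum.cong refl) (auto simp: g)
      then show ?thesis using b by simp
    qed
    have "f v \<bullet> f w = (\<Sum>b\<in>Basis. (v \<bullet> b) * (g b \<bullet> f w))"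
      by (simp add: f_def[of v] inner_sum_left)
    also have "\<dots> = v \<bullet> w" by (simp add: gw euclidean_inner[of v w])
    finally show ?thesis .
  qed
  then show "orthogonal_transformation f" using lin by (simp add: orthogonal_transformation_def)
  show "f i = g i" if "i \<in> Basis" for i
  proof -
    have "f i = (\<Sum>b\<in>Basis. if b = i then g i else 0)"
      unfolding f_def using that by (intro sum.cong refl) (auto simp: inner_Basis)
    then show ?thesis using that by simp
  qed
qed

lemma orthogonal_transformation_inverse:
  fixes f :: "'a::euclidean_space \<Rightarrow> 'a"
  assumes f: "orthogonal_transformation f"
  obtains k where "orthogonal_transformation k" "\<And>x. f (k x) = x" "\<And>x. k (f x) = x"
proof -
  have lin: "linear f" and inj: "inj f"
    using f by (auto simp: orthogonal_transformation_def intro!: linear_injective_0[THEN iffD2])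
      (metis inner_eq_zero_iff)+
  then obtain k where k: "linear k" "\<And>x. k (f x) = x" "\<And>x. f (k x) = x"
    using linear_injective_isomorphism by metis
  have "k v \<bullet> k w = v \<bullet> w" for v w
    using orthogonal_transformation_inner[OF f, of "k v" "k w"] by (simp add: k)
  then show ?thesis using k by (intro that[of k]) (auto simp: orthogonal_transformation_def)
qed

definition perp :: "'a::real_inner set \<Rightarrow> 'a set" where
  "perp T = {y. \<forall>x\<in>T. x \<bullet> y = 0}"

lemma subspace_perp: "subspace (perp T)"
  by (auto simp: perp_def subspace_def inner_add_right)

lemma closed_perp: "closed (perp T)"
proof -
  have "perp T = (\<Inter>x\<in>T. {y. x \<bullet> y = 0})" by (auto simp: perp_def)
  then show ?thesis by (simp add: closed_INT closed_hyperplane)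
qed

lemma dim_perp: "subspace T \<Longrightarrow> dim (perp T) + dim (T :: 'a::euclidean_space set) = DIM('a)"
  using dim_subspace_orthogonal_to_vectors[of T UNIV] by (simp add: perp_def orthogonal_def)

definition slab_window :: "'a::euclidean_space set \<Rightarrow> 'a \<Rightarrow> 'a set" where
  "slab_window T u = {s *\<^sub>R u + y | s y. 0 \<le> s \<and> s \<le> 1 \<and> y \<in> perp T \<and> norm y \<le> 1}"

text \<open>A full-dimensional solid over a flat piece \<open>F\<close> of \<open>T\<close>: height
  1 along the normal \<open>u\<close>, and a unit ball in the complement of \<open>T\<close>. Its
  volume is a fixed multiple of the area of \<open>F\<close>.\<close>

definition prism :: "'a::euclidean_space set \<Rightarrow> 'a \<Rightarrow> 'a set \<Rightarrow> 'a set" where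
  "prism T u F = {x + q | x q. x \<in> F \<and> q \<in> slab_window T u}"

lemma compact_slab_window: "compact (slab_window T u)"
proof -
  have "slab_window T u = {x + y | x y. x \<in> (\<lambda>s. s *\<^sub>R u) ` {0..1} \<and> y \<in> perp T \<inter> cball 0 1}"
    by (force simp: slab_window_def)
  then show ?thesis
    by (simp only:) (intro compact_sums compact_continuous_image continuous_intros closed_Int_compact closed_perp compact_Icc compact_cball)
qed

lemma compact_prism: "compact F \<Longrightarrow> compact (prism T u F)"
  unfolding prism_def by (rule compact_sums) (auto simp: compact_slab_window)

lemma prism_translate: "prism T u ((+) z ` F) = (+) z ` prism T u F"
proof -
  have "prism T u ((+) z ` F) = {z + x + q | x q. x \<in> F \<and> q \<in> slab_window T u}"
    by (auto simp: prism_def)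
  also have "\<dots> = {z + (x + q) | x q. x \<in> F \<and> q \<in> slab_window T u}" by (simp add: add.assoc)
  also have "\<dots> = (+) z ` prism T u F" by (auto simp: prism_def)
  finally show ?thesis .
qed

text \<open>Orthonormal bases of the line of \<open>u\<close>, of its complement in \<open>T\<close>
  and of \<open>perp T\<close> are matched with basis vectors, so that questions about
  \<open>T\<close> become questions about a coordinate subspace.\<close>

lemma frame_exists:
  fixes T E :: "'a::euclidean_space set"
  assumes T: "subspace T" and u: "u \<in> T" "norm u = 1"
    and E: "E \<subseteq> Basis" "card E = dim T" and e: "e \<in> E"
  obtains k where "orthogonal_transformation k" "k u = e"
    "\<And>x. x \<in> T \<longleftrightarrow> k x \<in> coord_space E"
    "\<And>x. x \<in> perp T \<longleftrightarrow> k x \<in> coord_space (Basis - E)"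
proof -
  have finE: "finite E" using E(1) finite_Basis by (rule finite_subset)
  define T' where "T' = {x \<in> T. u \<bullet> x = 0}"
  have sT': "subspace T'" using T by (auto simp: T'_def subspace_def inner_add_right)
  have "dim T' + dim (span {u}) = dim T"
  proof -
    have "T' = {y \<in> T. \<forall>x\<in>span {u}. orthogonal x y}"
      by (auto simp: T'_def orthogonal_def span_singleton)
    then show ?thesis
      using dim_subspace_orthogonal_to_vectors[of "span {u}" T] T u by (simp add: span_minimal)
  qed
  moreover have "dim (span {u}) = 1"
    using u(2) by (subst dim_span, subst dim_eq_card_independent) (auto simp: norm_eq_zero)
  ultimately have dT': "dim T' = card (E - {e})" using E e finE by simp
  have dP: "dim (perp T) = card (Basis - E)"
    using dim_perp[OF T] E finE by (simp add: card_Diff_subset)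
  obtain B1 where B1: "B1 \<subseteq> T'" "pairwise orthogonal B1" "\<And>x. x \<in> B1 \<Longrightarrow> norm x = 1"
      "independent B1" "card B1 = dim T'" "span B1 = T'"
    using orthonormal_basis_subspace[OF sT'] by metis
  obtain B2 where B2: "B2 \<subseteq> perp T" "pairwise orthogonal B2" "\<And>x. x \<in> B2 \<Longrightarrow> norm x = 1"
      "independent B2" "card B2 = dim (perp T)" "span B2 = perp T"
    using orthonormal_basis_subspace[OF subspace_perp] by metis
  obtain g1 where g1: "bij_betw g1 (E - {e}) B1"
    using finite_same_card_bij[of "E - {e}" B1] B1(5) dT' finE independent_imp_finite[OF B1(4)] by auto
  obtain g2 where g2: "bij_betw g2 (Basis - E) B2"
    using finite_same_card_bij[of "Basis - E" B2] B2(5) dP independent_imp_finite[OF B2(4)] by auto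
  define g where "g i = (if i = e then u else if i \<in> E then g1 i else g2 i)" for i
  have g1in: "g1 i \<in> B1" if "i \<in> E" "i \<noteq> e" for i using g1 that by (auto simp: bij_betw_def)
  have g2in: "g2 i \<in> B2" if "i \<in> Basis" "i \<notin> E" for i using g2 that by (auto simp: bij_betw_def)
  have u1: "u \<bullet> u = 1" using u(2) by (simp add: dot_square_norm)
  have n1: "x \<bullet> x = 1" if "x \<in> B1 \<or> x \<in> B2" for x using B1(3) B2(3) that by (auto simp: dot_square_norm)
  have ou: "u \<bullet> x = 0" "x \<bullet> u = 0" if "x \<in> B1 \<or> x \<in> B2" for x
    using that B1(1) B2(1) u(1) by (auto simp: T'_def perp_def inner_commute)
  have o12: "x \<bullet> y = 0" "y \<bullet> x = 0" if "x \<in> B1" "y \<in> B2" for x y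
    using that B1(1) B2(1) by (auto simp: T'_def perp_def inner_commute subset_iff)
  have o1: "g1 i \<bullet> g1 j = 0" if "i \<in> E" "j \<in> E" "i \<noteq> e" "j \<noteq> e" "i \<noteq> j" for i j
    using B1(2) g1in[OF that(1,3)] g1in[OF that(2,4)] g1 that
    by (auto simp: pairwise_def orthogonal_def bij_betw_def inj_on_def)
  have o2: "g2 i \<bullet> g2 j = 0" if "i \<in> Basis - E" "j \<in> Basis - E" "i \<noteq> j" for i j
    using B2(2) g2in[of i] g2in[of j] g2 that
    by (auto simp: pairwise_def orthogonal_def bij_betw_def inj_on_def)
  have orth: "g i \<bullet> g j = (if i = j then 1 else 0)" if "i \<in> Basis" "j \<in> Basis" for i j
    using that e by (auto simp: g_def u1 n1 ou o12 o1 o2 g1in g2in)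
  obtain f where f: "orthogonal_transformation f" "\<And>i. i \<in> Basis \<Longrightarrow> f i = g i"
    using orthogonal_transformation_of_basis[OF orth] by blast
  obtain k where k: "orthogonal_transformation k" "\<And>x. f (k x) = x" "\<And>x. k (f x) = x"
    using orthogonal_transformation_inverse[OF f(1)] by blast
  have ki: "k x \<bullet> i = x \<bullet> g i" if "i \<in> Basis" for x i
    using orthogonal_transformation_inner[OF f(1), of "k x" i] that by (simp add: k f)
  have eB: "e \<in> Basis" using e E by auto
  have gE: "g i \<in> T" if "i \<in> E" for i
    using that g1in B1(1) u(1) by (auto simp: g_def T'_def subset_iff)
  have gP: "g i \<in> perp T" if "i \<in> Basis - E" for i
    using that g2in B2(1) e by (auto simp: g_def subset_iff)
  \<comment> \<open>Double orthogonality: a vector orthogonal to a basis of \<open>perp T\<close>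
    has no component outside \<open>T\<close>.\<close>
  have TT: "x \<in> T" if "\<forall>y\<in>B2. y \<bullet> x = 0" for x
  proof -
    have "\<forall>y\<in>span B2. orthogonal x y"
      using that orthogonal_to_span[of _ B2 x] by (simp add: orthogonal_def inner_commute)
    then have *: "\<forall>y\<in>perp T. x \<bullet> y = 0" by (simp add: B2(6) orthogonal_def)
    obtain a b where ab: "a \<in> span T" "\<And>w. w \<in> span T \<Longrightarrow> orthogonal b w" "x = a + b"
      using orthogonal_subspace_decomp_exists by metis
    then have "b \<in> perp T" by (auto simp: perp_def orthogonal_def inner_commute span_base)
    then have "x \<bullet> b = 0" using * by simp
    moreover have "a \<bullet> b = 0" using ab(1) ab(2)[of a] by (simp add: orthogonal_def inner_commute)
    ultimately have "b = 0" using ab(3) by (simp add: inner_add_left)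
    then show "x \<in> T" using ab T by (simp add: span_eq_iff[THEN iffD2])
  qed
  show ?thesis
  proof (rule that[OF k(1)])
    show "k u = e"
      using k(3)[of e] f(2)[OF eB] by (simp add: g_def)
    show "x \<in> T \<longleftrightarrow> k x \<in> coord_space E" for x
    proof
      assume "x \<in> T"
      then show "k x \<in> coord_space E" using gP by (auto simp: coord_space_def ki perp_def)
    next
      assume "k x \<in> coord_space E"
      then have "x \<bullet> g i = 0" if "i \<in> Basis - E" for i using that by (auto simp: coord_space_def ki)
      moreover have "\<exists>i\<in>Basis - E. y = g i" if "y \<in> B2" for y
        using that g2 e by (auto simp: bij_betw_def g_def image_iff)
      ultimately have "y \<bullet> x = 0" if "y \<in> B2" for y using that by (metis inner_commute)
      then show "x \<in> T" by (intro TT) auto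
    qed
    show "x \<in> perp T \<longleftrightarrow> k x \<in> coord_space (Basis - E)" for x
    proof
      assume "x \<in> perp T"
      then show "k x \<in> coord_space (Basis - E)" using gE E by (auto simp: coord_space_def ki perp_def) (metis inner_commute)
    next
      assume "k x \<in> coord_space (Basis - E)"
      then have x: "x \<bullet> g i = 0" if "i \<in> E" for i using that E by (auto simp: coord_space_def ki)
      have xu: "x \<bullet> u = 0" using x[OF e] by (simp add: g_def)
      have "x \<bullet> y = 0" if "y \<in> B1" for y
      proof -
        from that have "y \<in> g1 ` (E - {e})" using g1 by (simp add: bij_betw_def)
        then obtain i where "i \<in> E - {e}" "y = g1 i" by blast
        then show ?thesis using x[of i] by (simp add: g_def)
      qed
      then have T0: "x \<bullet> y = 0" if "y \<in> T'" for y
        using that orthogonal_to_span[of y B1 x] by (auto simp: B1(6) orthogonal_def)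
      have "y \<bullet> x = 0" if "y \<in> T" for y
      proof -
        have "y - (u \<bullet> y) *\<^sub>R u \<in> T'"
          using that u T by (auto simp: T'_def inner_diff_right u1 subspace_diff subspace_scale)
        from T0[OF this] xu show ?thesis by (simp add: inner_diff_right inner_commute)
      qed
      then show "x \<in> perp T" by (simp add: perp_def)
    qed
  qed
qed

text \<open>\<open>c\<close> is chosen before \<open>T\<close>, \<open>u\<close> and
  \<open>F\<close> and depends only on the dimension \<open>m\<close>. A rotation takes
  \<open>T\<close> to one fixed coordinate subspace and \<open>u\<close> to one fixed basis vector,
  where \<open>c\<close> is the ratio of the two measures of the cell.\<close>

theorem hausdorff_flat:
  assumes m: "1 \<le> m" "m \<le> DIM('a::euclidean_space)"
  obtains c where "c > 0" "\<And>(T :: 'a set) u F h. subspace T \<Longrightarrow> dim T = m \<Longrightarrow> u \<in> T \<Longrightarrow> norm u = 1 \<Longrightarrow>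
     compact F \<Longrightarrow> F \<subseteq> T \<Longrightarrow> (\<And>x. x \<in> F \<Longrightarrow> u \<bullet> x = h) \<Longrightarrow>
     hausdorff_measure (m - 1) F = ennreal c * emeasure lborel (prism T u F)"
proof -
  obtain E :: "'a set" where E: "E \<subseteq> Basis" "card E = m"
    using m obtain_subset_with_card_n by metis
  have finE: "finite E" using E(1) finite_Basis by (rule finite_subset)
  obtain e where e: "e \<in> E" using E m by fastforce
  have eB: "e \<in> Basis" using e E by auto
  define D where "D = E - {e}"
  define Q where "Q = {s *\<^sub>R e + y | s y. 0 \<le> s \<and> s \<le> 1 \<and> y \<in> coord_space (Basis - E) \<and> norm y \<le> 1}"
  interpret window D Q "m - 1"
  proof
    have "Q = {x + y | x y. x \<in> (\<lambda>s. s *\<^sub>R e) ` {0..1} \<and> y \<in> coord_space (Basis - E) \<inter> cball 0 1}"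
      by (force simp: Q_def)
    then show "compact Q"
      by (simp only:) (intro compact_sums compact_continuous_image continuous_intros closed_Int_compact closed_coord_space compact_Icc compact_cball)
    show "Q \<subseteq> coord_space (Basis - D)"
      using eB E by (auto simp: Q_def D_def coord_space_def inner_add_left inner_Basis split: if_splits)
  qed (use E e finE in \<open>auto simp: D_def\<close>)
  have pos: "emeasure lborel (thick cell) > 0"
  proof -
    \<comment> \<open>An open set inside \<open>thick cell\<close>; containing the point
      \<open>p\<close>, it shows that the cell has positive thickened volume.\<close>
    define G where "G = (\<Inter>i\<in>E. {p. 0 < p \<bullet> i} \<inter> {p. p \<bullet> i < 1}) \<inter> {p. norm (p - coord_proj E p) < 1}"
    have "continuous_on UNIV (coord_proj E)" unfolding coord_proj_def by (intro continuous_intros)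
    then have oG: "open G" unfolding G_def using finE
      by (intro open_Int open_INT ballI open_halfspace_component_gt open_halfspace_component_lt open_Collect_less
             continuous_intros) auto
    define p where "p = (\<Sum>i\<in>Basis. (if i \<in> E then 1/2 else 0) *\<^sub>R i :: 'a)"
    have pi: "p \<bullet> i = (if i \<in> E then 1/2 else 0)" if "i \<in> Basis" for i using that by (simp add: p_def)
    have "coord_proj E p = p" using E by (intro coord_proj_id) (auto simp: coord_space_def pi)
    then have "p \<in> G" using E by (auto simp: G_def pi subset_iff)
    moreover have DE: "D \<subseteq> E" by (auto simp: D_def)
    have "G \<subseteq> thick cell"
    proof
      fix x assume x: "x \<in> G"
      have "coord_proj D x \<in> cell"
        using x D coord_proj_in[OF D] DE by (auto simp: cell_def coord_proj_inner G_def less_imp_le subset_iff)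
      moreover have "x - coord_proj D x = (x \<bullet> e) *\<^sub>R e + (x - coord_proj E x)"
        unfolding coord_proj_def D_def using e finE by (simp add: sum.remove[of E e])
      moreover have "x - coord_proj E x \<in> coord_space (Basis - E)"
        using E by (auto simp: coord_space_def inner_diff_left coord_proj_inner)
      moreover have "0 \<le> x \<bullet> e" "x \<bullet> e \<le> 1" "norm (x - coord_proj E x) \<le> 1"
        using x e by (auto simp: G_def less_imp_le)
      ultimately have "x - coord_proj D x \<in> Q" unfolding Q_def by blast
      then show "x \<in> thick cell" using \<open>coord_proj D x \<in> cell\<close> by (simp add: thick_def)
    qed
    ultimately show ?thesis
      using emeasure_lborel_open_pos[OF oG] emeasure_mono[of G "thick cell" lborel] thick_borel[OF cell_borel]
      by (metis less_le_trans sets_lborel)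
  qed
  define q where "q = enn2real (emeasure lborel (thick cell))"
  define h where "h = enn2real (hausdorff_measure (m - 1) cell)"
  have q: "emeasure lborel (thick cell) = ennreal q" "q > 0"
    using vol_cell_finite pos by (auto simp: q_def enn2real_positive_iff)
  have h: "hausdorff_measure (m - 1) cell = ennreal h" "h > 0"
    using hausdorff_cell_finite hausdorff_cell_pos[OF pos] by (auto simp: h_def enn2real_positive_iff)
  have eq: "hausdorff_measure (m - 1) F = ennreal (h / q) * emeasure lborel (thick F)"
    if F: "compact F" "F \<subseteq> coord_space D" for F
  proof -
    have "hausdorff_measure (m - 1) F = ennreal (1 / q) * (ennreal q * hausdorff_measure (m - 1) F)"
      using q by (simp add: mult.assoc[symmetric] flip: ennreal_mult)
    also have "ennreal q * hausdorff_measure (m - 1) F = ennreal h * emeasure lborel (thick F)"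
      using hausdorff_compact_eq[OF F pos] unfolding q(1) h(1) .
    also have "ennreal (1 / q) * (ennreal h * emeasure lborel (thick F)) = ennreal (h / q) * emeasure lborel (thick F)"
      using q h by (simp add: mult.assoc[symmetric] flip: ennreal_mult)
    finally show ?thesis .
  qed
  show ?thesis
  proof (rule that[of "h / q"])
    show "h / q > 0" using q h by simp
    fix T :: "'a set" and u F r
    assume T: "subspace T" "dim T = m" and u: "u \<in> T" "norm u = 1" and F: "compact F" "F \<subseteq> T"
      and r: "\<And>x. x \<in> F \<Longrightarrow> u \<bullet> x = r"
    have u1: "u \<bullet> u = 1" using u(2) by (simp add: dot_square_norm)
    \<comment> \<open>Translation along the normal brings the flat piece to height 0, so that its
      rotated copy lies in the span of \<open>D = E - {e}\<close>.\<close>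
    define F' where "F' = (+) (- r *\<^sub>R u) ` F"
    have "compact F'" unfolding F'_def by (rule compact_translation[OF F(1)])
    moreover have "F' \<subseteq> T" "\<And>x. x \<in> F' \<Longrightarrow> u \<bullet> x = 0"
      using F r u T unfolding F'_def
      by (auto intro!: subspace_add subspace_diff subspace_scale simp: inner_diff_right u1)
    ultimately have F': "compact F'" "F' \<subseteq> T" "\<And>x. x \<in> F' \<Longrightarrow> u \<bullet> x = 0" by auto
    obtain k where k: "orthogonal_transformation k" "k u = e"
        "\<And>x. x \<in> T \<longleftrightarrow> k x \<in> coord_space E"
        "\<And>x. x \<in> perp T \<longleftrightarrow> k x \<in> coord_space (Basis - E)"
      using frame_exists[OF T(1) u E(1) _ e] E(2) T(2) by metis
    have lin: "linear k" using k(1) by (simp add: orthogonal_transformation_def)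
    obtain k' where k': "\<And>x. k (k' x) = x" "\<And>x. k' (k x) = x"
      using orthogonal_transformation_inverse[OF k(1)] by metis
    have kn: "norm (k x) = norm x" for x using k(1) by (simp add: orthogonal_transformation)
    have kF: "compact (k ` F')"
      using F'(1) lin by (intro compact_continuous_image linear_continuous_on)
        (auto simp: linear_conv_bounded_linear)
    have kFD: "k ` F' \<subseteq> coord_space D"
    proof
      fix y assume "y \<in> k ` F'"
      then obtain x where x: "x \<in> F'" "y = k x" by auto
      have "k x \<bullet> e = 0"
        using orthogonal_transformation_inner[OF k(1), of x u] F'(3)[OF x(1)] by (simp add: k(2) inner_commute)
      moreover have "k x \<in> coord_space E" using F'(2) x k(3) by auto
      ultimately show "y \<in> coord_space D" using x by (auto simp: coord_space_def D_def)
    qed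
    have kQ: "k ` slab_window T u = Q"
    proof (intro set_eqI iffI)
      fix z assume "z \<in> k ` slab_window T u"
      then obtain s y where *: "0 \<le> s" "s \<le> 1" "y \<in> perp T" "norm y \<le> 1" "z = k (s *\<^sub>R u + y)"
        by (auto simp: slab_window_def)
      then have "z = s *\<^sub>R e + k y" using lin k(2) by (simp add: linear_add linear_scale)
      moreover have "k y \<in> coord_space (Basis - E)" "norm (k y) \<le> 1" using * k(4) kn by auto
      ultimately show "z \<in> Q" using *(1,2) unfolding Q_def by blast
    next
      fix z assume "z \<in> Q"
      then obtain s y where *: "0 \<le> s" "s \<le> 1" "y \<in> coord_space (Basis - E)" "norm y \<le> 1" "z = s *\<^sub>R e + y"
        by (auto simp: Q_def)
      have "k' y \<in> perp T" "norm (k' y) \<le> 1" using * k(4)[of "k' y"] kn[of "k' y"] by (auto simp: k')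
      moreover have "z = k (s *\<^sub>R u + k' y)" using lin k(2) * by (simp add: linear_add linear_scale k')
      ultimately show "z \<in> k ` slab_window T u" using * unfolding slab_window_def by blast
    qed
    have kP: "k ` prism T u F' = thick (k ` F')"
    proof -
      have "thick (k ` F') = {x + y | x y. x \<in> k ` F' \<and> y \<in> k ` slab_window T u}"
        using thick_eq_sums[OF kFD] kQ by simp
      also have "\<dots> = {k (x + y) | x y. x \<in> F' \<and> y \<in> slab_window T u}"
        using lin by (auto simp: linear_add)
      also have "\<dots> = k ` prism T u F'" by (auto simp: prism_def)
      finally show ?thesis by simp
    qed
    have "hausdorff_measure (m - 1) F = hausdorff_measure (m - 1) F'"
      unfolding F'_def by (rule hausdorff_measure_isometry[symmetric], rule dist_add_cancel)
    also have "\<dots> = hausdorff_measure (m - 1) (k ` F')"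
      using k(1) by (intro hausdorff_measure_isometry[symmetric])
        (auto simp: dist_norm orthogonal_transformation simp flip: linear_diff)
    also have "\<dots> = ennreal (h / q) * emeasure lborel (thick (k ` F'))" by (rule eq[OF kF kFD])
    also have "emeasure lborel (thick (k ` F')) = emeasure lborel (prism T u F')"
      unfolding kP[symmetric] by (rule emeasure_orthogonal_image[OF k(1) compact_prism[OF F'(1)]])
    also have "prism T u F' = (+) (- r *\<^sub>R u) ` prism T u F"
      unfolding F'_def by (rule prism_translate)
    also have "emeasure lborel \<dots> = emeasure lborel (prism T u F)"
      by (rule emeasure_translate[OF compact_prism[OF F(1)]])
    finally show "hausdorff_measure (m - 1) F = ennreal (h / q) * emeasure lborel (prism T u F)" .
  qed
qed

section \<open>Radial boundaries of convex bodies\<close>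

text \<open>For a convex body with \<open>0\<close> in its interior the radial boundary is the frontier, and it is
  compatible with intersecting the body with a subspace.\<close>

definition radial_boundary :: "'a::real_vector set \<Rightarrow> 'a set" where
  "radial_boundary C = {x \<in> C. \<forall>l>1. l *\<^sub>R x \<notin> C}"

text \<open>With \<open>T = UNIV\<close> this covers the bodies themselves, with \<open>T\<close> a
  hyperplane their central sections. The ball condition says that \<open>0\<close> is in the
  interior relative to \<open>T\<close>, which makes the radial boundary meaningful.\<close>

definition rel_body :: "'a::euclidean_space set \<Rightarrow> 'a set \<Rightarrow> bool" where
  "rel_body T C \<longleftrightarrow> subspace T \<and> convex C \<and> compact C \<and> C \<subseteq> T \<and> (\<exists>r>0. T \<inter> cball 0 r \<subseteq> C)"

text \<open>The complement is filled with the same unit ball as in \<open>slab_window\<close>, so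
  prisms over facets and cylinders over bodies live in one solid and their volumes can be
  added.\<close>

definition cylinder :: "'a::euclidean_space set \<Rightarrow> 'a set \<Rightarrow> 'a set" where
  "cylinder T A = {x + y | x y. x \<in> A \<and> y \<in> perp T \<inter> cball 0 1}"

lemma compact_cylinder: "compact A \<Longrightarrow> compact (cylinder T A)"
  unfolding cylinder_def by (intro compact_sums closed_Int_compact closed_perp compact_cball)

lemma cylinder_mono: "A \<subseteq> B \<Longrightarrow> cylinder T A \<subseteq> cylinder T B"
  by (auto simp: cylinder_def)

lemma rel_bodyD:
  assumes "rel_body T C"
  shows "subspace T" "convex C" "compact C" "C \<subseteq> T" "0 \<in> C"
  using assms by (auto simp: rel_body_def subset_iff subspace_0)

lemma rel_body_scale:
  assumes C: "rel_body T C" and x: "x \<in> C" and s: "0 \<le> s" "s \<le> 1"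
  shows "s *\<^sub>R x \<in> C"
  using convexD[OF rel_bodyD(2)[OF C] x rel_bodyD(5)[OF C], of s "1 - s"] s by simp

text \<open>A point \<open>l * y\<close> of \<open>D\<close> with \<open>l > 1\<close> and the ball
  around \<open>0\<close> have a convex hull that contains a neighbourhood of \<open>y\<close> in
  \<open>T\<close>.\<close>

lemma rel_body_not_radial:
  assumes D: "rel_body T D" and y: "y \<in> D" "y \<notin> radial_boundary D"
  obtains e where "e > 0" "\<And>z. z \<in> T \<Longrightarrow> norm (z - y) \<le> e \<Longrightarrow> z \<in> D"
proof -
  obtain r where r: "r > 0" "T \<inter> cball 0 r \<subseteq> D" using D by (auto simp: rel_body_def)
  obtain l where l: "l > 1" "l *\<^sub>R y \<in> D" using y by (auto simp: radial_boundary_def)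
  show ?thesis
  proof (rule that[of "(1 - 1 / l) * r"])
    show "(1 - 1 / l) * r > 0" using l r by simp
    fix z assume z: "z \<in> T" "norm (z - y) \<le> (1 - 1 / l) * r"
    define w where "w = (1 / (1 - 1 / l)) *\<^sub>R (z - y)"
    have l': "1 - 1 / l > 0" using l by simp
    have "w \<in> T" unfolding w_def using z y rel_bodyD[OF D]
      by (intro subspace_scale subspace_diff) auto
    moreover have "norm w \<le> r"
    proof -
      have "norm w = norm (z - y) / (1 - 1 / l)"
        unfolding w_def norm_scaleR abs_divide abs_of_pos[OF l'] by simp
      then show ?thesis using z(2) l' by (simp add: pos_divide_le_eq mult.commute)
    qed
    ultimately have "w \<in> D" using r by auto
    then have "(1 / l) *\<^sub>R (l *\<^sub>R y) + (1 - 1 / l) *\<^sub>R w \<in> D"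
      using l l' by (intro convexD[OF rel_bodyD(2)[OF D] l(2)]) auto
    then show "z \<in> D" using l l' by (simp add: w_def)
  qed
qed

lemma rel_body_support:
  assumes C: "rel_body T C" and x: "x \<in> radial_boundary C"
  obtains u where "u \<in> T" "norm u = 1" "\<And>z. z \<in> C \<Longrightarrow> u \<bullet> z \<le> u \<bullet> x"
proof -
  note CD = rel_bodyD[OF C]
  obtain r where r: "r > 0" "T \<inter> cball 0 r \<subseteq> C" using C by (auto simp: rel_body_def)
  have xC: "x \<in> C" using x by (simp add: radial_boundary_def)
  have aff: "affine hull C \<subseteq> T" using CD(1,4) by (intro hull_minimal) (auto intro: subspace_imp_affine)
  have "0 \<in> rel_interior C"
    unfolding mem_rel_interior_cball using CD(5) r aff by auto
  have "x \<notin> rel_interior C"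
  proof
    assume "x \<in> rel_interior C"
    then obtain e where e: "e > 0" "cball x e \<inter> affine hull C \<subseteq> C" by (auto simp: mem_rel_interior_cball)
    define l where "l = 1 + e / (norm x + 1)"
    have n: "norm x + 1 > 0" by (smt (verit) norm_ge_zero)
    have l: "l > 1" using e n by (simp add: l_def)
    have "norm (x - l *\<^sub>R x) = e / (norm x + 1) * norm x"
    proof -
      have "x - l *\<^sub>R x = - ((e / (norm x + 1)) *\<^sub>R x)" by (simp add: l_def scaleR_add_left)
      then show ?thesis using e n by (simp add: norm_minus_cancel)
    qed
    also have "\<dots> \<le> e" using e n by (simp add: field_simps)
    finally have "l *\<^sub>R x \<in> cball x e" by (simp add: dist_norm)
    moreover have "l *\<^sub>R x \<in> affine hull C"
    proof -
      have "(1 - l) *\<^sub>R 0 + l *\<^sub>R x \<in> affine hull C"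
        using xC CD(5) by (intro mem_affine) (auto intro: hull_inc)
      then show ?thesis by simp
    qed
    ultimately have "l *\<^sub>R x \<in> C" using e by auto
    then show False using x l by (auto simp: radial_boundary_def)
  qed
  then obtain a where a: "\<And>y. y \<in> C \<Longrightarrow> a \<bullet> x \<le> a \<bullet> y" "\<And>y. y \<in> rel_interior C \<Longrightarrow> a \<bullet> x < a \<bullet> y"
    using supporting_hyperplane_rel_boundary[OF CD(2) xC] by metis
  have ax: "a \<bullet> x < 0" using a(2)[OF \<open>0 \<in> rel_interior C\<close>] by simp
  \<comment> \<open>Only the component of the supporting functional in \<open>T\<close> acts on
    \<open>C\<close>; it is nonzero because the functional is negative at \<open>x\<close>.\<close>
  obtain p q where pq: "p \<in> span T" "\<And>w. w \<in> span T \<Longrightarrow> orthogonal q w" "a = p + q"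
    using orthogonal_subspace_decomp_exists by metis
  have pT: "p \<in> T" using pq(1) CD(1) by (simp add: span_eq_iff[THEN iffD2])
  have ap: "a \<bullet> z = p \<bullet> z" if "z \<in> T" for z
    using pq(2)[OF span_base[OF that]] by (simp add: pq(3) inner_add_left orthogonal_def)
  have "p \<noteq> 0" using ax ap[of x] xC CD(4) by auto
  show ?thesis
  proof (rule that[of "- (1 / norm p) *\<^sub>R p"])
    show "- (1 / norm p) *\<^sub>R p \<in> T" using pT CD(1) by (simp add: subspace_neg subspace_scale)
    show "norm (- (1 / norm p) *\<^sub>R p) = 1" using \<open>p \<noteq> 0\<close> by simp
    fix z assume z: "z \<in> C"
    have "x \<in> T" "z \<in> T" using xC z CD(4) by auto
    then have "p \<bullet> x \<le> p \<bullet> z" using a(1)[OF z] ap[of x] ap[of z] by simp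
    then show "(- (1 / norm p) *\<^sub>R p) \<bullet> z \<le> (- (1 / norm p) *\<^sub>R p) \<bullet> x"
      by (simp add: divide_right_mono)
  qed
qed

text \<open>The nearest-point projection onto \<open>C\<close> is 1-Lipschitz and maps the outer boundary onto the inner one.\<close>

lemma hausdorff_radial_boundary_mono:
  assumes C: "rel_body T C" and D: "rel_body T D" and CD: "C \<subseteq> D"
  shows "hausdorff_measure d (radial_boundary C) \<le> hausdorff_measure d (radial_boundary D)"
proof -
  note C' = rel_bodyD[OF C] and D' = rel_bodyD[OF D]
  have cl: "closed C" using C'(3) by (rule compact_imp_closed)
  have "radial_boundary C \<subseteq> closest_point C ` radial_boundary D"
  proof
    fix x assume x: "x \<in> radial_boundary C"
    then have xC: "x \<in> C" by (simp add: radial_boundary_def)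
    obtain u where u: "u \<in> T" "norm u = 1" "\<And>z. z \<in> C \<Longrightarrow> u \<bullet> z \<le> u \<bullet> x"
      using rel_body_support[OF C x] by metis
    \<comment> \<open>From \<open>x\<close> one walks along the outer normal to the last point
      \<open>y\<close> still in \<open>D\<close>. It lies on the radial boundary of
      \<open>D\<close>, and its nearest point in \<open>C\<close> is \<open>x\<close>.\<close>
    define S where "S = {s. 0 \<le> s \<and> x + s *\<^sub>R u \<in> D}"
    have Sne: "0 \<in> S" using xC CD by (auto simp: S_def)
    have Sclosed: "closed S"
    proof -
      have "S = {0..} \<inter> (\<lambda>s. x + s *\<^sub>R u) -` D" by (auto simp: S_def)
      then show ?thesis
        using compact_imp_closed[OF D'(3)]
        by (simp only:) (intro closed_Int closed_atLeast closed_vimage continuous_intros)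
    qed
    obtain B where B: "\<And>y. y \<in> D \<Longrightarrow> norm y \<le> B"
      using D'(3) compact_imp_bounded bounded_iff by metis
    have "s \<le> B + norm x" if "s \<in> S" for s
    proof -
      have "s = norm (s *\<^sub>R u)" using that u by (simp add: S_def)
      also have "\<dots> \<le> norm (x + s *\<^sub>R u) + norm x"
        using norm_triangle_ineq4[of "x + s *\<^sub>R u" x] by simp
      finally show ?thesis using B[of "x + s *\<^sub>R u"] that by (auto simp: S_def)
    qed
    then have bdd: "bdd_above S" by (auto simp: bdd_above_def)
    define s where "s = Sup S"
    have sS: "s \<in> S" unfolding s_def using Sne bdd Sclosed by (intro closed_contains_Sup) auto
    have smax: "t \<le> s" if "t \<in> S" for t unfolding s_def using that bdd by (rule cSup_upper)
    define y where "y = x + s *\<^sub>R u"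
    have yD: "y \<in> D" and s0: "s \<ge> 0" using sS by (auto simp: S_def y_def)
    have "y \<in> radial_boundary D"
    proof (rule ccontr)
      assume "y \<notin> radial_boundary D"
      then obtain e where e: "e > 0" "\<And>z. z \<in> T \<Longrightarrow> norm (z - y) \<le> e \<Longrightarrow> z \<in> D"
        using rel_body_not_radial[OF D yD] by metis
      have "x + (s + e) *\<^sub>R u \<in> D"
        using xC C'(1,4) u e by (intro e(2)) (auto simp: y_def algebra_simps intro!: subspace_add subspace_scale)
      then have "s + e \<in> S" using s0 e by (simp add: S_def)
      then show False using smax[of "s + e"] e by simp
    qed
    moreover have "closest_point C y = x"
    proof (rule closest_point_unique[OF C'(2) cl, symmetric, OF xC, rule_format])
      fix z assume z: "z \<in> C"
      have "(norm (y - z))\<^sup>2 = (norm (y - x))\<^sup>2 + (norm (x - z))\<^sup>2 + 2 * ((y - x) \<bullet> (x - z))"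
        by (simp add: power2_norm_eq_inner inner_diff_left inner_diff_right inner_commute)
      moreover have "(y - x) \<bullet> (x - z) \<ge> 0"
        using u(3)[OF z] s0 by (simp add: y_def inner_diff_right mult_left_mono)
      ultimately have "(norm (y - x))\<^sup>2 \<le> (norm (y - z))\<^sup>2" by (smt (verit) zero_le_power2)
      then show "dist y x \<le> dist y z" unfolding dist_norm by (rule power2_le_imp_le) simp
    qed
    ultimately show "x \<in> closest_point C ` radial_boundary D" by force
  qed
  then have "hausdorff_measure d (radial_boundary C) \<le> hausdorff_measure d (closest_point C ` radial_boundary D)"
    by (rule hausdorff_measure_mono)
  also have "\<dots> \<le> ennreal (1 ^ d) * hausdorff_measure d (radial_boundary D)"
    using closest_point_lipschitz[OF C'(2) cl] C'(5) by (intro hausdorff_measure_lipschitz_image) auto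
  finally show ?thesis by simp
qed

definition poly_in :: "'a::euclidean_space set \<Rightarrow> ('a \<times> real) set \<Rightarrow> 'a set" where
  "poly_in T I = {x \<in> T. \<forall>(u, h)\<in>I. u \<bullet> x \<le> h}"

definition poly_face :: "'a::euclidean_space set \<Rightarrow> ('a \<times> real) set \<Rightarrow> 'a \<times> real \<Rightarrow> 'a set" where
  "poly_face T I i = {x \<in> poly_in T I. fst i \<bullet> x = snd i}"

lemma closed_poly_in: "subspace T \<Longrightarrow> closed (poly_in T I)"
proof -
  assume "subspace T"
  then have "closed T" by (rule closed_subspace)
  moreover have "poly_in T I = T \<inter> (\<Inter>i\<in>I. {x. fst i \<bullet> x \<le> snd i})"
    by (auto simp: poly_in_def split_beta)
  ultimately show ?thesis by (simp add: closed_INT closed_Int closed_halfspace_le)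
qed

text \<open>Compactness: the points of \<open>(1 + \<eta>) C\<close> that stay away from
  \<open>C\<close> are covered by finitely many open half-spaces missing \<open>C\<close>. If the
  polytope so defined left \<open>(1 + \<eta>) C\<close>, the last point on the segment towards
  \<open>0\<close> that is still inside would be such a point.\<close>

lemma poly_approx:
  assumes C: "rel_body T C" and \<eta>: "\<eta> > 0"
  obtains I where "finite I" "\<And>u h. (u, h) \<in> I \<Longrightarrow> u \<in> T \<and> norm u = 1 \<and> h > 0"
    "C \<subseteq> poly_in T I" "poly_in T I \<subseteq> (\<lambda>x. (1 + \<eta>) *\<^sub>R x) ` C"
proof -
  note CD = rel_bodyD[OF C]
  obtain r where r: "r > 0" "T \<inter> cball 0 r \<subseteq> C" using C by (auto simp: rel_body_def)
  define C2 where "C2 = (\<lambda>x. (1 + \<eta>) *\<^sub>R x) ` C"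
  have cC2: "compact C2" unfolding C2_def using CD(3) by (rule compact_scaling)
  have C2T: "C2 \<subseteq> T" unfolding C2_def using CD(1,4) by (auto intro: subspace_scale)
  \<comment> \<open>As \<open>C\<close> contains the ball of radius \<open>r\<close> in
    \<open>T\<close>, the boundary of \<open>(1 + \<eta>) C\<close> has distance at least
    \<open>\<eta> * r\<close> from \<open>C\<close>; half of that leaves room for the argument
    below.\<close>
  define Z where "Z = C2 \<inter> {x. \<eta> * r / 2 \<le> infdist x C}"
  have cZ: "compact Z" unfolding Z_def using cC2
    by (intro compact_Int_closed closed_Collect_le continuous_intros)
  define V where "V i = {x :: 'a. fst i \<bullet> x > snd i}" for i :: "'a \<times> real"
  define J where "J = {(u, h). u \<in> T \<and> norm u = 1 \<and> h > 0 \<and> (\<forall>x\<in>C. u \<bullet> x \<le> h)}"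
  have "Z \<subseteq> (\<Union>i\<in>J. V i)"
  proof
    fix y assume y: "y \<in> Z"
    have "\<eta> * r > 0" using \<eta> r by simp
    then have "infdist y C > 0" using y by (auto simp: Z_def)
    then have yC: "y \<notin> C" by auto
    define p where "p = closest_point C y"
    have clC: "closed C" and neC: "C \<noteq> {}" using CD by (auto intro: compact_imp_closed)
    have pC: "p \<in> C" unfolding p_def by (rule closest_point_in_set[OF clC neC])
    have ne: "y - p \<noteq> 0" using yC pC by auto
    define u where "u = (1 / norm (y - p)) *\<^sub>R (y - p)"
    have dot: "(y - p) \<bullet> (z - p) \<le> 0" if "z \<in> C" for z
      unfolding p_def by (rule closest_point_dot[OF CD(2) clC that])
    have uz: "u \<bullet> z \<le> u \<bullet> p" if "z \<in> C" for z
      using dot[OF that] ne by (simp add: u_def inner_diff_right divide_right_mono)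
    have uT: "u \<in> T" unfolding u_def using y pC C2T CD by (intro subspace_scale subspace_diff) (auto simp: Z_def)
    have un: "norm u = 1" using ne by (simp add: u_def)
    have "r *\<^sub>R u \<in> C" using r uT un CD(1) by (auto simp: subspace_scale)
    then have "r \<le> u \<bullet> p" using uz[of "r *\<^sub>R u"] un by (simp add: dot_square_norm)
    then have "(u, u \<bullet> p) \<in> J" using uT un uz r by (auto simp: J_def)
    moreover have "u \<bullet> y > u \<bullet> p"
    proof -
      have "u \<bullet> (y - p) = norm (y - p)" using ne by (simp add: u_def dot_square_norm power2_eq_square)
      moreover have "norm (y - p) > 0" using ne by simp
      ultimately show ?thesis unfolding inner_diff_right by linarith
    qed
    ultimately show "y \<in> (\<Union>i\<in>J. V i)" by (intro UN_I[of "(u, u \<bullet> p)"]) (auto simp: V_def)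
  qed
  moreover have "open (V i)" for i unfolding V_def by (simp add: open_halfspace_gt)
  ultimately obtain I where I: "I \<subseteq> J" "finite I" "Z \<subseteq> (\<Union>i\<in>I. V i)"
    using compactE_image[OF cZ, of J V] by metis
  show ?thesis
  proof (rule that[OF I(2)])
    show "u \<in> T \<and> norm u = 1 \<and> h > 0" if "(u, h) \<in> I" for u h using that I(1) by (auto simp: J_def)
    show "C \<subseteq> poly_in T I" using I(1) CD(4) by (auto simp: poly_in_def J_def)
    show "poly_in T I \<subseteq> (\<lambda>x. (1 + \<eta>) *\<^sub>R x) ` C"
    proof (rule ccontr)
      assume "\<not> poly_in T I \<subseteq> (\<lambda>x. (1 + \<eta>) *\<^sub>R x) ` C"
      then obtain p where p: "p \<in> poly_in T I" "p \<notin> C2" by (auto simp: C2_def)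
      have star: "t *\<^sub>R p \<in> poly_in T I" if "0 \<le> t" "t \<le> 1" for t
      proof -
        have "t * (u \<bullet> p) \<le> h" if "(u, h) \<in> I" for u h
        proof -
          have h: "u \<bullet> p \<le> h" "h > 0" using that p(1) I(1) by (auto simp: poly_in_def J_def)
          have "t * (u \<bullet> p) \<le> t * h" using h \<open>0 \<le> t\<close> by (intro mult_left_mono) auto
          also have "\<dots> \<le> h" using h \<open>0 \<le> t\<close> \<open>t \<le> 1\<close> by (simp add: mult_left_le_one_le)
          finally show ?thesis .
        qed
        then show ?thesis using p(1) CD(1) by (auto simp: poly_in_def subspace_scale)
      qed
      define S where "S = {t. 0 \<le> t \<and> t \<le> 1 \<and> t *\<^sub>R p \<in> C2}"
      have S0: "0 \<in> S" using CD(5) by (auto simp: S_def C2_def image_iff intro!: bexI[of _ 0])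
      have "S = {0..1} \<inter> (\<lambda>t. t *\<^sub>R p) -` C2" by (auto simp: S_def)
      then have Scl: "closed S"
        using compact_imp_closed[OF cC2]
        by (simp only:) (intro closed_Int closed_atLeastAtMost closed_vimage continuous_intros)
      have Sb: "bdd_above S" by (auto simp: S_def bdd_above_def)
      define t where "t = Sup S"
      have tS: "t \<in> S" unfolding t_def using S0 Sb Scl by (intro closed_contains_Sup) auto
      have tmax: "t' \<le> t" if "t' \<in> S" for t' unfolding t_def using that Sb by (rule cSup_upper)
      have t1: "t < 1" using tS p(2) by (cases "t = 1") (auto simp: S_def)
      have "infdist (t *\<^sub>R p) C \<ge> \<eta> * r / 2"
      proof (rule ccontr)
        assume "\<not> infdist (t *\<^sub>R p) C \<ge> \<eta> * r / 2"
        moreover obtain c where c: "c \<in> C" "infdist (t *\<^sub>R p) C = dist (t *\<^sub>R p) c"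
          using infdist_attains_inf[OF compact_imp_closed[OF CD(3)]] CD(5) by (metis empty_iff)
        ultimately have d: "dist (t *\<^sub>R p) c < \<eta> * r / 2" by simp
        \<comment> \<open>Then \<open>t p = c + (\<eta> / 2) w\<close> with \<open>c\<close> and
          \<open>w\<close> in \<open>C\<close>, so \<open>t p\<close> lies in
          \<open>(1 + \<eta> / 2) C\<close> and the segment can be prolonged inside
          \<open>C2\<close>, against the maximality of \<open>t\<close>.\<close>
        define w where "w = (2 / \<eta>) *\<^sub>R (t *\<^sub>R p - c)"
        have "w \<in> T" unfolding w_def using p(1) c CD by (intro subspace_scale subspace_diff) (auto simp: poly_in_def)
        moreover have "norm w \<le> r"
        proof -
          have "norm w = 2 / \<eta> * dist (t *\<^sub>R p) c" using \<eta> by (simp add: w_def dist_norm)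
          also have "\<dots> \<le> 2 / \<eta> * (\<eta> * r / 2)" using d \<eta> by (intro mult_left_mono) auto
          finally show ?thesis using \<eta> by simp
        qed
        ultimately have wC: "w \<in> C" using r by auto
        define q where "q = (1 / (1 + \<eta> / 2)) *\<^sub>R c + (\<eta> / 2 / (1 + \<eta> / 2)) *\<^sub>R w"
        have "1 / (1 + \<eta> / 2) + \<eta> / 2 / (1 + \<eta> / 2) = 1"
          using \<eta> by (subst add_divide_distrib[symmetric]) simp
        then have "q \<in> C" unfolding q_def using \<eta>
          by (intro convexD[OF CD(2) c(1) wC]) auto
        moreover have tp: "t *\<^sub>R p = (1 + \<eta> / 2) *\<^sub>R q"
          using \<eta> by (simp add: q_def w_def scaleR_add_right)
        ultimately have "((1 + \<eta>) / (1 + \<eta> / 2)) *\<^sub>R (t *\<^sub>R p) \<in> C2"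
          using \<eta> by (auto simp: C2_def)
        define l where "l = (1 + \<eta>) / (1 + \<eta> / 2)"
        have l: "l > 1" using \<eta> by (simp add: l_def)
        have lC: "(l * t) *\<^sub>R p \<in> C2" using \<open>_ *\<^sub>R (t *\<^sub>R p) \<in> C2\<close> by (simp add: l_def)
        show False
        proof (cases "l * t \<le> 1")
          case True
          then have "l * t \<in> S" using lC l tS by (auto simp: S_def)
          then have "l * t \<le> t" by (rule tmax)
          then have "(l - 1) * t \<le> 0" by (simp add: algebra_simps)
          then have "t = 0" using l tS by (auto simp: S_def mult_le_0_iff)
          define t' where "t' = min 1 (r / (norm p + 1))"
          have np: "norm p + 1 > 0" by (simp add: add_nonneg_pos)
          have t': "t' > 0" "t' \<le> 1" using r np by (auto simp: t'_def)
          have "norm (t' *\<^sub>R p) \<le> r"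
          proof -
            have "norm (t' *\<^sub>R p) = t' * norm p" using t' by simp
            also have "\<dots> \<le> r / (norm p + 1) * (norm p + 1)"
              using t' by (intro mult_mono) (auto simp: t'_def)
            finally show ?thesis using np by simp
          qed
          then have "t' *\<^sub>R p \<in> T \<inter> cball 0 r" using p(1) CD(1) by (auto simp: poly_in_def subspace_scale)
          then have "t' *\<^sub>R p \<in> C" using r by blast
          then have "(1 / (1 + \<eta>)) *\<^sub>R (t' *\<^sub>R p) \<in> C"
            using \<eta> by (rule_tac rel_body_scale[OF C]) auto
          then have "t' *\<^sub>R p \<in> C2" unfolding C2_def
            using \<eta> by (intro image_eqI[of _ _ "(1 / (1 + \<eta>)) *\<^sub>R (t' *\<^sub>R p)"]) auto
          then have "t' \<in> S" using t' by (simp add: S_def)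
          then show False using tmax[of t'] t' \<open>t = 0\<close> by simp
        next
          case False
          obtain q' where q': "q' \<in> C" "(l * t) *\<^sub>R p = (1 + \<eta>) *\<^sub>R q'" using lC by (auto simp: C2_def)
          have "p = (1 + \<eta>) *\<^sub>R ((1 / (l * t)) *\<^sub>R q')"
          proof -
            have "p = (1 / (l * t)) *\<^sub>R ((l * t) *\<^sub>R p)" using False by (cases "l * t = 0") auto
            then show ?thesis using q'(2) by (simp add: mult.commute)
          qed
          moreover have "(1 / (l * t)) *\<^sub>R q' \<in> C" using False by (intro rel_body_scale[OF C q'(1)]) auto
          ultimately have "p \<in> C2" unfolding C2_def by (rule image_eqI)
          then show False using p(2) by simp
        qed
      qed
      then have "t *\<^sub>R p \<in> Z" using tS by (simp add: Z_def S_def)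
      then obtain i where i: "i \<in> I" "fst i \<bullet> (t *\<^sub>R p) > snd i" using I(3) by (auto simp: V_def)
      moreover have "t *\<^sub>R p \<in> poly_in T I" using tS by (intro star) (auto simp: S_def)
      ultimately have "fst i \<bullet> (t *\<^sub>R p) \<le> snd i" by (auto simp: poly_in_def split_beta)
      then show False using i(2) by simp
    qed
  qed
qed

section \<open>Boundary measure and volumes of parallel bodies\<close>

lemma rel_body_poly:
  assumes T: "subspace T" and I: "finite I" "\<And>u h. (u, h) \<in> I \<Longrightarrow> u \<in> T \<and> norm u = 1 \<and> h > 0"
    and C: "rel_body T C" "C \<subseteq> poly_in T I" and bdd: "bounded (poly_in T I)"
  shows "rel_body T (poly_in T I)"
proof -
  have "convex (poly_in T I)"
  proof -
    have "poly_in T I = T \<inter> (\<Inter>i\<in>I. {x. fst i \<bullet> x \<le> snd i})"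
      by (auto simp: poly_in_def split_beta)
    moreover have "convex T" using T by (rule subspace_imp_convex)
    ultimately show ?thesis by (simp add: convex_INT convex_Int convex_halfspace_le)
  qed
  moreover have "poly_in T I \<subseteq> T" by (auto simp: poly_in_def)
  moreover obtain r where "r > 0" "T \<inter> cball 0 r \<subseteq> poly_in T I"
    using C unfolding rel_body_def by (meson order_trans)
  ultimately show ?thesis
    using closed_poly_in[OF T, of I] bdd T unfolding rel_body_def compact_eq_bounded_closed by blast
qed

lemma poly_faceD: "x \<in> poly_face T I i \<Longrightarrow> x \<in> T \<and> fst i \<bullet> x = snd i \<and> (\<forall>j\<in>I. fst j \<bullet> x \<le> snd j)"
  by (auto simp: poly_face_def poly_in_def split_beta)

lemma compact_poly_face: "compact (poly_in T I) \<Longrightarrow> compact (poly_face T I i)"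
proof -
  assume "compact (poly_in T I)"
  moreover have "poly_face T I i = poly_in T I \<inter> {x. fst i \<bullet> x = snd i}"
    by (auto simp: poly_face_def)
  ultimately show ?thesis by (simp add: compact_Int_closed closed_hyperplane)
qed

text \<open>Since the heights are positive, scaling by \<open>l > 1\<close> violates a constraint
  that is tight at \<open>x\<close>, whereas finitely many strict constraints survive for
  \<open>l\<close> close to 1.\<close>

lemma radial_boundary_poly:
  assumes T: "subspace T" and I: "finite I" "\<And>u h. (u, h) \<in> I \<Longrightarrow> u \<in> T \<and> norm u = 1 \<and> h > 0"
  shows "radial_boundary (poly_in T I) = (\<Union>i\<in>I. poly_face T I i)"
proof (intro set_eqI iffI)
  fix x assume x: "x \<in> (\<Union>i\<in>I. poly_face T I i)"
  then obtain u h where uh: "(u, h) \<in> I" "x \<in> poly_in T I" "u \<bullet> x = h" by (auto simp: poly_face_def)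
  have "l *\<^sub>R x \<notin> poly_in T I" if "l > 1" for l
  proof
    assume "l *\<^sub>R x \<in> poly_in T I"
    then have "l * h \<le> h" using uh by (auto simp: poly_in_def)
    then show False using that I(2)[OF uh(1)] by (simp add: mult_le_cancel_right1)
  qed
  then show "x \<in> radial_boundary (poly_in T I)" using uh by (simp add: radial_boundary_def)
next
  fix x assume x: "x \<in> radial_boundary (poly_in T I)"
  then have xP: "x \<in> poly_in T I" by (simp add: radial_boundary_def)
  show "x \<in> (\<Union>i\<in>I. poly_face T I i)"
  proof (rule ccontr)
    assume no: "x \<notin> (\<Union>i\<in>I. poly_face T I i)"
    have less: "fst i \<bullet> x < snd i" if "i \<in> I" for i
    proof -
      have "fst i \<bullet> x \<le> snd i" using xP that by (auto simp: poly_in_def)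
      moreover have "fst i \<bullet> x \<noteq> snd i" using no that xP by (auto simp: poly_face_def)
      ultimately show ?thesis by simp
    qed
    have "\<forall>\<^sub>F l in at_right 1. \<forall>i\<in>I. fst i \<bullet> (l *\<^sub>R x) < snd i"
    proof (intro eventually_ball_finite[OF I(1)] ballI)
      fix i assume "i \<in> I"
      have "((\<lambda>l. fst i \<bullet> (l *\<^sub>R x)) \<longlongrightarrow> fst i \<bullet> (1 *\<^sub>R x)) (at_right 1)" by (intro tendsto_intros)
      then show "\<forall>\<^sub>F l in at_right 1. fst i \<bullet> (l *\<^sub>R x) < snd i"
        using less[OF \<open>i \<in> I\<close>] by (intro order_tendstoD) auto
    qed
    then have "\<forall>\<^sub>F l in at_right (1::real). l > 1 \<and> (\<forall>i\<in>I. fst i \<bullet> (l *\<^sub>R x) < snd i)"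
      by (intro eventually_conj eventually_at_right_less) auto
    then obtain l :: real where l: "l > 1" "\<forall>i\<in>I. fst i \<bullet> (l *\<^sub>R x) < snd i"
      using eventually_happens[of _ "at_right (1::real)"] by auto
    then have "l *\<^sub>R x \<in> poly_in T I"
      using xP T by (force simp: poly_in_def subspace_scale)
    then show False using x l(1) by (auto simp: radial_boundary_def)
  qed
qed

lemma null_hyperplane:
  fixes a :: "'a::euclidean_space"
  assumes "a \<noteq> 0 \<or> b \<noteq> 0"
  shows "{x. a \<bullet> x = b} \<in> null_sets lborel"
proof -
  have "negligible {x. a \<bullet> x = b}" using assms by (rule negligible_hyperplane)
  then show ?thesis
    by (simp add: negligible_iff_null_sets null_sets_completion_iff closed_hyperplane borel_closed)
qed

lemma inner_slab_window:
  assumes "u \<in> T" "norm u = 1" "q \<in> slab_window T u"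
  obtains s y where "0 \<le> s" "s \<le> 1" "y \<in> perp T" "norm y \<le> 1" "q = s *\<^sub>R u + y"
  using assms(3) by (auto simp: slab_window_def)

lemma perp_decomp_unique:
  assumes T: "subspace T" and "x + y = x' + y'" "x \<in> T" "x' \<in> T" "y \<in> perp T" "y' \<in> perp T"
  shows "x = x' \<and> y = y'"
proof -
  have "x - x' \<in> T" using T assms by (intro subspace_diff)
  moreover have "y' - y \<in> perp T" using subspace_perp assms by (intro subspace_diff)
  moreover have "x - x' = y' - y" using assms(2) by (simp add: algebra_simps)
  ultimately have "(x - x') \<bullet> (x - x') = 0" by (simp add: perp_def)
  then show ?thesis using assms(2) by simp
qed

text \<open>Circumscribe a polytope: the outward unit prisms over its facets are disjoint.\<close>

lemma hausdorff_boundary_upper: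
  fixes T :: "'a::euclidean_space set"
  assumes C: "rel_body T C"
    and c: "c > 0" "\<And>u F h. u \<in> T \<Longrightarrow> norm u = 1 \<Longrightarrow> compact F \<Longrightarrow> F \<subseteq> T \<Longrightarrow> (\<And>x. x \<in> F \<Longrightarrow> u \<bullet> x = h) \<Longrightarrow>
       hausdorff_measure d F = ennreal c * emeasure lborel (prism T u F)"
    and \<eta>: "\<eta> > 0" and W: "compact W"
    "\<And>x z. x \<in> T \<Longrightarrow> z \<in> C \<Longrightarrow> dist x ((1 + \<eta>) *\<^sub>R z) \<le> 1 \<Longrightarrow> x \<in> W"
  shows "hausdorff_measure d (radial_boundary C) + ennreal c * emeasure lborel (cylinder T C)
       \<le> ennreal c * emeasure lborel (cylinder T W)"
proof -
  note CD = rel_bodyD[OF C]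
  note T = CD(1)
  obtain I where I: "finite I" "\<And>u h. (u, h) \<in> I \<Longrightarrow> u \<in> T \<and> norm u = 1 \<and> h > 0"
    and P1: "C \<subseteq> poly_in T I" and P2: "poly_in T I \<subseteq> (\<lambda>x. (1 + \<eta>) *\<^sub>R x) ` C"
    using poly_approx[OF C \<eta>] by metis
  define P where "P = poly_in T I"
  have "compact ((\<lambda>x. (1 + \<eta>) *\<^sub>R x) ` C)" using CD(3) by (rule compact_scaling)
  then have bP: "bounded P" using P2 unfolding P_def by (meson bounded_subset compact_imp_bounded)
  have P: "rel_body T P" unfolding P_def by (rule rel_body_poly[OF T I C P1 bP[unfolded P_def]])
  note PD = rel_bodyD[OF P]
  have cF: "compact (poly_face T I i)" for i
    using PD(3) unfolding P_def by (rule compact_poly_face)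
  have FT: "poly_face T I i \<subseteq> T" for i by (auto dest: poly_faceD)
  define A where "A i = prism T (fst i) (poly_face T I i)" for i
  \<comment> \<open>The base of the prism is removed, a null set; without it prisms over adjacent
    facets, and a prism and the polytope, could still share boundary points.\<close>
  define A' where "A' i = A i - {x. fst i \<bullet> x = snd i}" for i
  have iI: "fst i \<in> T" "norm (fst i) = 1" "snd i > 0" if "i \<in> I" for i
    using I(2)[of "fst i" "snd i"] that by auto
  have cA: "compact (A i)" for i unfolding A_def by (rule compact_prism[OF cF])
  have mA: "A i \<in> sets borel" "A' i \<in> sets borel" for i
    using cA[of i] by (auto simp: A'_def borel_compact closed_hyperplane borel_closed)
  have eA: "emeasure lborel (A' i) = emeasure lborel (A i)" if "i \<in> I" for i
    unfolding A'_def using mA iI[OF that] by (intro emeasure_Diff_null_set null_hyperplane) auto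
  have Hface: "hausdorff_measure d (poly_face T I i) = ennreal c * emeasure lborel (A i)" if "i \<in> I" for i
    unfolding A_def using iI[OF that] cF FT by (intro c(2)) (auto dest: poly_faceD)
  have A'E: "\<exists>x s y. p = x + s *\<^sub>R fst i + y \<and> x \<in> poly_face T I i \<and> 0 < s \<and> s \<le> 1 \<and> y \<in> perp T \<and> norm y \<le> 1"
    if i: "i \<in> I" and p: "p \<in> A' i" for p i
  proof -
    obtain x q where xq: "p = x + q" "x \<in> poly_face T I i" "q \<in> slab_window T (fst i)"
      using p by (auto simp: A'_def A_def prism_def)
    obtain s y where sy: "0 \<le> s" "s \<le> 1" "y \<in> perp T" "norm y \<le> 1" "q = s *\<^sub>R fst i + y"
      using inner_slab_window[OF iI(1,2)[OF i] xq(3)] by metis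
    have "fst i \<bullet> p = snd i + s"
    proof -
      have "fst i \<bullet> y = 0" using sy(3) iI(1)[OF i] by (simp add: perp_def)
      moreover have "fst i \<bullet> fst i = 1" using iI(2)[OF i] by (simp add: dot_square_norm)
      moreover have "fst i \<bullet> x = snd i" using poly_faceD[OF xq(2)] by simp
      ultimately show ?thesis by (simp add: xq sy(5) inner_add_right)
    qed
    moreover have "fst i \<bullet> p \<noteq> snd i" using p by (simp add: A'_def)
    ultimately show ?thesis using xq sy by (intro exI[of _ x] exI[of _ s] exI[of _ y]) (auto simp: add.assoc)
  qed
  have normal: "(x' - x) \<bullet> fst i \<le> 0" if "i \<in> I" "x \<in> poly_face T I i" "x' \<in> P" for i x x'
  proof -
    have "fst i \<bullet> x' \<le> snd i" using that by (auto simp: P_def poly_in_def split_beta)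
    moreover have "fst i \<bullet> x = snd i" using poly_faceD[OF that(2)] by simp
    ultimately show ?thesis by (simp add: inner_commute[of _ "fst i"] inner_diff_right)
  qed
  have FP: "poly_face T I i \<subseteq> P" for i by (auto simp: P_def poly_face_def)
  have FPD: "x \<in> P \<and> x \<in> T" if "x \<in> poly_face T I i" for x i using that FP[of i] FT[of i] by blast
  \<comment> \<open>Uniqueness of the nearest point: \<open>x\<close> plus an outer normal at
    \<open>x\<close> has only \<open>x\<close> as nearest point of \<open>P\<close>. Disjointness of
    two prisms is the case of two facet normals, disjointness from \<open>P\<close> the case of the
    zero vector.\<close>
  have dec: "x = x' \<and> s *\<^sub>R fst i = s' *\<^sub>R v \<and> y = y'"
    if i: "i \<in> I" and x: "x \<in> poly_face T I i" "0 \<le> s" and y: "y \<in> perp T" "y' \<in> perp T"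
      and x': "x' \<in> P" "v \<in> T" "s' \<ge> 0" "\<And>z. z \<in> P \<Longrightarrow> (z - x') \<bullet> (s' *\<^sub>R v) \<le> 0"
      and eq: "x + s *\<^sub>R fst i + y = x' + s' *\<^sub>R v + y'" for i x s y x' s' v y'
  proof -
    have xT: "x \<in> T" "x' \<in> T" using FT[of i] x(1) x'(1) PD(4) by blast+
    have "x + s *\<^sub>R fst i \<in> T" "x' + s' *\<^sub>R v \<in> T"
      using xT iI(1)[OF i] x' T by (auto intro!: subspace_add subspace_scale)
    then have e: "x + s *\<^sub>R fst i = x' + s' *\<^sub>R v" "y = y'"
      using perp_decomp_unique[OF T eq] y by auto
    have "(x - x') \<bullet> (x - x') = (x - x') \<bullet> (s' *\<^sub>R v) + (x' - x) \<bullet> (s *\<^sub>R fst i)"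
    proof -
      have "x - x' = s' *\<^sub>R v - s *\<^sub>R fst i" using e(1) by (simp add: algebra_simps)
      then have "(x - x') \<bullet> (x - x') = (x - x') \<bullet> (s' *\<^sub>R v - s *\<^sub>R fst i)" by simp
      then show ?thesis by (simp add: inner_diff_left inner_diff_right algebra_simps)
    qed
    also have "\<dots> \<le> 0"
    proof -
      have "(x - x') \<bullet> (s' *\<^sub>R v) \<le> 0" using FP[of i] x by (intro x'(4)) blast
      moreover have "(x' - x) \<bullet> (s *\<^sub>R fst i) \<le> 0"
        using normal[OF i x(1) x'(1)] x(2) by (simp add: mult_nonneg_nonpos)
      ultimately show ?thesis by linarith
    qed
    finally have "(x - x') \<bullet> (x - x') = 0" using inner_ge_zero[of "x - x'"] by linarith
    then have "x = x'" by simp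
    then show ?thesis using e by simp
  qed
  have disj: "A' i \<inter> A' j = {}" if ij: "i \<in> I" "j \<in> I" "i \<noteq> j" for i j
  proof (rule ccontr)
    assume "A' i \<inter> A' j \<noteq> {}"
    then obtain p where p: "p \<in> A' i" "p \<in> A' j" by auto
    obtain x s y where 1: "p = x + s *\<^sub>R fst i + y" "x \<in> poly_face T I i" "0 < s" "y \<in> perp T"
      using A'E[OF ij(1) p(1)] by blast
    obtain x' s' y' where 2: "p = x' + s' *\<^sub>R fst j + y'" "x' \<in> poly_face T I j" "0 < s'" "y' \<in> perp T"
      using A'E[OF ij(2) p(2)] by blast
    have "x = x' \<and> s *\<^sub>R fst i = s' *\<^sub>R fst j \<and> y = y'"
    proof (rule dec[OF ij(1) 1(2) _ 1(4) 2(4)])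
      show "(z - x') \<bullet> (s' *\<^sub>R fst j) \<le> 0" if "z \<in> P" for z
        using normal[OF ij(2) 2(2) that] 2(3) by (simp add: mult_nonneg_nonpos)
    qed (use 1(1) 1(3) 2(1) 2(3) FPD[OF 2(2)] iI(1)[OF ij(2)] in simp_all)
    then have eq: "x = x'" "s *\<^sub>R fst i = s' *\<^sub>R fst j" by simp_all
    have "s = s'"
      using arg_cong[OF eq(2), of norm] iI(2)[OF ij(1)] iI(2)[OF ij(2)] 1(3) 2(3) by simp
    then have "fst i = fst j" using eq(2) 1(3) by simp
    moreover have "snd i = snd j" using poly_faceD[OF 1(2)] poly_faceD[OF 2(2)] eq(1) \<open>fst i = fst j\<close> by simp
    ultimately show False using ij(3) by (simp add: prod_eq_iff)
  qed
  have disjP: "A' i \<inter> cylinder T P = {}" if i: "i \<in> I" for i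
  proof (rule ccontr)
    assume "A' i \<inter> cylinder T P \<noteq> {}"
    then obtain p where p: "p \<in> A' i" "p \<in> cylinder T P" by auto
    obtain x s y where 1: "p = x + s *\<^sub>R fst i + y" "x \<in> poly_face T I i" "0 < s" "y \<in> perp T"
      using A'E[OF i p(1)] by blast
    obtain x' y' where 2: "p = x' + y'" "x' \<in> P" "y' \<in> perp T" using p(2) by (auto simp: cylinder_def)
    have "x = x' \<and> s *\<^sub>R fst i = 0 *\<^sub>R fst i \<and> y = y'"
      by (rule dec[OF i 1(2) _ 1(4) 2(3) 2(2)]) (use 1(1) 1(3) 2(1) iI(1)[OF i] in simp_all)
    then have "s = 0 \<or> fst i = 0" by simp
    then show False using 1(3) iI(2)[OF i] by auto
  qed
  have subW: "(\<Union>i\<in>I. A' i) \<union> cylinder T P \<subseteq> cylinder T W"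
  proof -
    have W': "x \<in> W" if "x \<in> T" "z \<in> P" "dist x z \<le> 1" for x z
      using W(2)[OF that(1)] P2 that(2,3) unfolding P_def by blast
    have "p \<in> cylinder T W" if i: "i \<in> I" and p: "p \<in> A' i" for i p
    proof -
      obtain x s y where 1: "p = x + s *\<^sub>R fst i + y" "x \<in> poly_face T I i" "0 < s" "s \<le> 1" "y \<in> perp T" "norm y \<le> 1"
        using A'E[OF i p] by blast
      have "x + s *\<^sub>R fst i \<in> W"
      proof (rule W')
        show "x + s *\<^sub>R fst i \<in> T" using FPD[OF 1(2)] iI(1)[OF i] T by (intro subspace_add subspace_scale) auto
        show "dist (x + s *\<^sub>R fst i) x \<le> 1" using 1(3,4) iI(2)[OF i] by (simp add: dist_norm)
      qed (use FPD[OF 1(2)] in simp)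
      then show ?thesis using 1(1,5,6) unfolding cylinder_def by auto
    qed
    moreover have "P \<subseteq> W"
    proof
      fix x assume "x \<in> P"
      then show "x \<in> W" using PD(4) by (intro W'[of x x]) auto
    qed
    ultimately show ?thesis using cylinder_mono[of P W T] by blast
  qed
  have mP: "cylinder T P \<in> sets borel" using compact_cylinder[OF PD(3)] by (rule borel_compact)
  have "emeasure lborel (\<Union>i\<in>I. A' i) + emeasure lborel (cylinder T P)
      = emeasure lborel ((\<Union>i\<in>I. A' i) \<union> cylinder T P)"
    using disjP I(1) mA mP by (intro plus_emeasure) auto
  also have "\<dots> \<le> emeasure lborel (cylinder T W)"
    using subW compact_cylinder[OF W(1)] by (intro emeasure_mono) (auto simp: borel_compact)
  finally have le1: "emeasure lborel (\<Union>i\<in>I. A' i) + emeasure lborel (cylinder T P) \<le> emeasure lborel (cylinder T W)" .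
  have "emeasure lborel (\<Union>i\<in>I. A' i) = (\<Sum>i\<in>I. emeasure lborel (A' i))"
    using I(1) mA disj by (intro sum_emeasure[symmetric]) (auto simp: disjoint_family_on_def)
  also have "\<dots> = (\<Sum>i\<in>I. emeasure lborel (A i))" by (intro sum.cong eA) auto
  finally have le2: "(\<Sum>i\<in>I. emeasure lborel (A i)) + emeasure lborel (cylinder T P) \<le> emeasure lborel (cylinder T W)"
    using le1 by simp
  have "hausdorff_measure d (radial_boundary C) \<le> hausdorff_measure d (radial_boundary P)"
    using P1 by (intro hausdorff_radial_boundary_mono[OF C P]) (simp add: P_def)
  also have "\<dots> = hausdorff_measure d (\<Union>i\<in>I. poly_face T I i)"
    unfolding P_def using radial_boundary_poly[OF T I] by simp
  also have "\<dots> \<le> (\<Sum>i\<in>I. hausdorff_measure d (poly_face T I i))"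
    by (rule hausdorff_measure_finite_UN_le[OF I(1)])
  also have "\<dots> = ennreal c * (\<Sum>i\<in>I. emeasure lborel (A i))"
    unfolding sum_distrib_left by (intro sum.cong Hface) auto
  finally have H: "hausdorff_measure d (radial_boundary C) \<le> ennreal c * (\<Sum>i\<in>I. emeasure lborel (A i))" .
  have "emeasure lborel (cylinder T C) \<le> emeasure lborel (cylinder T P)"
    using P1 mP cylinder_mono[of C P T] by (intro emeasure_mono) (auto simp: P_def)
  then have "hausdorff_measure d (radial_boundary C) + ennreal c * emeasure lborel (cylinder T C)
      \<le> ennreal c * ((\<Sum>i\<in>I. emeasure lborel (A i)) + emeasure lborel (cylinder T P))"
    unfolding distrib_left by (intro add_mono H mult_left_mono) auto
  also have "\<dots> \<le> ennreal c * emeasure lborel (cylinder T W)"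
    by (intro mult_left_mono le2) auto
  finally show ?thesis .
qed

text \<open>Inscribe a polytope. Up to the null set of points equidistant from two facet
  hyperplanes, the layer of depth 1 is covered by the inward unit prisms over the open facets.\<close>

lemma hausdorff_boundary_lower:
  fixes T :: "'a::euclidean_space set"
  assumes C: "rel_body T C"
    and c: "c > 0" "\<And>u F h. u \<in> T \<Longrightarrow> norm u = 1 \<Longrightarrow> compact F \<Longrightarrow> F \<subseteq> T \<Longrightarrow> (\<And>x. x \<in> F \<Longrightarrow> u \<bullet> x = h) \<Longrightarrow>
       hausdorff_measure d F = ennreal c * emeasure lborel (prism T u F)"
    and \<eta>: "\<eta> > 0" and W: "compact W"
    "\<And>x. x \<in> T \<Longrightarrow> (\<And>z. z \<in> T \<Longrightarrow> dist x z \<le> 1 \<Longrightarrow> z \<in> C) \<Longrightarrow> x \<in> W"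
  shows "ennreal c * emeasure lborel (cylinder T ((\<lambda>x. (1 / (1 + \<eta>)) *\<^sub>R x) ` C))
       \<le> hausdorff_measure d (radial_boundary C) + ennreal c * emeasure lborel (cylinder T W)"
proof -
  note CD = rel_bodyD[OF C]
  note T = CD(1)
  \<comment> \<open>The approximating polytope lies between \<open>C'\<close> and
    \<open>(1 + \<eta>) C' = C\<close>, hence is inscribed in \<open>C\<close>.\<close>
  define C' where "C' = (\<lambda>x. (1 / (1 + \<eta>)) *\<^sub>R x) ` C"
  have C'T: "C' \<subseteq> T" unfolding C'_def using CD(4) T by (auto intro: subspace_scale)
  have C': "rel_body T C'"
  proof -
    obtain r where r: "r > 0" "T \<inter> cball 0 r \<subseteq> C" using C by (auto simp: rel_body_def)
    have "T \<inter> cball 0 (r / (1 + \<eta>)) \<subseteq> C'"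
    proof
      fix x assume x: "x \<in> T \<inter> cball 0 (r / (1 + \<eta>))"
      have "norm ((1 + \<eta>) *\<^sub>R x) = (1 + \<eta>) * norm x" using \<eta> by (simp only: norm_scaleR)
      also have "\<dots> \<le> (1 + \<eta>) * (r / (1 + \<eta>))" using x \<eta> by (intro mult_left_mono) auto
      also have "\<dots> = r" using \<eta> by simp
      finally have "(1 + \<eta>) *\<^sub>R x \<in> T \<inter> cball 0 r" using x subspace_scale[OF T] by (simp del: scaleR_add_left)
      then have "(1 + \<eta>) *\<^sub>R x \<in> C" using r by blast
      then show "x \<in> C'" unfolding C'_def using \<eta> by (intro image_eqI[of _ _ "(1 + \<eta>) *\<^sub>R x"]) auto
    qed
    moreover have "r / (1 + \<eta>) > 0" using r \<eta> by simp
    moreover have "convex C'" "compact C'" unfolding C'_def using CD by (auto intro: convex_scaling compact_scaling)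
    ultimately show ?thesis unfolding rel_body_def using T C'T by blast
  qed
  obtain I where I: "finite I" "\<And>u h. (u, h) \<in> I \<Longrightarrow> u \<in> T \<and> norm u = 1 \<and> h > 0"
    and P1: "C' \<subseteq> poly_in T I" and P2: "poly_in T I \<subseteq> (\<lambda>x. (1 + \<eta>) *\<^sub>R x) ` C'"
    using poly_approx[OF C' \<eta>] by metis
  define P where "P = poly_in T I"
  have PC: "P \<subseteq> C" using P2 \<eta> by (auto simp: P_def C'_def)
  then have bP: "bounded P" using CD(3) bounded_subset compact_imp_bounded by blast
  have P: "rel_body T P" unfolding P_def by (rule rel_body_poly[OF T I C' P1 bP[unfolded P_def]])
  note PD = rel_bodyD[OF P]
  have iI: "fst i \<in> T" "norm (fst i) = 1" "snd i > 0" "fst i \<bullet> fst i = 1" if "i \<in> I" for i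
    using I(2)[of "fst i" "snd i"] that by (auto simp: dot_square_norm)
  define sl where "sl i x = snd i - fst i \<bullet> x" for i :: "'a \<times> real" and x
  have slP: "x \<in> P \<longleftrightarrow> x \<in> T \<and> (\<forall>i\<in>I. sl i x \<ge> 0)" for x
    by (auto simp: P_def poly_in_def sl_def split_beta)
  have sl1: "\<bar>sl i x - sl i y\<bar> \<le> norm (x - y)" if "i \<in> I" for i x y
    using Cauchy_Schwarz_ineq2[of "fst i" "x - y"] iI(2)[OF that]
    by (simp add: sl_def inner_diff_right abs_minus_commute)
  \<comment> \<open>The part of facet \<open>i\<close> where every other constraint has slack at
    least \<open>1 / (k + 1)\<close>. Slacks are 1-Lipschitz, so these parts keep that distance from
    each other and their measures add up. Later \<open>k\<close> tends to infinity.\<close>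
  define G where "G k i = {x \<in> P. sl i x = 0 \<and> (\<forall>j\<in>I - {i}. sl j x \<ge> 1 / real (Suc k))}" for k i
  have cG: "compact (G k i)" for k i
  proof -
    have "G k i = P \<inter> ({x. fst i \<bullet> x = snd i} \<inter> (\<Inter>j\<in>I - {i}. {x. fst j \<bullet> x \<le> snd j - 1 / real (Suc k)}))"
      by (auto simp: G_def sl_def algebra_simps)
    then show ?thesis
      using PD(3) by (simp only:) (intro compact_Int_closed closed_Int closed_INT ballI closed_hyperplane closed_halfspace_le)
  qed
  define A where "A k i = prism T (- fst i) (G k i)" for k i
  have cA: "compact (A k i)" for k i unfolding A_def by (rule compact_prism[OF cG])
  have mA: "A k i \<in> sets borel" for k i using cA by (rule borel_compact)
  have GT: "G k i \<subseteq> T" for k i using PD(4) by (auto simp: G_def)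
  have HG: "hausdorff_measure d (G k i) = ennreal c * emeasure lborel (A k i)" if "i \<in> I" for k i
    unfolding A_def using iI[OF that] cG GT subspace_neg[OF T]
    by (intro c(2)[of _ _ "- snd i"]) (auto simp: G_def sl_def)
  have bound: "ennreal c * (\<Sum>i\<in>I. emeasure lborel (A k i)) \<le> hausdorff_measure d (radial_boundary C)" for k
  proof -
    have "ennreal c * (\<Sum>i\<in>I. emeasure lborel (A k i)) = (\<Sum>i\<in>I. hausdorff_measure d (G k i))"
      unfolding sum_distrib_left by (intro sum.cong HG[symmetric]) auto
    also have "\<dots> \<le> hausdorff_measure d (\<Union>i\<in>I. G k i)"
    proof (rule hausdorff_measure_separated_UN[OF I(1), of "1 / real (Suc k)"])
      fix i j x y assume *: "i \<in> I" "j \<in> I" "i \<noteq> j" "x \<in> G k i" "y \<in> G k j"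
      then have "sl j x \<ge> 1 / real (Suc k)" "sl j y = 0" by (auto simp: G_def)
      then show "1 / real (Suc k) \<le> dist x y" using sl1[OF *(2), of x y] by (simp add: dist_norm)
    qed simp
    also have "\<dots> \<le> hausdorff_measure d (\<Union>i\<in>I. poly_face T I i)"
      by (intro hausdorff_measure_mono) (auto simp: G_def P_def poly_face_def sl_def)
    also have "\<dots> = hausdorff_measure d (radial_boundary P)"
      unfolding P_def using radial_boundary_poly[OF T I] by simp
    also have "\<dots> \<le> hausdorff_measure d (radial_boundary C)"
      by (rule hausdorff_radial_boundary_mono[OF P C PC])
    finally show ?thesis .
  qed
  have incG: "G k i \<subseteq> G l i" if "k \<le> l" for k l i
  proof -
    have "1 / real (Suc l) \<le> 1 / real (Suc k)" using that by (simp add: frac_le)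
    then show ?thesis unfolding G_def by (blast intro: order_trans)
  qed
  have inc: "incseq (\<lambda>k. A k i)" for i
  proof -
    have "A k i \<subseteq> A l i" if "k \<le> l" for k l
      unfolding A_def prism_def using incG[OF that, of i] by blast
    then show ?thesis by (auto simp: incseq_def)
  qed
  have "(\<lambda>k. ennreal c * (\<Sum>i\<in>I. emeasure lborel (A k i))) \<longlonglongrightarrow> ennreal c * (\<Sum>i\<in>I. emeasure lborel (\<Union>k. A k i))"
    using mA inc by (intro ennreal_tendsto_cmult tendsto_sum Lim_emeasure_incseq) auto
  then have bound': "ennreal c * (\<Sum>i\<in>I. emeasure lborel (\<Union>k. A k i)) \<le> hausdorff_measure d (radial_boundary C)"
    by (rule LIMSEQ_le_const2) (use bound in auto)
  \<comment> \<open>Ties between the two smallest slacks. For \<open>i \<noteq> j\<close> with equal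
    normals the heights differ and the set is empty; otherwise it is a hyperplane.\<close>
  define N where "N = (\<Union>i\<in>I. \<Union>j\<in>I - {i}. {q. (fst i - fst j) \<bullet> q = snd i - snd j})"
  have N: "N \<in> null_sets lborel"
  proof -
    have h: "{q. (fst i - fst j) \<bullet> q = snd i - snd j} \<in> null_sets lborel" if "j \<in> I - {i}" for i j :: "'a \<times> real"
      using that by (intro null_hyperplane) (auto simp: prod_eq_iff)
    show ?thesis unfolding N_def
    proof (rule null_sets_UN'[OF countable_finite[OF I(1)]])
      fix i
      have "countable (I - {i})" using I(1) by (simp add: countable_finite)
      then show "(\<Union>j\<in>I - {i}. {q. (fst i - fst j) \<bullet> q = snd i - snd j}) \<in> null_sets lborel"
        by (rule null_sets_UN') (rule h)
    qed
  qed
  have cover: "cylinder T P \<subseteq> cylinder T W \<union> ((\<Union>i\<in>I. \<Union>k. A k i) \<union> N)"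
  proof
    fix q assume "q \<in> cylinder T P"
    then obtain p y where p: "p \<in> P" "y \<in> perp T" "norm y \<le> 1" "q = p + y" by (auto simp: cylinder_def)
    have pT: "p \<in> T" using p PD(4) by auto
    show "q \<in> cylinder T W \<union> ((\<Union>i\<in>I. \<Union>k. A k i) \<union> N)"
    proof (cases "p \<in> W")
      case True
      then show ?thesis using p by (auto simp: cylinder_def)
    next
      case False
      then obtain z where z: "z \<in> T" "dist p z \<le> 1" "z \<notin> P" using W(2)[OF pT] PC by blast
      then obtain j where j: "j \<in> I" "sl j z < 0" by (auto simp: slP not_le)
      then have j1: "sl j p < 1" using sl1[OF j(1), of p z] z(2) by (simp add: dist_norm)
      \<comment> \<open>The constraint with the smallest slack; moving along its normal,
        \<open>p\<close> meets this facet before any other.\<close>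
      obtain i where i: "i \<in> I" "\<And>j. j \<in> I \<Longrightarrow> sl i p \<le> sl j p"
        using ex_is_arg_min_if_finite[OF I(1), of "\<lambda>i. sl i p"] j(1)
        by (auto simp: is_arg_min_linorder)
      define s where "s = sl i p"
      have s: "0 \<le> s" "s \<le> 1" using i(1) i(2)[OF j(1)] j1 p(1) by (auto simp: s_def slP)
      show ?thesis
      proof (cases "\<exists>j\<in>I - {i}. sl j p = s")
        case True
        then obtain j where j: "j \<in> I" "j \<noteq> i" "sl j p = s" by auto
        have "fst i \<bullet> y = 0" "fst j \<bullet> y = 0" using p(2) iI(1)[OF i(1)] iI(1)[OF j(1)] by (auto simp: perp_def)
        then have "(fst i - fst j) \<bullet> q = snd i - snd j"
          using j(3) by (simp add: p(4) inner_diff_left inner_add_right s_def sl_def)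
        then show ?thesis using i(1) j(1,2) by (auto simp: N_def)
      next
        case nt: False
        \<comment> \<open>The foot of \<open>p\<close> on facet \<open>i\<close>. Every other slack
          drops by at most \<open>s\<close> on the way and was larger than \<open>s\<close>, so
          \<open>x\<close> lies in the open facet.\<close>
        define x where "x = p + s *\<^sub>R fst i"
        have xT: "x \<in> T" unfolding x_def using pT iI(1)[OF i(1)] T by (intro subspace_add subspace_scale)
        have x0: "sl i x = 0" using iI(4)[OF i(1)] by (simp add: x_def sl_def s_def inner_add_right)
        have xpos: "sl j x > 0" if "j \<in> I - {i}" for j
        proof -
          have "sl j p > s" using i(2)[of j] nt that by (fastforce simp: s_def)
          moreover have "sl j x = sl j p - s * (fst j \<bullet> fst i)" by (simp add: x_def sl_def inner_add_right)
          moreover have "fst j \<bullet> fst i \<le> 1"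
            using norm_cauchy_schwarz[of "fst j" "fst i"] iI(2) i(1) that by auto
          then have "s * (fst j \<bullet> fst i) \<le> s" using s(1) by (metis mult_left_mono mult.right_neutral)
          ultimately show ?thesis by linarith
        qed
        have "\<exists>k. \<forall>j\<in>I - {i}. 1 / real (Suc k) \<le> sl j x"
        proof (cases "I - {i} = {}")
          case False
          define m where "m = Min ((\<lambda>j. sl j x) ` (I - {i}))"
          have m: "m > 0" "\<And>j. j \<in> I - {i} \<Longrightarrow> m \<le> sl j x"
            unfolding m_def using False I(1) xpos by auto
          obtain k where "inverse (real (Suc k)) < m" using reals_Archimedean[OF m(1)] by auto
          then show ?thesis using m(2) by (intro exI[of _ k]) (force simp: inverse_eq_divide)
        qed auto
        then obtain k where k: "\<forall>j\<in>I - {i}. 1 / real (Suc k) \<le> sl j x" by auto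
        have "x \<in> P" unfolding slP using xT x0 xpos by (metis DiffI less_imp_le order_refl singletonD)
        then have xG: "x \<in> G k i" using x0 k by (simp add: G_def)
        have "s *\<^sub>R (- fst i) + y \<in> slab_window T (- fst i)"
          using s p by (auto simp: slab_window_def)
        then have "x + (s *\<^sub>R (- fst i) + y) \<in> A k i" unfolding A_def prism_def using xG by blast
        moreover have "x + (s *\<^sub>R (- fst i) + y) = q" by (simp add: x_def p(4))
        ultimately show ?thesis using i(1) by blast
      qed
    qed
  qed
  have mW: "cylinder T W \<in> sets borel" using compact_cylinder[OF W(1)] by (rule borel_compact)
  have mU: "(\<Union>i\<in>I. \<Union>k. A k i) \<in> sets borel" using mA I(1) by auto
  have Nb: "N \<in> sets borel" using N by auto
  have "emeasure lborel (cylinder T C') \<le> emeasure lborel (cylinder T W \<union> ((\<Union>i\<in>I. \<Union>k. A k i) \<union> N))"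
    using cover cylinder_mono[of C' P T] P1 mW mU Nb by (intro emeasure_mono) (auto simp: P_def)
  also have "\<dots> \<le> emeasure lborel (cylinder T W) + emeasure lborel ((\<Union>i\<in>I. \<Union>k. A k i) \<union> N)"
    using mW mU Nb by (intro emeasure_subadditive) auto
  also have "emeasure lborel ((\<Union>i\<in>I. \<Union>k. A k i) \<union> N) = emeasure lborel (\<Union>i\<in>I. \<Union>k. A k i)"
    using mU N by (intro emeasure_Un_null_set) auto
  also have "\<dots> \<le> (\<Sum>i\<in>I. emeasure lborel (\<Union>k. A k i))"
    using mA I(1) by (intro emeasure_subadditive_finite) auto
  finally have "ennreal c * emeasure lborel (cylinder T C')
      \<le> ennreal c * (emeasure lborel (cylinder T W) + (\<Sum>i\<in>I. emeasure lborel (\<Union>k. A k i)))"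
    by (intro mult_left_mono) (auto intro: add_left_mono)
  also have "\<dots> \<le> ennreal c * emeasure lborel (cylinder T W) + hausdorff_measure d (radial_boundary C)"
    unfolding distrib_left using bound' by (intro add_left_mono)
  finally show ?thesis by (simp add: C'_def add.commute)
qed

section \<open>Volumes of sets fibred by balls\<close>

lemma emeasure_PiM_split:
  fixes A B :: "('i \<Rightarrow> real) set"
  assumes fin: "finite I" "finite J" and disj: "I \<inter> J = {}"
    and A: "A \<in> sets (PiM I (\<lambda>_. lborel))" and B: "B \<in> sets (PiM J (\<lambda>_. lborel))"
  shows "emeasure (PiM (I \<union> J) (\<lambda>_. lborel))
      {f \<in> space (PiM (I \<union> J) (\<lambda>_. lborel)). restrict f I \<in> A \<and> restrict f J \<in> B}
    = emeasure (PiM I (\<lambda>_. lborel)) A * emeasure (PiM J (\<lambda>_. lborel)) B"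
proof -
  interpret product_sigma_finite "\<lambda>_. lborel :: real measure" by standard
  let ?M = "\<lambda>I :: 'i set. PiM I (\<lambda>_. lborel :: real measure)"
  let ?S = "{f \<in> space (?M (I \<union> J)). restrict f I \<in> A \<and> restrict f J \<in> B}"
  have m: "(\<lambda>f. restrict f I) \<in> measurable (?M (I \<union> J)) (?M I)"
      "(\<lambda>f. restrict f J) \<in> measurable (?M (I \<union> J)) (?M J)"
    by (auto intro: measurable_restrict_subset)
  have S: "?S \<in> sets (?M (I \<union> J))"
  proof -
    have "?S = ((\<lambda>f. restrict f I) -` A \<inter> space (?M (I \<union> J))) \<inter> ((\<lambda>f. restrict f J) -` B \<inter> space (?M (I \<union> J)))"
      by auto
    then show ?thesis using measurable_sets[OF m(1) A] measurable_sets[OF m(2) B] by auto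
  qed
  have "emeasure (?M (I \<union> J)) ?S = (\<integral>\<^sup>+f. indicator ?S f \<partial>?M (I \<union> J))"
    using S by simp
  also have "\<dots> = (\<integral>\<^sup>+x. \<integral>\<^sup>+y. indicator ?S (merge I J (x, y)) \<partial>?M J \<partial>?M I)"
    using S by (intro product_nn_integral_fold[OF disj fin]) auto
  also have "\<dots> = (\<integral>\<^sup>+x. \<integral>\<^sup>+y. indicator A x * indicator B y \<partial>?M J \<partial>?M I)"
  proof (intro nn_integral_cong)
    fix x y assume xy: "x \<in> space (?M I)" "y \<in> space (?M J)"
    have "merge I J (x, y) \<in> space (?M (I \<union> J))"
      using xy by (auto simp: space_PiM PiE_def merge_def extensional_def)
    moreover have "restrict (merge I J (x, y)) I = x"
      using xy by (auto simp: space_PiM PiE_def fun_eq_iff merge_def extensional_def restrict_def)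
    moreover have "restrict (merge I J (x, y)) J = y"
      using xy disj by (auto simp: space_PiM PiE_def fun_eq_iff merge_def extensional_def restrict_def)
    ultimately show "indicator ?S (merge I J (x, y)) = (indicator A x * indicator B y :: ennreal)"
      by (simp add: indicator_def)
  qed
  also have "\<dots> = (\<integral>\<^sup>+x. indicator A x * emeasure (?M J) B \<partial>?M I)"
    using B by (simp add: nn_integral_cmult)
  also have "\<dots> = emeasure (?M I) A * emeasure (?M J) B"
    using A by (simp add: nn_integral_multc)
  finally show ?thesis .
qed

definition coord_ball :: "'i set \<Rightarrow> real \<Rightarrow> ('i \<Rightarrow> real) set" where
  "coord_ball D r = {f \<in> space (PiM D (\<lambda>_. lborel)). sqrt (\<Sum>i\<in>D. (f i)\<^sup>2) \<le> r}"

lemma restrict_coord_ball: "restrict f D \<in> coord_ball D r \<longleftrightarrow> sqrt (\<Sum>i\<in>D. (f i)\<^sup>2) \<le> r"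
  by (simp add: coord_ball_def space_PiM)

lemma sets_coord_ball [measurable]: "finite D \<Longrightarrow> coord_ball D r \<in> sets (PiM D (\<lambda>_. lborel))"
  unfolding coord_ball_def by measurable

lemma emeasure_coord_ball:
  assumes D: "finite D" "D \<noteq> {}" and r: "r \<ge> 0"
  shows "emeasure (PiM D (\<lambda>_. lborel)) (coord_ball D r) = ennreal (unit_ball_vol (card D) * r ^ card D)"
proof (cases "r = 0")
  case False
  then show ?thesis using emeasure_cball_aux[OF D(1), of r] r
    by (simp add: coord_ball_def Collect_conj_eq Int_commute)
next
  case True
  have le: "emeasure (PiM D (\<lambda>_. lborel)) (coord_ball D r) \<le> ennreal (unit_ball_vol (card D) * e ^ card D)" if "e > 0" for e
  proof -
    have "r \<le> e" using True that by simp
    then have "coord_ball D r \<subseteq> coord_ball D e" unfolding coord_ball_def by force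
    then have "emeasure (PiM D (\<lambda>_. lborel)) (coord_ball D r) \<le> emeasure (PiM D (\<lambda>_. lborel)) (coord_ball D e)"
      using D by (intro emeasure_mono) auto
    also have "\<dots> = ennreal (unit_ball_vol (card D) * e ^ card D)"
      using emeasure_cball_aux[OF D(1), of e] that
      by (simp add: coord_ball_def Collect_conj_eq Int_commute)
    finally show ?thesis .
  qed
  have c: "card D > 0" using D by (simp add: card_gt_0_iff)
  have "((\<lambda>e. unit_ball_vol (card D) * e ^ card D) \<longlongrightarrow> unit_ball_vol (card D) * 0 ^ card D) (at_right 0)"
    by (intro tendsto_intros)
  then have "((\<lambda>e. ennreal (unit_ball_vol (card D) * e ^ card D)) \<longlongrightarrow> ennreal 0) (at_right 0)"
    using c by (intro tendsto_ennrealI) (simp add: power_0_left)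
  then have "emeasure (PiM D (\<lambda>_. lborel)) (coord_ball D r) \<le> ennreal 0"
    by (rule tendsto_lowerbound) (auto simp: eventually_at_filter le)
  then show ?thesis using True c by (simp add: power_0_left)
qed

lemma norm_coord_proj:
  fixes D :: "'a::euclidean_space set"
  assumes "D \<subseteq> Basis" shows "norm (coord_proj D p) = sqrt (\<Sum>i\<in>D. (p \<bullet> i)\<^sup>2)"
proof -
  have "(\<Sum>i\<in>Basis. (coord_proj D p \<bullet> i)\<^sup>2) = (\<Sum>i\<in>D. (p \<bullet> i)\<^sup>2)"
    using assms by (intro sum.mono_neutral_cong_right) (auto simp: coord_proj_inner subset_iff)
  then show ?thesis
    unfolding norm_eq_sqrt_inner euclidean_inner[of "coord_proj D p" "coord_proj D p"] by (simp add: power2_eq_square)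
qed

lemma emeasure_lborel_PiM:
  fixes S :: "'a::euclidean_space set"
  assumes "S \<in> sets borel"
  shows "emeasure lborel S = emeasure (PiM Basis (\<lambda>_. lborel))
     {f \<in> space (PiM Basis (\<lambda>_. lborel)). (\<Sum>b\<in>Basis. f b *\<^sub>R b) \<in> S}"
proof -
  have "emeasure (lborel :: 'a measure) S
      = emeasure (distr (PiM Basis (\<lambda>_. lborel)) borel (\<lambda>f. \<Sum>b\<in>Basis. f b *\<^sub>R (b :: 'a))) S"
    by (subst lborel_eq) simp
  also have "\<dots> = emeasure (PiM Basis (\<lambda>_. lborel)) ((\<lambda>f. \<Sum>b\<in>Basis. f b *\<^sub>R (b :: 'a)) -` S \<inter> space (PiM Basis (\<lambda>_. lborel)))"
    using assms by (intro emeasure_distr) auto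
  finally show ?thesis by (simp add: vimage_def Int_def conj_commute)
qed

lemma closed_two_balls:
  "closed {p :: 'a::euclidean_space. norm (coord_proj D1 p) \<le> r1 \<and> norm (coord_proj D2 p) \<le> r2}"
  unfolding coord_proj_def by (intro closed_Collect_conj closed_Collect_le continuous_intros)

lemma emeasure_two_balls:
  fixes D1 D2 :: "'a::euclidean_space set"
  assumes D: "D1 \<union> D2 = Basis" "D1 \<inter> D2 = {}" "D1 \<noteq> {}" "D2 \<noteq> {}" and r: "r1 \<ge> 0" "r2 \<ge> 0"
  shows "emeasure lborel {p :: 'a. norm (coord_proj D1 p) \<le> r1 \<and> norm (coord_proj D2 p) \<le> r2}
    = ennreal (unit_ball_vol (card D1) * r1 ^ card D1 * (unit_ball_vol (card D2) * r2 ^ card D2))"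
    (is "emeasure lborel ?S = _")
proof -
  have sub: "D1 \<subseteq> Basis" "D2 \<subseteq> Basis" using D by auto
  then have fin: "finite D1" "finite D2" by (auto intro: finite_subset)
  have bor: "?S \<in> sets borel" by (rule borel_closed[OF closed_two_balls])
  have "emeasure lborel ?S = emeasure (PiM (D1 \<union> D2) (\<lambda>_. lborel))
     {f \<in> space (PiM (D1 \<union> D2) (\<lambda>_. lborel)). restrict f D1 \<in> coord_ball D1 r1 \<and> restrict f D2 \<in> coord_ball D2 r2}"
    unfolding emeasure_lborel_PiM[OF bor] D(1)
  proof (intro arg_cong[where f = "emeasure (PiM Basis (\<lambda>_. lborel))"] Collect_cong conj_cong refl)
    fix f :: "'a \<Rightarrow> real" assume f: "f \<in> space (PiM Basis (\<lambda>_. lborel))"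
    have "(\<Sum>b\<in>Basis. f b *\<^sub>R b) \<bullet> i = f i" if "i \<in> Basis" for i using that by simp
    then have "(\<Sum>i\<in>D'. ((\<Sum>b\<in>Basis. f b *\<^sub>R b) \<bullet> i)\<^sup>2) = (\<Sum>i\<in>D'. (f i)\<^sup>2)" if "D' \<subseteq> Basis" for D'
      using that by (intro sum.cong) auto
    then show "((\<Sum>b\<in>Basis. f b *\<^sub>R b) \<in> ?S) = (restrict f D1 \<in> coord_ball D1 r1 \<and> restrict f D2 \<in> coord_ball D2 r2)"
      using sub f by (auto simp: norm_coord_proj coord_ball_def space_PiM PiE_def)
  qed
  also have "\<dots> = ennreal (unit_ball_vol (card D1) * r1 ^ card D1) * ennreal (unit_ball_vol (card D2) * r2 ^ card D2)"
    using D fin r by (subst emeasure_PiM_split) (auto simp: emeasure_coord_ball)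
  finally show ?thesis using r by (simp add: ennreal_mult')
qed

text \<open>Fubini along \<open>e1\<close>: over each \<open>t\<close> the fibre is a segment of
  length 2 in direction \<open>e2\<close> times two balls, one in each group of remaining
  coordinates.\<close>

lemma emeasure_fibred:
  fixes D1 D2 :: "'a::euclidean_space set" and G1 G2 :: "real \<Rightarrow> real"
  assumes D: "insert e1 (insert e2 (D1 \<union> D2)) = Basis" "e1 \<noteq> e2" "e1 \<notin> D1 \<union> D2" "e2 \<notin> D1 \<union> D2"
    "D1 \<inter> D2 = {}" "D1 \<noteq> {}" "D2 \<noteq> {}"
    and J: "\<And>t. t \<in> J \<Longrightarrow> G1 t \<ge> 0 \<and> G2 t \<ge> 0"
    and S: "S \<in> sets borel"
      "\<And>p. p \<in> S \<longleftrightarrow> \<bar>p \<bullet> e2\<bar> \<le> 1 \<and> p \<bullet> e1 \<in> J \<and> norm (coord_proj D1 p) \<le> G1 (p \<bullet> e1) \<and> norm (coord_proj D2 p) \<le> G2 (p \<bullet> e1)"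
  shows "emeasure lborel S = (\<integral>\<^sup>+t. indicator J t * ennreal (2 * unit_ball_vol (card D1) * unit_ball_vol (card D2) * (G1 t ^ card D1 * G2 t ^ card D2)) \<partial>lborel)"
proof -
  interpret product_sigma_finite "\<lambda>_. lborel :: real measure" by standard
  let ?M = "\<lambda>I :: 'a set. PiM I (\<lambda>_. lborel :: real measure)"
  define D' where "D' = insert e2 (D1 \<union> D2)"
  have B: "insert e1 D' = Basis" "e1 \<notin> D'" using D by (auto simp: D'_def)
  have sub: "D1 \<subseteq> Basis" "D2 \<subseteq> Basis" "e1 \<in> Basis" "e2 \<in> Basis" using D by auto
  then have fin: "finite D1" "finite D2" "finite D'" by (auto simp: D'_def intro: finite_subset)
  let ?v = "\<lambda>f. \<Sum>b\<in>Basis. f b *\<^sub>R (b :: 'a)"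
  let ?P = "{f \<in> space (?M Basis). ?v f \<in> S}"
  have vin: "?v f \<bullet> i = f i" if "i \<in> Basis" for i f using that by simp
  have P: "?P \<in> sets (?M Basis)"
  proof -
    have "?v \<in> measurable (?M Basis) borel" by measurable
    from measurable_sets[OF this S(1)] show ?thesis by (simp add: vimage_def Int_def conj_commute)
  qed
  have "emeasure lborel S = (\<integral>\<^sup>+f. indicator ?P f \<partial>?M (insert e1 D'))"
    using P unfolding emeasure_lborel_PiM[OF S(1)] B(1) by simp
  also have "\<dots> = (\<integral>\<^sup>+t. \<integral>\<^sup>+x. indicator ?P (x(e1 := t)) \<partial>?M D' \<partial>lborel)"
    using P B fin by (intro product_nn_integral_insert_rev) (auto simp: B(1))
  also have "\<dots> = (\<integral>\<^sup>+t. indicator J t * ennreal (2 * unit_ball_vol (card D1) * unit_ball_vol (card D2) * (G1 t ^ card D1 * G2 t ^ card D2)) \<partial>lborel)"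
  proof (intro nn_integral_cong)
    fix t :: real
    show "(\<integral>\<^sup>+x. indicator ?P (x(e1 := t)) \<partial>?M D')
      = indicator J t * ennreal (2 * unit_ball_vol (card D1) * unit_ball_vol (card D2) * (G1 t ^ card D1 * G2 t ^ card D2))"
    proof (cases "t \<in> J")
      case False
      have "indicator ?P (x(e1 := t)) = (0 :: ennreal)" for x
        using False S(2)[of "?v (x(e1 := t))"] vin[OF sub(3), of "x(e1 := t)"] by auto
      then show ?thesis using False by simp
    next
      case True
      note G = J[OF True]
      let ?R = "{f \<in> space (?M (D1 \<union> D2)). restrict f D1 \<in> coord_ball D1 (G1 t) \<and> restrict f D2 \<in> coord_ball D2 (G2 t)}"
      let ?Q = "{f \<in> space (?M ({e2} \<union> (D1 \<union> D2))). restrict f {e2} \<in> coord_ball {e2} 1 \<and> restrict f (D1 \<union> D2) \<in> ?R}"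
      have eR: "emeasure (?M (D1 \<union> D2)) ?R = ennreal (unit_ball_vol (card D1) * G1 t ^ card D1) * ennreal (unit_ball_vol (card D2) * G2 t ^ card D2)"
        using D fin G by (subst emeasure_PiM_split) (auto simp: emeasure_coord_ball)
      have mr: "(\<lambda>f. restrict f D1) \<in> measurable (?M (D1 \<union> D2)) (?M D1)"
          "(\<lambda>f. restrict f D2) \<in> measurable (?M (D1 \<union> D2)) (?M D2)"
        by (auto intro: measurable_restrict_subset)
      have mR: "?R \<in> sets (?M (D1 \<union> D2))"
      proof -
        have "?R = ((\<lambda>f. restrict f D1) -` coord_ball D1 (G1 t) \<inter> space (?M (D1 \<union> D2))) \<inter> ((\<lambda>f. restrict f D2) -` coord_ball D2 (G2 t) \<inter> space (?M (D1 \<union> D2)))"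
          by auto
        then show ?thesis
          using measurable_sets[OF mr(1) sets_coord_ball[OF fin(1)]] measurable_sets[OF mr(2) sets_coord_ball[OF fin(2)]] by auto
      qed
      have eQ: "emeasure (?M D') ?Q = ennreal 2 * (ennreal (unit_ball_vol (card D1) * G1 t ^ card D1) * ennreal (unit_ball_vol (card D2) * G2 t ^ card D2))"
      proof -
        have "D' = {e2} \<union> (D1 \<union> D2)" by (auto simp: D'_def)
        then show ?thesis
          using D fin mR emeasure_coord_ball[of "{e2}" 1] by (simp only:) (subst emeasure_PiM_split, auto simp: eR)
      qed
      have mQ: "?Q \<in> sets (?M D')"
      proof -
        have "(\<lambda>f. restrict f {e2}) \<in> measurable (?M D') (?M {e2})" "(\<lambda>f. restrict f (D1 \<union> D2)) \<in> measurable (?M D') (?M (D1 \<union> D2))"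
          by (auto intro: measurable_restrict_subset simp: D'_def)
        from measurable_sets[OF this(1) sets_coord_ball[of "{e2}" 1]] measurable_sets[OF this(2) mR]
        have "((\<lambda>f. restrict f {e2}) -` coord_ball {e2} 1 \<inter> space (?M D')) \<inter> ((\<lambda>f. restrict f (D1 \<union> D2)) -` ?R \<inter> space (?M D')) \<in> sets (?M D')"
          by auto
        also have "((\<lambda>f. restrict f {e2}) -` coord_ball {e2} 1 \<inter> space (?M D')) \<inter> ((\<lambda>f. restrict f (D1 \<union> D2)) -` ?R \<inter> space (?M D')) = ?Q"
          by (auto simp: D'_def)
        finally show ?thesis .
      qed
      have "(\<integral>\<^sup>+x. indicator ?P (x(e1 := t)) \<partial>?M D') = (\<integral>\<^sup>+x. indicator ?Q x \<partial>?M D')"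
      proof (intro nn_integral_cong)
        fix x assume x: "x \<in> space (?M D')"
        let ?p = "?v (x(e1 := t))"
        have sp: "x(e1 := t) \<in> space (?M Basis)"
          using x B by (auto simp: space_PiM PiE_def extensional_def)
        have pe: "?p \<bullet> e1 = t" "?p \<bullet> e2 = x e2" using vin[OF sub(3)] vin[OF sub(4)] D(2) by auto
        have pi: "?p \<bullet> i = x i" if "i \<in> D1 \<union> D2" for i
        proof -
          have "i \<in> Basis" "i \<noteq> e1" using that sub D(3) by auto
          have "?p \<bullet> i = (x(e1 := t)) i" by (rule vin) fact
          also have "\<dots> = x i" using \<open>i \<noteq> e1\<close> by (rule fun_upd_other)
          finally show ?thesis .
        qed
        have sc: "(\<Sum>i\<in>E. (?p \<bullet> i)\<^sup>2) = (\<Sum>i\<in>E. (x i)\<^sup>2)" if "E \<subseteq> D1 \<union> D2" for E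
          by (rule sum.cong[OF refl]) (subst pi, use that in auto)
        have n: "norm (coord_proj D1 ?p) = sqrt (\<Sum>i\<in>D1. (x i)\<^sup>2)" "norm (coord_proj D2 ?p) = sqrt (\<Sum>i\<in>D2. (x i)\<^sup>2)"
          using sc[OF Un_upper1] sc[OF Un_upper2] by (simp_all only: norm_coord_proj[OF sub(1)] norm_coord_proj[OF sub(2)])
        have spx: "x \<in> space (?M ({e2} \<union> (D1 \<union> D2)))" using x by (simp add: D'_def)
        have sp': "restrict x (D1 \<union> D2) \<in> space (?M (D1 \<union> D2))" by (simp add: space_PiM)
        have rr: "(\<Sum>i\<in>D1. (restrict x (D1 \<union> D2) i)\<^sup>2) = (\<Sum>i\<in>D1. (x i)\<^sup>2)"
            "(\<Sum>i\<in>D2. (restrict x (D1 \<union> D2) i)\<^sup>2) = (\<Sum>i\<in>D2. (x i)\<^sup>2)"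
          by (auto intro!: sum.cong)
        have e2b: "sqrt (\<Sum>i\<in>{e2}. (x i)\<^sup>2) \<le> 1 \<longleftrightarrow> \<bar>x e2\<bar> \<le> 1" by simp
        have "x \<in> ?Q \<longleftrightarrow> \<bar>x e2\<bar> \<le> 1 \<and> sqrt (\<Sum>i\<in>D1. (x i)\<^sup>2) \<le> G1 t \<and> sqrt (\<Sum>i\<in>D2. (x i)\<^sup>2) \<le> G2 t"
          by (simp only: mem_Collect_eq spx sp' rr restrict_coord_ball e2b simp_thms)
        moreover have "x(e1 := t) \<in> ?P \<longleftrightarrow> \<bar>x e2\<bar> \<le> 1 \<and> sqrt (\<Sum>i\<in>D1. (x i)\<^sup>2) \<le> G1 t \<and> sqrt (\<Sum>i\<in>D2. (x i)\<^sup>2) \<le> G2 t"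
        proof -
          have "x(e1 := t) \<in> ?P \<longleftrightarrow> ?p \<in> S" using sp by (simp only: mem_Collect_eq simp_thms)
          also have "\<dots> \<longleftrightarrow> \<bar>x e2\<bar> \<le> 1 \<and> sqrt (\<Sum>i\<in>D1. (x i)\<^sup>2) \<le> G1 t \<and> sqrt (\<Sum>i\<in>D2. (x i)\<^sup>2) \<le> G2 t"
            unfolding S(2)[of ?p] unfolding pe n using True by (simp only: simp_thms)
          finally show ?thesis .
        qed
        ultimately have "x(e1 := t) \<in> ?P \<longleftrightarrow> x \<in> ?Q" by (simp only:)
        then show "indicator ?P (x(e1 := t)) = (indicator ?Q x :: ennreal)" unfolding indicator_def by (simp only:)
      qed
      also have "\<dots> = emeasure (?M D') ?Q" using mQ by simp
      also have "\<dots> = ennreal (2 * (unit_ball_vol (card D1) * G1 t ^ card D1 * (unit_ball_vol (card D2) * G2 t ^ card D2)))"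
        unfolding eQ using G by (simp add: ennreal_mult)
      also have "2 * (unit_ball_vol (card D1) * G1 t ^ card D1 * (unit_ball_vol (card D2) * G2 t ^ card D2))
          = 2 * unit_ball_vol (card D1) * unit_ball_vol (card D2) * (G1 t ^ card D1 * G2 t ^ card D2)" by simp
      finally have F: "(\<integral>\<^sup>+x. indicator ?P (x(e1 := t)) \<partial>?M D') = ennreal (2 * unit_ball_vol (card D1) * unit_ball_vol (card D2) * (G1 t ^ card D1 * G2 t ^ card D2))" .
      have ind: "indicator J t = (1 :: ennreal)" using True by simp
      show ?thesis unfolding ind F by simp
    qed
  qed
  finally show ?thesis .
qed

section \<open>An integral inequality for the fibres\<close>

text \<open>The integral of \<open>(1 - x^2)^(m / 2)\<close> over \<open>[-1, 1]\<close>,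
  equivalently the ratio of the unit ball volumes in dimensions \<open>m + 1\<close> and
  \<open>m\<close>.\<close>

definition semicircle_integral :: "nat \<Rightarrow> real" where
  "semicircle_integral m = Beta (1 / 2) (real m / 2 + 1)"

lemma semicircle_has_integral:
  "integrable lborel (\<lambda>x. indicator {-1..1} x * sqrt (1 - x\<^sup>2) ^ m)"
  "(LBINT x. indicator {-1..1} x * sqrt (1 - x\<^sup>2) ^ m) = semicircle_integral m"
proof -
  have nonneg: "0 \<le> indicator {-1..1} x * sqrt (1 - x\<^sup>2) ^ m" for x :: real
    by (auto simp: indicator_def abs_le_iff power2_le_iff_abs_le intro!: zero_le_power)
      (simp add: abs_square_le_1 abs_le_iff)
  have B: "Beta (1/2) (real m / 2 + 1) \<ge> 0" by (auto simp: Beta_def intro!: divide_nonneg_nonneg mult_nonneg_nonneg Gamma_real_nonneg)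
  note I = emeasure_cball_aux_integral[of m]
  show int: "integrable lborel (\<lambda>x. indicator {-1..1} x * sqrt (1 - x\<^sup>2) ^ m)"
    using nonneg I by (intro integrableI_nonneg) auto
  show "(LBINT x. indicator {-1..1} x * sqrt (1 - x\<^sup>2) ^ m) = semicircle_integral m"
    using nonneg I B by (subst integral_eq_nn_integral) (auto simp: semicircle_integral_def)
qed

lemma semicircle_integral_pos: "semicircle_integral m > 0"
  unfolding semicircle_integral_def Beta_def by (intro divide_pos_pos mult_pos_pos Gamma_real_pos) auto

lemma semicircle_integral_rec:
  "semicircle_integral (m + 2) = semicircle_integral m * (real m + 2) / (real m + 3)"
proof -
  define y where "y = real m / 2 + 1"
  have y: "y > 0" by (simp add: y_def)
  have "y \<notin> \<int>\<^sub>\<le>\<^sub>0" "1/2 + y \<notin> \<int>\<^sub>\<le>\<^sub>0" using y by (auto elim!: nonpos_Ints_cases)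
  from Gamma_plus1[OF this(1)] Gamma_plus1[OF this(2)]
  have G: "Gamma (y + 1) = y * Gamma y" "Gamma (1/2 + y + 1) = (1/2 + y) * Gamma (1/2 + y)" .
  have pos: "Gamma (1/2 + y) > 0" using y by (intro Gamma_real_pos) auto
  have "semicircle_integral (m + 2) = Gamma (1/2) * (y * Gamma y) / ((1/2 + y) * Gamma (1/2 + y))"
    using G by (simp add: semicircle_integral_def Beta_def y_def add.commute add.left_commute add_divide_distrib)
  also have "\<dots> = Gamma (1/2) * Gamma y / Gamma (1/2 + y) * (y / (1/2 + y))" by (simp add: mult_ac)
  also have "y / (1/2 + y) = (real m + 2) / (real m + 3)" by (simp add: y_def field_simps)
  also have "Gamma (1/2) * Gamma y / Gamma (1/2 + y) = semicircle_integral m"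
    by (simp add: semicircle_integral_def Beta_def y_def)
  finally show ?thesis by simp
qed

lemma unit_ball_vol_Suc: "unit_ball_vol (real (Suc m)) = unit_ball_vol (real m) * semicircle_integral m"
proof -
  have "Gamma (1 + real m / 2) > 0" "Gamma (real m / 2 + 3/2) > 0" by (auto intro!: Gamma_real_pos add_nonneg_pos add_pos_nonneg)
  then have "Gamma (1 + real m / 2) \<noteq> 0" "Gamma (real m / 2 + 3/2) \<noteq> 0" by linarith+
  moreover have "pi powr (real (Suc m) / 2) = pi powr (real m / 2) * sqrt pi"
    by (simp add: powr_half_sqrt[symmetric] powr_add[symmetric] add_divide_distrib add.commute)
  ultimately show ?thesis
    by (simp add: unit_ball_vol_def semicircle_integral_def Beta_def Gamma_one_half_real add_divide_distrib add.commute add.left_commute)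
qed

text \<open>With \<open>S^2 = 1 - x^2\<close> one has
  \<open>x^4 (1 - x^2) = S^2 - 2 S^4 + S^6\<close>, so the integral reduces to the recursion for
  semicircle integrals. The combination yields \<open>3 (N + 2) / ((N + 3) (N + 5) (N + 7))\<close>,
  and \<open>3 * 3/4\<close> is the \<open>9/4\<close>.\<close>

lemma semicircle_gain:
  "integrable lborel (\<lambda>x. indicator {-1..1} x * (sqrt (1 - x\<^sup>2) ^ N * (1 - 3/4 * (x\<^sup>2)\<^sup>2 * (1 - x\<^sup>2))))"
  "(LBINT x. indicator {-1..1} x * (sqrt (1 - x\<^sup>2) ^ N * (1 - 3/4 * (x\<^sup>2)\<^sup>2 * (1 - x\<^sup>2))))
    = semicircle_integral N * (1 - 9/4 * (real N + 2) / ((real N + 3) * (real N + 5) * (real N + 7)))"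
proof -
  let ?s = "\<lambda>m x :: real. indicator {-1..1} x * sqrt (1 - x\<^sup>2) ^ m"
  have eq: "indicator {-1..1} x * (sqrt (1 - x\<^sup>2) ^ N * (1 - 3/4 * (x\<^sup>2)\<^sup>2 * (1 - x\<^sup>2)))
      = ?s N x - 3/4 * (?s (N + 2) x - 2 * ?s (N + 4) x + ?s (N + 6) x)" for x :: real
  proof (cases "x \<in> {-1..1}")
    case True
    define S where "S = sqrt (1 - x\<^sup>2)"
    have "x\<^sup>2 \<le> 1" using True by (simp add: abs_square_le_1 abs_le_iff)
    then have S: "S\<^sup>2 = 1 - x\<^sup>2" by (simp add: S_def)
    then have x: "x\<^sup>2 = 1 - S\<^sup>2" by simp
    show ?thesis using True unfolding S_def[symmetric] unfolding x
      by (simp add: power_add algebra_simps power2_eq_square power4_eq_xxxx eval_nat_numeral)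
  qed simp
  note int = semicircle_has_integral(1)
  show "integrable lborel (\<lambda>x. indicator {-1..1} x * (sqrt (1 - x\<^sup>2) ^ N * (1 - 3/4 * (x\<^sup>2)\<^sup>2 * (1 - x\<^sup>2))))"
    unfolding eq by (intro Bochner_Integration.integrable_diff Bochner_Integration.integrable_add integrable_mult_right int)
  have "(LBINT x. ?s N x - 3/4 * (?s (N + 2) x - 2 * ?s (N + 4) x + ?s (N + 6) x))
      = semicircle_integral N - 3/4 * (semicircle_integral (N + 2) - 2 * semicircle_integral (N + 4) + semicircle_integral (N + 6))"
    by (simp only: Bochner_Integration.integral_diff Bochner_Integration.integral_add integral_mult_right int
        Bochner_Integration.integrable_diff Bochner_Integration.integrable_add integrable_mult_right semicircle_has_integral(2)
        integral_mult_right_zero)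
  also have "\<dots> = semicircle_integral N * (1 - 9/4 * (real N + 2) / ((real N + 3) * (real N + 5) * (real N + 7)))"
  proof -
    have r: "semicircle_integral (N + 4) = semicircle_integral (N + 2) * (real N + 4) / (real N + 5)"
        "semicircle_integral (N + 6) = semicircle_integral (N + 4) * (real N + 6) / (real N + 7)"
      using semicircle_integral_rec[of "N + 2"] semicircle_integral_rec[of "N + 4"] by (simp_all add: add.assoc del: add_2_eq_Suc add_2_eq_Suc')
    have nz: "real N + 3 \<noteq> 0" "real N + 5 \<noteq> 0" "real N + 7 \<noteq> 0" by auto
    have eq1: "semicircle_integral (N + 2) - 2 * semicircle_integral (N + 4) + semicircle_integral (N + 6)
        = semicircle_integral N * (3 * (real N + 2) / ((real N + 3) * (real N + 5) * (real N + 7)))"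
      unfolding r semicircle_integral_rec using nz by (simp add: divide_simps) (simp add: algebra_simps)
    have alg: "S - 3/4 * (S * (3 * p / D)) = S * (1 - 9/4 * p / D)" for S p D :: real
      by (simp add: right_diff_distrib)
    show ?thesis unfolding eq1 by (rule alg)
  qed
  finally show "(LBINT x. indicator {-1..1} x * (sqrt (1 - x\<^sup>2) ^ N * (1 - 3/4 * (x\<^sup>2)\<^sup>2 * (1 - x\<^sup>2))))
    = semicircle_integral N * (1 - 9/4 * (real N + 2) / ((real N + 3) * (real N + 5) * (real N + 7)))"
    unfolding eq .
qed

text \<open>The inequality of means for \<open>a\<close> copies of \<open>y\<close> and
  \<open>b - a\<close> copies of \<open>1\<close>. It raises the exponent \<open>a\<close> to
  \<open>b\<close>, so that the two factors in \<open>fibre_bound\<close> can be paired.\<close>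

lemma amgm_step:
  fixes y :: real
  assumes "y \<ge> 0" and b: "b = a \<or> b = Suc a" and "a > 0"
  shows "y ^ a \<le> ((real a * y + (real b - real a)) / real b) ^ b"
proof (cases "b = a")
  case True
  then show ?thesis using assms by simp
next
  case False
  then have b: "b = Suc a" using b by simp
  show ?thesis
  proof (cases "y = 0")
    case True
    then show ?thesis using assms by (auto simp: power_0_left intro!: zero_le_power divide_nonneg_nonneg)
  next
    case False
    then have y: "y > 0" using assms by simp
    \<comment> \<open>Determined by \<open>1 + b h = 1 / y\<close>; Bernoulli's inequality
      multiplied by \<open>y^b\<close> is then the claim.\<close>
    define h where "h = (1 - y) / (real b * y)"
    have bp: "real b > 0" using b by simp
    have "h \<ge> - 1"
    proof -
      have "0 \<le> y * real a" using y by simp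
      moreover have "real b * y = y + y * real a" by (simp add: b algebra_simps)
      ultimately have "- (real b * y) \<le> 1 - y" by linarith
      then show ?thesis unfolding h_def using y bp by (simp add: pos_le_divide_eq mult.commute)
    qed
    then have "1 + real b * h \<le> (1 + h) ^ b" by (rule Bernoulli_inequality)
    moreover have "1 + real b * h = 1 / y" using y bp by (simp add: h_def field_simps)
    ultimately have "y ^ b * (1 / y) \<le> y ^ b * (1 + h) ^ b" using y by (intro mult_left_mono) auto
    moreover have "y ^ b * (1 / y) = y ^ a" using y by (simp add: b)
    moreover have "y * (1 + h) = (real a * y + (real b - real a)) / real b"
    proof -
      have "y * (1 + h) = y + y * h" by (simp add: distrib_left)
      also have "y * h = (1 - y) / real b" using y bp by (simp add: h_def)
      finally show ?thesis using bp b by (simp add: field_simps)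
    qed
    ultimately show ?thesis by (simp add: power_mult_distrib[symmetric])
  qed
qed

text \<open>Either \<open>w\<close> is large and the AM-GM deficit alone suffices, or \<open>w\<close> is small and
  \<open>M\<close> is of order \<open>\<sigma>\<^sup>2\<close>.\<close>

lemma deficit_tradeoff:
  fixes w \<sigma> M g :: real
  assumes w: "0 \<le> w" "w \<le> 1" and \<sigma>: "0 < \<sigma>" "\<sigma> \<le> 1" and g: "g \<ge> 3/13"
    and M: "M \<ge> 0" "M \<ge> 51/52 * \<sigma>\<^sup>2 - 153/100 * w * (1 - \<sigma>)\<^sup>2"
  shows "(1 - w) ^ 3 * (1 - g * M / \<sigma>) \<le> 1 - 3/4 * \<sigma>\<^sup>2 * (1 - \<sigma>)"
proof -
  define v where "v = 1 - \<sigma>"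
  define r where "r = 3/4 * \<sigma>\<^sup>2 * v"
  \<comment> \<open>\<open>3/13\<close> is the least value of \<open>a b / (N (N + 1))\<close> for
    the admissible pairs, attained at \<open>a = b = 6\<close>.\<close>
  define L where "L = 1 - 3/13 * M / \<sigma>"
  have v: "0 \<le> v" "v \<le> 1" using \<sigma> by (auto simp: v_def)
  have sv: "\<sigma> * v \<le> 1/4"
    using zero_le_power2[of "\<sigma> - 1/2"] by (simp add: v_def power2_eq_square algebra_simps)
  have r: "0 \<le> r" "r \<le> 1/9"
  proof -
    show "0 \<le> r" using v by (simp add: r_def)
    \<comment> \<open>\<open>\<sigma>^2 (1 - \<sigma>)\<close> is maximal at \<open>2/3\<close> with
      value \<open>4/27\<close>; hence the double root there.\<close>
    have "0 \<le> (\<sigma> - 2/3)\<^sup>2 * (\<sigma> + 1/3)" using \<sigma> by simp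
    also have "\<dots> = 4/27 - \<sigma>\<^sup>2 * v" by (simp add: v_def power2_eq_square field_simps)
    finally show "r \<le> 1/9" by (simp add: r_def)
  qed
  \<comment> \<open>Enough because \<open>(1 - w)^3 (1 + 3 w) \<le> 1\<close>: the factor
    \<open>1 + 3 w\<close> is what the deficit \<open>(1 - w)^3\<close> can pay for.\<close>
  have "L \<le> (1 - r) * (1 + 3 * w)"
  proof (cases "3 * w * (1 - r) \<ge> r")
    case True
    have "M / \<sigma> \<ge> 0" using M \<sigma> by simp
    then have "L \<le> 1" by (simp add: L_def)
    also have "1 \<le> (1 - r) * (1 + 3 * w)" using True by (simp add: algebra_simps)
    finally show ?thesis .
  next
    case False
    have "3 * w * (8/9) \<le> 3 * w * (1 - r)" using w r by (intro mult_left_mono) auto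
    then have w': "w \<le> 3/8 * r" using False by simp
    have "M / \<sigma> \<ge> (51/52 * \<sigma>\<^sup>2 - 153/100 * w * v\<^sup>2) / \<sigma>"
      using M(2) \<sigma> by (intro divide_right_mono) (auto simp: v_def)
    also have "(51/52 * \<sigma>\<^sup>2 - 153/100 * w * v\<^sup>2) / \<sigma> = 51/52 * \<sigma> - 153/100 * w * v\<^sup>2 / \<sigma>"
      using \<sigma> by (simp add: diff_divide_distrib power2_eq_square)
    finally have M': "M / \<sigma> \<ge> 51/52 * \<sigma> - 153/100 * w * v\<^sup>2 / \<sigma>" .
    have "w * v\<^sup>2 / \<sigma> \<le> (3/8 * r) * v\<^sup>2 / \<sigma>"
      using w' \<sigma> by (intro divide_right_mono mult_right_mono) auto
    also have "\<dots> = 9/32 * \<sigma> * v * v\<^sup>2" using \<sigma> by (simp add: r_def power2_eq_square)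
    also have "\<dots> \<le> 9/32 * \<sigma> * v * v"
    proof -
      have "v\<^sup>2 \<le> v" using v by (simp add: power2_eq_square mult_left_le)
      then show ?thesis using v \<sigma> by (intro mult_left_mono) auto
    qed
    finally have wv: "w * v\<^sup>2 / \<sigma> \<le> 9/32 * \<sigma> * v * v" .
    have "L \<le> 1 - 3/13 * (51/52 * \<sigma> - 153/100 * (9/32 * \<sigma> * v * v))"
      using M' wv unfolding L_def by simp
    also have "\<dots> \<le> 1 - r"
    proof -
      have quad: "3/4 * ((1 - v) * v) + 4131/41600 * (v * v) \<le> 153/676"
      proof -
        \<comment> \<open>\<open>577/1000\<close> is close to the maximiser of the concave quadratic
          to be bounded; the tangent line of \<open>v^2\<close> there makes the rest linear. The
          coefficient \<open>4131/41600\<close> is \<open>3/13 * 153/100 * 9/32\<close>, and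
          \<open>153/676\<close> is \<open>3/13 * 51/52\<close>.\<close>
        have "0 \<le> (v - 577/1000)\<^sup>2" by simp
        then have "v * v \<ge> 1154/1000 * v - 332929/1000000" by (simp add: power2_eq_square algebra_simps)
        moreover have "(1 - v) * v = v - v * v" by (simp add: algebra_simps)
        ultimately show ?thesis using v by linarith
      qed
      have "\<sigma> * (3/4 * ((1 - v) * v) + 4131/41600 * (v * v)) \<le> \<sigma> * (153/676)"
        using quad \<sigma> by (intro mult_left_mono) auto
      moreover have "1 - v = \<sigma>" by (simp add: v_def)
      ultimately show ?thesis by (simp add: r_def power2_eq_square algebra_simps)
    qed
    also have "1 - r \<le> (1 - r) * (1 + 3 * w)" using mult_right_mono[of r 1 w] r w by (simp add: algebra_simps)
    finally show ?thesis .
  qed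
  moreover have "1 - g * M / \<sigma> \<le> L"
  proof -
    have "3/13 * M / \<sigma> \<le> g * M / \<sigma>" using g M \<sigma> by (intro divide_right_mono mult_right_mono) auto
    then show ?thesis unfolding L_def by linarith
  qed
  ultimately have "(1 - w) ^ 3 * (1 - g * M / \<sigma>) \<le> (1 - w) ^ 3 * ((1 - r) * (1 + 3 * w))"
    using w by (intro mult_left_mono) auto
  also have "\<dots> = (1 - r) * (1 - w\<^sup>2 * (6 - 8 * w + 3 * w\<^sup>2))"
    by (simp add: algebra_simps eval_nat_numeral)
  also have "\<dots> \<le> (1 - r) * 1"
  proof (intro mult_left_mono)
    have "3 * (w - 4/3)\<^sup>2 + 2/3 \<ge> 0" by simp
    also have "3 * (w - 4/3)\<^sup>2 + 2/3 = 6 - 8 * w + 3 * w\<^sup>2" by (simp add: power2_eq_square algebra_simps)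
    finally show "1 - w\<^sup>2 * (6 - 8 * w + 3 * w\<^sup>2) \<le> 1" by simp
  qed (use r in auto)
  finally show ?thesis by (simp add: r_def v_def)
qed

text \<open>With \<open>x = c^2 t^2 / a\<close> and \<open>y = s^2 t^2 / b\<close> the weighted mean
  of \<open>x\<close>, \<open>y\<close> is \<open>\<sigma> = t^2 / N\<close>, whatever the
  direction. The loss in the inequality of means is governed by \<open>x - y\<close>, the curvature
  correction by the product \<open>x y\<close>; if \<open>x - y\<close> is small, the product is
  close to \<open>\<sigma>^2\<close>.\<close>

lemma fibre_bound:
  fixes s c t :: real and a b N :: nat
  assumes a: "a \<ge> 6" and b: "b = a \<or> b = Suc a" and N: "N = a + b" and sc: "s\<^sup>2 + c\<^sup>2 = 1"
    and t: "c\<^sup>2 * t\<^sup>2 \<le> a" "s\<^sup>2 * t\<^sup>2 \<le> b"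
  shows "t\<^sup>2 / N \<le> 1" and
    "sqrt (1 - c\<^sup>2 * t\<^sup>2 / a) ^ a * sqrt (1 - s\<^sup>2 * t\<^sup>2 / b) ^ b * (1 - s\<^sup>2 * c\<^sup>2 * t\<^sup>2 / (N + 1))
      \<le> sqrt (1 - t\<^sup>2 / N) ^ N * (1 - 3/4 * (t\<^sup>2 / N)\<^sup>2 * (1 - t\<^sup>2 / N))"
proof -
  have ap: "real a > 0" "real b > 0" "real N > 0" and bge: "b \<ge> 6" and ab: "a \<le> b" using a b N by auto
  define x where "x = c\<^sup>2 * t\<^sup>2 / a"
  define y where "y = s\<^sup>2 * t\<^sup>2 / b"
  define \<sigma> where "\<sigma> = t\<^sup>2 / N"
  define \<alpha> where "\<alpha> = real a / N"
  define \<beta> where "\<beta> = real b / N"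
  define e where "e = x - y"
  define v where "v = 1 - \<sigma>"
  define X where "X = 1 - x"
  define Y where "Y = 1 - y"
  have x: "0 \<le> x" "x \<le> 1" and y: "0 \<le> y" "y \<le> 1" using t ap by (auto simp: x_def y_def)
  have \<alpha>\<beta>: "\<alpha> + \<beta> = 1" using N ap by (simp add: \<alpha>_def \<beta>_def add_divide_distrib[symmetric])
  have pos: "\<alpha> > 0" "\<beta> > 0" using ap by (auto simp: \<alpha>_def \<beta>_def)
  have "\<alpha> * x + \<beta> * y = (c\<^sup>2 + s\<^sup>2) * t\<^sup>2 / N"
    using ap by (simp add: \<alpha>_def \<beta>_def x_def y_def add_divide_distrib distrib_right)
  then have mean: "\<alpha> * x + \<beta> * y = \<sigma>" using sc by (simp add: \<sigma>_def add.commute)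
  have \<sigma>: "0 \<le> \<sigma>" "\<sigma> \<le> 1"
  proof -
    show "0 \<le> \<sigma>" using ap by (simp add: \<sigma>_def)
    have "\<alpha> * x + \<beta> * y \<le> \<alpha> * 1 + \<beta> * 1" using x y pos by (intro add_mono mult_left_mono) auto
    then show "\<sigma> \<le> 1" using mean \<alpha>\<beta> by simp
  qed
  then show "t\<^sup>2 / N \<le> 1" by (simp add: \<sigma>_def)
  have \<alpha>1: "\<alpha> = 1 - \<beta>" using \<alpha>\<beta> by simp
  have xe: "x = \<sigma> + \<beta> * e" "y = \<sigma> - \<alpha> * e"
    unfolding mean[symmetric] \<alpha>1 by (simp_all add: e_def algebra_simps)
  show "sqrt (1 - c\<^sup>2 * t\<^sup>2 / a) ^ a * sqrt (1 - s\<^sup>2 * t\<^sup>2 / b) ^ b * (1 - s\<^sup>2 * c\<^sup>2 * t\<^sup>2 / (N + 1))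
      \<le> sqrt (1 - t\<^sup>2 / N) ^ N * (1 - 3/4 * (t\<^sup>2 / N)\<^sup>2 * (1 - t\<^sup>2 / N))"
  proof (cases "t = 0")
    case True
    then show ?thesis by simp
  next
    case t0: False
    then have \<sigma>0: "\<sigma> > 0" using ap by (simp add: \<sigma>_def)
    have XY: "0 \<le> X" "0 \<le> Y" using x y by (auto simp: X_def Y_def)
    show ?thesis
    proof (cases "v = 0")
      case True
      have "\<alpha> * X + \<beta> * Y = v" using mean \<alpha>\<beta> by (simp add: X_def Y_def v_def right_diff_distrib)
      then have "X = 0" using True XY pos by (smt (verit) mult_nonneg_nonneg mult_pos_pos)
      then have "1 - c\<^sup>2 * t\<^sup>2 / a = 0" by (simp only: X_def x_def)
      then have z1: "sqrt (1 - c\<^sup>2 * t\<^sup>2 / a) ^ a = 0" using ap by (simp only: real_sqrt_zero) simp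
      have z2: "sqrt (1 - t\<^sup>2 / N) ^ N = 0"
      proof -
        have z: "1 - t\<^sup>2 / N = 0" using True by (simp only: v_def \<sigma>_def)
        have "N \<noteq> 0" using bge N by auto
        then show ?thesis unfolding z by simp
      qed
      show ?thesis by (simp only: z1 z2 mult_zero_left order_refl)
    next
      case False
      then have v: "v > 0" using \<sigma> by (simp add: v_def)
      \<comment> \<open>The deviation measured relative to \<open>v = 1 - \<sigma>\<close>, so that
        \<open>v\<close> factors out of \<open>X\<close> and \<open>Y\<close>; \<open>w\<close> is
        the resulting relative deficit.\<close>
      define z where "z = e / v"
      define w where "w = \<alpha>\<^sup>2 * z\<^sup>2"
      have vz: "v * z = e" using v by (simp add: z_def)
      have "v * (1 - \<beta> * z) = v - \<beta> * (v * z)" "v * (1 + \<alpha> * z) = v + \<alpha> * (v * z)"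
        by (simp_all add: algebra_simps)
      then have Xv: "X = v * (1 - \<beta> * z)" and Yv: "Y = v * (1 + \<alpha> * z)"
        unfolding vz by (simp_all add: X_def Y_def xe v_def)
      have fac: "0 \<le> 1 - \<beta> * z" "0 \<le> 1 + \<alpha> * z" using XY v unfolding Xv Yv by (auto simp: zero_le_mult_iff)
      have avg: "(real a * (1 - \<beta> * z) + (real b - real a)) / real b = 1 - \<alpha> * z"
        using ap by (simp add: \<alpha>_def \<beta>_def field_simps)
      have am: "(1 - \<beta> * z) ^ a \<le> (1 - \<alpha> * z) ^ b"
        using amgm_step[OF fac(1) b] a by (simp add: avg)
      have fac2: "0 \<le> 1 - \<alpha> * z"
        unfolding avg[symmetric] using fac(1) ab ap by (intro divide_nonneg_nonneg add_nonneg_nonneg mult_nonneg_nonneg) auto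
      have w1: "w = 1 - (1 - \<alpha> * z) * (1 + \<alpha> * z)" by (simp add: w_def power2_eq_square algebra_simps)
      have w: "0 \<le> w" "w \<le> 1"
      proof -
        show "0 \<le> w" by (simp add: w_def)
        have "(1 - \<alpha> * z) * (1 + \<alpha> * z) \<ge> 0" using fac fac2 by (intro mult_nonneg_nonneg)
        then show "w \<le> 1" unfolding w1 by linarith
      qed
      have "X ^ a * Y ^ b = v ^ N * ((1 - \<beta> * z) ^ a * (1 + \<alpha> * z) ^ b)"
        by (simp add: Xv Yv power_mult_distrib N power_add)
      also have "\<dots> \<le> v ^ N * ((1 - \<alpha> * z) ^ b * (1 + \<alpha> * z) ^ b)"
        using am fac v by (intro mult_left_mono mult_right_mono) auto
      also have "(1 - \<alpha> * z) ^ b * (1 + \<alpha> * z) ^ b = (1 - w) ^ b"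
        by (simp add: w1 power_mult_distrib)
      \<comment> \<open>Only \<open>b \<ge> 6\<close> is kept, so the square root contributes
        \<open>(1 - w)^3\<close> uniformly in the dimension.\<close>
      also have "v ^ N * (1 - w) ^ b \<le> v ^ N * (1 - w) ^ 6"
        using w v bge by (intro mult_left_mono power_decreasing) auto
      also have "(1 - w) ^ 6 = ((1 - w) ^ 3)\<^sup>2" by (simp add: power_mult[symmetric])
      finally have "sqrt (X ^ a * Y ^ b) \<le> sqrt (v ^ N * ((1 - w) ^ 3)\<^sup>2)" by (rule real_sqrt_le_mono)
      moreover have "sqrt (((1 - w) ^ 3)\<^sup>2) = (1 - w) ^ 3" using w by (simp only: real_sqrt_abs) simp
      ultimately have F: "sqrt X ^ a * sqrt Y ^ b \<le> sqrt v ^ N * (1 - w) ^ 3"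
        by (simp only: real_sqrt_mult real_sqrt_power)
      \<comment> \<open>Chosen so that the curvature correction \<open>s^2 c^2 t^2 / (N + 1)\<close>
        equals \<open>g * (x * y) / \<sigma>\<close>.\<close>
      define g where "g = real a * b / (N * (N + 1))"
      have g: "g \<ge> 3/13"
      proof -
        have "3 * real (N * (N + 1)) \<le> 13 * (real a * real b)"
        proof (cases "b = a")
          case True
          have "6 * real a \<le> real a * real a" using a by (intro mult_right_mono) auto
          then show ?thesis using True N by (simp add: algebra_simps)
        next
          case False
          then have bb: "b = Suc a" using b by simp
          have "6 * real a \<le> real a * real a" "6 \<le> real a" using a by (auto intro!: mult_right_mono)
          then have "6 + 5 * real a \<le> real a * real a" by linarith
          then show ?thesis using bb N by (simp add: algebra_simps)
        qed
        then have "3/13 * real (N * (N + 1)) \<le> real a * real b" by linarith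
        moreover have "0 < real N * (real N + 1)" using ap by simp
        ultimately show ?thesis unfolding g_def by (subst pos_le_divide_eq) (simp_all add: algebra_simps)
      qed
      have q: "s\<^sup>2 * c\<^sup>2 * t\<^sup>2 / (N + 1) = g * (x * y) / \<sigma>"
      proof -
        have gen: "u * w * T / M = A * B / (n * M) * ((w * T / A) * (u * T / B)) / (T / n)"
          if "A > 0" "B > 0" "n > 0" "M > 0" "T > 0" for u w T M A B n :: real
          using that by (simp add: field_simps)
        have "g = real a * real b / (real N * real (N + 1))" by (simp add: g_def algebra_simps)
        moreover have "real (N + 1) > 0" "t\<^sup>2 > 0" using t0 by auto
        ultimately show ?thesis
          using gen[of a b N "real (N + 1)" "t\<^sup>2" "s\<^sup>2" "c\<^sup>2"] ap by (simp add: x_def y_def \<sigma>_def)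
      qed
      have wv: "w * v\<^sup>2 = \<alpha>\<^sup>2 * e\<^sup>2" using v by (simp add: w_def z_def power_divide)
      \<comment> \<open>For equal dimensions \<open>x y = \<sigma>^2 - w v^2\<close> exactly; the
        slack in \<open>51/52\<close> and \<open>153/100\<close> is there for
        \<open>b = a + 1\<close>, where a cross term of size \<open>1 / N\<close> appears.\<close>
      have M: "x * y \<ge> 51/52 * \<sigma>\<^sup>2 - 153/100 * w * (1 - \<sigma>)\<^sup>2"
      proof (cases "b = a")
        case True
        then have h: "\<alpha> = 1/2" "\<beta> = 1/2" using N ap by (auto simp: \<alpha>_def \<beta>_def)
        have "x * y = \<sigma>\<^sup>2 - w * v\<^sup>2"
          unfolding wv xe h by (simp add: power2_eq_square algebra_simps)
        moreover have "51/52 * \<sigma>\<^sup>2 \<le> \<sigma>\<^sup>2" by simp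
        moreover have "w * v\<^sup>2 \<le> 153/100 * (w * v\<^sup>2)" using w by simp
        ultimately have "x * y \<ge> 51/52 * \<sigma>\<^sup>2 - 153/100 * (w * v\<^sup>2)" by linarith
        then show ?thesis by (simp add: v_def mult.assoc)
      next
        case False
        then have bb: "real b = real a + 1" "real N = 2 * real a + 1" using b N by auto
        have diff: "\<beta> - \<alpha> = 1 / N" using ap bb by (simp add: \<alpha>_def \<beta>_def field_simps)
        have "x * y = \<sigma>\<^sup>2 + (\<beta> - \<alpha>) * \<sigma> * e - \<alpha> * \<beta> * e\<^sup>2"
          unfolding xe by (simp add: power2_eq_square algebra_simps)
        then have xy: "x * y = \<sigma>\<^sup>2 + (1 / N) * (\<sigma> * e) - \<alpha> * \<beta> * e\<^sup>2" unfolding diff by simp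
        \<comment> \<open>Splits the cross term between \<open>\<sigma>^2\<close> and
          \<open>e^2\<close>. As \<open>N \<ge> 13\<close> in this case, the share of
          \<open>\<sigma>^2\<close> is at most \<open>1 / (4 * 13) = 1/52\<close>.\<close>
        have "0 \<le> (\<sigma> / 2 + e)\<^sup>2" by simp
        then have "\<sigma> * e \<ge> - (\<sigma>\<^sup>2 / 4 + e\<^sup>2)" by (simp add: power2_eq_square algebra_simps)
        then have "(1 / N) * (\<sigma> * e) \<ge> (1 / N) * (- (\<sigma>\<^sup>2 / 4 + e\<^sup>2))" using ap by (intro mult_left_mono) auto
        then have "x * y \<ge> \<sigma>\<^sup>2 - (1 / N) * (\<sigma>\<^sup>2 / 4) - (\<alpha> * \<beta> + 1 / N) * e\<^sup>2"
          unfolding xy by (simp add: algebra_simps)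
        moreover have "(1 / N) * (\<sigma>\<^sup>2 / 4) \<le> 1/52 * \<sigma>\<^sup>2"
        proof -
          have "1 / real N \<le> 1 / 13" using bb a by (intro divide_left_mono) auto
          then have "(1 / N) * (\<sigma>\<^sup>2 / 4) \<le> (1 / 13) * (\<sigma>\<^sup>2 / 4)" by (rule mult_right_mono) simp
          then show ?thesis by simp
        qed
        moreover have "(\<alpha> * \<beta> + 1 / N) * e\<^sup>2 \<le> 153/100 * (w * v\<^sup>2)"
        proof -
          \<comment> \<open>The ratio of \<open>a b + N\<close> to \<open>a^2\<close> is largest at
            \<open>a = 6\<close>, where it is \<open>55/36 < 153/100\<close>.\<close>
          have "real a * real b + real N \<le> 153/100 * (real a * real a)"
          proof -
            have "6 * real a \<le> real a * real a" "6 \<le> real a" using a by (auto intro!: mult_right_mono)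
            then have "3 * real a + 1 \<le> 53/100 * (real a * real a)" by linarith
            moreover have "real a * real b + real N = real a * real a + (3 * real a + 1)"
              unfolding bb by (simp add: algebra_simps)
            ultimately show ?thesis by linarith
          qed
          then have "(real a * real b + real N) / (real N * real N) \<le> (153/100 * (real a * real a)) / (real N * real N)"
            by (rule divide_right_mono) simp
          then have "\<alpha> * \<beta> + 1 / N \<le> 153/100 * \<alpha>\<^sup>2"
            using ap by (simp add: \<alpha>_def \<beta>_def add_divide_distrib power2_eq_square)
          then have "(\<alpha> * \<beta> + 1 / N) * e\<^sup>2 \<le> 153/100 * \<alpha>\<^sup>2 * e\<^sup>2" by (rule mult_right_mono) simp
          then show ?thesis unfolding wv by simp
        qed
        ultimately have "x * y \<ge> 51/52 * \<sigma>\<^sup>2 - 153/100 * (w * v\<^sup>2)" by linarith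
        then show ?thesis by (simp add: v_def mult.assoc)
      qed
      have M0: "x * y \<ge> 0" using x y by simp
      note trade = deficit_tradeoff[OF w \<sigma>0 \<sigma>(2) g M0 M]
      show ?thesis
      \<comment> \<open>The estimate of the first factors may be multiplied by the bracket only if
        that is nonnegative; otherwise the left-hand side is at most 0.\<close>
      proof (cases "1 - g * (x * y) / \<sigma> \<ge> 0")
        case True
        have "sqrt X ^ a * sqrt Y ^ b * (1 - g * (x * y) / \<sigma>) \<le> sqrt v ^ N * (1 - w) ^ 3 * (1 - g * (x * y) / \<sigma>)"
          using F True by (rule mult_right_mono)
        also have "\<dots> \<le> sqrt v ^ N * (1 - 3/4 * \<sigma>\<^sup>2 * (1 - \<sigma>))"
          using mult_left_mono[OF trade, of "sqrt v ^ N"] v by (simp add: mult.assoc)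
        finally show ?thesis unfolding q by (simp add: X_def Y_def x_def y_def v_def \<sigma>_def)
      next
        case False
        have "sqrt X ^ a * sqrt Y ^ b * (1 - g * (x * y) / \<sigma>) \<le> 0"
          using False XY by (intro mult_nonneg_nonpos) auto
        also have "0 \<le> sqrt v ^ N * (1 - 3/4 * \<sigma>\<^sup>2 * (1 - \<sigma>))"
        proof -
          have "\<sigma>\<^sup>2 * (1 - \<sigma>) \<le> 1 * 1" using \<sigma> by (intro mult_mono) (auto simp: power_le_one)
          then show ?thesis using v by (intro mult_nonneg_nonneg) auto
        qed
        finally show ?thesis unfolding q by (simp add: X_def Y_def x_def y_def v_def \<sigma>_def)
      qed
    qed
  qed
qed

text \<open>The pointwise bound is integrated. Its majorant is nonnegative on
  \<open>[-sqrt N, sqrt N]\<close>, which contains the direction-dependent domain \<open>J\<close>,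
  so the integral may be extended; the substitution \<open>t = sqrt N * z\<close> reduces it to
  \<open>semicircle_gain\<close>.\<close>

lemma fibre_integral:
  fixes s c :: real and a b N :: nat
  assumes a: "a \<ge> 6" and b: "b = a \<or> b = Suc a" and N: "N = a + b" and sc: "s\<^sup>2 + c\<^sup>2 = 1"
  defines "J \<equiv> {t. c\<^sup>2 * t\<^sup>2 \<le> a \<and> s\<^sup>2 * t\<^sup>2 \<le> b}"
    and "F \<equiv> \<lambda>t. sqrt (1 - c\<^sup>2 * t\<^sup>2 / a) ^ a * sqrt (1 - s\<^sup>2 * t\<^sup>2 / b) ^ b"
  shows "compact J" "integrable lborel (\<lambda>t. indicator J t * F t)"
    "integrable lborel (\<lambda>t. indicator J t * (t\<^sup>2 * F t))"
    "(LBINT t. indicator J t * F t) - s\<^sup>2 * c\<^sup>2 / (N + 1) * (LBINT t. indicator J t * (t\<^sup>2 * F t))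
      \<le> sqrt N * semicircle_integral N * (1 - 9/4 * (real N + 2) / ((real N + 3) * (real N + 5) * (real N + 7)))"
proof -
  have ap: "real a > 0" "real b > 0" "real N > 0" using a b N by auto
  have "closed J" unfolding J_def by (intro closed_Collect_conj closed_Collect_le continuous_intros)
  moreover have Jsub: "J \<subseteq> {- sqrt N..sqrt N}"
  proof
    fix t assume "t \<in> J"
    then have "t\<^sup>2 / N \<le> 1" using fibre_bound(1)[OF a b N sc, of t] by (simp add: J_def)
    then have "t\<^sup>2 \<le> N" using ap by simp
    then have "\<bar>t\<bar> \<le> sqrt N" using real_le_rsqrt[of "\<bar>t\<bar>" N] by simp
    then show "t \<in> {- sqrt N..sqrt N}" by (auto simp: abs_le_iff)
  qed
  ultimately show cJ: "compact J" by (meson bounded_closed_interval bounded_subset compact_eq_bounded_closed)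
  have cF: "continuous_on A F" for A unfolding F_def using ap by (intro continuous_intros) auto
  show i1: "integrable lborel (\<lambda>t. indicator J t * F t)"
    using borel_integrable_compact[OF cJ cF] by simp
  show i2: "integrable lborel (\<lambda>t. indicator J t * (t\<^sup>2 * F t))"
    using borel_integrable_compact[OF cJ, of "\<lambda>t. t\<^sup>2 * F t"] cF by (simp add: continuous_on_mult continuous_on_power continuous_on_id)
  define g where "g t = indicator {- sqrt N..sqrt N} t * (sqrt (1 - t\<^sup>2 / N) ^ N * (1 - 3/4 * (t\<^sup>2 / N)\<^sup>2 * (1 - t\<^sup>2 / N)))" for t :: real
  have ig: "integrable lborel g"
  proof -
    have "continuous_on {- sqrt N..sqrt N} (\<lambda>t. sqrt (1 - t\<^sup>2 / N) ^ N * (1 - 3/4 * (t\<^sup>2 / N)\<^sup>2 * (1 - t\<^sup>2 / N)))"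
      using ap by (intro continuous_intros) auto
    from borel_integrable_compact[OF _ this] show ?thesis by (simp add: g_def[abs_def])
  qed
  have gnn: "g t \<ge> 0" for t
  proof (cases "t \<in> {- sqrt N..sqrt N}")
    case True
    then have "\<bar>t\<bar> \<le> sqrt N" by (auto simp: abs_le_iff)
    then have "t\<^sup>2 \<le> N" using power_mono[of "\<bar>t\<bar>" "sqrt N" 2] ap by simp
    then have s01: "0 \<le> t\<^sup>2 / N" "t\<^sup>2 / N \<le> 1" using ap by auto
    then have "(t\<^sup>2 / N)\<^sup>2 * (1 - t\<^sup>2 / N) \<le> 1 * 1" by (intro mult_mono) (auto simp: power_le_one)
    then show ?thesis unfolding g_def using s01 by (intro mult_nonneg_nonneg) auto
  qed (simp add: g_def)
  have "(LBINT t. indicator J t * F t) - s\<^sup>2 * c\<^sup>2 / (N + 1) * (LBINT t. indicator J t * (t\<^sup>2 * F t))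
      = (LBINT t. indicator J t * F t - s\<^sup>2 * c\<^sup>2 / (N + 1) * (indicator J t * (t\<^sup>2 * F t)))"
    using i1 i2 by simp
  also have "\<dots> \<le> (LBINT t. g t)"
  proof (rule integral_mono)
    show "integrable lborel (\<lambda>t. indicator J t * F t - s\<^sup>2 * c\<^sup>2 / (N + 1) * (indicator J t * (t\<^sup>2 * F t)))"
      using i1 i2 by (intro Bochner_Integration.integrable_diff integrable_mult_right)
    show "indicator J t * F t - s\<^sup>2 * c\<^sup>2 / (N + 1) * (indicator J t * (t\<^sup>2 * F t)) \<le> g t" for t
    proof (cases "t \<in> J")
      case True
      then have "F t * (1 - s\<^sup>2 * c\<^sup>2 * t\<^sup>2 / (N + 1)) \<le> g t"
        using fibre_bound(2)[OF a b N sc, of t] Jsub by (auto simp: J_def F_def g_def)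
      moreover have "F t - s\<^sup>2 * c\<^sup>2 / (N + 1) * (t\<^sup>2 * F t) = F t * (1 - s\<^sup>2 * c\<^sup>2 * t\<^sup>2 / (N + 1))"
        by (simp add: right_diff_distrib)
      ultimately show ?thesis using True by simp
    qed (use gnn in auto)
  qed (rule ig)
  also have "(LBINT t. g t) = sqrt N * (LBINT z. g (sqrt N * z))"
    using lborel_integral_real_affine[of "sqrt N" g 0] ap by simp
  also have "(LBINT z. g (sqrt N * z)) = (LBINT z. indicator {-1..1} z * (sqrt (1 - z\<^sup>2) ^ N * (1 - 3/4 * (z\<^sup>2)\<^sup>2 * (1 - z\<^sup>2))))"
  proof (intro Bochner_Integration.integral_cong refl)
    fix z :: real
    have "(sqrt N * z)\<^sup>2 / N = z\<^sup>2" using ap by (simp add: power_mult_distrib)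
    moreover have "sqrt N * z \<in> {- sqrt N..sqrt N} \<longleftrightarrow> z \<in> {-1..1}"
    proof -
      have sN: "sqrt N > 0" using ap by simp
      have "sqrt N * z \<le> sqrt N \<longleftrightarrow> z \<le> 1" using sN by (metis mult.right_neutral mult_le_cancel_left_pos)
      moreover have "- sqrt N \<le> sqrt N * z \<longleftrightarrow> -1 \<le> z"
        using mult_le_cancel_left_pos[OF sN, of "-1" z] by simp
      ultimately show ?thesis by simp
    qed
    ultimately show "g (sqrt N * z) = indicator {-1..1} z * (sqrt (1 - z\<^sup>2) ^ N * (1 - 3/4 * (z\<^sup>2)\<^sup>2 * (1 - z\<^sup>2)))"
      by (simp add: g_def indicator_def)
  qed
  also have "\<dots> = semicircle_integral N * (1 - 9/4 * (real N + 2) / ((real N + 3) * (real N + 5) * (real N + 7)))"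
    by (rule semicircle_gain(2))
  finally show "(LBINT t. indicator J t * F t) - s\<^sup>2 * c\<^sup>2 / (N + 1) * (LBINT t. indicator J t * (t\<^sup>2 * F t))
      \<le> sqrt N * semicircle_integral N * (1 - 9/4 * (real N + 2) / ((real N + 3) * (real N + 5) * (real N + 7)))"
    by (simp add: mult.assoc)
qed

section \<open>The choice of the radius\<close>

text \<open>Machin's formula with \<open>arctan x \<ge> x - x^3 / 3\<close> at \<open>1/5\<close>
  and \<open>arctan x \<le> x\<close> at \<open>1/239\<close>; this gives slightly more than
  \<open>3.1405\<close>.\<close>

lemma pi_gt_314: "pi > 314/100"
proof -
  have lower: "x - x ^ 3 / 3 \<le> arctan x" if "x \<ge> 0" for x :: real
  proof -
    have "\<exists>y. ((\<lambda>x. arctan x - (x - x ^ 3 / 3)) has_real_derivative y) (at z) \<and> y \<ge> 0" if "z \<ge> 0" for z :: real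
    proof (intro exI conjI)
      show "((\<lambda>x. arctan x - (x - x ^ 3 / 3)) has_real_derivative (inverse (1 + z\<^sup>2) - (1 - z\<^sup>2))) (at z)"
        by (auto intro!: derivative_eq_intros)
      have "(1 + z\<^sup>2) * (1 - z\<^sup>2) \<le> 1" by (simp add: algebra_simps)
      then show "inverse (1 + z\<^sup>2) - (1 - z\<^sup>2) \<ge> 0"
        by (simp add: inverse_eq_divide pos_le_divide_eq add_pos_nonneg mult.commute)
    qed
    then have "arctan 0 - (0 - 0 ^ 3 / 3) \<le> arctan x - (x - x ^ 3 / 3)"
      using that by (intro DERIV_nonneg_imp_nondecreasing[of 0 x "\<lambda>x. arctan x - (x - x ^ 3 / 3)"]) auto
    then show ?thesis by simp
  qed
  have upper: "arctan x \<le> x" if "x \<ge> 0" for x :: real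
    using that by (rule arctan_le_self)
  have "arctan (1/5) \<ge> 1/5 - (1/5) ^ 3 / 3" by (rule lower) simp
  moreover have "arctan (1/239) \<le> 1/239" by (rule upper) simp
  ultimately show ?thesis using machin by (simp add: power_divide)
qed

section \<open>Wallis-type identities and estimates for ratios of ball volumes\<close>

lemma semicircle_integral_antimono: "semicircle_integral (Suc m) \<le> semicircle_integral m"
proof -
  have "(LBINT x. indicator {-1..1} x * sqrt (1 - x\<^sup>2) ^ Suc m) \<le> (LBINT x. indicator {-1..1} x * sqrt (1 - x\<^sup>2) ^ m)"
  proof (intro integral_mono semicircle_has_integral(1))
    fix x :: real
    show "indicator {-1..1} x * sqrt (1 - x\<^sup>2) ^ Suc m \<le> indicator {-1..1} x * sqrt (1 - x\<^sup>2) ^ m"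
    proof (cases "x \<in> {-1..1}")
      case True
      then have "x\<^sup>2 \<le> 1" by (simp add: abs_square_le_1 abs_le_iff)
      then show ?thesis using True power_decreasing[of m "Suc m" "sqrt (1 - x\<^sup>2)"] by simp
    qed simp
  qed
  then show ?thesis by (simp only: semicircle_has_integral(2))
qed

text \<open>The recursion in steps of two moves the product from \<open>m\<close> to
  \<open>m + 1\<close> with factor \<open>(m + 2) / (m + 3)\<close>; the base case is the area
  \<open>pi\<close> of the disc.\<close>

lemma semicircle_integral_mult: "semicircle_integral m * semicircle_integral (Suc m) = 2 * pi / (real m + 2)"
proof (induction m rule: nat_less_induct)
  case (1 m)
  show ?case
  proof (cases m)
    case 0
    have "unit_ball_vol 2 = pi" using unit_ball_vol_even[of 1] by simp
    then show ?thesis using unit_ball_vol_Suc[of 0] unit_ball_vol_Suc[of 1] 0 by (simp add: mult_ac)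
  next
    case (Suc k)
    have "semicircle_integral (k + 2) = semicircle_integral k * (real k + 2) / (real k + 3)"
      by (rule semicircle_integral_rec)
    moreover have "semicircle_integral k * semicircle_integral (Suc k) = 2 * pi / (real k + 2)"
      using 1 Suc by auto
    ultimately have "semicircle_integral (Suc k) * semicircle_integral (k + 2) = 2 * pi / (real k + 3)"
      by (simp add: field_simps)
    then show ?thesis by (simp add: Suc add.commute)
  qed
qed

text \<open>The quotient \<open>h\<close> of the two sides decreases along steps of two and is
  bounded below by a sequence tending to \<open>pi\<close>, obtained from
  \<open>semicircle_integral_mult\<close> and monotonicity. Hence \<open>h m \<ge> pi\<close> for
  every \<open>m\<close>.\<close>

lemma semicircle_integral_lower: "pi * (2 * real m + 1) \<le> (real m + 1)\<^sup>2 * (semicircle_integral m)\<^sup>2"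
proof -
  define h where "h k = (semicircle_integral k)\<^sup>2 * (real k + 1)\<^sup>2 / (2 * real k + 1)" for k
  have step: "h (k + 2) \<le> h k" for k
  proof -
    have "h (k + 2) = (semicircle_integral k)\<^sup>2 * ((real k + 2) / (real k + 3))\<^sup>2 * (real k + 3)\<^sup>2 / (2 * real k + 5)"
    proof -
      have "real (k + 2) + 1 = real k + 3" "2 * real (k + 2) + 1 = 2 * real k + 5" by simp_all
      then show ?thesis unfolding h_def semicircle_integral_rec by (simp only: power_mult_distrib power_divide times_divide_eq_right[symmetric])
    qed
    also have "\<dots> = (semicircle_integral k)\<^sup>2 * ((real k + 2)\<^sup>2 / (2 * real k + 5))"
    proof -
      have "real k + 3 \<noteq> 0" by linarith
      then have "((real k + 2) / (real k + 3))\<^sup>2 * (real k + 3)\<^sup>2 = (real k + 2)\<^sup>2"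
        by (simp only: power_mult_distrib[symmetric]) simp
      then show ?thesis by (simp only: mult.assoc times_divide_eq_right[symmetric] times_divide_eq_left[symmetric])
    qed
    also have "\<dots> \<le> (semicircle_integral k)\<^sup>2 * ((real k + 1)\<^sup>2 / (2 * real k + 1))"
    proof (rule mult_left_mono)
      show "(real k + 2)\<^sup>2 / (2 * real k + 5) \<le> (real k + 1)\<^sup>2 / (2 * real k + 1)"
        by (subst frac_le_eq) (auto simp: power2_eq_square algebra_simps divide_le_0_iff)
    qed simp
    finally show ?thesis by (simp add: h_def)
  qed
  have mono: "h (m + 2 * j) \<le> h m" for j
  proof (induction j)
    case (Suc j)
    have "h (m + 2 * Suc j) \<le> h (m + 2 * j)" using step[of "m + 2 * j"] by simp
    then show ?case using Suc by simp
  qed simp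
  have low: "2 * pi * (real k + 1)\<^sup>2 / ((real k + 2) * (2 * real k + 1)) \<le> h k" for k
  proof -
    have "2 * pi / (real k + 2) \<le> (semicircle_integral k)\<^sup>2"
      unfolding semicircle_integral_mult[symmetric] power2_eq_square
      using semicircle_integral_antimono[of k] semicircle_integral_pos[of k] by (intro mult_left_mono) auto
    then have "2 * pi / (real k + 2) * ((real k + 1)\<^sup>2 / (2 * real k + 1)) \<le> (semicircle_integral k)\<^sup>2 * ((real k + 1)\<^sup>2 / (2 * real k + 1))"
      by (rule mult_right_mono) simp
    then show ?thesis by (simp add: h_def)
  qed
  have "(\<lambda>k. 2 * pi * (real k + 1)\<^sup>2 / ((real k + 2) * (2 * real k + 1))) \<longlonglongrightarrow> pi"
  proof -
    have "(\<lambda>k. 2 * pi * (1 + 1 / real k)\<^sup>2 / ((1 + 2 / real k) * (2 + 1 / real k))) \<longlonglongrightarrow> 2 * pi * (1 + 0)\<^sup>2 / ((1 + 0) * (2 + 0))"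
      by (intro tendsto_intros lim_const_over_n lim_1_over_n) auto
    moreover have "eventually (\<lambda>k. 2 * pi * (1 + 1 / real k)\<^sup>2 / ((1 + 2 / real k) * (2 + 1 / real k)) = 2 * pi * (real k + 1)\<^sup>2 / ((real k + 2) * (2 * real k + 1))) sequentially"
      using eventually_gt_at_top[of 0]
    proof eventually_elim
      case (elim k)
      then have k: "real k > 0" by simp
      have "1 + 1 / real k = (real k + 1) / real k" "1 + 2 / real k = (real k + 2) / real k" "2 + 1 / real k = (2 * real k + 1) / real k"
        using k by (simp_all add: field_simps)
      then show ?case using k by (simp add: power2_eq_square)
    qed
    ultimately show ?thesis by (simp add: tendsto_cong)
  qed
  then have "(\<lambda>j. 2 * pi * (real (m + 2 * j) + 1)\<^sup>2 / ((real (m + 2 * j) + 2) * (2 * real (m + 2 * j) + 1))) \<longlonglongrightarrow> pi"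
    by (rule filterlim_compose) (auto intro!: filterlim_subseq simp: strict_mono_def)
  then have "pi \<le> h m"
    by (rule LIMSEQ_le_const2) (use low mono order_trans in blast)
  then show ?thesis by (simp add: h_def pos_le_divide_eq mult.commute)
qed

lemma unit_ball_vol_mult_Suc: "unit_ball_vol (real a) * unit_ball_vol (real (Suc a)) = 2 * (2 * pi) ^ a / fact (Suc a)"
proof (induction a)
  case (Suc a)
  have "unit_ball_vol (real (Suc (Suc a))) = unit_ball_vol (real a) * (semicircle_integral a * semicircle_integral (Suc a))"
    by (simp only: unit_ball_vol_Suc[of "Suc a"] unit_ball_vol_Suc[of a] mult.assoc)
  then have "unit_ball_vol (real (Suc a)) * unit_ball_vol (real (Suc (Suc a)))
      = (unit_ball_vol (real a) * unit_ball_vol (real (Suc a))) * (semicircle_integral a * semicircle_integral (Suc a))"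
    by simp
  also have "\<dots> = 2 * (2 * pi) ^ a / fact (Suc a) * (2 * pi / (real a + 2))"
    by (simp only: Suc semicircle_integral_mult)
  also have "\<dots> = 2 * (2 * pi) ^ Suc a / fact (Suc (Suc a))"
    by (simp add: field_simps)
  finally show ?case .
qed simp

text \<open>The relative saving of the sections of the product of balls over those of the ball, as it appears in
  the bound of \<open>fibre_integral\<close>.\<close>

definition gain :: "nat \<Rightarrow> real" where
  "gain N = 9/4 * (real N + 2) / ((real N + 3) * (real N + 5) * (real N + 7))"

lemma gain_bounds: "0 \<le> gain N" "gain N < 1"
proof -
  show "0 \<le> gain N" by (simp add: gain_def)
  have "9/4 * (real N + 2) < (real N + 3) * 5 * 7" by simp
  also have "\<dots> \<le> (real N + 3) * (real N + 5) * (real N + 7)" by (intro mult_mono) auto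
  finally show "gain N < 1" by (simp add: gain_def)
qed

section \<open>Numerical inequalities behind the choice of the radius\<close>

lemma exp_two_bound: "exp 2 < (73984/10000 :: real)"
proof -
  have "exp 2 = (exp (1::real))\<^sup>2" by (simp add: power2_eq_square exp_add[symmetric])
  also have "\<dots> < (272/100)\<^sup>2" using e_less_272 by (intro power_strict_mono) auto
  finally show ?thesis by (simp add: power2_eq_square)
qed

lemma power_le_exp:
  fixes h :: real
  assumes "h \<ge> 0" shows "(1 + h) ^ n \<le> exp (real n * h)"
proof -
  have "(1 + h) ^ n \<le> exp h ^ n" using assms by (intro power_mono exp_ge_add_one_self) auto
  then show ?thesis by (simp add: exp_of_nat_mult)
qed

text \<open>\<open>(1 + 1 / M)^(4 a)\<close> stays below \<open>exp 2\<close> while the right-hand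
  side grows linearly, so from \<open>a = 9\<close> on the gain factor can be estimated by 1. The
  values 6, 7, 8 are computed with \<open>314/100\<close> for \<open>pi\<close>.\<close>

lemma numeric_even:
  assumes "a \<ge> 6"
  defines "M \<equiv> 2 * real a + 1"
  shows "(1 - gain (2 * a)) ^ (4 * a + 2) * (1 + 1 / M) ^ (4 * a) < pi * M / 8"
proof (cases "a \<le> 8")
  case True
  then consider "a = 6" | "a = 7" | "a = 8" using assms by linarith
  then have "(1 - gain (2 * a)) ^ (4 * a + 2) * (1 + 1 / M) ^ (4 * a) < 314/100 * M / 8"
    by cases (simp_all add: gain_def M_def power_divide)
  also have "\<dots> < pi * M / 8" using pi_gt_314 by (intro divide_strict_right_mono mult_strict_right_mono) (auto simp: M_def)
  finally show ?thesis .
next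
  case False
  then have a: "a \<ge> 9" by simp
  have g: "0 \<le> 1 - gain (2 * a)" "1 - gain (2 * a) \<le> 1" using gain_bounds[of "2 * a"] by auto
  have "(1 - gain (2 * a)) ^ (4 * a + 2) * (1 + 1 / M) ^ (4 * a) \<le> 1 * exp (real (4 * a) * (1 / M))"
    using g by (intro mult_mono power_le_exp power_le_one) (auto simp: M_def)
  also have "\<dots> \<le> exp 2" using a by (simp add: M_def field_simps)
  also have "\<dots> < 73984/10000" by (rule exp_two_bound)
  also have "\<dots> < 314/100 * M / 8"
  proof -
    have "M \<ge> 19" using a by (simp add: M_def)
    then show ?thesis by simp
  qed
  also have "\<dots> < pi * M / 8" using pi_gt_314 by (intro divide_strict_right_mono mult_strict_right_mono) (auto simp: M_def)
  finally show ?thesis .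
qed

text \<open>\<open>S\<close> is a rational upper bound for \<open>1 + sqrt (b / a)\<close> with
  \<open>b = a + 1\<close>, and \<open>(x + 2) * S / ((x + 1) * S + 1)\<close> bounds the
  \<open>\<theta>\<close> of \<open>radius_odd\<close>. As in the even case the left-hand powers are
  controlled by \<open>exp 2\<close> for large \<open>a\<close>, and small \<open>a\<close> are
  computed.\<close>

lemma numeric_odd:
  assumes "a \<ge> 6"
  defines "x \<equiv> real a" and "S \<equiv> 2 + 1 / (2 * real a)"
  shows "(1 - gain (2 * a + 1)) ^ (4 * a + 4) * S\<^sup>2 * ((x + 2) * S / ((x + 1) * S + 1)) ^ (4 * a + 2)
      * (1 + 1 / (4 * x * (x + 1))) ^ (a + 1) * (2 * x + 1)\<^sup>2 < pi * (x + 1)\<^sup>2 * (4 * x + 1)"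
proof (cases "a \<le> 9")
  case True
  then consider "a = 6" | "a = 7" | "a = 8" | "a = 9" using assms by linarith
  then have "(1 - gain (2 * a + 1)) ^ (4 * a + 4) * S\<^sup>2 * ((x + 2) * S / ((x + 1) * S + 1)) ^ (4 * a + 2)
      * (1 + 1 / (4 * x * (x + 1))) ^ (a + 1) * (2 * x + 1)\<^sup>2 < 314/100 * (x + 1)\<^sup>2 * (4 * x + 1)"
    by cases (simp_all add: gain_def x_def S_def power_divide)
  also have "\<dots> < pi * (x + 1)\<^sup>2 * (4 * x + 1)"
    using pi_gt_314 by (intro mult_strict_right_mono) (auto simp: x_def)
  finally show ?thesis .
next
  case False
  then have a: "a \<ge> 10" and x: "x \<ge> 10" by (auto simp: x_def)
  have g: "0 \<le> 1 - gain (2 * a + 1)" "1 - gain (2 * a + 1) \<le> 1" using gain_bounds[of "2 * a + 1"] by auto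
  have S: "S \<ge> 2" "S = (4 * x + 1) / (2 * x)" using x by (auto simp: S_def x_def field_simps)
  have d: "(x + 1) * S + 1 > 0" using S x by (simp add: add_pos_pos)
  define h where "h = (S - 1) / ((x + 1) * S + 1)"
  have h0: "h \<ge> 0" using S d by (simp add: h_def)
  have th: "(x + 2) * S / ((x + 1) * S + 1) = 1 + h" using d by (simp add: h_def field_simps)
  have "(1 + h) ^ (4 * a + 2) \<le> exp (real (4 * a + 2) * h)" by (rule power_le_exp[OF h0])
  also have "\<dots> \<le> exp 2"
  proof -
    have "(4 * x + 2) * (S - 1) \<le> 2 * ((x + 1) * S + 1)"
      unfolding S(2) using x by (simp add: field_simps)
    then have "(4 * x + 2) * h \<le> 2" using d by (simp add: h_def pos_divide_le_eq)
    then show ?thesis by (simp add: x_def add.commute)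
  qed
  finally have T1: "(1 + h) ^ (4 * a + 2) \<le> exp 2" .
  have T2: "(1 + 1 / (4 * x * (x + 1))) ^ (a + 1) \<le> 4 * x / (4 * x - 1)"
  proof -
    have "(1 + 1 / (4 * x * (x + 1))) ^ (a + 1) \<le> exp (real (a + 1) * (1 / (4 * x * (x + 1))))"
      using x by (intro power_le_exp) auto
    also have "real (a + 1) * (1 / (4 * x * (x + 1))) = 1 / (4 * x)"
    proof -
      define y where "y = x + 1"
      have "y \<noteq> 0" "real (a + 1) = y" using x by (auto simp: y_def x_def)
      then show ?thesis unfolding y_def[symmetric] by simp
    qed
    also have "exp (1 / (4 * x)) \<le> 4 * x / (4 * x - 1)"
    proof -
      have "1 - 1 / (4 * x) \<le> exp (- (1 / (4 * x)))" using exp_ge_add_one_self[of "- (1 / (4 * x))"] by simp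
      then have "(1 - 1 / (4 * x)) * exp (1 / (4 * x)) \<le> exp (- (1 / (4 * x))) * exp (1 / (4 * x))"
        by (rule mult_right_mono) simp
      then have "(4 * x - 1) / (4 * x) * exp (1 / (4 * x)) \<le> 1" using x by (simp add: exp_minus field_simps)
      then show ?thesis using x by (simp add: field_simps)
    qed
    finally show ?thesis .
  qed
  have "(1 - gain (2 * a + 1)) ^ (4 * a + 4) * S\<^sup>2 * ((x + 2) * S / ((x + 1) * S + 1)) ^ (4 * a + 2)
      * (1 + 1 / (4 * x * (x + 1))) ^ (a + 1) * (2 * x + 1)\<^sup>2 \<le> 1 * S\<^sup>2 * exp 2 * (4 * x / (4 * x - 1)) * (2 * x + 1)\<^sup>2"
    unfolding th using g T1 T2 h0 x by (intro mult_mono power_le_one mult_nonneg_nonneg order_refl) auto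
  also have "\<dots> < 1 * S\<^sup>2 * (73984/10000) * (4 * x / (4 * x - 1)) * (2 * x + 1)\<^sup>2"
    using exp_two_bound S x by (intro mult_strict_right_mono mult_strict_left_mono) auto
  also have "\<dots> = (73984/10000) * (4 * x + 1)\<^sup>2 * (2 * x + 1)\<^sup>2 / (x * (4 * x - 1))"
    unfolding S(2) using x by (simp add: power2_eq_square field_simps)
  also have "\<dots> \<le> 314/100 * (x + 1)\<^sup>2 * (4 * x + 1)"
  proof -
    have p: "x * (4 * x - 1) > 0" using x by simp
    have "(2 * x + 1)\<^sup>2 \<le> 4 * (x + 1)\<^sup>2" using x by (simp add: power2_eq_square algebra_simps)
    then have "(73984/10000) * (4 * x + 1)\<^sup>2 * (2 * x + 1)\<^sup>2 \<le> (73984/10000) * (4 * x + 1)\<^sup>2 * (4 * (x + 1)\<^sup>2)"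
      by (intro mult_left_mono) auto
    also have "\<dots> = (73984/10000 * 4 * (4 * x + 1)) * ((x + 1)\<^sup>2 * (4 * x + 1))"
      by (simp add: power2_eq_square)
    also have "\<dots> \<le> (314/100 * (x * (4 * x - 1))) * ((x + 1)\<^sup>2 * (4 * x + 1))"
    proof (rule mult_right_mono)
      have "10 * x \<le> x * x" using x by (intro mult_right_mono) auto
      then show "73984/10000 * 4 * (4 * x + 1) \<le> 314/100 * (x * (4 * x - 1))"
        unfolding right_diff_distrib distrib_left using x by linarith
    qed (use x in auto)
    finally have "(73984/10000) * (4 * x + 1)\<^sup>2 * (2 * x + 1)\<^sup>2 \<le> (314/100 * (x + 1)\<^sup>2 * (4 * x + 1)) * (x * (4 * x - 1))"
      by (simp only: mult_ac)
    then show ?thesis unfolding pos_divide_le_eq[OF p] .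
  qed
  also have "\<dots> < pi * (x + 1)\<^sup>2 * (4 * x + 1)"
    using pi_gt_314 x by (intro mult_strict_right_mono) auto
  finally show ?thesis .
qed

text \<open>With \<open>R^N = Q\<close> the claim raised to the power \<open>2 N\<close> reads
  \<open>Q^(2 (N + 1)) < S^(2 N)\<close>. Squaring clears the square roots that occur in
  \<open>Q\<close> and \<open>S\<close>.\<close>

lemma root_power_less:
  fixes Q S :: real
  assumes N: "N > 0" and Q: "Q > 0" and S: "S > 0" and less: "Q\<^sup>2 * (Q\<^sup>2 / S\<^sup>2) ^ N < 1"
  shows "root N Q ^ (N + 1) < S"
proof -
  define R where "R = root N Q"
  have R: "R ^ N = Q" "R > 0" using N Q by (auto simp: R_def)
  have "((R ^ (N + 1))\<^sup>2) ^ N = ((R ^ N)\<^sup>2) ^ (N + 1)" by (simp only: power_mult[symmetric] mult_ac)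
  also have "\<dots> = Q\<^sup>2 * (Q\<^sup>2 / S\<^sup>2) ^ N * (S\<^sup>2) ^ N" using S by (simp add: R power_divide)
  also have "\<dots> < 1 * (S\<^sup>2) ^ N" using less S by (intro mult_strict_right_mono) auto
  finally have "((R ^ (N + 1))\<^sup>2) ^ N < (S\<^sup>2) ^ N" by simp
  then have "(R ^ (N + 1))\<^sup>2 < S\<^sup>2" by (rule power_less_imp_less_base) simp
  then show ?thesis unfolding R_def[symmetric] by (rule power_less_imp_less_base) (use S in simp)
qed

text \<open>\<open>G * G'\<close> has a closed form, and \<open>G^2\<close> is bounded through
  \<open>semicircle_integral_lower\<close>. Writing \<open>G^2 / G'^2\<close> as
  \<open>G^4 / (G G')^2\<close> leaves elementary factors for \<open>numeric_even\<close>.\<close>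

lemma radius_even:
  fixes a :: nat
  assumes a: "a \<ge> 6"
  defines "G \<equiv> unit_ball_vol (real a) ^ 2 / unit_ball_vol (real (2 * a))"
    and "G' \<equiv> unit_ball_vol (real (a + 1)) ^ 2 / unit_ball_vol (real (2 * a + 2))"
  shows "2 * G\<^sup>2 * (2 * G\<^sup>2 / G'\<^sup>2) ^ (2 * a) * (1 - gain (2 * a)) ^ (4 * a + 2) < 1"
proof -
  define M where "M = 2 * real a + 1"
  define P where "P = 4 ^ (a + 1) / pi"
  have M0: "M > 0" and P0: "P > 0" by (auto simp: M_def P_def)
  have km: "unit_ball_vol (real a) * unit_ball_vol (real (a + 1)) = 2 * (2 * pi) ^ a / fact (a + 1)"
    using unit_ball_vol_mult_Suc[of a] by simp
  have e1: "unit_ball_vol (real (2 * a)) = pi ^ a / fact a" by (rule unit_ball_vol_even)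
  have e2: "unit_ball_vol (real (2 * a + 2)) = pi ^ (a + 1) / fact (a + 1)"
    using unit_ball_vol_even[of "a + 1"] by (simp add: algebra_simps)
  have pos: "unit_ball_vol (real a) > 0" "unit_ball_vol (real (a + 1)) > 0" by (intro unit_ball_vol_pos; simp)+
  have GG: "G * G' = P / (real a + 1)"
  proof -
    have "G * G' = (unit_ball_vol (real a) * unit_ball_vol (real (a + 1)))\<^sup>2
        / (unit_ball_vol (real (2 * a)) * unit_ball_vol (real (2 * a + 2)))"
      by (simp add: G_def G'_def power_mult_distrib)
    also have "\<dots> = (2 * (2 * pi) ^ a / fact (a + 1))\<^sup>2 / (pi ^ a / fact a * (pi ^ (a + 1) / fact (a + 1)))"
      unfolding km e1 e2 ..
    also have "\<dots> = (2 * (2 ^ a * pi ^ a) / ((real a + 1) * fact a))\<^sup>2 / (pi ^ a / fact a * (pi * pi ^ a / ((real a + 1) * fact a)))"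
      by (simp add: power_mult_distrib add.commute)
    also have "\<dots> = 4 * (2 ^ a * 2 ^ a) / (pi * (real a + 1))"
    proof -
      have gen: "(2 * (t * p) / (A * f))\<^sup>2 / (p / f * (pi * p / (A * f))) = 4 * (t * t) / (pi * A)"
        if "p > 0" "f > 0" "A > 0" for t p A f :: real
        using that by (simp add: power2_eq_square divide_simps)
      show ?thesis by (rule gen) auto
    qed
    also have "\<dots> = P / (real a + 1)" by (simp add: P_def power_mult_distrib[symmetric])
    finally show ?thesis .
  qed
  have G0: "G > 0" "G' > 0" unfolding G_def G'_def by (intro divide_pos_pos zero_less_power unit_ball_vol_pos; simp)+
  have GB: "G * semicircle_integral a * (real a + 1) = 2 ^ (a + 1)"
  proof -
    have "G * semicircle_integral a = unit_ball_vol (real a) * unit_ball_vol (real (a + 1)) / unit_ball_vol (real (2 * a))"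
      using unit_ball_vol_Suc[of a] by (simp add: G_def power2_eq_square)
    also have "\<dots> = (2 * (2 * pi) ^ a / fact (a + 1)) / (pi ^ a / fact a)" unfolding km e1 ..
    also have "\<dots> = 2 ^ (a + 1) / (real a + 1)" by (simp add: power_mult_distrib)
    finally show ?thesis by simp
  qed
  have G2: "G\<^sup>2 \<le> P / M"
  proof -
    have "G\<^sup>2 * (pi * (2 * real a + 1)) \<le> G\<^sup>2 * ((real a + 1)\<^sup>2 * (semicircle_integral a)\<^sup>2)"
      by (intro mult_left_mono semicircle_integral_lower) simp
    also have "\<dots> = (G * semicircle_integral a * (real a + 1))\<^sup>2" by (simp add: power_mult_distrib mult_ac)
    also have "\<dots> = 4 ^ (a + 1)" unfolding GB by (simp add: power2_eq_square power_mult_distrib[symmetric])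
    finally have "G\<^sup>2 * (pi * M) \<le> 4 ^ (a + 1)" unfolding M_def .
    then show ?thesis unfolding P_def divide_divide_eq_left using M0 by (subst pos_le_divide_eq) auto
  qed
  have "G\<^sup>2 * G\<^sup>2 \<le> P / M * (P / M)" using G2 P0 M0 by (intro mult_mono) auto
  then have "2 * (G\<^sup>2 * G\<^sup>2) / (G * G')\<^sup>2 \<le> 2 * (P / M * (P / M)) / (G * G')\<^sup>2"
    by (intro divide_right_mono mult_left_mono) auto
  also have "\<dots> = (1 + 1 / M)\<^sup>2 / 2"
  proof -
    have "1 + 1 / M = 2 * (real a + 1) / M" using M0 by (simp add: M_def field_simps)
    moreover have "2 * (p / m * (p / m)) / (p / y)\<^sup>2 = (2 * y / m)\<^sup>2 / 2" if "p > 0" "m > 0" "y > 0" for p m y :: real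
      using that by (simp add: power2_eq_square divide_simps)
    ultimately show ?thesis unfolding GG using M0 P0 by (metis of_nat_0_le_iff add_nonneg_pos zero_less_one)
  qed
  also have "2 * (G\<^sup>2 * G\<^sup>2) / (G * G')\<^sup>2 = 2 * G\<^sup>2 / G'\<^sup>2" using G0 by (simp add: power2_eq_square)
  finally have r: "2 * G\<^sup>2 / G'\<^sup>2 \<le> (1 + 1 / M)\<^sup>2 / 2" .
  have g: "0 \<le> 1 - gain (2 * a)" using gain_bounds[of "2 * a"] by auto
  have "2 * G\<^sup>2 * (2 * G\<^sup>2 / G'\<^sup>2) ^ (2 * a) * (1 - gain (2 * a)) ^ (4 * a + 2)
      \<le> 2 * (P / M) * ((1 + 1 / M)\<^sup>2 / 2) ^ (2 * a) * (1 - gain (2 * a)) ^ (4 * a + 2)"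
    using G2 r g G0 P0 M0 by (intro mult_mono power_mono mult_nonneg_nonneg order_refl) auto
  also have "((1 + 1 / M)\<^sup>2 / 2) ^ (2 * a) = (1 + 1 / M) ^ (4 * a) / 4 ^ a"
  proof -
    have "((1 + 1 / M)\<^sup>2) ^ (2 * a) = (1 + 1 / M) ^ (4 * a)" by (simp only: power_mult[symmetric]) simp
    moreover have "(2::real) ^ (2 * a) = 4 ^ a" by (simp add: power_mult)
    ultimately show ?thesis by (simp only: power_divide)
  qed
  also have "2 * (P / M) * ((1 + 1 / M) ^ (4 * a) / 4 ^ a) * (1 - gain (2 * a)) ^ (4 * a + 2)
      = 8 / (pi * M) * ((1 - gain (2 * a)) ^ (4 * a + 2) * (1 + 1 / M) ^ (4 * a))"
    by (simp add: P_def)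
  also have "\<dots> < 8 / (pi * M) * (pi * M / 8)"
    using numeric_even[OF a] M0 by (intro mult_strict_left_mono) (auto simp: M_def)
  also have "\<dots> = 1" using M0 by simp
  finally show ?thesis .
qed

text \<open>\<open>u\<close> is the factor \<open>\<Lambda> / sqrt b\<close> from
  \<open>radius_exists\<close>, and \<open>\<theta>\<close> is what remains of it in the quotient of
  the two squared bounds. Both increase with \<open>u\<close>, so the irrational
  \<open>sqrt (b / a)\<close> can be replaced by a rational upper bound.\<close>

lemma radius_odd:
  fixes a :: nat and s :: real
  assumes a: "a \<ge> 6" and b: "b = a + 1" and N: "N = a + b"
  defines "D \<equiv> unit_ball_vol (real a) * unit_ball_vol (real b) / unit_ball_vol (real N)"
    and "u \<equiv> 1 + sqrt (real b / real a)"
  defines "\<theta> \<equiv> (real b + 1) * u / (real b * u + 1)"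
  shows "D\<^sup>2 * real a ^ a * real b ^ b * u\<^sup>2 * real N * (1 - gain N)\<^sup>2 / (4 * real b)
      * (real N * (1 - gain N)\<^sup>2 * \<theta>\<^sup>2 / (4 * real a * real b)) ^ N < 1"
    and "unit_ball_vol (real (a + 1)) * unit_ball_vol (real (b + 1)) / unit_ball_vol (real (N + 2))
      = D * (2 * real a + 3) / (real a + 2)"
proof -
  define x where "x = real a"
  define S where "S = 2 + 1 / (2 * real a)"
  have x: "x \<ge> 6" using a by (simp add: x_def)
  have rb: "real b = x + 1" and rN: "real N = 2 * x + 1" using b N by (auto simp: x_def)
  \<comment> \<open>Used for \<open>j = a\<close> and \<open>j = a + 1\<close>: the first evaluates
    \<open>D\<close> in terms of one semicircle integral, and both together with the recursion give
    the ratio of the two volume quotients.\<close>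
  have DB: "unit_ball_vol (real j) * unit_ball_vol (real (Suc j)) / unit_ball_vol (real (Suc (2 * j)))
      * (semicircle_integral (2 * j) * (real j + 1)) = 2 ^ (j + 1)" for j
  proof -
    have "unit_ball_vol (real j) * unit_ball_vol (real (Suc j)) / unit_ball_vol (real (Suc (2 * j))) * semicircle_integral (2 * j)
        = (2 * (2 * pi) ^ j / fact (Suc j)) / (pi ^ j / fact j)"
      unfolding unit_ball_vol_mult_Suc unit_ball_vol_Suc[of "2 * j"] unit_ball_vol_even using semicircle_integral_pos[of "2 * j"] by simp
    also have "\<dots> = 2 ^ (j + 1) / (real j + 1)" by (simp add: power_mult_distrib)
    finally have "unit_ball_vol (real j) * unit_ball_vol (real (Suc j)) / unit_ball_vol (real (Suc (2 * j))) * semicircle_integral (2 * j)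
        = 2 ^ (j + 1) / (real j + 1)" .
    moreover have "real j + 1 \<noteq> 0" by linarith
    ultimately show ?thesis by (simp only: mult.assoc[symmetric]) simp
  qed
  have D: "D * (semicircle_integral (2 * a) * (x + 1)) = 2 ^ (a + 1)"
  proof -
    have "N = Suc (2 * a)" "b = Suc a" using b N by auto
    then show ?thesis using DB[of a] by (simp only: D_def x_def)
  qed
  define D' where "D' = unit_ball_vol (real (a + 1)) * unit_ball_vol (real (b + 1)) / unit_ball_vol (real (N + 2))"
  have "D' * (semicircle_integral (2 * a + 2) * (x + 2)) = 2 ^ (a + 2)"
  proof -
    have "N + 2 = Suc (2 * Suc a)" "a + 1 = Suc a" "b + 1 = Suc (Suc a)" using b N by auto
    then show ?thesis using DB[of "Suc a"] unfolding D'_def by (simp add: x_def algebra_simps)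
  qed
  also have "semicircle_integral (2 * a + 2) = semicircle_integral (2 * a) * (2 * x + 2) / (2 * x + 3)"
    using semicircle_integral_rec[of "2 * a"] by (simp add: x_def)
  finally have D'1: "D' * (semicircle_integral (2 * a) * (2 * x + 2) / (2 * x + 3) * (x + 2)) = 2 * (D * (semicircle_integral (2 * a) * (x + 1)))"
    unfolding D by simp
  define B where "B = semicircle_integral (2 * a)"
  have B0: "B > 0" by (simp add: B_def semicircle_integral_pos)
  have "D' * (B * (2 * x + 2) / (2 * x + 3) * (x + 2)) = (2 * B * (x + 1)) * (D' * (x + 2) / (2 * x + 3))"
    using x by (simp add: field_simps)
  then have "(2 * B * (x + 1)) * (D' * (x + 2) / (2 * x + 3)) = (2 * B * (x + 1)) * D"
    using D'1 unfolding B_def[symmetric] by (simp add: mult_ac)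
  moreover have "2 * B * (x + 1) \<noteq> 0" using B0 x by simp
  ultimately have "D' * (x + 2) / (2 * x + 3) = D" by (metis mult_left_cancel)
  then have "D' = D * (2 * x + 3) / (x + 2)" using x by (simp add: field_simps)
  then show "unit_ball_vol (real (a + 1)) * unit_ball_vol (real (b + 1)) / unit_ball_vol (real (N + 2))
      = D * (2 * real a + 3) / (real a + 2)" by (simp add: D'_def x_def)
  have D2: "D\<^sup>2 \<le> 4 ^ b * (2 * x + 1)\<^sup>2 / ((x + 1)\<^sup>2 * pi * (4 * x + 1))"
  proof -
    have "D\<^sup>2 * (x + 1)\<^sup>2 * (pi * (4 * x + 1)) \<le> D\<^sup>2 * (x + 1)\<^sup>2 * ((2 * x + 1)\<^sup>2 * B\<^sup>2)"
      using semicircle_integral_lower[of "2 * a"] by (intro mult_left_mono) (auto simp: x_def B_def)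
    also have "\<dots> = (D * (B * (x + 1)))\<^sup>2 * (2 * x + 1)\<^sup>2" by (simp add: power_mult_distrib mult_ac)
    also have "\<dots> = 4 ^ b * (2 * x + 1)\<^sup>2"
      unfolding D[folded B_def] b by (simp add: power2_eq_square power_mult_distrib[symmetric])
    finally have "D\<^sup>2 * ((x + 1)\<^sup>2 * pi * (4 * x + 1)) \<le> 4 ^ b * (2 * x + 1)\<^sup>2" by (simp only: mult.assoc)
    then show ?thesis using x by (subst pos_le_divide_eq) auto
  qed
  have u: "1 \<le> u" "u \<le> S"
  proof -
    show "1 \<le> u" by (simp add: u_def)
    \<comment> \<open>\<open>1 + 1 / x\<close> lacks only the square of \<open>1 / (2 x)\<close> to
      be a perfect square.\<close>
    have "real b / real a \<le> (1 + 1 / (2 * x))\<^sup>2" unfolding rb x_def[symmetric] using x by (simp add: power2_eq_square field_simps)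
    then have "sqrt (real b / real a) \<le> 1 + 1 / (2 * x)" using x by (intro real_le_lsqrt) auto
    then show "u \<le> S" by (simp add: u_def S_def x_def)
  qed
  define \<theta>' where "\<theta>' = (x + 2) * S / ((x + 1) * S + 1)"
  have \<theta>: "0 \<le> \<theta>" "\<theta> \<le> \<theta>'"
  proof -
    have t: "\<theta> = (x + 2) * u / ((x + 1) * u + 1)" by (simp add: \<theta>_def rb add.assoc)
    have p: "(x + 1) * u + 1 > 0" "(x + 1) * S + 1 > 0" using u x by (auto intro!: add_pos_pos mult_pos_pos)
    show "0 \<le> \<theta>" unfolding t using u x p by (intro divide_nonneg_pos mult_nonneg_nonneg) auto
    have "(x + 2) * u \<le> (x + 2) * S" using u x by (intro mult_left_mono) auto
    then have "((x + 2) * u) * ((x + 1) * S + 1) \<le> ((x + 2) * S) * ((x + 1) * u + 1)" by (simp add: algebra_simps)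
    then show "\<theta> \<le> \<theta>'" unfolding t \<theta>'_def
      by (simp only: pos_divide_le_eq[OF p(1)] times_divide_eq_left pos_le_divide_eq[OF p(2)])
  qed
  define e where "e = 1 - gain N"
  have e: "0 \<le> e" using gain_bounds[of N] by (simp add: e_def)
  have e2: "e = 1 - gain (2 * a + 1)" 
  proof -
    have "N = 2 * a + 1" using b N by auto
    then show ?thesis by (simp only: e_def)
  qed
  define W where "W = 4 ^ b * (2 * x + 1)\<^sup>2 / ((x + 1)\<^sup>2 * pi * (4 * x + 1))"
  have "D\<^sup>2 * real a ^ a * real b ^ b * u\<^sup>2 * real N * e\<^sup>2 / (4 * real b) * (real N * e\<^sup>2 * \<theta>\<^sup>2 / (4 * real a * real b)) ^ N
      \<le> W * x ^ a * (x + 1) ^ b * S\<^sup>2 * (2 * x + 1) * e\<^sup>2 / (4 * (x + 1)) * ((2 * x + 1) * e\<^sup>2 * \<theta>'\<^sup>2 / (4 * x * (x + 1))) ^ N"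
    unfolding rb rN x_def[symmetric] using D2 u \<theta> x e
    by (intro mult_mono power_mono divide_right_mono order_refl mult_nonneg_nonneg divide_nonneg_nonneg) (auto simp: W_def)
  also have "\<dots> = e ^ (4 * a + 4) * S\<^sup>2 * \<theta>' ^ (4 * a + 2) * (1 + 1 / (4 * x * (x + 1))) ^ (a + 1) * (2 * x + 1)\<^sup>2 / (pi * (x + 1)\<^sup>2 * (4 * x + 1))"
  proof -
    have one: "1 + 1 / (4 * x * (x + 1)) = (2 * x + 1)\<^sup>2 / (4 * x * (x + 1))"
    proof -
      have "4 * x * (x + 1) \<noteq> 0" using x by simp
      then have "1 + 1 / (4 * x * (x + 1)) = (4 * x * (x + 1) + 1) / (4 * x * (x + 1))" by (metis add_divide_distrib divide_self)
      moreover have "4 * x * (x + 1) + 1 = (2 * x + 1)\<^sup>2" by (simp add: power2_eq_square algebra_simps)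
      ultimately show ?thesis by simp
    qed
    have N1: "N = Suc a + a" using N b by simp
    define y z where "y = x + 1" and "z = 2 * x + 1"
    have yz: "y > 0" "z > 0" "x > 0" using x by (auto simp: y_def z_def)
    have pN: "(z * e\<^sup>2 * \<theta>'\<^sup>2 / (4 * x * y)) ^ N
        = z ^ Suc a * z ^ a * e ^ (4 * a + 2) * \<theta>' ^ (4 * a + 2) / (4 ^ Suc a * 4 ^ a * (x ^ Suc a * x ^ a) * (y ^ Suc a * y ^ a))"
    proof -
      have "(e\<^sup>2) ^ N = e ^ (4 * a + 2)" "(\<theta>'\<^sup>2) ^ N = \<theta>' ^ (4 * a + 2)"
        unfolding N1 by (simp_all only: power_mult[symmetric]) (simp_all add: algebra_simps)
      then show ?thesis by (simp only: power_divide power_mult_distrib) (simp only: N1 power_add)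
    qed
    have "4 * a + 4 = 2 + (4 * a + 2)" by simp
    then have e4: "e ^ (4 * a + 4) = e\<^sup>2 * e ^ (4 * a + 2)" by (simp only: power_add)
    have one': "1 + 1 / (4 * x * y) = z\<^sup>2 / (4 * x * y)" using one by (simp only: y_def z_def)
    have z2: "(z\<^sup>2 / (4 * x * y)) ^ Suc a = z ^ Suc a * z ^ Suc a / (4 ^ Suc a * x ^ Suc a * y ^ Suc a)"
      by (simp add: power_divide power_mult_distrib power2_eq_square mult_ac)
    show ?thesis
    proof -
      define q where "q = 4 * x + 1"
      have q: "q > 0" using x by (simp add: q_def)
      have gen: "(4 * f * zz / (yy * p * q)) * xa * (y * ya) * ss * z * ee / (4 * y) * (z * za * za * E * T / (4 * f * f * (x * xa * xa) * (y * ya * ya)))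
          = ee * E * ss * T * ((z * za) * (z * za) / (4 * f * (x * xa) * (y * ya))) * zz / (p * yy * q)"
        if "f > 0" "xa > 0" "ya > 0" "yy > 0" "p > 0" for f zz yy p xa ya ss ee E T za :: real
        using that yz q by (simp add: divide_simps)
      have p: "(4::real) ^ a > 0" "x ^ a > 0" "y ^ a > 0" "y\<^sup>2 > 0" "pi > 0" using yz by auto
      show ?thesis
        unfolding W_def y_def[symmetric] z_def[symmetric] q_def[symmetric] unfolding one' b Suc_eq_plus1[symmetric]
        unfolding z2 e4 pN unfolding power_Suc
        using gen[OF p, where zz = "z\<^sup>2" and ss = "S\<^sup>2" and ee = "e\<^sup>2" and za = "z ^ a" and E = "e ^ (4 * a + 2)" and T = "\<theta>' ^ (4 * a + 2)"]
        by (simp only: mult_ac)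
    qed
  qed
  also have "\<dots> < 1"
    using numeric_odd[OF a] x unfolding e2 \<theta>'_def S_def x_def by (subst pos_divide_less_eq) auto
  finally show "D\<^sup>2 * real a ^ a * real b ^ b * u\<^sup>2 * real N * (1 - gain N)\<^sup>2 / (4 * real b)
      * (real N * (1 - gain N)\<^sup>2 * \<theta>\<^sup>2 / (4 * real a * real b)) ^ N < 1"
    unfolding e_def .
qed

lemma sqrt_power_power2: "x \<ge> 0 \<Longrightarrow> (sqrt x ^ m)\<^sup>2 = x ^ m"
  by (metis power_commutes power_mult mult.commute real_sqrt_pow2)

text \<open>The equality fixes \<open>R^N\<close> so that the bound for sections of the product
  coincides with the sections of the ball of radius \<open>R\<close>; the strict inequality is the
  comparison of surface areas.\<close>

lemma radius_exists:
  fixes a b N :: nat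
  assumes a: "a \<ge> 6" and b: "b = a \<or> b = Suc a" and N: "N = a + b"
  obtains R :: real where "R > 0"
    "unit_ball_vol (real a) * unit_ball_vol (real b) * (sqrt a ^ a * sqrt b ^ b) * ((real a + 1) / sqrt a + sqrt b)
        * (sqrt N * semicircle_integral N * (1 - gain N))
      = (real N + 1) * unit_ball_vol (real (N + 1)) * R ^ N"
    "(real N + 2) * unit_ball_vol (real (N + 2)) * R ^ (N + 1)
      < unit_ball_vol (real (a + 1)) * unit_ball_vol (real (b + 1)) * (sqrt a ^ (a + 1) * sqrt b ^ (b + 1))
        * ((real a + 1) / sqrt a + (real b + 1) / sqrt b)"
proof -
  have ap: "real a > 0" "real b > 0" "N > 0" "real N > 0" using a b N by auto
  define e where "e = 1 - gain N"
  have e: "e > 0" using gain_bounds[of N] by (simp add: e_def)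
  define \<Lambda> where "\<Lambda> = (real a + 1) / sqrt a + sqrt b"
  define \<Lambda>2 where "\<Lambda>2 = (real a + 1) / sqrt a + (real b + 1) / sqrt b"
  have \<Lambda>: "\<Lambda> > 0" "\<Lambda>2 > 0" using ap by (auto simp: \<Lambda>_def \<Lambda>2_def intro!: add_pos_pos)
  define D where "D = unit_ball_vol (real a) * unit_ball_vol (real b) / unit_ball_vol (real N)"
  define D' where "D' = unit_ball_vol (real (a + 1)) * unit_ball_vol (real (b + 1)) / unit_ball_vol (real (N + 2))"
  have k: "unit_ball_vol (real m) > 0" for m by (rule unit_ball_vol_pos) simp
  have D: "D > 0" "D' > 0" using k by (auto simp: D_def D'_def simp del: of_nat_add of_nat_Suc)
  \<comment> \<open>The value of \<open>R^N\<close> forced by the equality, after cancelling the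
    volume ratio between dimensions \<open>N + 1\<close> and \<open>N\<close>. \<open>S\<close>
    below is the bound that \<open>R^(N + 1)\<close> has to stay under.\<close>
  define Q where "Q = D * (sqrt a ^ a * sqrt b ^ b) * \<Lambda> * (sqrt N * e) / (real N + 1)"
  define S where "S = D' * (sqrt a ^ (a + 1) * sqrt b ^ (b + 1)) * \<Lambda>2 / (real N + 2)"
  have QS: "Q > 0" "S > 0" using ap D \<Lambda> e by (auto simp: Q_def S_def intro!: divide_pos_pos mult_pos_pos)
  have Q2: "Q\<^sup>2 = D\<^sup>2 * (real a ^ a * real b ^ b) * \<Lambda>\<^sup>2 * (N * e\<^sup>2) / (real N + 1)\<^sup>2"
    using ap by (simp add: Q_def power_mult_distrib power_divide sqrt_power_power2)
  have S2: "S\<^sup>2 = D'\<^sup>2 * (real a ^ (a + 1) * real b ^ (b + 1)) * \<Lambda>2\<^sup>2 / (real N + 2)\<^sup>2"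
    using ap by (simp add: S_def power_mult_distrib power_divide sqrt_power_power2 del: power_Suc)
  have key: "Q\<^sup>2 * (Q\<^sup>2 / S\<^sup>2) ^ N < 1"
  proof (cases "b = a")
    case True
    then have NN: "N = 2 * a" using N by simp
    have L: "\<Lambda>\<^sup>2 = (2 * real a + 1)\<^sup>2 / a" "\<Lambda>2\<^sup>2 = (2 * real a + 2)\<^sup>2 / a"
    proof -
      have "\<Lambda> = (2 * real a + 1) / sqrt a"
        using ap True by (simp add: \<Lambda>_def field_simps)
      then show "\<Lambda>\<^sup>2 = (2 * real a + 1)\<^sup>2 / a" by (simp add: power_divide)
      have "\<Lambda>2 = (2 * real a + 2) / sqrt a"
        using ap True by (simp add: \<Lambda>2_def add_divide_distrib)
      then show "\<Lambda>2\<^sup>2 = (2 * real a + 2)\<^sup>2 / a" by (simp add: power_divide)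
    qed
    have "2 * real a + 1 \<noteq> 0" "2 * real a + 2 \<noteq> 0" by linarith+
    then have q: "Q\<^sup>2 = 2 * D\<^sup>2 * e\<^sup>2 * (real a ^ a * real a ^ a)"
      and t: "S\<^sup>2 = D'\<^sup>2 * (real a * (real a ^ a * real a ^ a))"
      unfolding Q2 S2 L using True NN ap by (simp_all add: field_simps)
    have "Q\<^sup>2 / S\<^sup>2 = (2 * D\<^sup>2 / D'\<^sup>2) * (e\<^sup>2 / a)" unfolding q t using ap D by (simp add: field_simps)
    then have "Q\<^sup>2 * (Q\<^sup>2 / S\<^sup>2) ^ N = 2 * D\<^sup>2 * e\<^sup>2 * (real a ^ a * real a ^ a) * ((2 * D\<^sup>2 / D'\<^sup>2) ^ (2 * a) * ((e\<^sup>2) ^ (2 * a) / a ^ (2 * a)))"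
      unfolding q by (simp add: NN power_mult_distrib power_divide)
    also have "\<dots> = 2 * D\<^sup>2 * (2 * D\<^sup>2 / D'\<^sup>2) ^ (2 * a) * (e\<^sup>2 * (e\<^sup>2) ^ (2 * a)) * ((real a ^ a * real a ^ a) / a ^ (2 * a))"
      by simp
    also have "(real a ^ a * real a ^ a) / a ^ (2 * a) = 1" using ap by (simp add: mult_2 power_add)
    also have "e\<^sup>2 * (e\<^sup>2) ^ (2 * a) = e ^ (4 * a + 2)"
      by (simp only: power_mult[symmetric] power_add[symmetric]) (simp add: algebra_simps)
    also have "2 * D\<^sup>2 * (2 * D\<^sup>2 / D'\<^sup>2) ^ (2 * a) * e ^ (4 * a + 2) * 1 < 1"
      using radius_even[OF a] True NN by (simp add: D_def D'_def e_def power2_eq_square)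
    finally show ?thesis .
  next
    case False
    then have bb: "b = a + 1" using b by simp
    define u where "u = 1 + sqrt (real b / real a)"
    define \<theta> where "\<theta> = (real b + 1) * u / (real b * u + 1)"
    note odd = radius_odd[OF a bb N, folded u_def, folded D_def e_def \<theta>_def D'_def]
    have rb: "real b = real a + 1" "real N = 2 * real a + 1" using bb N by auto
    have u0: "u > 0" using ap by (simp add: u_def add_pos_nonneg)
    have Lu: "\<Lambda> = sqrt b * u"
    proof -
      have "(real a + 1) / sqrt a = sqrt b * (sqrt b / sqrt a)" using ap rb by simp
      then show ?thesis by (simp add: \<Lambda>_def u_def real_sqrt_divide distrib_left)
    qed
    have L2u: "\<Lambda>2 = sqrt b * u + 1 / sqrt b"
    proof -
      have "\<Lambda>2 = \<Lambda> + 1 / sqrt b" using ap by (simp add: \<Lambda>_def \<Lambda>2_def add_divide_distrib real_div_sqrt)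
      then show ?thesis by (simp add: Lu)
    qed
    have L2: "\<Lambda>2 = (real b * u + 1) / sqrt b" unfolding L2u using ap by (simp add: field_simps)
    have q: "Q\<^sup>2 = D\<^sup>2 * real a ^ a * real b ^ b * u\<^sup>2 * real N * e\<^sup>2 / (4 * real b)"
    proof -
      have n1: "real N + 1 = 2 * real b" using rb by simp
      show ?thesis unfolding Q2 Lu n1 using ap by (simp add: power_mult_distrib power2_eq_square field_simps)
    qed
    have t: "S\<^sup>2 = D\<^sup>2 * (real a ^ (a + 1) * real b ^ (b + 1)) * ((real b * u + 1)\<^sup>2 / b) / (real b + 1)\<^sup>2"
    proof -
      have n2: "real N + 2 = 2 * real a + 3" "real a + 2 = real b + 1" using rb by auto
      have "2 * real a + 3 \<noteq> 0" by linarith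
      then show ?thesis unfolding S2 L2 odd(2) n2 using ap by (simp add: power_mult_distrib power_divide)
    qed
    have "Q\<^sup>2 / S\<^sup>2 = real N * e\<^sup>2 * \<theta>\<^sup>2 / (4 * real a * real b)"
    proof -
      have gen: "(d * A * B * u2 * n * E / (4 * y)) / (d * (x * A * (y * B)) * (v / y) / w) = n * E * (w * u2 / v) / (4 * x * y)"
        if "d > 0" "A > 0" "B > 0" "x > 0" "y > 0" "v > 0" "w > 0" for d A B u2 n E x y v w :: real
        using that by (simp add: field_simps)
      have p: "real b * u + 1 > 0" using ap u0 by (simp add: add_pos_pos)
      have "\<theta>\<^sup>2 = (real b + 1)\<^sup>2 * u\<^sup>2 / (real b * u + 1)\<^sup>2" by (simp add: \<theta>_def power_divide power_mult_distrib)
      then show ?thesis unfolding q t using gen[of "D\<^sup>2" "real a ^ a" "real b ^ b" a b "(real b * u + 1)\<^sup>2" "(real b + 1)\<^sup>2" "u\<^sup>2" N "e\<^sup>2"] ap D p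
        by simp
    qed
    then show ?thesis using odd(1) unfolding q by simp
  qed
  define R where "R = root N Q"
  have R: "R > 0" "R ^ N = Q" using ap QS by (auto simp: R_def)
  have R2: "R ^ (N + 1) < S" unfolding R_def by (rule root_power_less[OF ap(3) QS key])
  show ?thesis
  proof (rule that[OF R(1)])
    have eq1: "unit_ball_vol (real (N + 1)) = unit_ball_vol (real N) * semicircle_integral N"
      using unit_ball_vol_Suc[of N] by simp
    have eq2: "unit_ball_vol (real a) * unit_ball_vol (real b) = D * unit_ball_vol (real N)"
      unfolding D_def using less_imp_neq[OF k[of N]] by (metis nonzero_eq_divide_eq)
    have eq3: "(real N + 1) * Q = D * (sqrt a ^ a * sqrt b ^ b) * \<Lambda> * (sqrt N * e)"
    proof -
      have "real N + 1 \<noteq> 0" by linarith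
      then show ?thesis by (simp add: Q_def)
    qed
    have "(real N + 1) * unit_ball_vol (real (N + 1)) * Q = (unit_ball_vol (real N) * semicircle_integral N) * ((real N + 1) * Q)"
      unfolding eq1 by (simp only: mult_ac)
    also have "\<dots> = (D * unit_ball_vol (real N)) * (sqrt a ^ a * sqrt b ^ b) * \<Lambda> * (sqrt N * semicircle_integral N * e)"
      unfolding eq3 by (simp only: mult_ac)
    finally show "unit_ball_vol (real a) * unit_ball_vol (real b) * (sqrt a ^ a * sqrt b ^ b) * ((real a + 1) / sqrt a + sqrt b)
        * (sqrt N * semicircle_integral N * (1 - gain N)) = (real N + 1) * unit_ball_vol (real (N + 1)) * R ^ N"
      unfolding R(2) \<Lambda>_def[symmetric] e_def[symmetric] eq2 by simp
    have "(real N + 2) * unit_ball_vol (real (N + 2)) * R ^ (N + 1) < (real N + 2) * unit_ball_vol (real (N + 2)) * S"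
      using R2 k[of "N + 2"] by (intro mult_strict_left_mono mult_pos_pos) auto
    also have "\<dots> = unit_ball_vol (real (N + 2)) * D' * (sqrt a ^ (a + 1) * sqrt b ^ (b + 1)) * \<Lambda>2"
    proof -
      have "real N + 2 \<noteq> 0" by linarith
      then show ?thesis by (simp add: S_def del: power_Suc)
    qed
    also have "unit_ball_vol (real (N + 2)) * D' = unit_ball_vol (real (a + 1)) * unit_ball_vol (real (b + 1))"
      unfolding D'_def using less_imp_neq[OF k[of "N + 2"]] by (metis nonzero_eq_divide_eq mult.commute)
    finally show "(real N + 2) * unit_ball_vol (real (N + 2)) * R ^ (N + 1)
      < unit_ball_vol (real (a + 1)) * unit_ball_vol (real (b + 1)) * (sqrt a ^ (a + 1) * sqrt b ^ (b + 1))
        * ((real a + 1) / sqrt a + (real b + 1) / sqrt b)" unfolding \<Lambda>2_def .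
  qed
qed

section \<open>Surface area of balls and products of balls\<close>

text \<open>The right-hand difference quotient of \<open>A - B\<close> at 0 is at most
  \<open>H\<close>. Boundary measures enter as \<open>H\<close>, with finiteness not known
  beforehand, hence the extended reals.\<close>

lemma ennreal_derivative_le:
  fixes A B :: "real \<Rightarrow> real"
  assumes le: "\<And>x. 0 < x \<Longrightarrow> x < \<delta> \<Longrightarrow> ennreal (A x) \<le> ennreal x * H + ennreal (B x)" and \<delta>: "\<delta> > 0"
    and B: "\<And>x. 0 < x \<Longrightarrow> x < \<delta> \<Longrightarrow> B x \<ge> 0" and eq: "A 0 = B 0"
    and D: "(A has_real_derivative A') (at 0)" "(B has_real_derivative B') (at 0)"
  shows "ennreal (A' - B') \<le> H"
proof (cases H)
  case (real h)
  have "((\<lambda>x. (A x - B x) / x) \<longlongrightarrow> A' - B') (at 0)"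
    using DERIV_diff[OF D] eq by (simp add: has_field_derivative_iff)
  then have lim: "((\<lambda>x. (A x - B x) / x) \<longlongrightarrow> A' - B') (at_right 0)"
    by (rule filterlim_at_split[THEN iffD1, THEN conjunct2])
  have "eventually (\<lambda>x. (A x - B x) / x \<le> h) (at_right 0)"
    unfolding eventually_at_right_field
  proof (intro exI[of _ \<delta>] conjI allI impI \<delta>)
    fix x assume x: "0 < x" "x < \<delta>"
    have "ennreal (A x) \<le> ennreal (x * h + B x)"
      using le[OF x] x B[OF x] real by (simp add: ennreal_mult ennreal_plus)
    then have "A x \<le> x * h + B x" using x B[OF x] real by (subst (asm) ennreal_le_iff) auto
    then show "(A x - B x) / x \<le> h" using x by (simp add: pos_divide_le_eq mult.commute)
  qed
  then have "A' - B' \<le> h" by (rule tendsto_upperbound[OF lim]) simp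
  then show ?thesis using real by (simp add: ennreal_leI)
qed simp

lemma ennreal_derivative_ge:
  fixes A B :: "real \<Rightarrow> real"
  assumes le: "\<And>x. 0 < x \<Longrightarrow> x < \<delta> \<Longrightarrow> ennreal x * H + ennreal (A x) \<le> ennreal (B x)" and \<delta>: "\<delta> > 0"
    and A: "\<And>x. 0 < x \<Longrightarrow> x < \<delta> \<Longrightarrow> A x \<ge> 0" and B: "\<And>x. 0 < x \<Longrightarrow> x < \<delta> \<Longrightarrow> B x \<ge> 0" and eq: "A 0 = B 0"
    and D: "(A has_real_derivative A') (at 0)" "(B has_real_derivative B') (at 0)"
  shows "H \<le> ennreal (B' - A')"
proof (cases H)
  case (real h)
  have "((\<lambda>x. (B x - A x) / x) \<longlongrightarrow> B' - A') (at 0)"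
    using DERIV_diff[OF D(2,1)] eq by (simp add: has_field_derivative_iff)
  then have lim: "((\<lambda>x. (B x - A x) / x) \<longlongrightarrow> B' - A') (at_right 0)"
    by (rule filterlim_at_split[THEN iffD1, THEN conjunct2])
  have "eventually (\<lambda>x. h \<le> (B x - A x) / x) (at_right 0)"
    unfolding eventually_at_right_field
  proof (intro exI[of _ \<delta>] conjI allI impI \<delta>)
    fix x assume x: "0 < x" "x < \<delta>"
    have le': "ennreal (x * h + A x) \<le> ennreal (B x)"
      using le[OF x] x A[OF x] real by (simp add: ennreal_mult ennreal_plus)
    have "x * h + A x \<le> B x" using le' B[OF x] by (simp only: ennreal_le_iff)
    then show "h \<le> (B x - A x) / x" using x by (simp add: pos_le_divide_eq mult.commute)
  qed
  then have "h \<le> B' - A'" by (rule tendsto_lowerbound[OF lim]) simp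
  then show ?thesis using real by (simp add: ennreal_leI)
next
  case top
  \<comment> \<open>An infinite \<open>H\<close> contradicts the hypothesis at
    \<open>\<delta> / 2\<close>, whose right-hand side is finite.\<close>
  have "ennreal (\<delta> / 2) * H + ennreal (A (\<delta> / 2)) \<le> ennreal (B (\<delta> / 2))" using le[of "\<delta> / 2"] \<delta> by simp
  then show ?thesis using top \<delta> by (simp add: ennreal_mult_top top_unique)
qed

text \<open>With \<open>0\<close> in the interior, a point of \<open>C\<close> that can be scaled
  outward inside \<open>C\<close> is interior, and an interior point can be scaled outward along its
  ray, which stays in \<open>T\<close>. So the boundary of the section is the section of the
  boundary.\<close>

lemma frontier_Int_subspace:
  fixes C T :: "'a::euclidean_space set"
  assumes C: "convex C" "compact C" "0 \<in> interior C" and T: "subspace T"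
  shows "frontier C \<inter> T = radial_boundary (C \<inter> T)"
proof (intro set_eqI iffI)
  fix x assume x: "x \<in> frontier C \<inter> T"
  have "l *\<^sub>R x \<notin> C" if l: "l > 1" for l
  proof
    assume "l *\<^sub>R x \<in> C"
    then have "l *\<^sub>R x - (1 - 1 / l) *\<^sub>R (l *\<^sub>R x - 0) \<in> interior C"
      using l C by (intro mem_interior_convex_shrink) auto
    moreover have "l *\<^sub>R x - (1 - 1 / l) *\<^sub>R (l *\<^sub>R x - 0) = x" using l by (simp add: algebra_simps)
    ultimately show False using x by (simp add: frontier_def)
  qed
  then show "x \<in> radial_boundary (C \<inter> T)"
    using x compact_imp_closed[OF C(2)] by (auto simp: radial_boundary_def frontier_def)
next
  fix x assume "x \<in> radial_boundary (C \<inter> T)"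
  then have x: "x \<in> C" "x \<in> T" "\<And>l. l > 1 \<Longrightarrow> l *\<^sub>R x \<notin> C \<inter> T" by (auto simp: radial_boundary_def)
  have "x \<notin> interior C"
  proof
    assume "x \<in> interior C"
    then obtain e where e: "e > 0" "cball x e \<subseteq> C" by (meson mem_interior_cball)
    define l where "l = 1 + e / (norm x + 1)"
    have n: "norm x + 1 > 0" by (simp add: add_nonneg_pos)
    have "x - l *\<^sub>R x = - (e / (norm x + 1)) *\<^sub>R x" by (simp add: l_def algebra_simps)
    then have "dist x (l *\<^sub>R x) = e / (norm x + 1) * norm x" using e by (simp add: dist_norm)
    also have "\<dots> \<le> e" using e n by (simp add: field_simps)
    finally have "l *\<^sub>R x \<in> C" using e by auto
    moreover have "l > 1" using e n by (simp add: l_def)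
    ultimately show False using x T by (auto simp: subspace_scale)
  qed
  then show "x \<in> frontier C \<inter> T" using x closure_subset by (auto simp: frontier_def)
qed

section \<open>Dilations, products of balls and the parallel-body bounds in usable form\<close>

lemma scaleR_image_iff: "Z > 0 \<Longrightarrow> x \<in> (\<lambda>x. Z *\<^sub>R x) ` A \<longleftrightarrow> (1 / Z) *\<^sub>R x \<in> A" for Z :: real and x :: "'a::real_vector"
proof
  assume "Z > 0" "(1 / Z) *\<^sub>R x \<in> A"
  then have "Z *\<^sub>R (1 / Z) *\<^sub>R x \<in> (\<lambda>x. Z *\<^sub>R x) ` A" "Z *\<^sub>R (1 / Z) *\<^sub>R x = x" by (blast, simp)
  then show "x \<in> (\<lambda>x. Z *\<^sub>R x) ` A" by simp
qed auto

lemma radial_boundary_scale: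
  fixes A :: "'a::real_vector set"
  assumes "Z > 0"
  shows "radial_boundary ((\<lambda>x. Z *\<^sub>R x) ` A) = (\<lambda>x. Z *\<^sub>R x) ` radial_boundary A"
  by (rule set_eqI) (simp add: radial_boundary_def scaleR_image_iff[OF assms] mult.commute)

lemma hausdorff_radial_boundary_scale:
  fixes A :: "'a::real_normed_vector set"
  assumes "Z > 0"
  shows "hausdorff_measure d (radial_boundary ((\<lambda>x. Z *\<^sub>R x) ` A)) = ennreal (Z ^ d) * hausdorff_measure d (radial_boundary A)"
  unfolding radial_boundary_scale[OF assms] by (rule hausdorff_measure_scaleR[OF assms])

lemma cylinder_UNIV: "cylinder UNIV A = A"
proof -
  have "perp UNIV = {0 :: 'a::euclidean_space}" 
  proof (intro set_eqI iffI)
    fix y :: 'a assume "y \<in> perp UNIV"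
    then have "y \<bullet> y = 0" by (simp add: perp_def)
    then show "y \<in> {0}" by simp
  qed (simp add: perp_def)
  then show ?thesis by (auto simp: cylinder_def)
qed

lemma linear_coord_proj: "linear (coord_proj D)"
  unfolding coord_proj_def
  by (rule linearI) (simp_all add: inner_add_left scaleR_add_left sum.distrib scaleR_sum_right)

lemma coord_proj_Basis: "coord_proj Basis x = x"
  by (simp add: coord_proj_def euclidean_representation)

lemma norm_coord_proj_le: "D \<subseteq> Basis \<Longrightarrow> norm (coord_proj D x) \<le> norm x"
  using norm_coord_proj[of D x] norm_coord_proj[of Basis x]
  by (simp add: coord_proj_Basis) (intro sum_mono2, auto)

lemma inner_coord_proj: "coord_proj D x \<bullet> y = (\<Sum>i\<in>D. (x \<bullet> i) * (y \<bullet> i))"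
  unfolding coord_proj_def inner_sum_left inner_scaleR_left by (intro sum.cong refl) (simp add: inner_commute)

lemma inner_coord_proj2:
  assumes "D \<subseteq> Basis" shows "coord_proj D x \<bullet> coord_proj D y = coord_proj D x \<bullet> y"
proof -
  have "(\<Sum>i\<in>D. (x \<bullet> i) * (coord_proj D y \<bullet> i)) = (\<Sum>i\<in>D. (x \<bullet> i) * (y \<bullet> i))"
    using assms by (intro sum.cong) (auto simp: coord_proj_inner subset_iff)
  then show ?thesis using inner_coord_proj[of D x "coord_proj D y"] inner_coord_proj[of D x y] by simp
qed

lemma coord_proj_Un:
  assumes "E1 \<union> E2 = Basis" "E1 \<inter> E2 = {}"
  shows "coord_proj E1 x + coord_proj E2 x = x"
proof -
  have "finite E1" "finite E2" using assms finite_Basis by (metis finite_Un)+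
  then have "coord_proj E1 x + coord_proj E2 x = coord_proj (E1 \<union> E2) x"
    unfolding coord_proj_def by (intro sum.union_disjoint[symmetric]) (use assms in auto)
  then show ?thesis using assms by (simp add: coord_proj_Basis)
qed

definition ball_product :: "'a::euclidean_space set \<Rightarrow> 'a set \<Rightarrow> real \<Rightarrow> real \<Rightarrow> 'a set" where
  "ball_product E1 E2 r1 r2 = {p. norm (coord_proj E1 p) \<le> r1 \<and> norm (coord_proj E2 p) \<le> r2}"

lemma convex_ball_product: "convex (ball_product E1 E2 r1 r2)"
proof -
  have "ball_product E1 E2 r1 r2 = coord_proj E1 -` cball 0 r1 \<inter> coord_proj E2 -` cball 0 r2"
    by (auto simp: ball_product_def)
  then show ?thesis by (simp add: convex_Int convex_linear_vimage linear_coord_proj)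
qed

lemma compact_ball_product:
  assumes "E1 \<union> E2 = Basis" "E1 \<inter> E2 = {}"
  shows "compact (ball_product E1 E2 r1 r2)"
proof -
  have "norm p \<le> r1 + r2" if "p \<in> ball_product E1 E2 r1 r2" for p
    using that norm_triangle_ineq[of "coord_proj E1 p" "coord_proj E2 p"] coord_proj_Un[OF assms, of p]
    by (simp add: ball_product_def)
  then have "bounded (ball_product E1 E2 r1 r2)" by (auto simp: bounded_iff)
  then show ?thesis
    using closed_two_balls[of E1 r1 E2 r2] by (simp add: ball_product_def compact_eq_bounded_closed)
qed

lemma cball_subset_ball_product:
  assumes "E1 \<subseteq> Basis" "E2 \<subseteq> Basis"
  shows "cball 0 (min r1 r2) \<subseteq> ball_product E1 E2 r1 r2"
proof
  fix x :: 'a assume "x \<in> cball 0 (min r1 r2)"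
  then have "norm x \<le> r1" "norm x \<le> r2" by auto
  then show "x \<in> ball_product E1 E2 r1 r2"
    using order_trans[OF norm_coord_proj_le[OF assms(1), of x]] order_trans[OF norm_coord_proj_le[OF assms(2), of x]]
    by (simp add: ball_product_def)
qed

lemma scaleR_ball_product:
  assumes Z: "Z > 0" and T: "subspace T"
  shows "(\<lambda>x. Z *\<^sub>R x) ` (ball_product E1 E2 r1 r2 \<inter> T) = ball_product E1 E2 (Z * r1) (Z * r2) \<inter> T"
proof (rule set_eqI)
  fix x
  have "(1 / Z) *\<^sub>R x \<in> T \<longleftrightarrow> x \<in> T"
  proof
    assume "(1 / Z) *\<^sub>R x \<in> T"
    then have "Z *\<^sub>R (1 / Z) *\<^sub>R x \<in> T" by (rule subspace_scale[OF T])
    then show "x \<in> T" using Z by simp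
  qed (rule subspace_scale[OF T])
  moreover have "norm (coord_proj E ((1 / Z) *\<^sub>R x)) \<le> r \<longleftrightarrow> norm (coord_proj E x) \<le> Z * r" for E r
    using Z by (simp add: linear_scale[OF linear_coord_proj] pos_divide_le_eq mult.commute)
  ultimately show "x \<in> (\<lambda>x. Z *\<^sub>R x) ` (ball_product E1 E2 r1 r2 \<inter> T) \<longleftrightarrow> x \<in> ball_product E1 E2 (Z * r1) (Z * r2) \<inter> T"
    unfolding scaleR_image_iff[OF Z] by (simp add: ball_product_def)
qed

lemma scaleR_cball:
  fixes T :: "'a::real_normed_vector set"
  assumes Z: "Z > 0" and T: "subspace T"
  shows "(\<lambda>x. Z *\<^sub>R x) ` (cball 0 r \<inter> T) = cball 0 (Z * r) \<inter> T"
proof (rule set_eqI)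
  fix x
  have "(1 / Z) *\<^sub>R x \<in> T \<longleftrightarrow> x \<in> T"
  proof
    assume "(1 / Z) *\<^sub>R x \<in> T"
    then have "Z *\<^sub>R (1 / Z) *\<^sub>R x \<in> T" by (rule subspace_scale[OF T])
    then show "x \<in> T" using Z by simp
  qed (rule subspace_scale[OF T])
  moreover have "norm ((1 / Z) *\<^sub>R x) \<le> r \<longleftrightarrow> norm x \<le> Z * r"
    using Z by (simp add: pos_divide_le_eq mult.commute)
  ultimately show "x \<in> (\<lambda>x. Z *\<^sub>R x) ` (cball 0 r \<inter> T) \<longleftrightarrow> x \<in> cball 0 (Z * r) \<inter> T"
    unfolding scaleR_image_iff[OF Z] by simp
qed

lemma rel_body_Int:
  assumes "convex C" "compact C" "cball 0 r \<subseteq> C" "r > 0" and T: "subspace T"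
  shows "rel_body T (C \<inter> T)"
  unfolding rel_body_def
proof (intro conjI T exI[of _ r])
  show "convex (C \<inter> T)" using assms(1) subspace_imp_convex[OF T] by (rule convex_Int)
  show "compact (C \<inter> T)" using assms(2) closed_subspace[OF T] by (rule compact_Int_closed)
qed (use assms in auto)

text \<open>The conclusion of \<open>hausdorff_flat\<close> for one subspace. Naming it lets the
  same \<open>c\<close> be handed to the upper bound for one body and the lower bound for the
  other.\<close>

definition flat_constant :: "'a::euclidean_space set \<Rightarrow> nat \<Rightarrow> real \<Rightarrow> bool" where
  "flat_constant T d c \<longleftrightarrow> c > 0 \<and> (\<forall>u F h. u \<in> T \<longrightarrow> norm u = 1 \<longrightarrow> compact F \<longrightarrow> F \<subseteq> T \<longrightarrow> (\<forall>x\<in>F. u \<bullet> x = h) \<longrightarrow>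
     hausdorff_measure d F = ennreal c * emeasure lborel (prism T u F))"

lemma flat_constant_exists:
  assumes "1 \<le> m" "m \<le> DIM('a::euclidean_space)"
  obtains c where "\<And>T :: 'a set. subspace T \<Longrightarrow> dim T = m \<Longrightarrow> flat_constant T (m - 1) c"
proof -
  obtain c where c: "c > 0" "\<And>(T :: 'a set) u F h. subspace T \<Longrightarrow> dim T = m \<Longrightarrow> u \<in> T \<Longrightarrow> norm u = 1 \<Longrightarrow>
     compact F \<Longrightarrow> F \<subseteq> T \<Longrightarrow> (\<And>x. x \<in> F \<Longrightarrow> u \<bullet> x = h) \<Longrightarrow>
     hausdorff_measure (m - 1) F = ennreal c * emeasure lborel (prism T u F)"
    using hausdorff_flat[OF assms] by metis
  show ?thesis by (rule that[of c]) (use c in \<open>auto simp: flat_constant_def\<close>)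
qed

lemma flat_constant_upper:
  assumes "rel_body T C" and "flat_constant T d c" and "\<eta> > 0" and "compact W"
    and "\<And>x z. x \<in> T \<Longrightarrow> z \<in> C \<Longrightarrow> dist x ((1 + \<eta>) *\<^sub>R z) \<le> 1 \<Longrightarrow> x \<in> W"
  shows "hausdorff_measure d (radial_boundary C) + ennreal c * emeasure lborel (cylinder T C)
       \<le> ennreal c * emeasure lborel (cylinder T W)"
  by (rule hausdorff_boundary_upper[OF assms(1) _ _ assms(3,4,5)]) (use assms(2) in \<open>auto simp: flat_constant_def\<close>)

lemma flat_constant_lower:
  assumes "rel_body T C" and "flat_constant T d c" and "\<eta> > 0" and "compact W"
    and "\<And>x. x \<in> T \<Longrightarrow> (\<And>z. z \<in> T \<Longrightarrow> dist x z \<le> 1 \<Longrightarrow> z \<in> C) \<Longrightarrow> x \<in> W"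
  shows "ennreal c * emeasure lborel (cylinder T ((\<lambda>x. (1 / (1 + \<eta>)) *\<^sub>R x) ` C))
       \<le> hausdorff_measure d (radial_boundary C) + ennreal c * emeasure lborel (cylinder T W)"
  by (rule hausdorff_boundary_lower[OF assms(1) _ _ assms(3,4,5)]) (use assms(2) in \<open>auto simp: flat_constant_def\<close>)

lemma norm_add_unit:
  fixes y :: "'a::real_normed_vector"
  shows "y \<noteq> 0 \<Longrightarrow> norm (y + (1 / norm y) *\<^sub>R y) = norm y + 1"
proof -
  assume y: "y \<noteq> 0"
  have "y + (1 / norm y) *\<^sub>R y = (1 + 1 / norm y) *\<^sub>R y" by (simp add: scaleR_add_left)
  then have "norm (y + (1 / norm y) *\<^sub>R y) = (1 + 1 / norm y) * norm y" by (simp add: abs_of_nonneg)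
  then show ?thesis using y by (simp add: distrib_right)
qed

text \<open>In the boundary estimates the body is dilated by the factor \<open>1 / x\<close> and \<open>x\<close> tends to \<open>0\<close>, so that
  the parallel bodies at distance \<open>1\<close> become parallel bodies at infinitesimal distance.\<close>

lemma ennreal_mult_cancel_scale:
  assumes x: "x > 0" shows "ennreal (x ^ Suc d) * (ennreal ((1 / x) ^ d) * H) = ennreal x * H"
proof -
  have "x ^ Suc d * (1 / x) ^ d = x" using x by (simp add: power_divide)
  then have "ennreal (x ^ Suc d) * ennreal ((1 / x) ^ d) = ennreal x"
    using x by (simp only: ennreal_mult[symmetric] zero_le_power less_imp_le divide_nonneg_nonneg zero_le_one)
  then show ?thesis by (simp only: mult.assoc[symmetric])
qed

lemma DERIV_minus_power: "((\<lambda>x. (r - x) ^ Suc m) has_real_derivative - (Suc m * r ^ m)) (at 0)" for r :: real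
proof -
  have "((\<lambda>x. r - x) has_real_derivative - 1) (at 0)" by (auto intro!: derivative_eq_intros)
  from DERIV_power[OF this, of "Suc m"] show ?thesis by (simp del: power_Suc of_nat_Suc)
qed

text \<open>The inner parallel body at distance 1 of a product of balls has both radii smaller by 1.
  After dilation by \<open>1 / x\<close> and rescaling of the volumes, the derivative of the inner
  volume at 0 is minus the surface area.\<close>

lemma ball_product_surface_lower:
  fixes E1 E2 :: "'a::euclidean_space set"
  assumes E: "E1 \<union> E2 = Basis" "E1 \<inter> E2 = {}" "card E1 = Suc a" "card E2 = Suc b" and r: "r1 > 0" "r2 > 0"
    and c: "flat_constant (UNIV :: 'a set) d c" and d: "d = Suc (a + b)"
  shows "ennreal (c * (unit_ball_vol (Suc a) * unit_ball_vol (Suc b)) * (r1 ^ Suc a * r2 ^ Suc b * (Suc a / r1 + Suc b / r2)))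
    \<le> hausdorff_measure d (radial_boundary (ball_product E1 E2 r1 r2))"
proof -
  define V where "V = c * (unit_ball_vol (Suc a) * unit_ball_vol (Suc b))"
  have c0: "c > 0" using c by (simp add: flat_constant_def)
  have V0: "V \<ge> 0" using c0 by (simp add: V_def less_imp_le del: of_nat_Suc)
  have ne: "E1 \<noteq> {}" "E2 \<noteq> {}" and EB: "E1 \<subseteq> Basis" "E2 \<subseteq> Basis" using E by auto
  \<comment> \<open>\<open>A\<close> is the rescaled volume of the slightly shrunk body, with zero
    derivative at 0; \<open>B\<close> is that of the inner parallel body.\<close>
  define A where "A x = V * ((r1 / (1 + x\<^sup>2)) ^ Suc a * (r2 / (1 + x\<^sup>2)) ^ Suc b)" for x
  define B where "B x = V * ((r1 - x) ^ Suc a * (r2 - x) ^ Suc b)" for x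
  have vol: "ennreal (x ^ Suc d) * (ennreal c * emeasure lborel (ball_product E1 E2 (1 / x * u1) (1 / x * u2)))
      = ennreal (V * (u1 ^ Suc a * u2 ^ Suc b))" if "u1 \<ge> 0" "u2 \<ge> 0" "x > 0" for x u1 u2 :: real
  proof -
    have "emeasure lborel (ball_product E1 E2 (1 / x * u1) (1 / x * u2))
        = ennreal (unit_ball_vol (Suc a) * (1 / x * u1) ^ Suc a * (unit_ball_vol (Suc b) * (1 / x * u2) ^ Suc b))"
      unfolding ball_product_def using emeasure_two_balls[OF E(1,2) ne, of "1 / x * u1" "1 / x * u2"] that
      by (simp only: E divide_nonneg_nonneg mult_nonneg_nonneg less_imp_le zero_le_one)
    then have "ennreal (x ^ Suc d) * (ennreal c * emeasure lborel (ball_product E1 E2 (1 / x * u1) (1 / x * u2)))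
      = ennreal (x ^ Suc d * (c * (unit_ball_vol (Suc a) * (1 / x * u1) ^ Suc a * (unit_ball_vol (Suc b) * (1 / x * u2) ^ Suc b))))"
      using that c0 by (simp only: ennreal_mult' zero_le_power less_imp_le)
    also have "x ^ Suc d * (c * (unit_ball_vol (Suc a) * (1 / x * u1) ^ Suc a * (unit_ball_vol (Suc b) * (1 / x * u2) ^ Suc b)))
      = V * ((x * (1 / x * u1)) ^ Suc a * (x * (1 / x * u2)) ^ Suc b)"
    proof -
      have "Suc d = Suc a + Suc b" by (simp add: d)
      then show ?thesis unfolding V_def by (simp only: power_mult_distrib power_add mult_ac)
    qed
    also have "\<dots> = V * (u1 ^ Suc a * u2 ^ Suc b)" using that by simp
    finally show ?thesis .
  qed
  have le: "ennreal (A x) \<le> ennreal x * hausdorff_measure d (radial_boundary (ball_product E1 E2 r1 r2)) + ennreal (B x)"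
    if x: "0 < x" "x < min r1 r2" for x
  proof -
    define Z where "Z = 1 / x"
    have Z: "Z > 0" using x by (simp add: Z_def)
    define C where "C = ball_product E1 E2 (Z * r1) (Z * r2)"
    have CZ: "C = (\<lambda>x. Z *\<^sub>R x) ` ball_product E1 E2 r1 r2"
      using scaleR_ball_product[OF Z subspace_UNIV, of E1 E2 r1 r2, symmetric] by (simp add: C_def)
    have body: "rel_body UNIV C"
      using rel_body_Int[OF convex_ball_product compact_ball_product[OF E(1,2)] cball_subset_ball_product[OF EB] _ subspace_UNIV, of "Z * r1" "Z * r2"] Z r
      by (simp add: C_def)
    have Zr: "1 \<le> Z * r1" "1 \<le> Z * r2" using x by (auto simp: Z_def pos_le_divide_eq)
    \<comment> \<open>If the unit ball around \<open>y\<close> keeps its projection within radius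
      \<open>\<rho>\<close>, moving \<open>y\<close> by 1 in the direction of its own projection
      shows that one unit of room is left.\<close>
    have shrink: "norm (coord_proj E y) \<le> \<rho> - 1"
      if "E \<subseteq> Basis" "\<rho> \<ge> 1" and y: "\<And>z. dist y z \<le> 1 \<Longrightarrow> norm (coord_proj E z) \<le> \<rho>" for E y \<rho>
    proof (cases "coord_proj E y = 0")
      case False
      let ?p = "coord_proj E y"
      have "coord_proj E (y + (1 / norm ?p) *\<^sub>R ?p) = ?p + (1 / norm ?p) *\<^sub>R ?p"
        using that(1) by (simp add: linear_add[OF linear_coord_proj] linear_scale[OF linear_coord_proj] coord_proj_id coord_proj_in)
      moreover have "dist y (y + (1 / norm ?p) *\<^sub>R ?p) \<le> 1" using False by (simp add: dist_norm)
      ultimately have "norm ?p + 1 \<le> \<rho>" using y norm_add_unit[OF False] by metis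
      then show ?thesis by simp
    qed (use that in simp)
    have "ennreal c * emeasure lborel (cylinder UNIV ((\<lambda>y. (1 / (1 + x\<^sup>2)) *\<^sub>R y) ` C))
       \<le> hausdorff_measure d (radial_boundary C) + ennreal c * emeasure lborel (cylinder UNIV (ball_product E1 E2 (Z * r1 - 1) (Z * r2 - 1)))"
    proof (rule flat_constant_lower[OF body c _ compact_ball_product[OF E(1,2)]])
      \<comment> \<open>The polytope approximation error is taken as \<open>x^2\<close>, of second
        order, so that it does not enter the derivative.\<close>
      show "x\<^sup>2 > 0" using x by simp
      show "y \<in> ball_product E1 E2 (Z * r1 - 1) (Z * r2 - 1)" if "\<And>z. z \<in> UNIV \<Longrightarrow> dist y z \<le> 1 \<Longrightarrow> z \<in> C" for y
        unfolding ball_product_def using that shrink[OF EB(1) Zr(1), of y] shrink[OF EB(2) Zr(2), of y]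
        by (auto simp: C_def ball_product_def)
    qed
    moreover have "(\<lambda>y. (1 / (1 + x\<^sup>2)) *\<^sub>R y) ` C = ball_product E1 E2 (1 / x * (r1 / (1 + x\<^sup>2))) (1 / x * (r2 / (1 + x\<^sup>2)))"
      using scaleR_ball_product[OF _ subspace_UNIV, of "1 / (1 + x\<^sup>2)" E1 E2 "Z * r1" "Z * r2"]
      by (simp add: C_def Z_def add_pos_nonneg mult_ac)
    moreover have "ball_product E1 E2 (Z * r1 - 1) (Z * r2 - 1) = ball_product E1 E2 (1 / x * (r1 - x)) (1 / x * (r2 - x))"
      using x by (simp add: Z_def right_diff_distrib)
    ultimately have "ennreal c * emeasure lborel (ball_product E1 E2 (1 / x * (r1 / (1 + x\<^sup>2))) (1 / x * (r2 / (1 + x\<^sup>2))))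
       \<le> hausdorff_measure d (radial_boundary C) + ennreal c * emeasure lborel (ball_product E1 E2 (1 / x * (r1 - x)) (1 / x * (r2 - x)))"
      by (simp only: cylinder_UNIV)
    from mult_left_mono[OF this, of "ennreal (x ^ Suc d)"]
    have "ennreal (A x) \<le> ennreal (x ^ Suc d) * hausdorff_measure d (radial_boundary C) + ennreal (B x)"
      unfolding distrib_left A_def B_def using x r vol[of "r1 / (1 + x\<^sup>2)" "r2 / (1 + x\<^sup>2)" x] vol[of "r1 - x" "r2 - x" x] by simp
    then show ?thesis
      unfolding CZ hausdorff_radial_boundary_scale[OF Z] unfolding Z_def using ennreal_mult_cancel_scale[OF x(1), of d] by simp
  qed
  have DA: "(A has_real_derivative 0) (at 0)"
    unfolding A_def by (auto intro!: derivative_eq_intros)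
  have DB: "(B has_real_derivative V * (- (Suc a * r1 ^ a) * r2 ^ Suc b + - (Suc b * r2 ^ b) * r1 ^ Suc a)) (at 0)"
    using DERIV_cmult[OF DERIV_mult[OF DERIV_minus_power[of r1 a] DERIV_minus_power[of r2 b]], of V] unfolding B_def by (simp del: power_Suc of_nat_Suc)
  have "ennreal (0 - V * (- (Suc a * r1 ^ a) * r2 ^ Suc b + - (Suc b * r2 ^ b) * r1 ^ Suc a))
      \<le> hausdorff_measure d (radial_boundary (ball_product E1 E2 r1 r2))"
  proof (rule ennreal_derivative_le[OF le _ _ _ DA DB])
    show "min r1 r2 > 0" using r by simp
    show "B x \<ge> 0" if "0 < x" "x < min r1 r2" for x using that V0 by (simp add: B_def)
    show "A 0 = B 0" by (simp add: A_def B_def)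
  qed
  also have "0 - V * (- (Suc a * r1 ^ a) * r2 ^ Suc b + - (Suc b * r2 ^ b) * r1 ^ Suc a) = V * (r1 ^ Suc a * r2 ^ Suc b * (Suc a / r1 + Suc b / r2))"
    using r by (simp add: field_simps)
  finally show ?thesis unfolding V_def .
qed

text \<open>Here the outer parallel body is used, since the ball's surface must be bounded from
  above; its radius after rescaling is \<open>(1 + x^2) R + x\<close>, with derivative 1 at
  0.\<close>

lemma sphere_surface_upper:
  assumes c: "flat_constant (UNIV :: 'a::euclidean_space set) d c" and d: "Suc d = DIM('a)" and R: "R > 0"
  shows "hausdorff_measure d (radial_boundary (cball (0 :: 'a) R)) \<le> ennreal (c * (Suc d * unit_ball_vol (Suc d) * R ^ d))"
proof -
  define V where "V = c * unit_ball_vol (Suc d)"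
  have c0: "c > 0" using c by (simp add: flat_constant_def)
  have V0: "V \<ge> 0" using c0 by (simp add: V_def less_imp_le del: of_nat_Suc)
  define B where "B x = V * ((1 + x\<^sup>2) * R + x) ^ Suc d" for x
  have vol: "ennreal (x ^ Suc d) * (ennreal c * emeasure lborel (cball (0 :: 'a) (1 / x * u))) = ennreal (V * u ^ Suc d)"
    if "u \<ge> 0" "x > 0" for x u :: real
  proof -
    have "ennreal (x ^ Suc d) * (ennreal c * emeasure lborel (cball (0 :: 'a) (1 / x * u)))
       = ennreal (x ^ Suc d) * (ennreal c * ennreal (unit_ball_vol (Suc d) * (1 / x * u) ^ Suc d))"
      using emeasure_cball[of "1 / x * u" "0 :: 'a"] that unfolding d[symmetric] by simp
    also have "\<dots> = ennreal (x ^ Suc d * (c * (unit_ball_vol (Suc d) * (1 / x * u) ^ Suc d)))"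
      using that c0 by (simp only: ennreal_mult' zero_le_power less_imp_le)
    also have "x ^ Suc d * (c * (unit_ball_vol (Suc d) * (1 / x * u) ^ Suc d)) = V * (x * (1 / x * u)) ^ Suc d"
      unfolding V_def by (simp only: power_mult_distrib mult_ac)
    also have "x * (1 / x * u) = u" using that by simp
    finally show ?thesis .
  qed
  have le: "ennreal x * hausdorff_measure d (radial_boundary (cball (0 :: 'a) R)) + ennreal (V * R ^ Suc d) \<le> ennreal (B x)"
    if x: "0 < x" "x < 1" for x
  proof -
    define Z where "Z = 1 / x"
    have Z: "Z > 0" using x by (simp add: Z_def)
    define C where "C = cball (0 :: 'a) (Z * R)"
    have CZ: "C = (\<lambda>x. Z *\<^sub>R x) ` cball 0 R"
      using scaleR_cball[OF Z subspace_UNIV, of R, symmetric] by (simp add: C_def)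
    have body: "rel_body UNIV C"
      using rel_body_Int[OF convex_cball compact_cball order_refl _ subspace_UNIV, of "Z * R"] Z R by (simp add: C_def)
    have "hausdorff_measure d (radial_boundary C) + ennreal c * emeasure lborel (cylinder UNIV C)
       \<le> ennreal c * emeasure lborel (cylinder UNIV (cball (0 :: 'a) ((1 + x\<^sup>2) * (Z * R) + 1)))"
    proof (rule flat_constant_upper[OF body c _ compact_cball])
      show "x\<^sup>2 > 0" using x by simp
      show "y \<in> cball 0 ((1 + x\<^sup>2) * (Z * R) + 1)" if "z \<in> C" "dist y ((1 + x\<^sup>2) *\<^sub>R z) \<le> 1" for y z
      proof -
        have "norm y \<le> norm ((1 + x\<^sup>2) *\<^sub>R z) + 1"
          using that(2) norm_triangle_sub[of y "(1 + x\<^sup>2) *\<^sub>R z"] by (simp add: dist_norm)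
        also have "norm ((1 + x\<^sup>2) *\<^sub>R z) = (1 + x\<^sup>2) * norm z" by (simp add: abs_of_nonneg)
        also have "(1 + x\<^sup>2) * norm z \<le> (1 + x\<^sup>2) * (Z * R)" using that(1) by (intro mult_left_mono) (auto simp: C_def)
        finally show ?thesis by simp
      qed
    qed
    moreover have "cball (0 :: 'a) ((1 + x\<^sup>2) * (Z * R) + 1) = cball 0 (1 / x * ((1 + x\<^sup>2) * R + x))"
      using x by (simp add: Z_def distrib_left mult_ac)
    ultimately have "hausdorff_measure d (radial_boundary C) + ennreal c * emeasure lborel (cball (0 :: 'a) (1 / x * R))
       \<le> ennreal c * emeasure lborel (cball (0 :: 'a) (1 / x * ((1 + x\<^sup>2) * R + x)))"
      by (simp only: cylinder_UNIV) (simp add: C_def Z_def)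
    note m = mult_left_mono[OF this, of "ennreal (x ^ Suc d)", OF zero_le]
    have v: "R \<ge> 0" "(1 + x\<^sup>2) * R + x \<ge> 0" using x R by auto
    have "ennreal (x ^ Suc d) * hausdorff_measure d (radial_boundary C) + ennreal (V * R ^ Suc d) \<le> ennreal (B x)"
      using m unfolding distrib_left[of "ennreal (x ^ Suc d)"] B_def vol[OF v(1) x(1)] vol[OF v(2) x(1)] .
    then show ?thesis
      unfolding CZ hausdorff_radial_boundary_scale[OF Z] unfolding Z_def using ennreal_mult_cancel_scale[OF x(1), of d] by simp
  qed
  have "((\<lambda>x. (1 + x\<^sup>2) * R + x) has_real_derivative 1) (at 0)" by (auto intro!: derivative_eq_intros)
  from DERIV_cmult[OF DERIV_power[OF this, of "Suc d"], of V]
  have DB: "(B has_real_derivative V * (Suc d * R ^ d)) (at 0)" unfolding B_def by (simp del: power_Suc of_nat_Suc)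
  have "hausdorff_measure d (radial_boundary (cball (0 :: 'a) R)) \<le> ennreal (V * (Suc d * R ^ d) - 0)"
    by (rule ennreal_derivative_ge[OF le zero_less_one _ _ _ _ DB]) (use V0 R in \<open>auto simp: B_def\<close>)
  then show ?thesis by (simp add: V_def mult_ac)
qed

lemma cylinder_hyperplane:
  fixes a :: "'a::euclidean_space"
  assumes a: "norm a = 1" and A: "A \<subseteq> {x. a \<bullet> x = 0}"
  shows "q \<in> cylinder {x. a \<bullet> x = 0} A \<longleftrightarrow> \<bar>a \<bullet> q\<bar> \<le> 1 \<and> q - (a \<bullet> q) *\<^sub>R a \<in> A"
proof
  have aa: "a \<bullet> a = 1" using a by (simp add: dot_square_norm)
  assume "q \<in> cylinder {x. a \<bullet> x = 0} A"
  then obtain x y where q: "q = x + y" "x \<in> A" "y \<in> perp {x. a \<bullet> x = 0}" "norm y \<le> 1" by (auto simp: cylinder_def)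
  let ?z = "y - (a \<bullet> y) *\<^sub>R a"
  have "a \<bullet> ?z = 0" by (simp add: inner_diff_right aa)
  then have "?z \<bullet> y = 0" using q(3) by (auto simp: perp_def)
  then have "?z \<bullet> ?z = 0" using \<open>a \<bullet> ?z = 0\<close> by (simp add: inner_diff_right inner_commute)
  then have y: "y = (a \<bullet> y) *\<^sub>R a" by simp
  have "a \<bullet> x = 0" using q A by auto
  then have aq: "a \<bullet> q = a \<bullet> y" by (simp add: q inner_add_right)
  have "\<bar>a \<bullet> y\<bar> \<le> norm a * norm y" by (rule Cauchy_Schwarz_ineq2)
  then show "\<bar>a \<bullet> q\<bar> \<le> 1 \<and> q - (a \<bullet> q) *\<^sub>R a \<in> A" using q a aq y by (simp add: algebra_simps)
next
  assume q: "\<bar>a \<bullet> q\<bar> \<le> 1 \<and> q - (a \<bullet> q) *\<^sub>R a \<in> A"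
  have "q = (q - (a \<bullet> q) *\<^sub>R a) + (a \<bullet> q) *\<^sub>R a" by simp
  moreover have "(a \<bullet> q) *\<^sub>R a \<in> perp {x. a \<bullet> x = 0} \<inter> cball 0 1"
    using q a by (auto simp: perp_def inner_commute)
  ultimately show "q \<in> cylinder {x. a \<bullet> x = 0} A" using q unfolding cylinder_def by blast
qed

text \<open>Rotating the normal to a basis vector turns the cylinder into a ball times
  \<open>[-1, 1]\<close>; that segment is the factor 2.\<close>

lemma sphere_section_volume:
  fixes a :: "'a::euclidean_space"
  assumes a: "norm a = 1" and n: "DIM('a) = Suc m" "m > 0" and \<rho>: "\<rho> \<ge> 0"
  shows "emeasure lborel (cylinder {x. a \<bullet> x = 0} (cball 0 \<rho> \<inter> {x. a \<bullet> x = 0})) = ennreal (2 * unit_ball_vol m * \<rho> ^ m)"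
proof -
  obtain e :: 'a where e: "e \<in> Basis" using nonempty_Basis by blast
  obtain k where k: "orthogonal_transformation k" "k a = e"
    using frame_exists[of UNIV a Basis e] a e by (auto simp: dim_UNIV)
  obtain f where f: "orthogonal_transformation f" "\<And>x. k (f x) = x" "\<And>x. f (k x) = x"
    using orthogonal_transformation_inverse[OF k(1)] by metis
  have fe: "f e = a" using f(3)[of a] k by simp
  let ?cyl = "cylinder {x. a \<bullet> x = 0} (cball 0 \<rho> \<inter> {x. a \<bullet> x = 0})"
  have aa: "a \<bullet> a = 1" using a by (simp add: dot_square_norm)
  have "k ` ?cyl = {p. norm (coord_proj (Basis - {e}) p) \<le> \<rho> \<and> norm (coord_proj {e} p) \<le> 1}"
  proof (rule set_eqI)
    fix q
    have "q \<in> k ` ?cyl \<longleftrightarrow> f q \<in> ?cyl"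
    proof
      assume "f q \<in> ?cyl"
      then have "k (f q) \<in> k ` ?cyl" by (rule imageI)
      then show "q \<in> k ` ?cyl" by (simp only: f)
    next
      assume "q \<in> k ` ?cyl"
      then obtain p where "q = k p" "p \<in> ?cyl" by (rule imageE)
      then show "f q \<in> ?cyl" by (simp only: f)
    qed
    also have "\<dots> \<longleftrightarrow> \<bar>a \<bullet> f q\<bar> \<le> 1 \<and> norm (f q - (a \<bullet> f q) *\<^sub>R a) \<le> \<rho>"
      by (subst cylinder_hyperplane[OF a]) (auto simp: inner_diff_right aa)
    also have "a \<bullet> f q = q \<bullet> e" using orthogonal_transformation_inner[OF f(1), of e q] fe by (simp add: inner_commute)
    also have "f q - (q \<bullet> e) *\<^sub>R a = f (q - (q \<bullet> e) *\<^sub>R e)"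
      using orthogonal_transformation_linear[OF f(1)] fe by (simp add: linear_diff linear_scale)
    also have "norm (f (q - (q \<bullet> e) *\<^sub>R e)) = norm (q - (q \<bullet> e) *\<^sub>R e)"
      using f(1) by (simp add: orthogonal_transformation_norm)
    also have "q - (q \<bullet> e) *\<^sub>R e = coord_proj (Basis - {e}) q"
    proof -
      have "coord_proj (Basis - {e}) q + coord_proj {e} q = q" using e by (intro coord_proj_Un) auto
      moreover have "coord_proj {e} q = (q \<bullet> e) *\<^sub>R e" by (simp add: coord_proj_def)
      ultimately show ?thesis by (metis add_diff_cancel_right')
    qed
    also have "\<bar>q \<bullet> e\<bar> = norm (coord_proj {e} q)" using e by (simp add: coord_proj_def)
    finally show "q \<in> k ` ?cyl \<longleftrightarrow> q \<in> {p. norm (coord_proj (Basis - {e}) p) \<le> \<rho> \<and> norm (coord_proj {e} p) \<le> 1}" by auto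
  qed
  moreover have "compact ?cyl"
    by (intro compact_cylinder compact_Int_closed compact_cball closed_hyperplane)
  ultimately have "emeasure lborel ?cyl = emeasure lborel {p. norm (coord_proj (Basis - {e}) p) \<le> \<rho> \<and> norm (coord_proj {e} p) \<le> 1}"
    using emeasure_orthogonal_image[OF k(1)] by metis
  also have "\<dots> = ennreal (unit_ball_vol (card (Basis - {e})) * \<rho> ^ card (Basis - {e}) * (unit_ball_vol (card {e}) * 1 ^ card {e}))"
  proof (rule emeasure_two_balls)
    have m: "card (Basis - {e}) = m" using e n by simp
    show "Basis - {e} \<noteq> {}"
    proof
      assume "Basis - {e} = {}"
      then have "card (Basis - {e}) = 0" by (simp only: card.empty)
      then show False using m n by simp
    qed
  qed (use e \<rho> in auto)
  also have "card (Basis - {e}) = m" using e n by simp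
  also have "unit_ball_vol m * \<rho> ^ m * (unit_ball_vol (card {e}) * 1 ^ card {e}) = 2 * unit_ball_vol m * \<rho> ^ m"
    using unit_ball_vol_odd[of 0] by simp
  finally show ?thesis .
qed

text \<open>The factor 2 is the length of the segment added by \<open>cylinder\<close>. It occurs in
  \<open>section_upper\<close> as well and cancels in the comparison.\<close>

lemma sphere_section_lower:
  fixes a :: "'a::euclidean_space"
  assumes a: "norm a = 1" and n: "DIM('a) = Suc (Suc d)" and R: "R > 0" and c: "flat_constant {x. a \<bullet> x = 0} d c"
  shows "ennreal (c * (2 * (Suc d * unit_ball_vol (Suc d) * R ^ d))) \<le> hausdorff_measure d (radial_boundary (cball 0 R \<inter> {x. a \<bullet> x = 0}))"
proof -
  let ?T = "{x. a \<bullet> x = 0}"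
  have T: "subspace ?T" by (rule subspace_hyperplane)
  define V where "V = c * (2 * unit_ball_vol (Suc d))"
  have c0: "c > 0" using c by (simp add: flat_constant_def)
  have V0: "V \<ge> 0" using c0 by (simp add: V_def less_imp_le del: of_nat_Suc)
  define A where "A x = V * (R / (1 + x\<^sup>2)) ^ Suc d" for x
  define B where "B x = V * (R - x) ^ Suc d" for x
  have vol: "ennreal (x ^ Suc d) * (ennreal c * emeasure lborel (cylinder ?T (cball 0 (1 / x * u) \<inter> ?T))) = ennreal (V * u ^ Suc d)"
    if "u \<ge> 0" "x > 0" for x u :: real
  proof -
    have "ennreal (x ^ Suc d) * (ennreal c * emeasure lborel (cylinder ?T (cball 0 (1 / x * u) \<inter> ?T)))
       = ennreal (x ^ Suc d) * (ennreal c * ennreal (2 * unit_ball_vol (Suc d) * (1 / x * u) ^ Suc d))"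
      using sphere_section_volume[OF a n zero_less_Suc, of "1 / x * u"] that by simp
    also have "\<dots> = ennreal (x ^ Suc d * (c * (2 * unit_ball_vol (Suc d) * (1 / x * u) ^ Suc d)))"
      using that c0 by (simp only: ennreal_mult' zero_le_power less_imp_le)
    also have "x ^ Suc d * (c * (2 * unit_ball_vol (Suc d) * (1 / x * u) ^ Suc d)) = V * (x * (1 / x * u)) ^ Suc d"
      unfolding V_def by (simp only: power_mult_distrib mult_ac)
    also have "x * (1 / x * u) = u" using that by simp
    finally show ?thesis .
  qed
  have le: "ennreal (A x) \<le> ennreal x * hausdorff_measure d (radial_boundary (cball 0 R \<inter> ?T)) + ennreal (B x)"
    if x: "0 < x" "x < R" for x
  proof -
    define Z where "Z = 1 / x"
    have Z: "Z > 0" using x by (simp add: Z_def)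
    define C where "C = cball 0 (Z * R) \<inter> ?T"
    have CZ: "C = (\<lambda>x. Z *\<^sub>R x) ` (cball 0 R \<inter> ?T)"
      unfolding C_def by (rule scaleR_cball[OF Z T, symmetric])
    have body: "rel_body ?T C"
      using rel_body_Int[OF convex_cball compact_cball order_refl _ T, of "Z * R"] Z R by (simp add: C_def)
    have Zr: "1 \<le> Z * R" using x by (auto simp: Z_def pos_le_divide_eq)
    have "ennreal c * emeasure lborel (cylinder ?T ((\<lambda>y. (1 / (1 + x\<^sup>2)) *\<^sub>R y) ` C))
       \<le> hausdorff_measure d (radial_boundary C) + ennreal c * emeasure lborel (cylinder ?T (cball 0 (Z * R - 1) \<inter> ?T))"
    proof (rule flat_constant_lower[OF body c _ compact_Int_closed[OF compact_cball closed_hyperplane]])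
      show "x\<^sup>2 > 0" using x by simp
      fix y assume y: "y \<in> ?T" "\<And>z. z \<in> ?T \<Longrightarrow> dist y z \<le> 1 \<Longrightarrow> z \<in> C"
      show "y \<in> cball 0 (Z * R - 1) \<inter> ?T"
      proof (cases "y = 0")
        case False
        have "y + (1 / norm y) *\<^sub>R y \<in> ?T" using y by (simp add: inner_add_right)
        moreover have "dist y (y + (1 / norm y) *\<^sub>R y) \<le> 1" using False by (simp add: dist_norm)
        ultimately have "y + (1 / norm y) *\<^sub>R y \<in> C" by (rule y(2))
        then have "norm y + 1 \<le> Z * R" using norm_add_unit[OF False] by (simp add: C_def)
        then show ?thesis using y by simp
      qed (use Zr in simp)
    qed
    moreover have "(\<lambda>y. (1 / (1 + x\<^sup>2)) *\<^sub>R y) ` C = cball 0 (1 / x * (R / (1 + x\<^sup>2))) \<inter> ?T"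
      using scaleR_cball[OF _ T, of "1 / (1 + x\<^sup>2)" "Z * R"]
      by (simp add: C_def Z_def add_pos_nonneg mult_ac)
    moreover have "cball 0 (Z * R - 1) \<inter> ?T = cball 0 (1 / x * (R - x)) \<inter> ?T"
      using x by (simp add: Z_def right_diff_distrib)
    ultimately have "ennreal c * emeasure lborel (cylinder ?T (cball 0 (1 / x * (R / (1 + x\<^sup>2))) \<inter> ?T))
       \<le> hausdorff_measure d (radial_boundary C) + ennreal c * emeasure lborel (cylinder ?T (cball 0 (1 / x * (R - x)) \<inter> ?T))"
      by (simp only:)
    from mult_left_mono[OF this, of "ennreal (x ^ Suc d)"]
    have "ennreal (A x) \<le> ennreal (x ^ Suc d) * hausdorff_measure d (radial_boundary C) + ennreal (B x)"
      unfolding distrib_left A_def B_def using x R vol[of "R / (1 + x\<^sup>2)" x] vol[of "R - x" x] by simp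
    then show ?thesis
      unfolding CZ hausdorff_radial_boundary_scale[OF Z] unfolding Z_def using ennreal_mult_cancel_scale[OF x(1), of d] by simp
  qed
  have DA: "(A has_real_derivative 0) (at 0)"
    unfolding A_def by (auto intro!: derivative_eq_intros)
  have DB: "(B has_real_derivative - (V * (Suc d * R ^ d))) (at 0)"
    using DERIV_cmult[OF DERIV_minus_power[of R d], of V] unfolding B_def by (simp del: power_Suc of_nat_Suc)
  have "ennreal (0 - - (V * (Suc d * R ^ d))) \<le> hausdorff_measure d (radial_boundary (cball 0 R \<inter> ?T))"
    by (rule ennreal_derivative_le[OF le R _ _ DA DB]) (use V0 R in \<open>auto simp: A_def B_def\<close>)
  then show ?thesis by (simp add: V_def mult_ac)
qed

section \<open>Central sections of products of balls\<close>

lemma continuous_on_coord_proj [continuous_intros]: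
  "continuous_on A f \<Longrightarrow> continuous_on A (\<lambda>x. coord_proj E (f x))" for f :: "'b::topological_space \<Rightarrow> 'a::euclidean_space"
  unfolding coord_proj_def by (intro continuous_intros)

text \<open>The source of the curvature correction. A step of length 1 inside the hyperplane cannot
  follow the outer normal \<open>p\<close> of the round factor when \<open>p\<close> is not tangent
  to the hyperplane; it gains only the tangential part of \<open>p\<close>, which is shorter by the
  factor \<open>sqrt (1 - q^2 / \<rho>^2)\<close>.\<close>

lemma coord_proj_bulge:
  fixes x y a :: "'a::euclidean_space"
  assumes E: "E \<subseteq> Basis" and a: "norm a = 1" and xy: "a \<bullet> x = a \<bullet> y" "norm (x - y) \<le> 1"
    and R: "norm (coord_proj E y) \<le> R"
  shows "norm (coord_proj E x) \<le> R + sqrt (1 - (coord_proj E x \<bullet> a)\<^sup>2 / (R + 1)\<^sup>2)"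
proof -
  define p q \<rho> where "p = coord_proj E x" and "q = p \<bullet> a" and "\<rho> = norm p"
  have R0: "R \<ge> 0" using R norm_ge_zero order_trans by blast
  have "p = coord_proj E y + coord_proj E (x - y)" by (simp add: p_def linear_diff[OF linear_coord_proj])
  then have "\<rho> \<le> norm (coord_proj E y) + norm (coord_proj E (x - y))" by (simp add: \<rho>_def norm_triangle_ineq)
  then have "\<rho> \<le> R + 1" using R xy(2) norm_coord_proj_le[OF E, of "x - y"] by linarith
  moreover have "\<bar>q\<bar> \<le> \<rho>" unfolding q_def \<rho>_def using Cauchy_Schwarz_ineq2[of p a] a by simp
  ultimately have \<rho>: "\<rho> \<le> R + 1" "\<bar>q\<bar> \<le> \<rho>" by auto
  have "q\<^sup>2 \<le> (R + 1)\<^sup>2" using \<rho> power_mono[of "\<bar>q\<bar>" "R + 1" 2] by simp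
  then have q1: "q\<^sup>2 / (R + 1)\<^sup>2 \<le> 1" using R0 by (simp add: divide_le_eq_1)
  show ?thesis
  proof (cases "\<rho> \<le> R")
    case True
    have "sqrt (1 - q\<^sup>2 / (R + 1)\<^sup>2) \<ge> 0" using q1 by simp
    then show ?thesis using True unfolding q_def \<rho>_def p_def by linarith
  next
    case False
    then have \<rho>0: "\<rho> > 0" using R0 by simp
    have aa: "a \<bullet> a = 1" using a by (simp add: dot_square_norm)
    have "\<rho>\<^sup>2 = p \<bullet> x" unfolding \<rho>_def p_def power2_norm_eq_inner by (rule inner_coord_proj2[OF E])
    \<comment> \<open>Since \<open>x - y\<close> is orthogonal to \<open>a\<close>, the vector
      \<open>p\<close> may be replaced by its component \<open>p - q a\<close> in the
      hyperplane.\<close>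
    also have "\<dots> = p \<bullet> coord_proj E y + (p - q *\<^sub>R a) \<bullet> (x - y)"
      using xy(1) inner_coord_proj2[OF E, of x y] by (simp add: p_def inner_diff_left inner_diff_right)
    also have "\<dots> \<le> \<rho> * R + norm (p - q *\<^sub>R a) * 1"
    proof (rule add_mono)
      have "p \<bullet> coord_proj E y \<le> norm p * norm (coord_proj E y)" by (rule norm_cauchy_schwarz)
      also have "\<dots> \<le> \<rho> * R" unfolding \<rho>_def using R by (intro mult_left_mono) auto
      finally show "p \<bullet> coord_proj E y \<le> \<rho> * R" .
      have "(p - q *\<^sub>R a) \<bullet> (x - y) \<le> norm (p - q *\<^sub>R a) * norm (x - y)" by (rule norm_cauchy_schwarz)
      also have "\<dots> \<le> norm (p - q *\<^sub>R a) * 1" using xy(2) by (intro mult_left_mono) auto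
      finally show "(p - q *\<^sub>R a) \<bullet> (x - y) \<le> norm (p - q *\<^sub>R a) * 1" .
    qed
    also have "norm (p - q *\<^sub>R a) \<le> \<rho> * sqrt (1 - q\<^sup>2 / (R + 1)\<^sup>2)"
    proof -
      have "(norm (p - q *\<^sub>R a))\<^sup>2 = p \<bullet> p - 2 * q * (p \<bullet> a) + q * q * (a \<bullet> a)"
        by (simp add: power2_norm_eq_inner inner_diff_left inner_diff_right inner_commute algebra_simps)
      also have "\<dots> = \<rho>\<^sup>2 - q\<^sup>2"
        unfolding aa q_def[symmetric] \<rho>_def power2_norm_eq_inner by (simp add: power2_eq_square)
      also have "\<dots> \<le> \<rho>\<^sup>2 * (1 - q\<^sup>2 / (R + 1)\<^sup>2)"
      proof -
        have "\<rho>\<^sup>2 \<le> (R + 1)\<^sup>2" using \<rho> \<rho>0 by (intro power_mono) auto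
        then have "\<rho>\<^sup>2 * q\<^sup>2 \<le> (R + 1)\<^sup>2 * q\<^sup>2" by (rule mult_right_mono) simp
        moreover have "(R + 1)\<^sup>2 > 0" using R0 by simp
        ultimately have "\<rho>\<^sup>2 * q\<^sup>2 / (R + 1)\<^sup>2 \<le> q\<^sup>2" by (simp add: pos_divide_le_eq mult.commute)
        then show ?thesis by (simp add: right_diff_distrib)
      qed
      finally have "norm (p - q *\<^sub>R a) \<le> sqrt (\<rho>\<^sup>2 * (1 - q\<^sup>2 / (R + 1)\<^sup>2))" by (rule real_le_rsqrt)
      also have "\<dots> = \<rho> * sqrt (1 - q\<^sup>2 / (R + 1)\<^sup>2)" using \<rho>0 by (simp add: real_sqrt_mult)
      finally show ?thesis .
    qed
    finally have "\<rho> * \<rho> \<le> \<rho> * (R + sqrt (1 - q\<^sup>2 / (R + 1)\<^sup>2))" by (simp add: power2_eq_square distrib_left)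
    then have "\<rho> \<le> R + sqrt (1 - q\<^sup>2 / (R + 1)\<^sup>2)" using \<rho>0 by (simp only: mult_le_cancel_left_pos)
    then show ?thesis unfolding q_def \<rho>_def p_def .
  qed
qed

lemma sqrt_sum_le_iff:
  fixes x y g :: real
  assumes "y \<ge> 0"
  shows "sqrt (x\<^sup>2 + y\<^sup>2) \<le> g \<longleftrightarrow> \<bar>x\<bar> \<le> g \<and> y \<le> sqrt (g\<^sup>2 - x\<^sup>2)"
proof
  assume le: "sqrt (x\<^sup>2 + y\<^sup>2) \<le> g"
  have "\<bar>x\<bar> \<le> sqrt (x\<^sup>2 + y\<^sup>2)" by (rule real_le_rsqrt) simp
  moreover have "x\<^sup>2 + y\<^sup>2 \<le> g\<^sup>2" using power_mono[OF le, of 2] by simp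
  ultimately show "\<bar>x\<bar> \<le> g \<and> y \<le> sqrt (g\<^sup>2 - x\<^sup>2)"
    using order_trans[OF _ le, of "\<bar>x\<bar>"] by (auto intro: real_le_rsqrt)
next
  assume r: "\<bar>x\<bar> \<le> g \<and> y \<le> sqrt (g\<^sup>2 - x\<^sup>2)"
  then have "x\<^sup>2 \<le> g\<^sup>2" using power_mono[of "\<bar>x\<bar>" g 2] by simp
  then have "y\<^sup>2 \<le> g\<^sup>2 - x\<^sup>2" using r assms power_mono[of y "sqrt (g\<^sup>2 - x\<^sup>2)" 2] by simp
  then show "sqrt (x\<^sup>2 + y\<^sup>2) \<le> g" using r by (intro real_le_lsqrt) auto
qed

text \<open>In the hyperplane, \<open>w\<close> is the one direction that mixes the two factors. A
  point at \<open>t = p \<bullet> w\<close> has \<open>e1\<close>-coordinate \<open>c t\<close> and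
  \<open>e2\<close>-coordinate \<open>- s t\<close>; its other coordinates are free, so the fibre is
  a product of balls of dimensions \<open>a\<close> and \<open>b\<close>.\<close>

lemma section_fibred:
  fixes E1 E2 :: "'a::euclidean_space set" and g1 g2 :: "real \<Rightarrow> real"
  assumes E: "E1 \<union> E2 = Basis" "E1 \<inter> E2 = {}" "card E1 = Suc a" "card E2 = Suc b" "a > 0" "b > 0"
    and e: "e1 \<in> E1" "e2 \<in> E2" and sc: "s\<^sup>2 + c\<^sup>2 = (1 :: real)"
  defines "\<alpha> \<equiv> s *\<^sub>R e1 + c *\<^sub>R e2" and "w \<equiv> c *\<^sub>R e1 - s *\<^sub>R e2"
  assumes W: "W = {p. \<alpha> \<bullet> p = 0 \<and> norm (coord_proj E1 p) \<le> g1 (p \<bullet> w) \<and> norm (coord_proj E2 p) \<le> g2 (p \<bullet> w)}" "compact W"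
  shows "emeasure lborel (cylinder {x. \<alpha> \<bullet> x = 0} W) = (\<integral>\<^sup>+t. indicator {t. \<bar>c * t\<bar> \<le> g1 t \<and> \<bar>s * t\<bar> \<le> g2 t} t *
      ennreal (2 * unit_ball_vol a * unit_ball_vol b * (sqrt ((g1 t)\<^sup>2 - (c * t)\<^sup>2) ^ a * sqrt ((g2 t)\<^sup>2 - (s * t)\<^sup>2) ^ b)) \<partial>lborel)"
proof -
  have EB: "E1 \<subseteq> Basis" "E2 \<subseteq> Basis" and eB: "e1 \<in> Basis" "e2 \<in> Basis" and e12: "e1 \<noteq> e2" "e1 \<notin> E2" "e2 \<notin> E1"
    using E e by auto
  have bb: "i \<bullet> j = (if i = j then 1 else 0)" if "i \<in> Basis" "j \<in> Basis" for i j :: 'a using that by (rule inner_Basis)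
  have sc': "s * s + c * c = 1" using sc by (simp add: power2_eq_square)
  have nw: "w \<bullet> w = 1" "\<alpha> \<bullet> \<alpha> = 1" "w \<bullet> \<alpha> = 0" "\<alpha> \<bullet> w = 0"
    using sc' eB e12 by (simp_all add: w_def \<alpha>_def inner_add_left inner_add_right inner_diff_left inner_diff_right bb)
  have oth: "w \<bullet> i = 0" "\<alpha> \<bullet> i = 0" "i \<bullet> w = 0" "i \<bullet> \<alpha> = 0" if "i \<in> Basis" "i \<noteq> e1" "i \<noteq> e2" for i
    using that eB by (auto simp: w_def \<alpha>_def inner_add_left inner_add_right inner_diff_left inner_diff_right bb)
  \<comment> \<open>The rotation takes \<open>e1\<close> to \<open>w\<close> and \<open>e2\<close>
    to the normal, and fixes the remaining basis vectors, so those coordinates can be read off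
    unchanged.\<close>
  define g where "g i = (if i = e1 then w else if i = e2 then \<alpha> else i)" for i
  obtain f where f: "orthogonal_transformation f" "\<And>i. i \<in> Basis \<Longrightarrow> f i = g i"
  proof (rule orthogonal_transformation_of_basis[of g])
    show "g i \<bullet> g j = (if i = j then 1 else 0)" if "i \<in> Basis" "j \<in> Basis" for i j
      using that e12 nw oth by (auto simp: g_def bb)
  qed blast
  obtain k where k: "orthogonal_transformation k" "\<And>x. f (k x) = x" "\<And>x. k (f x) = x"
    using orthogonal_transformation_inverse[OF f(1)] by metis
  have lf: "linear f" using f(1) by (rule orthogonal_transformation_linear)
  have fe: "f e1 = w" "f e2 = \<alpha>" using f(2) eB e12 by (auto simp: g_def)
  have fi: "f i = i" if "i \<in> Basis" "i \<noteq> e1" "i \<noteq> e2" for i using f(2) that by (simp add: g_def)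
  have \<alpha>1: "norm \<alpha> = 1" using nw by (simp add: norm_eq_1)
  let ?T = "{x. \<alpha> \<bullet> x = 0}"
  define S where "S = k ` cylinder ?T W"
  have cyl: "compact (cylinder ?T W)" by (rule compact_cylinder[OF W(2)])
  have "compact S" unfolding S_def
    using compact_continuous_image[OF linear_continuous_on cyl, of k] orthogonal_transformation_linear[OF k(1)] by (simp add: linear_conv_bounded_linear)
  then have Sb: "S \<in> sets borel" by (simp add: borel_compact)
  have e1w: "e1 = c *\<^sub>R w + s *\<^sub>R \<alpha>" "e2 = c *\<^sub>R \<alpha> - s *\<^sub>R w"
  proof -
    have "c *\<^sub>R w + s *\<^sub>R \<alpha> = (s * s + c * c) *\<^sub>R e1" "c *\<^sub>R \<alpha> - s *\<^sub>R w = (s * s + c * c) *\<^sub>R e2"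
      by (simp_all add: w_def \<alpha>_def algebra_simps)
    then show "e1 = c *\<^sub>R w + s *\<^sub>R \<alpha>" "e2 = c *\<^sub>R \<alpha> - s *\<^sub>R w" by (simp_all add: sc')
  qed
  have Siff: "q \<in> S \<longleftrightarrow> \<bar>q \<bullet> e2\<bar> \<le> 1 \<and> q \<bullet> e1 \<in> {t. \<bar>c * t\<bar> \<le> g1 t \<and> \<bar>s * t\<bar> \<le> g2 t}
      \<and> norm (coord_proj (E1 - {e1}) q) \<le> sqrt ((g1 (q \<bullet> e1))\<^sup>2 - (c * (q \<bullet> e1))\<^sup>2)
      \<and> norm (coord_proj (E2 - {e2}) q) \<le> sqrt ((g2 (q \<bullet> e1))\<^sup>2 - (s * (q \<bullet> e1))\<^sup>2)" for q
  proof -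
    define t where "t = q \<bullet> e1"
    define p where "p = f q - (\<alpha> \<bullet> f q) *\<^sub>R \<alpha>"
    have \<alpha>q: "\<alpha> \<bullet> f q = q \<bullet> e2" using orthogonal_transformation_inner[OF f(1), of e2 q] fe by (simp add: inner_commute)
    have "q \<in> S \<longleftrightarrow> f q \<in> cylinder ?T W"
    proof
      assume "f q \<in> cylinder ?T W"
      then have "k (f q) \<in> S" unfolding S_def by (rule imageI)
      then show "q \<in> S" by (simp only: k)
    next
      assume "q \<in> S"
      then obtain r where "q = k r" "r \<in> cylinder ?T W" unfolding S_def by (rule imageE)
      then show "f q \<in> cylinder ?T W" by (simp only: k)
    qed
    also have "\<dots> \<longleftrightarrow> \<bar>\<alpha> \<bullet> f q\<bar> \<le> 1 \<and> p \<in> W"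
      unfolding p_def by (rule cylinder_hyperplane[OF \<alpha>1]) (use W(1) in blast)
    also have "\<dots> \<longleftrightarrow> \<bar>q \<bullet> e2\<bar> \<le> 1 \<and> p \<in> W" by (simp only: \<alpha>q)
    finally have 1: "q \<in> S \<longleftrightarrow> \<bar>q \<bullet> e2\<bar> \<le> 1 \<and> p \<in> W" .
    have pw: "p \<bullet> w = t"
      using orthogonal_transformation_inner[OF f(1), of q e1] fe nw by (simp add: p_def inner_diff_left t_def)
    have p\<alpha>: "p \<bullet> \<alpha> = 0" by (simp add: p_def inner_diff_left nw inner_commute[of "f q" \<alpha>])
    \<comment> \<open>\<open>e1\<close> and \<open>e2\<close> expressed in the rotated pair; the
      component along the normal vanishes on the hyperplane.\<close>
    have pe: "p \<bullet> e1 = c * t" "p \<bullet> e2 = - (s * t)"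
      by (subst e1w, simp add: inner_add_right inner_diff_right pw p\<alpha>)+
    have pi: "p \<bullet> i = q \<bullet> i" if i: "i \<in> Basis" "i \<noteq> e1" "i \<noteq> e2" for i
      using orthogonal_transformation_inner[OF f(1), of q i] fi[OF i] oth[OF i] by (simp add: p_def inner_diff_left)
    have nrm: "norm (coord_proj E p) = sqrt ((p \<bullet> i)\<^sup>2 + (norm (coord_proj (E - {i}) q))\<^sup>2)"
      if "i \<in> E" "E \<subseteq> Basis" "\<And>j. j \<in> E - {i} \<Longrightarrow> j \<noteq> e1 \<and> j \<noteq> e2" for E i
    proof -
      have fin: "finite E" using that(2) finite_Basis by (rule finite_subset)
      have "E - {i} \<subseteq> Basis" using that(2) by auto
      then have "(norm (coord_proj (E - {i}) q))\<^sup>2 = (\<Sum>j\<in>E - {i}. (q \<bullet> j)\<^sup>2)"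
        by (simp add: norm_coord_proj sum_nonneg)
      also have "\<dots> = (\<Sum>j\<in>E - {i}. (p \<bullet> j)\<^sup>2)" using that by (intro sum.cong refl) (use pi in auto)
      finally show ?thesis using norm_coord_proj[OF that(2), of p] sum.remove[OF fin that(1), of "\<lambda>j. (p \<bullet> j)\<^sup>2"] by simp
    qed
    have n1: "norm (coord_proj E1 p) = sqrt ((c * t)\<^sup>2 + (norm (coord_proj (E1 - {e1}) q))\<^sup>2)"
      using nrm[OF e(1) EB(1)] e12 by (auto simp: pe)
    have n2: "norm (coord_proj E2 p) = sqrt ((s * t)\<^sup>2 + (norm (coord_proj (E2 - {e2}) q))\<^sup>2)"
      using nrm[OF e(2) EB(2)] e12 by (auto simp: pe)
    have "p \<in> W \<longleftrightarrow> norm (coord_proj E1 p) \<le> g1 t \<and> norm (coord_proj E2 p) \<le> g2 t"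
      using p\<alpha> by (simp add: W(1) pw inner_commute)
    then show ?thesis unfolding 1 n1 n2 sqrt_sum_le_iff[OF norm_ge_zero] t_def[symmetric] by auto
  qed
  have "emeasure lborel (cylinder ?T W) = emeasure lborel S"
    unfolding S_def by (rule emeasure_orthogonal_image[OF k(1) cyl, symmetric])
  also have "\<dots> = (\<integral>\<^sup>+t. indicator {t. \<bar>c * t\<bar> \<le> g1 t \<and> \<bar>s * t\<bar> \<le> g2 t} t * ennreal (2 * unit_ball_vol (card (E1 - {e1})) * unit_ball_vol (card (E2 - {e2})) *
      (sqrt ((g1 t)\<^sup>2 - (c * t)\<^sup>2) ^ card (E1 - {e1}) * sqrt ((g2 t)\<^sup>2 - (s * t)\<^sup>2) ^ card (E2 - {e2}))) \<partial>lborel)"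
  proof (rule emeasure_fibred[OF _ e12(1) _ _ _ _ _ _ Sb Siff])
    show "insert e1 (insert e2 (E1 - {e1} \<union> (E2 - {e2}))) = Basis" using E(1) e by auto
    show "e1 \<notin> E1 - {e1} \<union> (E2 - {e2})" "e2 \<notin> E1 - {e1} \<union> (E2 - {e2})" using e12 by auto
    show "(E1 - {e1}) \<inter> (E2 - {e2}) = {}" using E(2) by auto
    have cd: "card (E1 - {e1}) = a" "card (E2 - {e2}) = b" using E e by simp_all
    show "E1 - {e1} \<noteq> {}" using cd(1) E(5) by (metis card.empty less_irrefl)
    show "E2 - {e2} \<noteq> {}" using cd(2) E(6) by (metis card.empty less_irrefl)
    fix t assume "t \<in> {t. \<bar>c * t\<bar> \<le> g1 t \<and> \<bar>s * t\<bar> \<le> g2 t}"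
    then have "\<bar>c * t\<bar>\<^sup>2 \<le> (g1 t)\<^sup>2" "\<bar>s * t\<bar>\<^sup>2 \<le> (g2 t)\<^sup>2"
      using power_mono[of "\<bar>c * t\<bar>" "g1 t" 2] power_mono[of "\<bar>s * t\<bar>" "g2 t" 2] by auto
    then show "sqrt ((g1 t)\<^sup>2 - (c * t)\<^sup>2) \<ge> 0 \<and> sqrt ((g2 t)\<^sup>2 - (s * t)\<^sup>2) \<ge> 0" by auto
  qed
  also have "card (E1 - {e1}) = a" using E e by simp
  also have "card (E2 - {e2}) = b" using E e by simp
  finally show ?thesis .
qed

section \<open>First-order bounds for the fibres of the outer parallel body\<close>

lemma exp_minus_le_quadratic:
  fixes x :: real
  assumes "x \<ge> 0" shows "exp (- x) \<le> 1 - x + x\<^sup>2 / 2"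
proof -
  have "1 + x + x\<^sup>2 / 2 \<le> exp x" using exp_lower_Taylor_quadratic[OF assms] by simp
  moreover have "1 - x + x\<^sup>2 / 2 \<ge> 0"
  proof -
    have "0 \<le> (1 - x)\<^sup>2" by simp
    then show ?thesis by (simp add: power2_eq_square algebra_simps)
  qed
  ultimately have "(1 - x + x\<^sup>2 / 2) * (1 + x + x\<^sup>2 / 2) \<le> (1 - x + x\<^sup>2 / 2) * exp x" by (rule mult_left_mono)
  moreover have "(1 - x + x\<^sup>2 / 2) * (1 + x + x\<^sup>2 / 2) = 1 + (x\<^sup>2)\<^sup>2 / 4" by (simp add: power2_eq_square algebra_simps)
  ultimately have "1 \<le> (1 - x + x\<^sup>2 / 2) * exp x" using zero_le_power2[of "x\<^sup>2"] by linarith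
  then show ?thesis by (simp add: exp_minus inverse_eq_divide pos_divide_le_eq)
qed

text \<open>The linear term keeps its dependence on \<open>\<tau>\<close>, whereas the quadratic
  remainder is bounded uniformly by means of \<open>c^2 \<tau>^2 \<le> a\<close>. The remainder is
  of order \<open>l^2\<close> and vanishes in the derivative.\<close>

lemma deficit_exp_le:
  fixes a s c \<tau> l :: real
  assumes "s\<^sup>2 + c\<^sup>2 = 1" "c\<^sup>2 * \<tau>\<^sup>2 \<le> a" "l \<ge> 0"
  shows "exp (- (s\<^sup>2 * c\<^sup>2 * \<tau>\<^sup>2 / 2 * l)) \<le> 1 - s\<^sup>2 * c\<^sup>2 * \<tau>\<^sup>2 / 2 * l + (a * l / 2)\<^sup>2 / 2"
proof -
  have s: "s\<^sup>2 \<le> 1" using assms(1) zero_le_power2[of c] by linarith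
  define y where "y = s\<^sup>2 * c\<^sup>2 * \<tau>\<^sup>2 / 2 * l"
  have y0: "y \<ge> 0" using assms by (simp add: y_def)
  have "s\<^sup>2 * (c\<^sup>2 * \<tau>\<^sup>2) \<le> 1 * a" using s assms by (intro mult_mono) auto
  then have "s\<^sup>2 * c\<^sup>2 * \<tau>\<^sup>2 * l \<le> a * l" using assms(3) by (intro mult_right_mono) (simp_all add: mult.assoc)
  then have "y \<le> a * l / 2" by (simp add: y_def)
  then have "y\<^sup>2 \<le> (a * l / 2)\<^sup>2" using y0 by (rule power_mono)
  then show ?thesis using exp_minus_le_quadratic[OF y0] unfolding y_def[symmetric] by linarith
qed

text \<open>From \<open>sqrt (1 - u) \<le> 1 - u / 2\<close> the reduced radius is at most
  \<open>\<theta>\<close> times the full radius \<open>R + 1\<close>; as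
  \<open>\<theta> \<le> 1\<close>, the factor can be pulled out of the root.\<close>

lemma bulge_component:
  fixes R q Y :: real
  defines "g \<equiv> R + sqrt (1 - q / (R + 1)\<^sup>2)" and "\<theta> \<equiv> 1 - q / (2 * (R + 1) ^ 3)"
  assumes R: "R \<ge> 0" and q: "0 \<le> q" "q \<le> (R + 1)\<^sup>2" and Y: "Y \<ge> 0"
  shows "0 \<le> \<theta>" "sqrt (g\<^sup>2 - Y) \<le> \<theta> * sqrt ((R + 1)\<^sup>2 - Y)" "g \<ge> 0"
proof -
  define u where "u = q / (R + 1)\<^sup>2"
  have R1: "R + 1 > 0" "(R + 1)\<^sup>2 > 0" using R by auto
  have u: "0 \<le> u" "u \<le> 1" using q R1 by (auto simp: u_def divide_le_eq_1)
  have \<theta>: "\<theta> = 1 - u / (2 * (R + 1))" by (simp add: \<theta>_def u_def power2_eq_square power3_eq_cube)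
  have "u / (2 * (R + 1)) \<le> 1" using u R by (simp add: pos_divide_le_eq)
  moreover have "u / (2 * (R + 1)) \<ge> 0" using u R by simp
  ultimately have \<theta>01: "0 \<le> \<theta>" "\<theta> \<le> 1" by (auto simp: \<theta>)
  have "1 - u \<le> (1 - u / 2)\<^sup>2" by (simp add: power2_eq_square algebra_simps)
  then have "sqrt (1 - u) \<le> 1 - u / 2" using u by (intro real_le_lsqrt) auto
  moreover have "(R + 1) * \<theta> = R + (1 - u / 2)" using R1 by (simp add: \<theta> field_simps)
  ultimately have g: "g \<le> (R + 1) * \<theta>" by (simp add: g_def u_def)
  show g0: "g \<ge> 0" using R u by (simp add: g_def u_def[symmetric])
  have "g\<^sup>2 - Y \<le> ((R + 1) * \<theta>)\<^sup>2 - Y" using power_mono[OF g g0, of 2] by simp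
  also have "\<dots> \<le> \<theta>\<^sup>2 * ((R + 1)\<^sup>2 - Y)"
  proof -
    have "\<theta>\<^sup>2 * Y \<le> 1 * Y" using \<theta>01 Y by (intro mult_right_mono) (auto simp: power_le_one)
    then show ?thesis by (simp add: power_mult_distrib right_diff_distrib mult.commute)
  qed
  finally have "sqrt (g\<^sup>2 - Y) \<le> sqrt (\<theta>\<^sup>2 * ((R + 1)\<^sup>2 - Y))" by (rule real_sqrt_le_mono)
  also have "\<dots> = \<theta> * sqrt ((R + 1)\<^sup>2 - Y)" using \<theta>01 by (simp add: real_sqrt_mult)
  finally show "sqrt (g\<^sup>2 - Y) \<le> \<theta> * sqrt ((R + 1)\<^sup>2 - Y)" .
  show "0 \<le> \<theta>" by (rule \<theta>01)
qed

text \<open>\<open>l1\<close> and \<open>l2\<close> are the dilation factors of the two radii in the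
  parallel body. Measuring \<open>t\<close> in units of the larger one, \<open>l1\<close>, reduces
  the fibre to the undilated one, times the correction from the two factors
  \<open>\<theta>1^a\<close> and \<open>\<theta>2^b\<close>.\<close>

lemma fibre_upper:
  fixes a b :: nat and s c t l1 l2 R1 R2 g1 g2 \<tau> L :: real
  assumes ab: "0 < a" "a \<le> b" and sc: "s\<^sup>2 + c\<^sup>2 = 1" and l: "l2 > 0" "l2 \<le> l1"
    and R: "l1 * sqrt a = R1 + 1" "l2 * sqrt b = R2 + 1" "R1 \<ge> 0" "R2 \<ge> 0"
  defines "g1 \<equiv> R1 + sqrt (1 - (s * c * t)\<^sup>2 / (R1 + 1)\<^sup>2)" and "g2 \<equiv> R2 + sqrt (1 - (s * c * t)\<^sup>2 / (R2 + 1)\<^sup>2)"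
    and "\<tau> \<equiv> t / l1" and "L \<equiv> (1 / sqrt a + 1 / sqrt b) / l1"
  assumes t: "\<bar>c * t\<bar> \<le> g1" "\<bar>s * t\<bar> \<le> g2"
  shows "c\<^sup>2 * \<tau>\<^sup>2 \<le> a" "s\<^sup>2 * \<tau>\<^sup>2 \<le> b"
    "sqrt (g1\<^sup>2 - (c * t)\<^sup>2) ^ a * sqrt (g2\<^sup>2 - (s * t)\<^sup>2) ^ b \<le> (l1 * sqrt a) ^ a * (l2 * sqrt b) ^ b *
      (sqrt (1 - c\<^sup>2 * \<tau>\<^sup>2 / a) ^ a * sqrt (1 - s\<^sup>2 * \<tau>\<^sup>2 / b) ^ b * (1 - s\<^sup>2 * c\<^sup>2 * \<tau>\<^sup>2 / 2 * L + (a * L / 2)\<^sup>2 / 2))"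
proof -
  have l1: "l1 > 0" using l by simp
  have bp: "real a > 0" "real b > 0" using ab by auto
  have sq: "(sqrt a)\<^sup>2 = a" "(sqrt b)\<^sup>2 = b" "sqrt a > 0" "sqrt b > 0" using bp by auto
  have ct_l: "c * t = l1 * (c * \<tau>)" "s * t = l1 * (s * \<tau>)" "s * c * t = l1 * (s * c * \<tau>)" using l1 by (simp_all add: \<tau>_def)
  have s1: "s\<^sup>2 \<le> 1" "c\<^sup>2 \<le> 1" using sc zero_le_power2[of c] zero_le_power2[of s] by linarith+
  define q where "q = (s * c * t)\<^sup>2"
  have sqrt1: "sqrt (1 - q / z\<^sup>2) \<le> 1" for z by (simp add: q_def)
  have ct: "\<bar>c * t\<bar> \<le> R1 + 1" "\<bar>s * t\<bar> \<le> R2 + 1"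
    using t sqrt1[of "R1 + 1"] sqrt1[of "R2 + 1"] unfolding g1_def g2_def q_def by linarith+
  have sq2: "(c * t)\<^sup>2 \<le> (R1 + 1)\<^sup>2" "(s * t)\<^sup>2 \<le> (R2 + 1)\<^sup>2"
    using power_mono[OF ct(1), of 2] power_mono[OF ct(2), of 2] by auto
  have q1: "q \<le> (R1 + 1)\<^sup>2"
  proof -
    have "q = s\<^sup>2 * (c * t)\<^sup>2" by (simp add: q_def power_mult_distrib)
    also have "\<dots> \<le> 1 * (R1 + 1)\<^sup>2" using s1 sq2 by (intro mult_mono) auto
    finally show ?thesis by simp
  qed
  have q2: "q \<le> (R2 + 1)\<^sup>2"
  proof -
    have "q = c\<^sup>2 * (s * t)\<^sup>2" by (simp add: q_def power_mult_distrib)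
    also have "\<dots> \<le> 1 * (R2 + 1)\<^sup>2" using s1 sq2 by (intro mult_mono) auto
    finally show ?thesis by simp
  qed
  have q0: "q \<ge> 0" by (simp add: q_def)
  define k0 where "k0 = s\<^sup>2 * c\<^sup>2 * \<tau>\<^sup>2 / 2"
  have k0: "k0 \<ge> 0" by (simp add: k0_def)
  have qk: "q = 2 * k0 * l1\<^sup>2" unfolding q_def k0_def ct_l power_mult_distrib by simp
  have R1sq: "(R1 + 1)\<^sup>2 = l1\<^sup>2 * a" "(R2 + 1)\<^sup>2 = l2\<^sup>2 * b" unfolding R(1,2)[symmetric] power_mult_distrib sq by simp_all
  have ctl: "(c * t)\<^sup>2 = l1\<^sup>2 * (c\<^sup>2 * \<tau>\<^sup>2)" "(s * t)\<^sup>2 = l1\<^sup>2 * (s\<^sup>2 * \<tau>\<^sup>2)"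
    unfolding ct_l power_mult_distrib by simp_all
  have l12: "l2\<^sup>2 \<le> l1\<^sup>2" using l by (intro power_mono) auto
  show c\<tau>: "c\<^sup>2 * \<tau>\<^sup>2 \<le> a" using sq2(1) l1 unfolding R1sq ctl by (simp add: mult_le_cancel_left_pos)
  have "l1\<^sup>2 * (s\<^sup>2 * \<tau>\<^sup>2) \<le> l1\<^sup>2 * b"
    using sq2(2) l12 bp unfolding R1sq ctl by (meson mult_right_mono less_imp_le order_trans)
  then show s\<tau>: "s\<^sup>2 * \<tau>\<^sup>2 \<le> b" using l1 by (simp add: mult_le_cancel_left_pos)
  define \<theta>1 \<theta>2 where "\<theta>1 = 1 - q / (2 * (R1 + 1) ^ 3)" and "\<theta>2 = 1 - q / (2 * (R2 + 1) ^ 3)"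
  define F1 F2 where "F1 = sqrt (1 - c\<^sup>2 * \<tau>\<^sup>2 / a)" and "F2 = sqrt (1 - s\<^sup>2 * \<tau>\<^sup>2 / b)"
  note bc1 = bulge_component[OF R(3) q0 q1 zero_le_power2[of "c * t"], folded \<theta>1_def, unfolded q_def, folded g1_def]
  note bc2 = bulge_component[OF R(4) q0 q2 zero_le_power2[of "s * t"], folded \<theta>2_def, unfolded q_def, folded g2_def]
  have F0: "F1 \<ge> 0" "F2 \<ge> 0" using c\<tau> s\<tau> bp by (auto simp: F1_def F2_def)
  have c1: "sqrt (g1\<^sup>2 - (c * t)\<^sup>2) \<le> \<theta>1 * (l1 * sqrt a * F1)"
  proof -
    have "(R1 + 1)\<^sup>2 - (c * t)\<^sup>2 = (l1 * sqrt a)\<^sup>2 * (1 - c\<^sup>2 * \<tau>\<^sup>2 / a)"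
      unfolding R1sq ctl unfolding power_mult_distrib sq using bp by (simp add: right_diff_distrib)
    then have "sqrt ((R1 + 1)\<^sup>2 - (c * t)\<^sup>2) = l1 * sqrt a * F1"
      using l1 sq by (simp add: F1_def real_sqrt_mult)
    then show ?thesis using bc1(2) by simp
  qed
  have c2: "sqrt (g2\<^sup>2 - (s * t)\<^sup>2) \<le> \<theta>2 * (l2 * sqrt b * F2)"
  proof -
    \<comment> \<open>Only an inequality, because \<open>t\<close> was rescaled by \<open>l1\<close>
      rather than \<open>l2\<close>; it has the right direction since
      \<open>l2 \<le> l1\<close>.\<close>
    have "(R2 + 1)\<^sup>2 - (s * t)\<^sup>2 \<le> (l2 * sqrt b)\<^sup>2 * (1 - s\<^sup>2 * \<tau>\<^sup>2 / b)"
    proof -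
      have "l2\<^sup>2 * (s\<^sup>2 * \<tau>\<^sup>2) \<le> l1\<^sup>2 * (s\<^sup>2 * \<tau>\<^sup>2)" using l12 by (intro mult_right_mono) auto
      then show ?thesis unfolding R1sq ctl unfolding power_mult_distrib sq using bp by (simp add: right_diff_distrib)
    qed
    then have "sqrt ((R2 + 1)\<^sup>2 - (s * t)\<^sup>2) \<le> sqrt ((l2 * sqrt b)\<^sup>2 * (1 - s\<^sup>2 * \<tau>\<^sup>2 / b))" by (rule real_sqrt_le_mono)
    also have "\<dots> = l2 * sqrt b * F2" using l sq by (simp add: F2_def real_sqrt_mult)
    finally have "\<theta>2 * sqrt ((R2 + 1)\<^sup>2 - (s * t)\<^sup>2) \<le> \<theta>2 * (l2 * sqrt b * F2)" using bc2(1) by (rule mult_left_mono)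
    then show ?thesis using bc2(2) by simp
  qed
  have nn: "sqrt (g1\<^sup>2 - (c * t)\<^sup>2) \<ge> 0" "sqrt (g2\<^sup>2 - (s * t)\<^sup>2) \<ge> 0"
    using power_mono[OF t(1), of 2] power_mono[OF t(2), of 2] by auto
  have "sqrt (g1\<^sup>2 - (c * t)\<^sup>2) ^ a * sqrt (g2\<^sup>2 - (s * t)\<^sup>2) ^ b \<le> (\<theta>1 * (l1 * sqrt a * F1)) ^ a * (\<theta>2 * (l2 * sqrt b * F2)) ^ b"
    using c1 c2 nn order_trans[OF nn(1) c1] by (intro mult_mono power_mono zero_le_power) auto
  also have "\<dots> = (l1 * sqrt a) ^ a * (l2 * sqrt b) ^ b * (F1 ^ a * F2 ^ b) * (\<theta>1 ^ a * \<theta>2 ^ b)"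
    by (simp only: power_mult_distrib mult_ac)
  also have "\<dots> \<le> (l1 * sqrt a) ^ a * (l2 * sqrt b) ^ b * (F1 ^ a * F2 ^ b) * (1 - s\<^sup>2 * c\<^sup>2 * \<tau>\<^sup>2 / 2 * L + (a * L / 2)\<^sup>2 / 2)"
  proof (rule mult_left_mono)
    \<comment> \<open>\<open>m\<close> factors each with relative loss
      \<open>q / (2 (l sqrt m)^3)\<close> lose \<open>k0 l1^2 / (l^3 sqrt m)\<close> in the
      exponent, at least \<open>k0 / (l1 sqrt m)\<close>. The two contributions add up to
      \<open>k0 * L\<close>.\<close>
    have pw: "\<theta> ^ m \<le> exp (- (k0 / (l1 * sqrt m)))"
      if "0 \<le> \<theta>" "\<theta> = 1 - q / (2 * (l * sqrt m) ^ 3)" "0 < l" "l \<le> l1" "0 < m" for \<theta> l :: real and m :: nat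
    proof -
      define h where "h = q / (2 * (l * sqrt m) ^ 3)"
      have r: "sqrt m > 0" "real m = sqrt m * sqrt m" using that by auto
      have "\<theta> \<le> exp (- h)" using exp_ge_add_one_self[of "- h"] that(2) by (simp add: h_def)
      then have "\<theta> ^ m \<le> exp (- h) ^ m" using that(1) by (rule power_mono)
      also have "\<dots> = exp (- (m * h))" by (simp add: exp_of_nat_mult[symmetric])
      also have "\<dots> \<le> exp (- (k0 / (l1 * sqrt m)))"
      proof -
        have "l ^ 3 \<le> l1 ^ 3" using that by (intro power_mono) auto
        then have "k0 * l ^ 3 \<le> k0 * l1 ^ 3" using k0 by (rule mult_left_mono)
        moreover have "m * h = k0 * l1\<^sup>2 / (l ^ 3 * sqrt m)"
          unfolding h_def qk power_mult_distrib using r that by (subst r(2)) (simp add: power3_eq_cube)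
        moreover have "k0 / (l1 * sqrt m) \<le> k0 * l1\<^sup>2 / (l ^ 3 * sqrt m)"
        proof -
          have "k0 / l1 \<le> k0 * l1\<^sup>2 / l ^ 3"
          proof -
            have "k0 * l ^ 3 \<le> (k0 * l1\<^sup>2) * l1" using calculation(1) by (simp add: power2_eq_square power3_eq_cube)
            then show ?thesis using that l1 by (simp add: pos_divide_le_eq pos_le_divide_eq)
          qed
          then have "k0 / l1 / sqrt m \<le> k0 * l1\<^sup>2 / l ^ 3 / sqrt m" using r by (intro divide_right_mono) auto
          then show ?thesis by simp
        qed
        ultimately show ?thesis by simp
      qed
      finally show ?thesis .
    qed
    have "\<theta>1 ^ a \<le> exp (- (k0 / (l1 * sqrt a)))"
      by (rule pw[of \<theta>1 l1 a, OF bc1(1)]) (use ab l1 in \<open>auto simp: \<theta>1_def R\<close>)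
    moreover have "\<theta>2 ^ b \<le> exp (- (k0 / (l1 * sqrt b)))"
      by (rule pw[of \<theta>2 l2 b, OF bc2(1)]) (use ab l in \<open>auto simp: \<theta>2_def R\<close>)
    ultimately have "\<theta>1 ^ a * \<theta>2 ^ b \<le> exp (- (k0 / (l1 * sqrt a))) * exp (- (k0 / (l1 * sqrt b)))"
      using bc2(1) by (intro mult_mono zero_le_power) auto
    also have "\<dots> = exp (- (k0 * L))"
      by (simp add: exp_add[symmetric] L_def add_divide_distrib distrib_left mult.commute)
    also have "\<dots> \<le> 1 - s\<^sup>2 * c\<^sup>2 * \<tau>\<^sup>2 / 2 * L + (a * L / 2)\<^sup>2 / 2"
      unfolding k0_def by (rule deficit_exp_le[OF sc c\<tau>]) (use l1 sq in \<open>simp add: L_def\<close>)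
    finally show "\<theta>1 ^ a * \<theta>2 ^ b \<le> 1 - s\<^sup>2 * c\<^sup>2 * \<tau>\<^sup>2 / 2 * L + (a * L / 2)\<^sup>2 / 2" .
    show "0 \<le> (l1 * sqrt a) ^ a * (l2 * sqrt b) ^ b * (F1 ^ a * F2 ^ b)"
      using l l1 F0 by (intro mult_nonneg_nonneg zero_le_power) auto
  qed
  finally show "sqrt (g1\<^sup>2 - (c * t)\<^sup>2) ^ a * sqrt (g2\<^sup>2 - (s * t)\<^sup>2) ^ b \<le> (l1 * sqrt a) ^ a * (l2 * sqrt b) ^ b *
      (sqrt (1 - c\<^sup>2 * \<tau>\<^sup>2 / a) ^ a * sqrt (1 - s\<^sup>2 * \<tau>\<^sup>2 / b) ^ b * (1 - s\<^sup>2 * c\<^sup>2 * \<tau>\<^sup>2 / 2 * L + (a * L / 2)\<^sup>2 / 2))"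
    unfolding F1_def F2_def by (simp only: mult.assoc)
qed

lemma nn_integral_scaled_indicator:
  fixes f :: "real \<Rightarrow> real"
  assumes int: "integrable lborel (\<lambda>t. indicator J t * f t)" and nn: "\<And>t. t \<in> J \<Longrightarrow> f t \<ge> 0" and "L > 0" "W \<ge> 0"
  shows "(\<integral>\<^sup>+t. indicator J (t / L) * ennreal (W * f (t / L)) \<partial>lborel) = ennreal (L * (W * (LBINT t. indicator J t * f t)))"
proof -
  define h where "h t = ennreal (W * (indicator J t * f t))" for t
  have h: "indicator J t * ennreal (W * f t) = h t" for t by (simp add: h_def indicator_def)
  have [measurable]: "(\<lambda>t. indicator J t * f t) \<in> borel_measurable borel" using borel_measurable_integrable[OF int] by simp
  have [measurable]: "h \<in> borel_measurable borel" unfolding h_def by measurable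
  have "(\<integral>\<^sup>+t. h (t / L) \<partial>lborel) = ennreal \<bar>L\<bar> * (\<integral>\<^sup>+t. h ((0 + L * t) / L) \<partial>lborel)"
    by (rule nn_integral_real_affine) (use assms in auto)
  also have "\<dots> = ennreal L * (\<integral>\<^sup>+t. h t \<partial>lborel)" using assms by simp
  also have "(\<integral>\<^sup>+t. h t \<partial>lborel) = ennreal (LBINT t. W * (indicator J t * f t))"
    unfolding h_def by (intro nn_integral_eq_integral integrable_mult_right int AE_I2) (use assms in \<open>auto simp: indicator_def\<close>)
  finally show ?thesis unfolding h using assms
    by (simp add: ennreal_mult'[symmetric] mult.assoc)
qed

lemma sqrt_diff_scaled:
  fixes m Z c t :: real
  assumes "m > 0" "Z > 0"
  shows "\<bar>c * t\<bar> \<le> Z * sqrt m \<longleftrightarrow> c\<^sup>2 * (t / Z)\<^sup>2 \<le> m"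
    "sqrt ((Z * sqrt m)\<^sup>2 - (c * t)\<^sup>2) = Z * sqrt m * sqrt (1 - c\<^sup>2 * (t / Z)\<^sup>2 / m)"
proof -
  have ct: "(c * t)\<^sup>2 = Z\<^sup>2 * (c\<^sup>2 * (t / Z)\<^sup>2)" using assms by (simp add: power_mult_distrib power_divide)
  have Zm: "(Z * sqrt m)\<^sup>2 = Z\<^sup>2 * m" using assms by (simp add: power_mult_distrib)
  have "\<bar>c * t\<bar> \<le> Z * sqrt m \<longleftrightarrow> (c * t)\<^sup>2 \<le> (Z * sqrt m)\<^sup>2"
    using abs_le_square_iff[of "c * t" "Z * sqrt m"] assms by simp
  also have "\<dots> \<longleftrightarrow> c\<^sup>2 * (t / Z)\<^sup>2 \<le> m" unfolding ct Zm using assms by (simp add: mult_le_cancel_left_pos)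
  finally show "\<bar>c * t\<bar> \<le> Z * sqrt m \<longleftrightarrow> c\<^sup>2 * (t / Z)\<^sup>2 \<le> m" .
  have "(Z * sqrt m)\<^sup>2 - (c * t)\<^sup>2 = (Z * sqrt m)\<^sup>2 * (1 - c\<^sup>2 * (t / Z)\<^sup>2 / m)"
    unfolding ct Zm using assms by (simp add: right_diff_distrib)
  then show "sqrt ((Z * sqrt m)\<^sup>2 - (c * t)\<^sup>2) = Z * sqrt m * sqrt (1 - c\<^sup>2 * (t / Z)\<^sup>2 / m)"
    using assms by (simp add: real_sqrt_mult)
qed

text \<open>The volume of the outer parallel body of the section is bounded fibre by fibre and
  differentiated at infinitesimal distance. Growth of the radii gives the main term with
  \<open>I0\<close>, the bulge correction the negative term with the second moment
  \<open>I2\<close>; \<open>fibre_integral\<close> bounds their combination.\<close>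

lemma section_upper:
  fixes E1 E2 :: "'a::euclidean_space set" and s c C :: real
  assumes E: "E1 \<union> E2 = Basis" "E1 \<inter> E2 = {}" "card E1 = Suc a" "card E2 = Suc b"
    and e: "e1 \<in> E1" "e2 \<in> E2" and sc: "s\<^sup>2 + c\<^sup>2 = 1" and a: "a \<ge> 6" and b: "b = a \<or> b = Suc a" and N: "N = a + b"
    and flat: "flat_constant {x. (s *\<^sub>R e1 + c *\<^sub>R e2) \<bullet> x = 0} N C"
  shows "hausdorff_measure N (radial_boundary (ball_product E1 E2 (sqrt a) (sqrt b) \<inter> {x. (s *\<^sub>R e1 + c *\<^sub>R e2) \<bullet> x = 0}))
    \<le> ennreal (C * (2 * (unit_ball_vol a * unit_ball_vol b * (sqrt a ^ a * sqrt b ^ b) * ((real a + 1) / sqrt a + sqrt b)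
        * (sqrt N * semicircle_integral N * (1 - 9/4 * (real N + 2) / ((real N + 3) * (real N + 5) * (real N + 7)))))))"
proof -
  let ?\<alpha> = "s *\<^sub>R e1 + c *\<^sub>R e2" and ?w = "c *\<^sub>R e1 - s *\<^sub>R e2"
  let ?T = "{x. ?\<alpha> \<bullet> x = 0}"
  have T: "subspace ?T" by (rule subspace_hyperplane)
  have ab: "a > 0" "b > 0" "a \<le> b" and rab: "real a > 0" "real b > 0" using a b by auto
  have C0: "C > 0" using flat by (simp add: flat_constant_def)
  have EB: "E1 \<subseteq> Basis" "E2 \<subseteq> Basis" "e1 \<in> Basis" "e2 \<in> Basis" "e1 \<noteq> e2" "e1 \<notin> E2" "e2 \<notin> E1" using E e by auto
  have sc': "s * s + c * c = 1" using sc by (simp add: power2_eq_square)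
  have \<alpha>1: "norm ?\<alpha> = 1"
    using sc' EB by (simp add: norm_eq_1 inner_add_left inner_add_right inner_Basis)
  define r1 r2 where "r1 = sqrt a" and "r2 = sqrt b"
  have r: "r1 > 0" "r2 > 0" using rab by (auto simp: r1_def r2_def)
  have r12: "r1 \<le> r2" using ab by (simp add: r1_def r2_def)
  define J where "J = {t. c\<^sup>2 * t\<^sup>2 \<le> real a \<and> s\<^sup>2 * t\<^sup>2 \<le> real b}"
  define F where "F t = sqrt (1 - c\<^sup>2 * t\<^sup>2 / real a) ^ a * sqrt (1 - s\<^sup>2 * t\<^sup>2 / real b) ^ b" for t
  have i1: "integrable lborel (\<lambda>t. indicator J t * F t)"
    unfolding J_def F_def by (rule fibre_integral(2)[OF a b N sc])
  have i2: "integrable lborel (\<lambda>t. indicator J t * (t\<^sup>2 * F t))"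
    unfolding J_def F_def by (rule fibre_integral(3)[OF a b N sc])
  define I0 I2 where "I0 = (LBINT t. indicator J t * F t)" and "I2 = (LBINT t. indicator J t * (t\<^sup>2 * F t))"
  have I: "I0 - s\<^sup>2 * c\<^sup>2 / (real N + 1) * I2
      \<le> sqrt N * semicircle_integral N * (1 - 9/4 * (real N + 2) / ((real N + 3) * (real N + 5) * (real N + 7)))"
    using fibre_integral(4)[OF a b N sc] unfolding I0_def I2_def J_def F_def by (simp add: add.commute)
  have F0: "F t \<ge> 0" if "t \<in> J" for t
    using that rab unfolding J_def F_def by (intro mult_nonneg_nonneg zero_le_power) auto
  have I00: "I0 \<ge> 0" unfolding I0_def
    by (intro Bochner_Integration.integral_nonneg) (use F0 in \<open>auto simp: indicator_def\<close>)
  \<comment> \<open>The integral over \<open>J\<close> of the fibre majorant \<open>M l\<close>,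
    where \<open>l\<close> is the size of the bulge correction.\<close>
  define IM where "IM l = (1 + (real a * l / 2)\<^sup>2 / 2) * I0 - s\<^sup>2 * c\<^sup>2 / 2 * l * I2" for l
  define M where "M l t = F t * (1 - s\<^sup>2 * c\<^sup>2 * t\<^sup>2 / 2 * l + (real a * l / 2)\<^sup>2 / 2)" for l t
  have Meq: "indicator J t * M l t = (1 + (real a * l / 2)\<^sup>2 / 2) * (indicator J t * F t) - s\<^sup>2 * c\<^sup>2 / 2 * l * (indicator J t * (t\<^sup>2 * F t))" for l t
    by (simp add: M_def algebra_simps)
  have Mi: "integrable lborel (\<lambda>t. indicator J t * M l t)" for l
    unfolding Meq using i1 i2 by (intro Bochner_Integration.integrable_diff integrable_mult_right)
  have MI: "(LBINT t. indicator J t * M l t) = IM l" for l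
    unfolding Meq IM_def I0_def I2_def using i1 i2 by simp
  have M0: "M l t \<ge> 0" if "t \<in> J" "l \<ge> 0" for l t
  proof -
    have "exp (- (s\<^sup>2 * c\<^sup>2 * t\<^sup>2 / 2 * l)) \<le> 1 - s\<^sup>2 * c\<^sup>2 * t\<^sup>2 / 2 * l + (real a * l / 2)\<^sup>2 / 2"
      using that by (intro deficit_exp_le[OF sc]) (auto simp: J_def)
    then have "0 \<le> 1 - s\<^sup>2 * c\<^sup>2 * t\<^sup>2 / 2 * l + (real a * l / 2)\<^sup>2 / 2" using exp_ge_zero order_trans by blast
    then show ?thesis unfolding M_def using F0[OF that(1)] by simp
  qed
  have IM0: "IM l \<ge> 0" if "l \<ge> 0" for l
    unfolding MI[symmetric] by (intro Bochner_Integration.integral_nonneg) (use M0 that in \<open>auto simp: indicator_def\<close>)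
  define kab where "kab = 2 * unit_ball_vol (real a) * unit_ball_vol (real b)"
  have kab: "kab > 0" by (simp add: kab_def)
  define V where "V = C * kab * (r1 ^ a * r2 ^ b)"
  have V0: "V > 0" using C0 kab r by (simp add: V_def)
  define L' where "L' = 1 / r1 + 1 / r2"
  have L'0: "L' > 0" using r by (simp add: L'_def add_pos_pos)
  \<comment> \<open>Growth factors of the two radii in the undilated picture: \<open>1 + x^2\<close>
    from the polytope approximation, and a distance \<open>x\<close> relative to the radius.\<close>
  define m1 m2 where "m1 x = 1 + x\<^sup>2 + x / r1" and "m2 x = 1 + x\<^sup>2 + x / r2" for x
  have m0: "m1 x > 0" "m2 x > 0" if "x > 0" for x
    using that r unfolding m1_def m2_def by (auto intro!: add_pos_pos add_pos_nonneg)
  \<comment> \<open>The power of \<open>m1 x\<close> exceeds the fibre dimension \<open>a\<close> by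
    one: this is the Jacobian of \<open>t = l1 * \<tau>\<close>, and the source of
    \<open>(a + 1) / sqrt a\<close> beside \<open>sqrt b\<close> in the bound.\<close>
  define B where "B x = V * (m1 x ^ Suc a * m2 x ^ b * IM (L' * (x / m1 x)))" for x
  let ?H = "hausdorff_measure N (radial_boundary (ball_product E1 E2 r1 r2 \<inter> ?T))"
  have le: "ennreal x * ?H + ennreal (V * I0) \<le> ennreal (B x)" if x: "0 < x" "x < 1" for x
  proof -
    define Z where "Z = 1 / x"
    have Z: "Z > 0" using x by (simp add: Z_def)
    define l1 l2 where "l1 = m1 x / x" and "l2 = m2 x / x"
    have l: "l1 > 0" "l2 > 0" using m0[OF x(1)] x by (auto simp: l1_def l2_def)
    have l21: "l2 \<le> l1"
    proof -
      have "x / r2 \<le> x / r1" using x r r12 by (intro divide_left_mono) auto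
      then show ?thesis using x unfolding l1_def l2_def m1_def m2_def by (intro divide_right_mono) auto
    qed
    define R1 R2 where "R1 = (1 + x\<^sup>2) * (Z * r1)" and "R2 = (1 + x\<^sup>2) * (Z * r2)"
    have R0: "R1 \<ge> 0" "R2 \<ge> 0" using Z r by (auto simp: R1_def R2_def)
    have lR: "l1 * r1 = R1 + 1" "l2 * r2 = R2 + 1"
      using x r by (simp_all add: l1_def l2_def m1_def m2_def R1_def R2_def Z_def field_simps)
    define g1 g2 where "g1 t = R1 + sqrt (1 - (s * c * t)\<^sup>2 / (R1 + 1)\<^sup>2)" and "g2 t = R2 + sqrt (1 - (s * c * t)\<^sup>2 / (R2 + 1)\<^sup>2)" for t
    define D where "D = ball_product E1 E2 (Z * r1) (Z * r2) \<inter> ?T"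
    have DZ: "D = (\<lambda>x. Z *\<^sub>R x) ` (ball_product E1 E2 r1 r2 \<inter> ?T)"
      unfolding D_def by (rule scaleR_ball_product[OF Z T, symmetric])
    have cD: "compact D" unfolding D_def
      by (intro compact_Int_closed compact_ball_product[OF E(1,2)] closed_hyperplane)
    have body: "rel_body ?T D" unfolding D_def
      by (rule rel_body_Int[OF convex_ball_product compact_ball_product[OF E(1,2)] cball_subset_ball_product[OF EB(1,2)] _ T]) (use Z r in simp)
    have Deq: "D = {p. ?\<alpha> \<bullet> p = 0 \<and> norm (coord_proj E1 p) \<le> Z * r1 \<and> norm (coord_proj E2 p) \<le> Z * r2}"
      by (auto simp: D_def ball_product_def)
    define W where "W = {p. ?\<alpha> \<bullet> p = 0 \<and> norm (coord_proj E1 p) \<le> g1 (p \<bullet> ?w) \<and> norm (coord_proj E2 p) \<le> g2 (p \<bullet> ?w)}"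
    have g1le: "g1 t \<le> R1 + 1" "g2 t \<le> R2 + 1" for t by (simp_all add: g1_def g2_def)
    have cW: "compact W"
    proof -
      have "R1 + 1 \<noteq> 0" "R2 + 1 \<noteq> 0" using R0 by auto
      then have "closed W" unfolding W_def g1_def g2_def
        by (intro closed_Collect_conj closed_Collect_le closed_Collect_eq continuous_intros) auto
      moreover have "W \<subseteq> ball_product E1 E2 (R1 + 1) (R2 + 1)"
        unfolding W_def ball_product_def using g1le order_trans by blast
      ultimately show ?thesis
        by (meson bounded_subset compact_ball_product[OF E(1,2)] compact_eq_bounded_closed)
    qed
    have near: "y \<in> W" if y: "y \<in> ?T" and z: "z \<in> D" and d: "dist y ((1 + x\<^sup>2) *\<^sub>R z) \<le> 1" for y z
    proof -
      let ?z = "(1 + x\<^sup>2) *\<^sub>R z" and ?t = "y \<bullet> ?w"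
      have \<alpha>y: "?\<alpha> \<bullet> y = 0" "?\<alpha> \<bullet> ?z = 0" using y z by (auto simp: D_def)
      have x1: "1 + x\<^sup>2 \<ge> 0" by simp
      have nz: "norm (coord_proj E1 ?z) \<le> R1" "norm (coord_proj E2 ?z) \<le> R2"
        using z x1 unfolding R1_def R2_def linear_scale[OF linear_coord_proj] norm_scaleR
        by (auto simp: D_def ball_product_def abs_of_nonneg intro!: mult_left_mono)
      have ye: "y \<bullet> e1 = c * ?t" "y \<bullet> e2 = - (s * ?t)"
      proof -
        have sy: "s * (y \<bullet> e1) + c * (y \<bullet> e2) = 0"
        proof -
          have "s * (e1 \<bullet> y) + c * (e2 \<bullet> y) = 0" using \<alpha>y(1) by (simp add: inner_add_left)
          then show ?thesis by (metis inner_commute)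
        qed
        have t: "?t = c * (y \<bullet> e1) - s * (y \<bullet> e2)" by (simp add: inner_diff_right)
        have "c * ?t = (s * s + c * c) * (y \<bullet> e1) - s * (s * (y \<bullet> e1) + c * (y \<bullet> e2))" unfolding t by (simp add: algebra_simps)
        then show "y \<bullet> e1 = c * ?t" unfolding sy sc' by simp
        have "- (s * ?t) = (s * s + c * c) * (y \<bullet> e2) - c * (s * (y \<bullet> e1) + c * (y \<bullet> e2))" unfolding t by (simp add: algebra_simps)
        then show "y \<bullet> e2 = - (s * ?t)" unfolding sy sc' by simp
      qed
      \<comment> \<open>The projections onto the two factors have opposite components along the
        normal, so \<open>g1\<close> and \<open>g2\<close> contain the same square
        \<open>(s c t)^2\<close>.\<close>
      have p\<alpha>: "coord_proj E1 y \<bullet> ?\<alpha> = s * c * ?t" "coord_proj E2 y \<bullet> ?\<alpha> = - (s * c * ?t)"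
        using e EB ye by (simp_all add: inner_add_right coord_proj_inner del: inner_diff_right)
      have "norm (coord_proj E1 y) \<le> R1 + sqrt (1 - (coord_proj E1 y \<bullet> ?\<alpha>)\<^sup>2 / (R1 + 1)\<^sup>2)"
        by (rule coord_proj_bulge[OF EB(1) \<alpha>1 _ _ nz(1)]) (use \<alpha>y d in \<open>simp_all add: dist_norm\<close>)
      moreover have "norm (coord_proj E2 y) \<le> R2 + sqrt (1 - (coord_proj E2 y \<bullet> ?\<alpha>)\<^sup>2 / (R2 + 1)\<^sup>2)"
        by (rule coord_proj_bulge[OF EB(2) \<alpha>1 _ _ nz(2)]) (use \<alpha>y d in \<open>simp_all add: dist_norm\<close>)
      ultimately show ?thesis using \<alpha>y unfolding p\<alpha> by (simp only: W_def g1_def g2_def power2_minus mem_Collect_eq simp_thms)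
    qed
    have up: "hausdorff_measure N (radial_boundary D) + ennreal C * emeasure lborel (cylinder ?T D) \<le> ennreal C * emeasure lborel (cylinder ?T W)"
      by (rule flat_constant_upper[OF body flat _ cW near, of "x\<^sup>2"]) (use x in simp_all)
    \<comment> \<open>The dilated section itself needs a lower bound of its volume, as it stands on
      the smaller side of the estimate; its fibres have constant radii, without bulge.\<close>
    have lowD: "ennreal (Z * (kab * ((Z * r1) ^ a * (Z * r2) ^ b) * I0)) \<le> emeasure lborel (cylinder ?T D)"
    proof -
      have "ennreal (Z * (kab * ((Z * r1) ^ a * (Z * r2) ^ b) * I0))
          = (\<integral>\<^sup>+t. indicator J (t / Z) * ennreal (kab * ((Z * r1) ^ a * (Z * r2) ^ b) * F (t / Z)) \<partial>lborel)"
        unfolding I0_def using nn_integral_scaled_indicator[OF i1 F0 Z, of "kab * ((Z * r1) ^ a * (Z * r2) ^ b)"] kab Z r by simp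
      also have "\<dots> \<le> (\<integral>\<^sup>+t. indicator {t. \<bar>c * t\<bar> \<le> Z * r1 \<and> \<bar>s * t\<bar> \<le> Z * r2} t *
        ennreal (kab * (sqrt ((Z * r1)\<^sup>2 - (c * t)\<^sup>2) ^ a * sqrt ((Z * r2)\<^sup>2 - (s * t)\<^sup>2) ^ b)) \<partial>lborel)"
      proof (rule nn_integral_mono)
        fix t
        show "indicator J (t / Z) * ennreal (kab * ((Z * r1) ^ a * (Z * r2) ^ b) * F (t / Z)) \<le>
          indicator {t. \<bar>c * t\<bar> \<le> Z * r1 \<and> \<bar>s * t\<bar> \<le> Z * r2} t *
          ennreal (kab * (sqrt ((Z * r1)\<^sup>2 - (c * t)\<^sup>2) ^ a * sqrt ((Z * r2)\<^sup>2 - (s * t)\<^sup>2) ^ b))"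
        proof (cases "t / Z \<in> J")
          case True
          then have "\<bar>c * t\<bar> \<le> Z * r1 \<and> \<bar>s * t\<bar> \<le> Z * r2"
            using sqrt_diff_scaled(1)[OF rab(1) Z, of c t] sqrt_diff_scaled(1)[OF rab(2) Z, of s t] by (simp add: J_def r1_def r2_def)
          moreover have "sqrt ((Z * r1)\<^sup>2 - (c * t)\<^sup>2) ^ a * sqrt ((Z * r2)\<^sup>2 - (s * t)\<^sup>2) ^ b = (Z * r1) ^ a * (Z * r2) ^ b * F (t / Z)"
            unfolding r1_def r2_def sqrt_diff_scaled(2)[OF rab(1) Z] sqrt_diff_scaled(2)[OF rab(2) Z] F_def
            by (simp only: power_mult_distrib mult_ac)
          ultimately show ?thesis using True by (simp add: mult.assoc)
        qed simp
      qed
      also have "\<dots> = emeasure lborel (cylinder ?T D)"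
        unfolding kab_def by (rule section_fibred[where ?g1.0 = "\<lambda>_. Z * r1" and ?g2.0 = "\<lambda>_. Z * r2", OF E ab(1,2) e sc Deq cD, symmetric])
      finally show ?thesis .
    qed
    have Lq: "L' / l1 \<ge> 0" using L'0 l by simp
    have upW: "emeasure lborel (cylinder ?T W) \<le> ennreal (l1 * (kab * ((l1 * r1) ^ a * (l2 * r2) ^ b) * IM (L' / l1)))"
    proof -
      have "emeasure lborel (cylinder ?T W) = (\<integral>\<^sup>+t. indicator {t. \<bar>c * t\<bar> \<le> g1 t \<and> \<bar>s * t\<bar> \<le> g2 t} t *
        ennreal (kab * (sqrt ((g1 t)\<^sup>2 - (c * t)\<^sup>2) ^ a * sqrt ((g2 t)\<^sup>2 - (s * t)\<^sup>2) ^ b)) \<partial>lborel)"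
        unfolding kab_def by (rule section_fibred[where ?g1.0 = g1 and ?g2.0 = g2, OF E ab(1,2) e sc W_def cW])
      also have "\<dots> \<le> (\<integral>\<^sup>+t. indicator J (t / l1) * ennreal (kab * ((l1 * r1) ^ a * (l2 * r2) ^ b) * M (L' / l1) (t / l1)) \<partial>lborel)"
      proof (rule nn_integral_mono)
        fix t
        show "indicator {t. \<bar>c * t\<bar> \<le> g1 t \<and> \<bar>s * t\<bar> \<le> g2 t} t *
          ennreal (kab * (sqrt ((g1 t)\<^sup>2 - (c * t)\<^sup>2) ^ a * sqrt ((g2 t)\<^sup>2 - (s * t)\<^sup>2) ^ b))
          \<le> indicator J (t / l1) * ennreal (kab * ((l1 * r1) ^ a * (l2 * r2) ^ b) * M (L' / l1) (t / l1))"
        proof (cases "\<bar>c * t\<bar> \<le> g1 t \<and> \<bar>s * t\<bar> \<le> g2 t")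
          case True
          note fu = fibre_upper[OF ab(1,3) sc l(2) l21 lR[unfolded r1_def r2_def] R0, of t, folded g1_def g2_def r1_def r2_def]
          have "t / l1 \<in> J" using fu(1,2) True by (simp add: J_def)
          moreover have "sqrt ((g1 t)\<^sup>2 - (c * t)\<^sup>2) ^ a * sqrt ((g2 t)\<^sup>2 - (s * t)\<^sup>2) ^ b
              \<le> (l1 * r1) ^ a * (l2 * r2) ^ b * M (L' / l1) (t / l1)"
            using fu(3) True unfolding M_def F_def L'_def by simp
          then have "kab * (sqrt ((g1 t)\<^sup>2 - (c * t)\<^sup>2) ^ a * sqrt ((g2 t)\<^sup>2 - (s * t)\<^sup>2) ^ b)
              \<le> kab * ((l1 * r1) ^ a * (l2 * r2) ^ b) * M (L' / l1) (t / l1)"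
            using kab by (simp add: mult.assoc)
          ultimately show ?thesis using True by (simp add: ennreal_leI)
        qed simp
      qed
      also have "\<dots> = ennreal (l1 * (kab * ((l1 * r1) ^ a * (l2 * r2) ^ b) * IM (L' / l1)))"
        unfolding MI[symmetric] by (rule nn_integral_scaled_indicator[OF Mi M0 l(1)]) (use kab l r Lq in auto)
      finally show ?thesis .
    qed
    have "ennreal (x ^ Suc N) * (ennreal ((1 / x) ^ N) * ?H) + ennreal (x ^ Suc N) * (ennreal C * ennreal (Z * (kab * ((Z * r1) ^ a * (Z * r2) ^ b) * I0)))
        \<le> ennreal (x ^ Suc N) * (hausdorff_measure N (radial_boundary D) + ennreal C * emeasure lborel (cylinder ?T D))"
      unfolding distrib_left[of "ennreal (x ^ Suc N)"] DZ hausdorff_radial_boundary_scale[OF Z]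
      using lowD[unfolded DZ] by (intro add_mono mult_left_mono) (auto simp: Z_def)
    also have "\<dots> \<le> ennreal (x ^ Suc N) * (ennreal C * ennreal (l1 * (kab * ((l1 * r1) ^ a * (l2 * r2) ^ b) * IM (L' / l1))))"
      using order_trans[OF up mult_left_mono[OF upW zero_le]] by (rule mult_left_mono) simp
    also have "\<dots> = ennreal (B x)"
    proof -
      have "x ^ Suc N * (C * (l1 * (kab * ((l1 * r1) ^ a * (l2 * r2) ^ b) * IM (L' / l1)))) = V * ((x * l1) ^ Suc a * (x * l2) ^ b * IM (L' / l1))"
        unfolding V_def N by (simp add: power_mult_distrib power_add mult_ac)
      moreover have "x * l1 = m1 x" "x * l2 = m2 x" "L' / l1 = L' * (x / m1 x)" using x by (auto simp: l1_def l2_def)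
      ultimately have "B x = x ^ Suc N * (C * (l1 * (kab * ((l1 * r1) ^ a * (l2 * r2) ^ b) * IM (L' / l1))))" by (simp only: B_def)
      then show ?thesis using x C0 by (simp only: ennreal_mult' zero_le_power less_imp_le)
    qed
    also have "ennreal (x ^ Suc N) * (ennreal C * ennreal (Z * (kab * ((Z * r1) ^ a * (Z * r2) ^ b) * I0))) = ennreal (V * I0)"
    proof -
      have "x ^ Suc N * (C * (Z * (kab * ((Z * r1) ^ a * (Z * r2) ^ b) * I0))) = V * ((x * Z) ^ Suc a * (x * Z) ^ b * I0)"
        unfolding V_def N by (simp add: power_mult_distrib power_add mult_ac)
      also have "\<dots> = V * I0" using x by (simp add: Z_def)
      finally show ?thesis using x C0 by (simp only: ennreal_mult'[symmetric] zero_le_power less_imp_le)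
    qed
    finally show ?thesis using ennreal_mult_cancel_scale[OF x(1), of N] by simp
  qed
  have dm1: "(m1 has_real_derivative 1 / r1) (at 0)" unfolding m1_def using r by (auto intro!: derivative_eq_intros)
  have dm2: "(m2 has_real_derivative 1 / r2) (at 0)" unfolding m2_def using r by (auto intro!: derivative_eq_intros)
  have m10: "m1 0 = 1" "m2 0 = 1" by (auto simp: m1_def m2_def)
  define f where "f x = L' * (x / m1 x)" for x
  have df: "(f has_real_derivative L') (at 0)"
    unfolding f_def using dm1 by (auto intro!: derivative_eq_intros simp: m10)
  have f0: "f 0 = 0" by (simp add: f_def)
  \<comment> \<open>The quadratic remainder of the exponential has derivative 0, so only the second
    moment survives.\<close>
  have dIM: "((\<lambda>x. IM (f x)) has_real_derivative - (s\<^sup>2 * c\<^sup>2 / 2 * L' * I2)) (at 0)"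
    unfolding IM_def using df by (auto intro!: derivative_eq_intros simp: f0)
  have IM00: "IM (f 0) = I0" by (simp add: f0 IM_def)
  have dP: "((\<lambda>x. m1 x ^ Suc a * m2 x ^ b) has_real_derivative (real (Suc a) / r1 + real b / r2)) (at 0)"
    using DERIV_mult[OF DERIV_power[OF dm1, of "Suc a"] DERIV_power[OF dm2, of b]] by (simp add: m10 del: of_nat_Suc power_Suc)
  have dB: "(B has_real_derivative V * ((real (Suc a) / r1 + real b / r2) * I0 - s\<^sup>2 * c\<^sup>2 / 2 * L' * I2)) (at 0)"
    unfolding B_def f_def[symmetric]
    using DERIV_cmult[OF DERIV_mult[OF dP dIM], of V] by (simp add: m10 IM00 algebra_simps del: of_nat_Suc)
  have "?H \<le> ennreal (V * ((real (Suc a) / r1 + real b / r2) * I0 - s\<^sup>2 * c\<^sup>2 / 2 * L' * I2) - 0)"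
  proof (rule ennreal_derivative_ge[OF le zero_less_one _ _ _ _ dB])
    show "V * I0 \<ge> 0" using V0 I00 by simp
    show "B x \<ge> 0" if "0 < x" for x unfolding B_def
      using V0 m0[OF that] L'0 that by (intro mult_nonneg_nonneg zero_le_power IM0 divide_nonneg_nonneg) auto
    show "V * I0 = B 0" by (simp add: B_def m10 IM_def)
  qed auto
  also have "V * ((real (Suc a) / r1 + real b / r2) * I0 - s\<^sup>2 * c\<^sup>2 / 2 * L' * I2) - 0
      = C * (2 * (unit_ball_vol a * unit_ball_vol b * (r1 ^ a * r2 ^ b) * ((real a + 1) / r1 + r2) * (I0 - s\<^sup>2 * c\<^sup>2 / (real N + 1) * I2)))"
  proof -
    have br: "real b / r2 = r2" using rab by (simp add: r2_def real_div_sqrt)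
    define \<Lambda> where "\<Lambda> = (real a + 1) / r1 + r2"
    have rr: "real a = r1 * r1" "real b = r2 * r2" using rab by (auto simp: r1_def r2_def)
    \<comment> \<open>In both parities the radii make \<open>2 * \<Lambda> / L'\<close> equal to
      \<open>N + 1\<close>. Thus \<open>\<Lambda>\<close> factors out of the derivative and leaves
      the combination with coefficient \<open>s^2 c^2 / (N + 1)\<close> that
      \<open>fibre_integral\<close> estimates.\<close>
    have L'\<Lambda>: "L' * (real N + 1) = 2 * \<Lambda>"
      using b
    proof
      assume "b = a"
      then have "r2 = r1" "real N = 2 * (r1 * r1)" using N rr by (auto simp: r1_def r2_def)
      then show ?thesis unfolding L'_def \<Lambda>_def rr(1) using r by (simp add: field_simps)
    next
      assume bb: "b = Suc a"
      then have 1: "real a + 1 = r2 * r2" "real N + 1 = 2 * (r2 * r2)" using N rr by auto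
      show ?thesis unfolding L'_def \<Lambda>_def 1 using r by (simp add: field_simps)
    qed
    have n0: "real N + 1 > 0" by linarith
    have L'2: "L' / 2 = \<Lambda> / (real N + 1)" using L'\<Lambda> n0 by (simp add: field_simps)
    have "s\<^sup>2 * c\<^sup>2 / 2 * L' * I2 = s\<^sup>2 * c\<^sup>2 * I2 * (L' / 2)" by simp
    also have "\<dots> = \<Lambda> * (s\<^sup>2 * c\<^sup>2 / (real N + 1) * I2)" unfolding L'2 by simp
    finally have 2: "s\<^sup>2 * c\<^sup>2 / 2 * L' * I2 = \<Lambda> * (s\<^sup>2 * c\<^sup>2 / (real N + 1) * I2)" .
    have 3: "real (Suc a) / r1 + real b / r2 = \<Lambda>" unfolding br \<Lambda>_def by (simp add: add.commute)
    show ?thesis unfolding 2 3 \<Lambda>_def[symmetric] V_def kab_def by (simp add: right_diff_distrib mult_ac)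
  qed
  also have "ennreal \<dots> \<le> ennreal (C * (2 * (unit_ball_vol a * unit_ball_vol b * (r1 ^ a * r2 ^ b) * ((real a + 1) / r1 + r2)
        * (sqrt N * semicircle_integral N * (1 - 9/4 * (real N + 2) / ((real N + 3) * (real N + 5) * (real N + 7)))))))"
  proof (rule ennreal_leI)
    have "0 \<le> unit_ball_vol a * unit_ball_vol b * (r1 ^ a * r2 ^ b) * ((real a + 1) / r1 + r2)"
      using r by (intro mult_nonneg_nonneg add_nonneg_nonneg divide_nonneg_nonneg zero_le_power) auto
    note m = mult_left_mono[OF mult_left_mono[OF mult_left_mono[OF I this], of 2], of C]
    show "C * (2 * (unit_ball_vol a * unit_ball_vol b * (r1 ^ a * r2 ^ b) * ((real a + 1) / r1 + r2) * (I0 - s\<^sup>2 * c\<^sup>2 / (real N + 1) * I2)))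
      \<le> C * (2 * (unit_ball_vol a * unit_ball_vol b * (r1 ^ a * r2 ^ b) * ((real a + 1) / r1 + r2)
        * (sqrt N * semicircle_integral N * (1 - 9/4 * (real N + 2) / ((real N + 3) * (real N + 5) * (real N + 7))))))"
      by (rule m) (use C0 in auto)
  qed
  finally show ?thesis unfolding r1_def r2_def .
qed

section \<open>The two bodies\<close>

lemma subspace_coord_space: "subspace (coord_space E)"
  by (auto simp: subspace_def coord_space_def inner_add_left)

lemma dim_coord_space: "E \<subseteq> Basis \<Longrightarrow> dim (coord_space E) = card E"
proof -
  assume E: "E \<subseteq> Basis"
  have "coord_space E = {x. \<forall>i\<in>Basis. i \<notin> E \<longrightarrow> x \<bullet> i = 0}" by (auto simp: coord_space_def)
  then show ?thesis using dim_substandard[OF E] by simp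
qed

lemma basis_in_coord_space: "E \<subseteq> Basis \<Longrightarrow> e \<in> E \<Longrightarrow> e \<in> coord_space E"
  by (auto simp: coord_space_def inner_Basis subset_iff)

text \<open>A frame adapted to the direction of \<open>y\<close> inside the coordinate subspace,
  inverted. For \<open>y = 0\<close> there is no direction and \<open>e\<close> itself is
  taken.\<close>

lemma coord_space_rotation:
  fixes y :: "'a::euclidean_space"
  assumes E: "E \<subseteq> Basis" "e \<in> E" and y: "y \<in> coord_space E"
  obtains h where "orthogonal_transformation h" "\<And>z. z \<in> coord_space E \<Longrightarrow> h z \<in> coord_space E" "norm y *\<^sub>R h e = y"
proof -
  define u where "u = (if y = 0 then e else (1 / norm y) *\<^sub>R y)"
  have u: "u \<in> coord_space E" "norm u = 1" "norm y *\<^sub>R u = y"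
    using E y basis_in_coord_space[OF E] subspace_scale[OF subspace_coord_space y] by (auto simp: u_def)
  obtain k where k: "orthogonal_transformation k" "k u = e" "\<And>x. x \<in> coord_space E \<longleftrightarrow> k x \<in> coord_space E"
    using frame_exists[OF subspace_coord_space u(1,2) E(1) dim_coord_space[OF E(1), symmetric] E(2)] by metis
  obtain h where h: "orthogonal_transformation h" "\<And>x. k (h x) = x" "\<And>x. h (k x) = x"
    using orthogonal_transformation_inverse[OF k(1)] by metis
  show ?thesis
  proof (rule that[OF h(1)])
    show "h z \<in> coord_space E" if "z \<in> coord_space E" for z using that k(3)[of "h z"] by (simp add: h)
    have "h e = u" using h(3)[of u] k(2) by simp
    then show "norm y *\<^sub>R h e = y" using u by simp
  qed
qed

lemma inner_coord_space:
  fixes x y :: "'a::euclidean_space"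
  assumes "E1 \<inter> E2 = {}" "x \<in> coord_space E1" "y \<in> coord_space E2"
  shows "x \<bullet> y = 0"
proof -
  have "(x \<bullet> i) * (y \<bullet> i) = 0" if "i \<in> Basis" for i using assms that by (auto simp: coord_space_def)
  then show ?thesis unfolding euclidean_inner[of x y] by (intro sum.neutral ballI)
qed

text \<open>The product of balls is invariant under rotating each factor separately. That suffices
  to bring any unit normal to the form \<open>s e1 + c e2\<close>, with \<open>s\<close> and
  \<open>c\<close> the lengths of its two components.\<close>

lemma split_rotation:
  fixes \<alpha> :: "'a::euclidean_space"
  assumes E: "E1 \<union> E2 = Basis" "E1 \<inter> E2 = {}" and e: "e1 \<in> E1" "e2 \<in> E2" and \<alpha>: "norm \<alpha> = 1"
  obtains f s c where "orthogonal_transformation f" "s\<^sup>2 + c\<^sup>2 = 1" "f (s *\<^sub>R e1 + c *\<^sub>R e2) = \<alpha>"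
    "\<And>p. norm (coord_proj E1 (f p)) = norm (coord_proj E1 p)" "\<And>p. norm (coord_proj E2 (f p)) = norm (coord_proj E2 p)"
proof -
  have EB: "E1 \<subseteq> Basis" "E2 \<subseteq> Basis" using E by auto
  obtain h1 where h1: "orthogonal_transformation h1" "\<And>z. z \<in> coord_space E1 \<Longrightarrow> h1 z \<in> coord_space E1"
    "norm (coord_proj E1 \<alpha>) *\<^sub>R h1 e1 = coord_proj E1 \<alpha>"
    using coord_space_rotation[OF EB(1) e(1) coord_proj_in[OF EB(1)]] by metis
  obtain h2 where h2: "orthogonal_transformation h2" "\<And>z. z \<in> coord_space E2 \<Longrightarrow> h2 z \<in> coord_space E2"
    "norm (coord_proj E2 \<alpha>) *\<^sub>R h2 e2 = coord_proj E2 \<alpha>"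
    using coord_space_rotation[OF EB(2) e(2) coord_proj_in[OF EB(2)]] by metis
  define g where "g i = (if i \<in> E1 then h1 i else h2 i)" for i
  obtain f where f: "orthogonal_transformation f" "\<And>i. i \<in> Basis \<Longrightarrow> f i = g i"
  proof (rule orthogonal_transformation_of_basis[of g])
    show "g i \<bullet> g j = (if i = j then 1 else 0)" if ij: "i \<in> Basis" "j \<in> Basis" for i j
    proof -
      have x: "h1 i \<bullet> h2 j = 0" if "i \<in> E1" "j \<in> E2" for i j
        by (rule inner_coord_space[OF E(2) h1(2)[OF basis_in_coord_space[OF EB(1) that(1)]] h2(2)[OF basis_in_coord_space[OF EB(2) that(2)]]])
      consider "i \<in> E1" "j \<in> E1" | "i \<in> E1" "j \<in> E2" "j \<notin> E1" | "i \<in> E2" "i \<notin> E1" "j \<in> E1" | "i \<in> E2" "i \<notin> E1" "j \<in> E2" "j \<notin> E1"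
        using ij E by blast
      then show ?thesis
      proof cases
        case 1
        then show ?thesis using orthogonal_transformation_inner[OF h1(1)] ij by (simp add: g_def inner_Basis)
      next
        case 2
        then have "i \<noteq> j" by auto
        then show ?thesis using 2 x by (simp add: g_def)
      next
        case 3
        then have "i \<noteq> j" by auto
        then show ?thesis using 3 x[of j i] by (simp add: g_def inner_commute)
      next
        case 4
        then show ?thesis using orthogonal_transformation_inner[OF h2(1)] ij by (simp add: g_def inner_Basis)
      qed
    qed
  qed blast
  have lin: "linear f" "linear h1" "linear h2" using f(1) h1(1) h2(1) by (auto intro: orthogonal_transformation_linear)
  have f1: "f (coord_proj E1 p) = h1 (coord_proj E1 p)" for p
    unfolding coord_proj_def linear_sum[OF lin(1)] linear_sum[OF lin(2)] linear_scale[OF lin(1)] linear_scale[OF lin(2)]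
    using EB f(2) by (intro sum.cong refl) (auto simp: g_def subset_iff)
  have f2: "f (coord_proj E2 p) = h2 (coord_proj E2 p)" for p
    unfolding coord_proj_def linear_sum[OF lin(1)] linear_sum[OF lin(3)] linear_scale[OF lin(1)] linear_scale[OF lin(3)]
    using EB f(2) E(2) by (intro sum.cong refl) (auto simp: g_def subset_iff)
  have z: "coord_proj D y = 0" if "D \<inter> D' = {}" "D \<subseteq> Basis" "y \<in> coord_space D'" for D D' and y :: 'a
    unfolding coord_proj_def using that by (intro sum.neutral) (auto simp: coord_space_def)
  have P: "coord_proj E1 (f p) = f (coord_proj E1 p)" "coord_proj E2 (f p) = f (coord_proj E2 p)" for p
  proof -
    have s: "f p = f (coord_proj E1 p) + f (coord_proj E2 p)"
      by (simp add: linear_add[OF lin(1), symmetric] coord_proj_Un[OF E])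
    have c: "f (coord_proj E1 p) \<in> coord_space E1" "f (coord_proj E2 p) \<in> coord_space E2"
      unfolding f1 f2 using h1(2) h2(2) coord_proj_in EB by auto
    have "E2 \<inter> E1 = {}" using E(2) by auto
    then show "coord_proj E1 (f p) = f (coord_proj E1 p)" "coord_proj E2 (f p) = f (coord_proj E2 p)"
      using c EB E(2) by (simp_all add: s linear_add[OF linear_coord_proj] coord_proj_id z[of E1 E2] z[of E2 E1])
  qed
  show ?thesis
  proof (rule that[OF f(1)])
    let ?s = "norm (coord_proj E1 \<alpha>)" and ?c = "norm (coord_proj E2 \<alpha>)"
    have "coord_proj E1 \<alpha> \<bullet> coord_proj E2 \<alpha> = 0"
      by (rule inner_coord_space[OF E(2)]) (use coord_proj_in EB in auto)
    then have "(norm (coord_proj E1 \<alpha> + coord_proj E2 \<alpha>))\<^sup>2 = ?s\<^sup>2 + ?c\<^sup>2"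
      by (simp add: power2_norm_eq_inner inner_add_left inner_add_right inner_commute)
    then show "?s\<^sup>2 + ?c\<^sup>2 = 1" by (simp add: coord_proj_Un[OF E] \<alpha>)
    have "e1 \<in> Basis" "e2 \<in> Basis" "e2 \<notin> E1" using e E by auto
    then have "f e1 = h1 e1" "f e2 = h2 e2" using e by (simp_all add: f(2) g_def)
    then show "f (?s *\<^sub>R e1 + ?c *\<^sub>R e2) = \<alpha>"
      using h1(3) h2(3) by (simp add: linear_add[OF lin(1)] linear_scale[OF lin(1)] coord_proj_Un[OF E])
    show "norm (coord_proj E1 (f p)) = norm (coord_proj E1 p)" "norm (coord_proj E2 (f p)) = norm (coord_proj E2 p)" for p
      unfolding P using f(1) by (simp_all add: orthogonal_transformation_norm)
  qed
qed

lemma radial_boundary_linear_image: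
  assumes "linear f" "inj f"
  shows "radial_boundary (f ` A) = f ` radial_boundary A"
proof -
  have "l *\<^sub>R f y \<in> f ` A \<longleftrightarrow> l *\<^sub>R y \<in> A" for l y
    using inj_image_mem_iff[OF assms(2), of "l *\<^sub>R y" A] by (simp add: linear_scale[OF assms(1)])
  then show ?thesis by (auto simp: radial_boundary_def)
qed

lemma ball_product_section_rotate:
  fixes f :: "'a::euclidean_space \<Rightarrow> 'a"
  assumes f: "orthogonal_transformation f" "f \<beta> = \<alpha>"
    and P: "\<And>p. norm (coord_proj E1 (f p)) = norm (coord_proj E1 p)" "\<And>p. norm (coord_proj E2 (f p)) = norm (coord_proj E2 p)"
  shows "hausdorff_measure d (radial_boundary (ball_product E1 E2 r1 r2 \<inter> {x. \<alpha> \<bullet> x = 0}))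
    = hausdorff_measure d (radial_boundary (ball_product E1 E2 r1 r2 \<inter> {x. \<beta> \<bullet> x = 0}))"
proof -
  obtain k where k: "\<And>x. f (k x) = x" "\<And>x. k (f x) = x" using orthogonal_transformation_inverse[OF f(1)] by metis
  have lf: "linear f" using f(1) by (rule orthogonal_transformation_linear)
  have inj: "inj f" using k(2) by (rule inj_on_inverseI)
  let ?A = "ball_product E1 E2 r1 r2 \<inter> {x. \<alpha> \<bullet> x = 0}" and ?B = "ball_product E1 E2 r1 r2 \<inter> {x. \<beta> \<bullet> x = 0}"
  have mem: "f x \<in> ?A \<longleftrightarrow> x \<in> ?B" for x
    using orthogonal_transformation_inner[OF f(1), of \<beta> x] by (simp add: ball_product_def P f(2))
  have "?A = f ` ?B"
  proof (intro set_eqI iffI)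
    fix y assume "y \<in> ?A"
    then have "k y \<in> ?B" using mem[of "k y"] by (simp only: k)
    then have "f (k y) \<in> f ` ?B" by (rule imageI)
    then show "y \<in> f ` ?B" by (simp only: k)
  next
    fix y assume "y \<in> f ` ?B"
    then obtain x where "y = f x" "x \<in> ?B" by (rule imageE)
    then show "y \<in> ?A" by (simp only: mem)
  qed
  then have "radial_boundary ?A = f ` radial_boundary ?B" using radial_boundary_linear_image[OF lf inj] by simp
  moreover have "dist (f x) (f y) = dist x y" for x y
    using f(1) by (simp add: dist_norm linear_diff[OF lf, symmetric] orthogonal_transformation_norm)
  ultimately show ?thesis using hausdorff_measure_isometry[of "radial_boundary ?B" f d] by simp
qed

lemma uminus_image_eq:
  fixes A :: "'a::real_vector set"
  assumes "\<And>x. x \<in> A \<Longrightarrow> - x \<in> A" shows "A = uminus ` A"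
proof (intro set_eqI iffI)
  fix x assume "x \<in> A"
  then have "- (- x) \<in> uminus ` A" using assms by (intro imageI)
  then show "x \<in> uminus ` A" by simp
qed (use assms in auto)

text \<open>Each comparison chains an upper bound for one body with a lower bound for the other:
  sections of the product against those of the ball, then the surface of the ball against that of
  the product. The radius from \<open>radius_exists\<close> links the two ends of each
  chain.\<close>

lemma smaller_sections_larger_surface:
  assumes n: "DIM('a::euclidean_space) \<ge> 14"
  shows "\<exists>K L :: 'a set. convex_body K \<and> origin_symmetric K \<and> convex_body L \<and> origin_symmetric L \<and>
    (\<forall>\<alpha> \<in> sphere 0 1. hausdorff_measure (DIM('a) - 2) (frontier K \<inter> orthogonal_hyperplane \<alpha>)
         \<le> hausdorff_measure (DIM('a) - 2) (frontier L \<inter> orthogonal_hyperplane \<alpha>)) \<and>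
    hausdorff_measure (DIM('a) - 1) (frontier K) > hausdorff_measure (DIM('a) - 1) (frontier L)"
proof -
  define N where "N = DIM('a) - 2"
  define a where "a = N div 2"
  define b where "b = N - a"
  have dN: "DIM('a) = Suc (Suc N)" and N12: "N \<ge> 12" using n by (auto simp: N_def)
  have N: "N = a + b" and a: "a \<ge> 6" and b: "b = a \<or> b = Suc a"
    using N12 unfolding a_def b_def by presburger+
  obtain E1 :: "'a set" where E1: "E1 \<subseteq> Basis" "card E1 = Suc a"
    using obtain_subset_with_card_n[of "Suc a" "Basis :: 'a set"] dN N by auto
  define E2 where "E2 = Basis - E1"
  have fin: "finite E1" using E1 finite_Basis finite_subset by blast
  have E: "E1 \<union> E2 = Basis" "E1 \<inter> E2 = {}" "card E1 = Suc a" "card E2 = Suc b"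
    using E1 fin dN N by (auto simp: E2_def card_Diff_subset)
  have EB: "E1 \<subseteq> Basis" "E2 \<subseteq> Basis" using E by auto
  have "E1 \<noteq> {}" "E2 \<noteq> {}" using E by auto
  then obtain e1 e2 where e: "e1 \<in> E1" "e2 \<in> E2" by blast
  obtain R where R: "R > 0"
    "unit_ball_vol (real a) * unit_ball_vol (real b) * (sqrt a ^ a * sqrt b ^ b) * ((real a + 1) / sqrt a + sqrt b)
        * (sqrt N * semicircle_integral N * (1 - gain N))
      = (real N + 1) * unit_ball_vol (real (N + 1)) * R ^ N"
    "(real N + 2) * unit_ball_vol (real (N + 2)) * R ^ (N + 1)
      < unit_ball_vol (real (a + 1)) * unit_ball_vol (real (b + 1)) * (sqrt a ^ (a + 1) * sqrt b ^ (b + 1))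
        * ((real a + 1) / sqrt a + (real b + 1) / sqrt b)"
    by (rule radius_exists[OF a b N])
  have r: "sqrt a > 0" "sqrt b > 0" using a b by auto
  define K where "K = ball_product E1 E2 (sqrt a) (sqrt b)"
  define L where "L = cball (0 :: 'a) R"
  have cK: "convex K" "compact K" "cball 0 (min (sqrt a) (sqrt b)) \<subseteq> K"
    unfolding K_def by (intro convex_ball_product compact_ball_product[OF E(1,2)] cball_subset_ball_product[OF EB])+
  have "ball 0 (min (sqrt a) (sqrt b)) \<subseteq> K" using cK(3) ball_subset_cball order_trans by blast
  then have "ball 0 (min (sqrt a) (sqrt b)) \<subseteq> interior K" by (intro interior_maximal) auto
  then have K0: "0 \<in> interior K" using r by auto
  have L0: "0 \<in> interior L" using R by (simp add: L_def)
  have cL: "convex L" "compact L" by (auto simp: L_def)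
  have sK: "origin_symmetric K"
  proof -
    have "- p \<in> K" if "p \<in> K" for p
      using that by (simp add: K_def ball_product_def linear_neg[OF linear_coord_proj])
    then show ?thesis unfolding origin_symmetric_def by (rule uminus_image_eq)
  qed
  have sL: "origin_symmetric L"
    unfolding origin_symmetric_def by (rule uminus_image_eq) (simp add: L_def)
  \<comment> \<open>One constant for all hyperplanes: the product is measured in the rotated
    hyperplane, the ball in the original one.\<close>
  obtain c1 where c1: "\<And>T :: 'a set. subspace T \<Longrightarrow> dim T = Suc N \<Longrightarrow> flat_constant T N c1"
    using flat_constant_exists[of "Suc N", where 'a = 'a] dN by auto
  obtain c2 where c2: "\<And>T :: 'a set. subspace T \<Longrightarrow> dim T = Suc (Suc N) \<Longrightarrow> flat_constant T (Suc N) c2"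
    using flat_constant_exists[of "Suc (Suc N)", where 'a = 'a] dN by auto
  have hyp: "flat_constant {x. \<alpha> \<bullet> x = 0} N c1" if "norm \<alpha> = 1" for \<alpha> :: 'a
  proof (rule c1[OF subspace_hyperplane])
    have "\<alpha> \<noteq> 0" using that by auto
    then show "dim {x. \<alpha> \<bullet> x = 0} = Suc N" using dN by (simp add: dim_hyperplane)
  qed
  have sections: "hausdorff_measure N (frontier K \<inter> orthogonal_hyperplane \<alpha>) \<le> hausdorff_measure N (frontier L \<inter> orthogonal_hyperplane \<alpha>)"
    if \<alpha>: "norm \<alpha> = 1" for \<alpha>
  proof -
    let ?T = "{x. \<alpha> \<bullet> x = 0}"
    obtain f s c where f: "orthogonal_transformation f" "s\<^sup>2 + c\<^sup>2 = 1" "f (s *\<^sub>R e1 + c *\<^sub>R e2) = \<alpha>"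
      "\<And>p. norm (coord_proj E1 (f p)) = norm (coord_proj E1 p)" "\<And>p. norm (coord_proj E2 (f p)) = norm (coord_proj E2 p)"
      using split_rotation[OF E(1,2) e \<alpha>] by metis
    have \<beta>: "norm (s *\<^sub>R e1 + c *\<^sub>R e2) = 1"
      using orthogonal_transformation_norm[OF f(1), of "s *\<^sub>R e1 + c *\<^sub>R e2"] f(3) \<alpha> by simp
    have "hausdorff_measure N (frontier K \<inter> ?T) = hausdorff_measure N (radial_boundary (K \<inter> {x. (s *\<^sub>R e1 + c *\<^sub>R e2) \<bullet> x = 0}))"
      unfolding frontier_Int_subspace[OF cK(1,2) K0 subspace_hyperplane] unfolding K_def
      by (rule ball_product_section_rotate[OF f(1,3,4,5)])
    \<comment> \<open>By the choice of \<open>R\<close> the bound for the product is literally the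
      value for the ball.\<close>
    also have "\<dots> \<le> ennreal (c1 * (2 * ((real N + 1) * unit_ball_vol (real (N + 1)) * R ^ N)))"
      using section_upper[OF E e f(2) a b N hyp[OF \<beta>]] unfolding K_def R(2)[symmetric] gain_def .
    also have "\<dots> = ennreal (c1 * (2 * (real (Suc N) * unit_ball_vol (real (Suc N)) * R ^ N)))"
      by (simp add: add.commute)
    also have "\<dots> \<le> hausdorff_measure N (radial_boundary (L \<inter> ?T))"
      unfolding L_def by (rule sphere_section_lower[OF \<alpha> dN R(1) hyp[OF \<alpha>]])
    also have "\<dots> = hausdorff_measure N (frontier L \<inter> ?T)"
      unfolding frontier_Int_subspace[OF cL L0 subspace_hyperplane] ..
    finally show ?thesis by (simp add: orthogonal_hyperplane_def)
  qed
  have flat: "flat_constant (UNIV :: 'a set) (Suc N) c2" by (rule c2) (auto simp: dim_UNIV dN)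
  then have c20: "c2 > 0" by (simp add: flat_constant_def)
  have fr: "frontier K = radial_boundary K" "frontier L = radial_boundary L"
    using frontier_Int_subspace[OF cK(1,2) K0 subspace_UNIV] frontier_Int_subspace[OF cL L0 subspace_UNIV] by auto
  have surface: "hausdorff_measure (Suc N) (frontier L) < hausdorff_measure (Suc N) (frontier K)"
  proof -
    have "hausdorff_measure (Suc N) (frontier L) \<le> ennreal (c2 * (real (Suc (Suc N)) * unit_ball_vol (real (Suc (Suc N))) * R ^ Suc N))"
      unfolding fr unfolding L_def by (rule sphere_surface_upper[OF flat dN[symmetric] R(1)])
    also have "\<dots> < ennreal (c2 * (unit_ball_vol (Suc a) * unit_ball_vol (Suc b)) * (sqrt a ^ Suc a * sqrt b ^ Suc b * (Suc a / sqrt a + Suc b / sqrt b)))"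
    proof (rule ennreal_lessI)
      have k: "unit_ball_vol (real m) > 0" for m by (rule unit_ball_vol_pos) simp
      have "0 < unit_ball_vol (Suc a) * unit_ball_vol (Suc b)" by (intro mult_pos_pos k)
      moreover have "0 < sqrt a ^ Suc a * sqrt b ^ Suc b * (Suc a / sqrt a + Suc b / sqrt b)"
        using r by (intro mult_pos_pos add_pos_pos divide_pos_pos zero_less_power) auto
      ultimately show "0 < c2 * (unit_ball_vol (Suc a) * unit_ball_vol (Suc b)) * (sqrt a ^ Suc a * sqrt b ^ Suc b * (Suc a / sqrt a + Suc b / sqrt b))"
        using c20 by (simp only: mult_pos_pos)
      have eqs: "N + 2 = Suc (Suc N)" "N + 1 = Suc N" "a + 1 = Suc a" "b + 1 = Suc b"
        "real N + 2 = real (Suc (Suc N))" "real a + 1 = real (Suc a)" "real b + 1 = real (Suc b)" by simp_all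
      have "c2 * (real (Suc (Suc N)) * unit_ball_vol (real (Suc (Suc N))) * R ^ Suc N)
        < c2 * (unit_ball_vol (Suc a) * unit_ball_vol (Suc b) * (sqrt a ^ Suc a * sqrt b ^ Suc b) * (Suc a / sqrt a + Suc b / sqrt b))"
        by (rule mult_strict_left_mono[OF R(3)[unfolded eqs] c20])
      then show "c2 * (real (Suc (Suc N)) * unit_ball_vol (real (Suc (Suc N))) * R ^ Suc N)
        < c2 * (unit_ball_vol (Suc a) * unit_ball_vol (Suc b)) * (sqrt a ^ Suc a * sqrt b ^ Suc b * (Suc a / sqrt a + Suc b / sqrt b))"
        by (simp only: mult.assoc)
    qed
    also have "\<dots> \<le> hausdorff_measure (Suc N) (frontier K)"
      unfolding fr unfolding K_def by (rule ball_product_surface_lower[OF E r flat]) (simp add: N)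
    finally show ?thesis .
  qed
  have "convex_body K" "convex_body L" using cK cL K0 L0 by (auto simp: convex_body_def)
  moreover have "DIM('a) - 2 = N" "DIM('a) - 1 = Suc N" using dN by auto
  ultimately show ?thesis using sK sL sections surface by (intro exI[of _ K] exI[of _ L]) simp
qed

theorem theorem12:
  assumes "CARD('n::finite) \<ge> 14"
  shows "\<exists>K L :: (real ^ 'n) set.
    convex_body K \<and> origin_symmetric K \<and> convex_body L \<and> origin_symmetric L \<and>
    (\<forall>a \<in> sphere 0 1.
       hausdorff_measure (CARD('n) - 2) (frontier K \<inter> orthogonal_hyperplane a)
         \<le> hausdorff_measure (CARD('n) - 2) (frontier L \<inter> orthogonal_hyperplane a)) \<and>
    hausdorff_measure (CARD('n) - 1) (frontier K) > hausdorff_measure (CARD('n) - 1) (frontier L)"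
  using smaller_sections_larger_surface[where 'a = "real ^ 'n"] assms by simp

end
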